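(* Let $(\mathcal A,\mathcal H,\mathcal D)$ be a $QC^\infty$ finitely summable semifinite spectral triple with spectral dimension $q\ge1$, and let $m\in\{P,P+2,\dots,M\}$. Define, for $a_0,\dots,a_m\in\mathcal A$, the $m$-th component of the reduced resolvent cocycle (as a meromorphic function of $r$ on $\mathrm{Re}(r)>(1-m)/2$) by $$\psi^r_m(a_0,\dots,a_m)=(-1)^P(\sqrt{2i})^P\,\frac{\sqrt\pi\,\Gamma(q/2+r-(m+1)/2)}{\Gamma(q/2+r)}\,\tau\Big(\frac1{2\pi i}\gamma\int_l\lambda^{-q/2-r+(m+1)/2}a_0R_0(\lambda)[\mathcal D,a_1]R_0(\lambda)\cdots[\mathcal D,a_m]R_0(\lambda)\,d\lambda\Big).$$ Then, modulo functions of $r$ holomorphic at $r=(1-q)/2$ (i.e. on an open right half-plane containing $(1-q)/2$), the $m$-th component of the resolvent cocycle satisfies $$\phi^r_m(a_0,\dots,a_m)=\psi^r_m(a_0,\dots,a_m).$$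
   Context: $\mathcal N$ is a semifinite von Neumann algebra on a Hilbert space $\mathcal H$ with faithful normal semifinite trace $\tau$; $\mathcal K_{\mathcal N}$ is the norm-closed ideal generated by projections of finite trace. A semifinite spectral triple $(\mathcal A,\mathcal H,\mathcal D)$ consists of a $*$-algebra $\mathcal A\subset\mathcal N$ containing the identity of $\mathcal N$ and a self-adjoint operator $\mathcal D$ affiliated to $\mathcal N$ such that $[\mathcal D,a]$ extends to a bounded operator in $\mathcal N$ for all $a\in\mathcal A$ and $(\lambda-\mathcal D)^{-1}\in\mathcal K_{\mathcal N}$ for $\lambda\notin\mathbb R$. It is even if there is $\gamma=\gamma^*\in\mathcal N$ with $\gamma^2=1$, $\gamma a=a\gamma$ for $a\in\mathcal A$, $\gamma\mathcal D+\mathcal D\gamma=0$; otherwise odd, and then $\gamma:=1$. $P=0$ in the even case, $P=1$ in the odd case. It is $QC^\infty$ if $a$ and $[\mathcal D,a]$ lie in the domain of $\delta^k$, $\delta(T)=[|\mathcal D|,T]$, for all $a\in\mathcal A$, $k\ge1$. The spectral dimension is $q=\inf\{k\in\mathbb R:\tau((1+\mathcal D^2)^{-k/2})<\infty\}$. $M=2[(q+1+P)/2]-P$ is the greatest integer $\le q+1$ congruent to $P$ mod 2. Let $0<a<1/2$, $l=\{a+iv:v\in\mathbb R\}$ with a fixed orientation (the same in all integrals), $R_s(\lambda)=(\lambda-(1+s^2+\mathcal D^2))^{-1}$ (so $R_0(\lambda)=(\lambda-(1+\mathcal D^2))^{-1}$), principal branch for complex powers of $\lambda$. The resolvent cocycle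 has components, for $\mathrm{Re}(r)>(1-m)/2$, $$\phi^r_m(a_0,\dots,a_m)=\eta_m\int_0^\infty s^m\,\tau\Big(\tfrac1{2\pi i}\gamma\int_l\lambda^{-q/2-r}a_0R_s(\lambda)[\mathcal D,a_1]R_s(\lambda)\cdots[\mathcal D,a_m]R_s(\lambda)\,d\lambda\Big)ds,$$ $$\eta_m=(-\sqrt{2i})^P2^{m+1}\frac{\Gamma(m/2+1)}{\Gamma(m+1)}.$$ In both formulas, for $\mathrm{Re}(r)>(1-m)/2$ the contour integral gives a trace class operator. *)

theory Defs
  imports "HOL-Analysis.Analysis" "HOL-Computational_Algebra.Polynomial"
begin

section \<open>Complex Hilbert spaces\<close>

text \<open>The inner product is conjugate linear in the first and linear in the second argument.\<close>

class complex_hilbert_space = banach +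
  fixes scaleC :: "complex \<Rightarrow> 'a \<Rightarrow> 'a" (infixr "*\<^sub>C" 75)
    and cinner :: "'a \<Rightarrow> 'a \<Rightarrow> complex"
  assumes scaleC_add_right: "c *\<^sub>C (x + y) = c *\<^sub>C x + c *\<^sub>C y"
    and scaleC_add_left: "(c + d) *\<^sub>C x = c *\<^sub>C x + d *\<^sub>C x"
    and scaleC_scaleC: "c *\<^sub>C (d *\<^sub>C x) = (c * d) *\<^sub>C x"
    and scaleC_of_real: "complex_of_real r *\<^sub>C x = r *\<^sub>R x"
    and cinner_commute: "cinner x y = cnj (cinner y x)"
    and cinner_add_right: "cinner x (y + z) = cinner x y + cinner x z"
    and cinner_scaleC_right: "cinner x (c *\<^sub>C y) = c * cinner x y"
    and cinner_self: "cinner x x = complex_of_real ((norm x)\<^sup>2)"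

lemma norm_scaleC: "norm (c *\<^sub>C x) = cmod c * norm (x :: 'h::complex_hilbert_space)"
proof -
  have "cinner (c *\<^sub>C x) (c *\<^sub>C x) = c * cnj (cinner x (c *\<^sub>C x))"
    by (metis cinner_commute cinner_scaleC_right)
  also have "\<dots> = (c * cnj c) * complex_of_real ((norm x)\<^sup>2)"
    by (simp add: cinner_scaleC_right cinner_self)
  also have "\<dots> = complex_of_real ((cmod c * norm x)\<^sup>2)"
    by (simp add: complex_norm_square power_mult_distrib flip: complex_norm_square)
  finally have "(norm (c *\<^sub>C x))\<^sup>2 = (cmod c * norm x)\<^sup>2"
    by (simp only: cinner_self of_real_eq_iff)
  then show ?thesis
    by (simp add: power2_eq_iff_nonneg)
qed

lemma bounded_linear_scaleC: "bounded_linear (\<lambda>x :: 'h::complex_hilbert_space. c *\<^sub>C x)"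
proof (rule bounded_linear_intro[where K = "cmod c"])
  fix r and x :: 'h
  show "c *\<^sub>C (r *\<^sub>R x) = r *\<^sub>R (c *\<^sub>C x)"
    by (simp add: scaleC_scaleC mult.commute flip: scaleC_of_real)
qed (simp_all add: scaleC_add_right norm_scaleC mult.commute)


section \<open>Bounded operators and von Neumann algebras\<close>

text \<open>The type of bounded linear functions carries the operator norm, but its elements are only
  real linear; the bounded operators of the Hilbert space are the complex linear ones.\<close>

definition bounded_ops :: "('h::complex_hilbert_space \<Rightarrow>\<^sub>L 'h) set" where
  "bounded_ops = {T :: 'h \<Rightarrow>\<^sub>L 'h. \<forall>c x. T (c *\<^sub>C x) = c *\<^sub>C T x}"

definition scal :: "complex \<Rightarrow> 'h::complex_hilbert_space \<Rightarrow>\<^sub>L 'h" where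
  "scal c = Blinfun (\<lambda>x. c *\<^sub>C x)"

lemma scal_apply: "scal c x = c *\<^sub>C x"
  by (simp add: scal_def bounded_linear_Blinfun_apply bounded_linear_scaleC)

definition star :: "('h::complex_hilbert_space \<Rightarrow>\<^sub>L 'h) \<Rightarrow> ('h \<Rightarrow>\<^sub>L 'h)" where
  "star T = (THE S. S \<in> bounded_ops \<and> (\<forall>x y. cinner (T x) y = cinner x (S y)))"

definition positive_op :: "('h::complex_hilbert_space \<Rightarrow>\<^sub>L 'h) \<Rightarrow> bool" where
  "positive_op T \<longleftrightarrow> T \<in> bounded_ops \<and> (\<forall>x. cinner x (T x) \<in> \<real>\<^sub>\<ge>\<^sub>0)"

definition op_le :: "('h::complex_hilbert_space \<Rightarrow>\<^sub>L 'h) \<Rightarrow> ('h \<Rightarrow>\<^sub>L 'h) \<Rightarrow> bool" where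
  "op_le S T \<longleftrightarrow> positive_op (T - S)"

definition commutant :: "('h::complex_hilbert_space \<Rightarrow>\<^sub>L 'h) set \<Rightarrow> ('h \<Rightarrow>\<^sub>L 'h) set" where
  "commutant N = {T \<in> bounded_ops. \<forall>S\<in>N. T o\<^sub>L S = S o\<^sub>L T}"

definition von_Neumann_algebra :: "('h::complex_hilbert_space \<Rightarrow>\<^sub>L 'h) set \<Rightarrow> bool" where
  "von_Neumann_algebra N \<longleftrightarrow>
     N \<subseteq> bounded_ops \<and> (\<forall>T\<in>N. star T \<in> N) \<and> commutant (commutant N) = N"

definition unital_star_subalgebra ::
  "('h::complex_hilbert_space \<Rightarrow>\<^sub>L 'h) set \<Rightarrow> ('h \<Rightarrow>\<^sub>L 'h) set \<Rightarrow> bool" where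
  "unital_star_subalgebra A N \<longleftrightarrow>
     A \<subseteq> N \<and> id_blinfun \<in> A \<and>
     (\<forall>S\<in>A. \<forall>T\<in>A. S + T \<in> A \<and> S o\<^sub>L T \<in> A) \<and>
     (\<forall>c. \<forall>T\<in>A. scal c o\<^sub>L T \<in> A) \<and> (\<forall>T\<in>A. star T \<in> A)"


section \<open>Traces\<close>

definition pos_cone :: "('h::complex_hilbert_space \<Rightarrow>\<^sub>L 'h) set \<Rightarrow> ('h \<Rightarrow>\<^sub>L 'h) set" where
  "pos_cone N = {T \<in> N. positive_op T}"

text \<open>A trace is a weight on the positive cone of \<open>N\<close>; its values elsewhere are irrelevant.
  In the normality clause \<open>T\<close> is the least upper bound of the bounded increasing net \<open>F\<close>.\<close>

definition fns_trace ::
  "('h::complex_hilbert_space \<Rightarrow>\<^sub>L 'h) set \<Rightarrow> (('h \<Rightarrow>\<^sub>L 'h) \<Rightarrow> ennreal) \<Rightarrow> bool" where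
  "fns_trace N \<tau> \<longleftrightarrow>
     (\<forall>S\<in>pos_cone N. \<forall>T\<in>pos_cone N. \<tau> (S + T) = \<tau> S + \<tau> T) \<and>
     (\<forall>c\<ge>0. \<forall>T\<in>pos_cone N. \<tau> (c *\<^sub>R T) = ennreal c * \<tau> T) \<and>
     (\<forall>T\<in>N. \<tau> (star T o\<^sub>L T) = \<tau> (T o\<^sub>L star T)) \<and>
     \<comment> \<open>faithful\<close>
     (\<forall>T\<in>pos_cone N. \<tau> T = 0 \<longrightarrow> T = 0) \<and>
     \<comment> \<open>normal\<close>
     (\<forall>F T. F \<subseteq> pos_cone N \<and> F \<noteq> {} \<and> T \<in> pos_cone N \<and>
        (\<forall>X\<in>F. \<forall>Y\<in>F. \<exists>Z\<in>F. op_le X Z \<and> op_le Y Z) \<and>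
        (\<forall>X\<in>F. op_le X T) \<and>
        (\<forall>U\<in>pos_cone N. (\<forall>X\<in>F. op_le X U) \<longrightarrow> op_le T U)
        \<longrightarrow> \<tau> T = (SUP X\<in>F. \<tau> X)) \<and>
     \<comment> \<open>semifinite\<close>
     (\<forall>T\<in>pos_cone N. T \<noteq> 0 \<longrightarrow>
        (\<exists>S\<in>pos_cone N. S \<noteq> 0 \<and> op_le S T \<and> \<tau> S < \<infinity>))"

text \<open>The linear extension of the trace to the trace class operators in \<open>N\<close>, i.e. to the linear
  span of the positive elements of finite trace.\<close>

definition trace_ext ::
  "('h::complex_hilbert_space \<Rightarrow>\<^sub>L 'h) set \<Rightarrow> (('h \<Rightarrow>\<^sub>L 'h) \<Rightarrow> ennreal) \<Rightarrow> ('h \<Rightarrow>\<^sub>L 'h) \<Rightarrow> complex" where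
  "trace_ext N \<tau> T = (THE z. \<exists>X\<^sub>1 X\<^sub>2 Y\<^sub>1 Y\<^sub>2.
     {X\<^sub>1, X\<^sub>2, Y\<^sub>1, Y\<^sub>2} \<subseteq> {X \<in> pos_cone N. \<tau> X < \<infinity>} \<and>
     T = (X\<^sub>1 - X\<^sub>2) + (scal \<i> o\<^sub>L (Y\<^sub>1 - Y\<^sub>2)) \<and>
     z = Complex (enn2real (\<tau> X\<^sub>1) - enn2real (\<tau> X\<^sub>2)) (enn2real (\<tau> Y\<^sub>1) - enn2real (\<tau> Y\<^sub>2)))"

definition closed_ideal ::
  "('h::complex_hilbert_space \<Rightarrow>\<^sub>L 'h) set \<Rightarrow> ('h \<Rightarrow>\<^sub>L 'h) set \<Rightarrow> bool" where
  "closed_ideal N I \<longleftrightarrow>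
     I \<subseteq> N \<and> 0 \<in> I \<and> (\<forall>S\<in>I. \<forall>T\<in>I. S + T \<in> I) \<and>
     (\<forall>S\<in>N. \<forall>T\<in>I. S o\<^sub>L T \<in> I \<and> T o\<^sub>L S \<in> I) \<and> closed I"

definition compact_ideal ::
  "('h::complex_hilbert_space \<Rightarrow>\<^sub>L 'h) set \<Rightarrow> (('h \<Rightarrow>\<^sub>L 'h) \<Rightarrow> ennreal) \<Rightarrow> ('h \<Rightarrow>\<^sub>L 'h) set" where
  "compact_ideal N \<tau> =
     \<Inter>{I. closed_ideal N I \<and> {p \<in> N. p o\<^sub>L p = p \<and> star p = p \<and> \<tau> p < \<infinity>} \<subseteq> I}"


section \<open>Unbounded operators\<close>

text \<open>Unbounded operators are represented by their graphs, so that composition of operators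
  (with its natural domain) is relational composition and inversion is the converse.\<close>

type_synonym 'h op_graph = "('h \<times> 'h) set"

definition graph_of :: "('h::complex_hilbert_space \<Rightarrow>\<^sub>L 'h) \<Rightarrow> 'h op_graph" where
  "graph_of T = {(x, T x) | x. True}"

definition adjoint_graph :: "'h::complex_hilbert_space op_graph \<Rightarrow> 'h op_graph" where
  "adjoint_graph D = {(y, z). \<forall>(x, w)\<in>D. cinner w y = cinner x z}"

definition self_adjoint :: "'h::complex_hilbert_space op_graph \<Rightarrow> bool" where
  "self_adjoint D \<longleftrightarrow> closure (Domain D) = UNIV \<and> adjoint_graph D = D"

text \<open>The operator commutes with every unitary in the commutant of \<open>N\<close>.\<close>

definition affiliated ::
  "('h::complex_hilbert_space \<Rightarrow>\<^sub>L 'h) set \<Rightarrow> 'h op_graph \<Rightarrow> bool" where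
  "affiliated N D \<longleftrightarrow>
     (\<forall>u\<in>commutant N. u o\<^sub>L star u = id_blinfun \<and> star u o\<^sub>L u = id_blinfun \<longrightarrow>
        (\<forall>(x, y)\<in>D. (u x, u y) \<in> D))"

definition scalar_plus :: "complex \<Rightarrow> 'h::complex_hilbert_space op_graph \<Rightarrow> 'h op_graph" where
  "scalar_plus c D = {(x, c *\<^sub>C x + y) | x y. (x, y) \<in> D}"

definition scalar_minus :: "complex \<Rightarrow> 'h::complex_hilbert_space op_graph \<Rightarrow> 'h op_graph" where
  "scalar_minus c D = {(x, c *\<^sub>C x - y) | x y. (x, y) \<in> D}"

definition bounded_inverse :: "'h::complex_hilbert_space op_graph \<Rightarrow> ('h \<Rightarrow>\<^sub>L 'h)" where
  "bounded_inverse D = (THE T. graph_of T = D\<inverse>)"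

text \<open>The modulus \<open>|D|\<close> is the positive square root of \<open>D\<^sup>2\<close>.\<close>

definition modulus :: "'h::complex_hilbert_space op_graph \<Rightarrow> 'h op_graph" where
  "modulus D = (THE A. self_adjoint A \<and> (\<forall>(x, y)\<in>A. cinner x y \<in> \<real>\<^sub>\<ge>\<^sub>0) \<and> A O A = D O D)"

text \<open>\<open>S\<close> is the bounded extension of \<open>[D, T]\<close>: the operator \<open>T\<close> maps the domain of \<open>D\<close> into itself
  and \<open>D T x = T D x + S x\<close> there.\<close>

definition extends_commutator ::
  "'h::complex_hilbert_space op_graph \<Rightarrow> ('h \<Rightarrow>\<^sub>L 'h) \<Rightarrow> ('h \<Rightarrow>\<^sub>L 'h) \<Rightarrow> bool" where
  "extends_commutator D T S \<longleftrightarrow>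
     S \<in> bounded_ops \<and> (\<forall>(x, y)\<in>D. (T x, T y + S x) \<in> D)"

definition commutator ::
  "'h::complex_hilbert_space op_graph \<Rightarrow> ('h \<Rightarrow>\<^sub>L 'h) \<Rightarrow> ('h \<Rightarrow>\<^sub>L 'h)" where
  "commutator D T = (THE S. extends_commutator D T S)"


section \<open>Real powers\<close>

definition op_power :: "('h::complex_hilbert_space \<Rightarrow>\<^sub>L 'h) \<Rightarrow> nat \<Rightarrow> ('h \<Rightarrow>\<^sub>L 'h)" where
  "op_power T n = ((\<lambda>S. T o\<^sub>L S) ^^ n) id_blinfun"

definition op_poly :: "real poly \<Rightarrow> ('h::complex_hilbert_space \<Rightarrow>\<^sub>L 'h) \<Rightarrow> ('h \<Rightarrow>\<^sub>L 'h)" where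
  "op_poly p T = (\<Sum>i\<le>degree p. coeff p i *\<^sub>R op_power T i)"

text \<open>Continuous functional calculus of a positive bounded operator, whose spectrum lies
  in \<open>[0, norm T]\<close>.\<close>

definition cont_calculus ::
  "(real \<Rightarrow> real) \<Rightarrow> ('h::complex_hilbert_space \<Rightarrow>\<^sub>L 'h) \<Rightarrow> ('h \<Rightarrow>\<^sub>L 'h)" where
  "cont_calculus f T = (THE S. \<forall>p :: nat \<Rightarrow> real poly.
     uniform_limit {0..norm T} (\<lambda>n. poly (p n)) f sequentially \<longrightarrow>
     (\<lambda>n. op_poly (p n) T) \<longlonglongrightarrow> S)"

text \<open>The operator \<open>(1 + D\<^sup>2) powr (- k / 2)\<close> for real \<open>k\<close>. For \<open>k > 0\<close> it is the power \<open>k / 2\<close> of the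
  bounded positive operator \<open>(1 + D\<^sup>2)\<^sup>-\<^sup>1\<close>; for \<open>k < 0\<close> it is in general unbounded.\<close>

definition one_plus_square_power :: "'h::complex_hilbert_space op_graph \<Rightarrow> real \<Rightarrow> 'h op_graph" where
  "one_plus_square_power D k =
     (let pw = (\<lambda>s. graph_of
                 (cont_calculus (\<lambda>x. x powr s) (bounded_inverse (scalar_plus 1 (D O D)))))
      in if k > 0 then pw (k / 2) else if k = 0 then Id else (pw (- k / 2))\<inverse>)"

text \<open>The canonical extension of a normal trace to positive self-adjoint affiliated operators. It
  agrees with \<open>\<tau>\<close> on bounded ones.\<close>

definition trace_graph ::
  "('h::complex_hilbert_space \<Rightarrow>\<^sub>L 'h) set \<Rightarrow> (('h \<Rightarrow>\<^sub>L 'h) \<Rightarrow> ennreal) \<Rightarrow> 'h op_graph \<Rightarrow> ennreal" where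
  "trace_graph N \<tau> G =
     (SUP T\<in>{T \<in> pos_cone N. \<forall>(x, y)\<in>G. Re (cinner x (T x)) \<le> Re (cinner x y)}. \<tau> T)"


section \<open>Semifinite spectral triples\<close>

definition semifinite_spectral_triple ::
  "('h::complex_hilbert_space \<Rightarrow>\<^sub>L 'h) set \<Rightarrow> (('h \<Rightarrow>\<^sub>L 'h) \<Rightarrow> ennreal) \<Rightarrow> ('h \<Rightarrow>\<^sub>L 'h) set \<Rightarrow>
    'h op_graph \<Rightarrow> bool" where
  "semifinite_spectral_triple N \<tau> A D \<longleftrightarrow>
     von_Neumann_algebra N \<and> fns_trace N \<tau> \<and> unital_star_subalgebra A N \<and>
     self_adjoint D \<and> affiliated N D \<and>
     (\<forall>a\<in>A. \<exists>S\<in>N. extends_commutator D a S) \<and>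
     (\<forall>z. z \<notin> \<real> \<longrightarrow>
        (\<exists>T\<in>compact_ideal N \<tau>. graph_of T = (scalar_minus z D)\<inverse>))"

definition grading ::
  "('h::complex_hilbert_space \<Rightarrow>\<^sub>L 'h) set \<Rightarrow> ('h \<Rightarrow>\<^sub>L 'h) set \<Rightarrow> 'h op_graph \<Rightarrow> ('h \<Rightarrow>\<^sub>L 'h) \<Rightarrow> bool" where
  "grading N A D \<gamma> \<longleftrightarrow>
     \<gamma> \<in> N \<and> star \<gamma> = \<gamma> \<and> \<gamma> o\<^sub>L \<gamma> = id_blinfun \<and>
     (\<forall>a\<in>A. \<gamma> o\<^sub>L a = a o\<^sub>L \<gamma>) \<and> (\<forall>(x, y)\<in>D. (\<gamma> x, - \<gamma> y) \<in> D)"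

definition even_triple ::
  "('h::complex_hilbert_space \<Rightarrow>\<^sub>L 'h) set \<Rightarrow> ('h \<Rightarrow>\<^sub>L 'h) set \<Rightarrow> 'h op_graph \<Rightarrow> bool" where
  "even_triple N A D \<longleftrightarrow> (\<exists>\<gamma>. grading N A D \<gamma>)"

definition parity ::
  "('h::complex_hilbert_space \<Rightarrow>\<^sub>L 'h) set \<Rightarrow> ('h \<Rightarrow>\<^sub>L 'h) set \<Rightarrow> 'h op_graph \<Rightarrow> ('h \<Rightarrow>\<^sub>L 'h) \<Rightarrow>
    nat \<Rightarrow> bool" where
  "parity N A D \<gamma> P \<longleftrightarrow>
     (if even_triple N A D then grading N A D \<gamma> \<and> P = 0 else \<gamma> = id_blinfun \<and> P = 1)"

primrec in_dom_delta_power ::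
  "'h::complex_hilbert_space op_graph \<Rightarrow> nat \<Rightarrow> ('h \<Rightarrow>\<^sub>L 'h) \<Rightarrow> bool" where
  "in_dom_delta_power D 0 T \<longleftrightarrow> T \<in> bounded_ops"
| "in_dom_delta_power D (Suc k) T \<longleftrightarrow>
     T \<in> bounded_ops \<and> (\<exists>S. extends_commutator (modulus D) T S \<and> in_dom_delta_power D k S)"

definition QC_infinity :: "('h::complex_hilbert_space \<Rightarrow>\<^sub>L 'h) set \<Rightarrow> 'h op_graph \<Rightarrow> bool" where
  "QC_infinity A D \<longleftrightarrow>
     (\<forall>a\<in>A. \<forall>k\<ge>1. in_dom_delta_power D k a \<and> in_dom_delta_power D k (commutator D a))"

definition finitely_summable ::
  "('h::complex_hilbert_space \<Rightarrow>\<^sub>L 'h) set \<Rightarrow> (('h \<Rightarrow>\<^sub>L 'h) \<Rightarrow> ennreal) \<Rightarrow> 'h op_graph \<Rightarrow> bool" where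
  "finitely_summable N \<tau> D \<longleftrightarrow> (\<exists>k. trace_graph N \<tau> (one_plus_square_power D k) < \<infinity>)"

definition spectral_dimension ::
  "('h::complex_hilbert_space \<Rightarrow>\<^sub>L 'h) set \<Rightarrow> (('h \<Rightarrow>\<^sub>L 'h) \<Rightarrow> ennreal) \<Rightarrow> 'h op_graph \<Rightarrow> ereal" where
  "spectral_dimension N \<tau> D =
     (INF k\<in>{k. trace_graph N \<tau> (one_plus_square_power D k) < \<infinity>}. ereal k)"


section \<open>The resolvent cocycle and the reduced resolvent cocycle\<close>

definition max_degree :: "real \<Rightarrow> nat \<Rightarrow> int" where
  "max_degree q P = 2 * \<lfloor>(q + 1 + real P) / 2\<rfloor> - int P"

definition resolvent :: "'h::complex_hilbert_space op_graph \<Rightarrow> real \<Rightarrow> complex \<Rightarrow> ('h \<Rightarrow>\<^sub>L 'h)" where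
  "resolvent D s z =
     bounded_inverse (scalar_minus z (scalar_plus (complex_of_real (1 + s\<^sup>2)) (D O D)))"

primrec resolvent_word ::
  "'h::complex_hilbert_space op_graph \<Rightarrow> (nat \<Rightarrow> 'h \<Rightarrow>\<^sub>L 'h) \<Rightarrow> real \<Rightarrow> complex \<Rightarrow> nat \<Rightarrow> ('h \<Rightarrow>\<^sub>L 'h)"
where
  "resolvent_word D a s z 0 = a 0 o\<^sub>L resolvent D s z"
| "resolvent_word D a s z (Suc j) =
     resolvent_word D a s z j o\<^sub>L commutator D (a (Suc j)) o\<^sub>L resolvent D s z"

text \<open>The integral, convergent in operator norm, over the vertical line through \<open>\<alpha>\<close>; it is oriented
  upwards for \<open>\<sigma> = 1\<close> and downwards for \<open>\<sigma> = -1\<close>.\<close>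

definition line_integral ::
  "real \<Rightarrow> real \<Rightarrow> (complex \<Rightarrow> 'h::complex_hilbert_space \<Rightarrow>\<^sub>L 'h) \<Rightarrow> ('h \<Rightarrow>\<^sub>L 'h)" where
  "line_integral \<sigma> \<alpha> f =
     scal (complex_of_real \<sigma> * \<i>) o\<^sub>L integral UNIV (\<lambda>v. f (Complex \<alpha> v))"

definition traced_integral ::
  "('h::complex_hilbert_space \<Rightarrow>\<^sub>L 'h) set \<Rightarrow> (('h \<Rightarrow>\<^sub>L 'h) \<Rightarrow> ennreal) \<Rightarrow> 'h op_graph \<Rightarrow> ('h \<Rightarrow>\<^sub>L 'h) \<Rightarrow>
    real \<Rightarrow> real \<Rightarrow> nat \<Rightarrow> (nat \<Rightarrow> 'h \<Rightarrow>\<^sub>L 'h) \<Rightarrow> real \<Rightarrow> complex \<Rightarrow> complex" where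
  "traced_integral N \<tau> D \<gamma> \<sigma> \<alpha> m a s w =
     trace_ext N \<tau> (scal (1 / (2 * of_real pi * \<i>)) o\<^sub>L \<gamma> o\<^sub>L
       line_integral \<sigma> \<alpha> (\<lambda>z. scal (z powr w) o\<^sub>L resolvent_word D a s z m))"

definition eta :: "nat \<Rightarrow> nat \<Rightarrow> complex" where
  "eta P m = (- csqrt (2 * \<i>)) ^ P * 2 ^ (m + 1) * Gamma (of_nat m / 2 + 1) / Gamma (of_nat m + 1)"

definition resolvent_cocycle ::
  "('h::complex_hilbert_space \<Rightarrow>\<^sub>L 'h) set \<Rightarrow> (('h \<Rightarrow>\<^sub>L 'h) \<Rightarrow> ennreal) \<Rightarrow> 'h op_graph \<Rightarrow> ('h \<Rightarrow>\<^sub>L 'h) \<Rightarrow>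
    nat \<Rightarrow> real \<Rightarrow> real \<Rightarrow> real \<Rightarrow> nat \<Rightarrow> complex \<Rightarrow> (nat \<Rightarrow> 'h \<Rightarrow>\<^sub>L 'h) \<Rightarrow> complex" where
  "resolvent_cocycle N \<tau> D \<gamma> P \<sigma> \<alpha> q m r a =
     eta P m * integral {0..}
       (\<lambda>s. of_real (s ^ m) *
            traced_integral N \<tau> D \<gamma> \<sigma> \<alpha> m a s (- of_real q / 2 - r))"

definition reduced_resolvent_cocycle ::
  "('h::complex_hilbert_space \<Rightarrow>\<^sub>L 'h) set \<Rightarrow> (('h \<Rightarrow>\<^sub>L 'h) \<Rightarrow> ennreal) \<Rightarrow> 'h op_graph \<Rightarrow> ('h \<Rightarrow>\<^sub>L 'h) \<Rightarrow>
    nat \<Rightarrow> real \<Rightarrow> real \<Rightarrow> real \<Rightarrow> nat \<Rightarrow> complex \<Rightarrow> (nat \<Rightarrow> 'h \<Rightarrow>\<^sub>L 'h) \<Rightarrow> complex" where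
  "reduced_resolvent_cocycle N \<tau> D \<gamma> P \<sigma> \<alpha> q m r a =
     (-1) ^ P * csqrt (2 * \<i>) ^ P *
     (of_real (sqrt pi) * Gamma (of_real q / 2 + r - (of_nat m + 1) / 2) / Gamma (of_real q / 2 + r)) *
     traced_integral N \<tau> D \<gamma> \<sigma> \<alpha> m a 0 (- of_real q / 2 - r + (of_nat m + 1) / 2)"

text \<open>Equality, modulo functions holomorphic on an open right half-plane containing
  \<open>(1 - q) / 2\<close>, of functions that are meromorphic on \<open>Re r > (1 - m) / 2\<close> with poles at most in \<open>S\<close>.
  Points of \<open>S\<close> are excluded because a total function takes a junk value there (the library's
  Gamma function is 0 at its poles).\<close>

definition equal_modulo_holomorphic ::
  "real \<Rightarrow> nat \<Rightarrow> complex set \<Rightarrow> (complex \<Rightarrow> complex) \<Rightarrow> (complex \<Rightarrow> complex) \<Rightarrow> bool" where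
  "equal_modulo_holomorphic q m S f g \<longleftrightarrow>
     (\<exists>c h. c < (1 - q) / 2 \<and> h holomorphic_on {r. Re r > c} \<and>
        (\<forall>r. Re r > (1 - real m) / 2 \<and> Re r > c \<and> r \<notin> S \<longrightarrow> f r = g r + h r))"

end

theory Submission
  imports Defs "HOL-Complex_Analysis.Complex_Analysis" "HOL-Computational_Algebra.Fundamental_Theorem_Algebra"
begin

text \<open>Write \<open>W\<^sub>k(z)\<close> for the \<open>k\<close>-th derivative of \<open>z \<mapsto> a\<^sub>0 R(z) [D, a\<^sub>1] R(z) \<dots> [D, a\<^sub>m] R(z)\<close>,
  where \<open>R(z) = (z - (1 + D\<^sup>2))\<^sup>-\<^sup>1\<close>. Representing \<open>z powr w\<close> by a Beta type integral
  and applying Cauchy's formula, integrals over the vertical line become integrals over the half line: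
  the integral of \<open>z powr w W\<^sub>0(z - c)\<close> is, up to orientation,
  \<open>2 \<pi> \<i> / (\<Gamma>(-w) \<Gamma>(w + k + 1))\<close> times that of \<open>x powr (w + k) W\<^sub>k(-x - c)\<close> over \<open>x > 0\<close>,
  with \<open>k\<close> free. For large \<open>k\<close> the operators \<open>W\<^sub>k(-x)\<close> contain a power of one resolvent that is of trace class,
  so the trace can be taken under the integral and becomes a continuous function \<open>\<omega>(x + c)\<close>.
  In the resolvent cocycle \<open>c = s\<^sup>2\<close>, and integration against \<open>s\<^sup>m ds\<close> is a fractional integral, which
  turns \<open>x powr (w + k)\<close> into \<open>x powr (w + k + (m + 1) / 2)\<close> at the price of a quotient of Gamma values.
  This is the reduced cocycle, by Legendre duplication; the two functions
  agree exactly wherever both are defined.\<close>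


section \<open>Hilbert space operators\<close>

text \<open>The obstacle is that \<open>trace_ext\<close> is a definite description that denotes
  only on trace class operators and is in general not continuous for the operator norm, while the
  contour integral converges in that norm. Trace and integral are therefore exchanged through norm
  continuous functionals: if \<open>S\<close> is self-adjoint and \<open>S o\<^sub>L S\<close> has
  finite trace, then X is sent boundedly to the trace of S X S. The operators
  \<open>W\<^sub>k(-x)\<close> are brought into the form of a finite sum of products C S S G with C
  bounded and G decaying; cyclicity under the integral turns C S S G into the functional applied to
  G C. The factor S S is (1 + D^2)^(-t). Differentiating k times distributes k further resolvents
  over m + 1 places, so if k is at least (m + 1) n with n > t, some place receives a power that
  contains (1 + D^2)^(-t). The number t depends on r: it may be taken as close to q / 2 as desired,
  and this is what reaches every r with real part above (1 - m) / 2. A large k also makes x powr (w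
  + k) continuous at 0. Fubini, the residue theorem and analytic continuation are applied to scalar
  matrix elements only.\<close>

lemma cinner_add_left: "cinner (x + y) z = cinner x z + cinner y (z :: 'h::complex_hilbert_space)"
  by (metis cinner_commute cinner_add_right complex_cnj_add)

lemma cinner_scaleC_left: "cinner (c *\<^sub>C x) y = cnj c * cinner x (y :: 'h::complex_hilbert_space)"
  by (metis cinner_commute cinner_scaleC_right complex_cnj_mult complex_cnj_cnj)

lemma cinner_scaleR_right: "cinner x (r *\<^sub>R y) = of_real r * cinner x (y :: 'h::complex_hilbert_space)"
  by (metis scaleC_of_real cinner_scaleC_right)

lemma cinner_scaleR_left: "cinner (r *\<^sub>R x) y = of_real r * cinner x (y :: 'h::complex_hilbert_space)"
  by (metis scaleC_of_real cinner_scaleC_left complex_cnj_complex_of_real)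

lemma cinner_zero_right [simp]: "cinner x (0 :: 'h::complex_hilbert_space) = 0"
  using cinner_add_right[of x 0 0] by simp

lemma cinner_zero_left [simp]: "cinner (0 :: 'h::complex_hilbert_space) x = 0"
  using cinner_add_left[of 0 0 x] by simp

lemma cinner_minus_right [simp]: "cinner x (- y) = - cinner x (y :: 'h::complex_hilbert_space)"
  using cinner_scaleR_right[of x "-1" y] by simp

lemma cinner_minus_left [simp]: "cinner (- x) y = - cinner x (y :: 'h::complex_hilbert_space)"
  using cinner_scaleR_left[of "-1" x y] by simp

lemma cinner_diff_right: "cinner x (y - z) = cinner x y - cinner x (z :: 'h::complex_hilbert_space)"
  using cinner_add_right[of x y "- z"] by simp

lemma cinner_diff_left: "cinner (x - y) z = cinner x z - cinner y (z :: 'h::complex_hilbert_space)"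
  using cinner_add_left[of x "- y" z] by simp

lemmas cinner_simps = cinner_add_left cinner_add_right cinner_diff_left cinner_diff_right
  cinner_scaleC_left cinner_scaleC_right cinner_scaleR_left cinner_scaleR_right

lemma Re_cinner_self: "Re (cinner x x) = (norm (x :: 'h::complex_hilbert_space))\<^sup>2"
  by (simp add: cinner_self)

lemma Re_cinner_commute: "Re (cinner x y) = Re (cinner y (x :: 'h::complex_hilbert_space))"
  by (subst cinner_commute) simp

lemma norm_add_sq:
  "(norm (x + y))\<^sup>2 = (norm x)\<^sup>2 + (norm y)\<^sup>2 + 2 * Re (cinner x (y :: 'h::complex_hilbert_space))"
  unfolding Re_cinner_self[symmetric] using Re_cinner_commute[of x y] by (simp add: cinner_simps)

lemma norm_diff_sq:
  "(norm (x - y))\<^sup>2 = (norm x)\<^sup>2 + (norm y)\<^sup>2 - 2 * Re (cinner x (y :: 'h::complex_hilbert_space))"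
  unfolding Re_cinner_self[symmetric] using Re_cinner_commute[of x y] by (simp add: cinner_simps)

lemma cinner_eq_all: "(\<And>x. cinner x y = cinner x z) \<Longrightarrow> y = (z :: 'h::complex_hilbert_space)"
  by (metis cinner_diff_right cinner_self eq_iff_diff_eq_0 norm_eq_zero of_real_eq_0_iff
      power_eq_0_iff)

lemma scaleC_zero_left [simp]: "0 *\<^sub>C x = (0 :: 'h::complex_hilbert_space)"
  using scaleC_of_real[of 0 x] by simp

lemma scaleC_zero_right [simp]: "c *\<^sub>C 0 = (0 :: 'h::complex_hilbert_space)"
  using scaleC_add_right[of c "0::'h" 0] by simp

lemma scaleC_one [simp]: "1 *\<^sub>C x = (x :: 'h::complex_hilbert_space)"
  using scaleC_of_real[of 1 x] by simp

lemma scaleC_minus_right [simp]: "c *\<^sub>C (- x) = - (c *\<^sub>C (x :: 'h::complex_hilbert_space))"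
  using scaleC_add_right[of c x "- x"] by (simp add: eq_neg_iff_add_eq_0 add.commute)

lemma scaleC_minus_left [simp]: "(- c) *\<^sub>C x = - (c *\<^sub>C (x :: 'h::complex_hilbert_space))"
  using scaleC_add_left[of c "- c" x] by (simp add: eq_neg_iff_add_eq_0 add.commute)

lemma scaleC_diff_right: "c *\<^sub>C (x - y) = c *\<^sub>C x - c *\<^sub>C (y :: 'h::complex_hilbert_space)"
  using scaleC_add_right[of c x "- y"] by simp

lemma scaleC_diff_left: "(c - d) *\<^sub>C x = c *\<^sub>C x - d *\<^sub>C (x :: 'h::complex_hilbert_space)"
  using scaleC_add_left[of c "- d" x] by simp

section \<open>Cauchy-Schwarz inequality and representation of bounded functionals\<close>

lemma Cauchy_Schwarz_cinner: "cmod (cinner x y) \<le> norm x * norm (y :: 'h::complex_hilbert_space)"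
proof (cases "y = 0")
  case False
  define c where "c = cinner y x / of_real ((norm y)\<^sup>2)"
  have n: "(norm y)\<^sup>2 > 0" using False by simp
  have xy: "cinner x y = cnj (cinner y x)" by (rule cinner_commute)
  have "0 \<le> (norm (x - c *\<^sub>C y))\<^sup>2" by simp
  also have "\<dots> = (norm x)\<^sup>2 + (cmod c * norm y)\<^sup>2 - 2 * Re (c * cinner x y)"
    by (simp add: norm_diff_sq norm_scaleC cinner_scaleC_right)
  also have "c * cinner x y = of_real ((cmod (cinner y x))\<^sup>2 / (norm y)\<^sup>2)"
    unfolding c_def xy by (simp add: complex_norm_square flip: of_real_power)
  also have "(cmod c * norm y)\<^sup>2 = (cmod (cinner y x))\<^sup>2 / (norm y)\<^sup>2"
    using n unfolding c_def by (simp add: norm_divide norm_power power_divide power_mult_distrib) (simp add: eval_nat_numeral)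
  finally have "(cmod (cinner y x))\<^sup>2 / (norm y)\<^sup>2 \<le> (norm x)\<^sup>2" by simp
  then have "(cmod (cinner y x))\<^sup>2 \<le> (norm x * norm y)\<^sup>2"
    using n by (simp add: field_simps)
  then have "cmod (cinner y x) \<le> norm x * norm y"
    by (rule power2_le_imp_le) simp
  then show ?thesis by (simp add: xy)
qed simp

lemma bounded_bilinear_cinner:
  "bounded_bilinear (cinner :: 'h::complex_hilbert_space \<Rightarrow> 'h \<Rightarrow> complex)"
proof
  show "\<exists>K. \<forall>a b :: 'h. norm (cinner a b) \<le> norm a * norm b * K"
    using Cauchy_Schwarz_cinner by (intro exI[of _ 1]) auto
qed (simp_all add: cinner_simps scaleR_conv_of_real)

text \<open>The representing vector is found by minimising \<open>\<Phi>\<close> x = |x|^2 - 2 Re (f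
  x): the parallelogram law makes minimising sequences Cauchy, and the vanishing of the first
  variation at the minimiser says that f is the inner product with it.\<close>

lemma Riesz_representation:
  fixes f :: "'h::complex_hilbert_space \<Rightarrow> complex"
  assumes add: "\<And>x y. f (x + y) = f x + f y"
    and scal: "\<And>c x. f (c *\<^sub>C x) = c * f x"
    and bd: "\<And>x. cmod (f x) \<le> K * norm x"
  shows "\<exists>y. \<forall>x. f x = cinner y x"
proof -
  define \<Phi> where "\<Phi> x = (norm x)\<^sup>2 - 2 * Re (f x)" for x
  have fR: "f (r *\<^sub>R x) = of_real r * f x" for r x
    by (metis scal scaleC_of_real)
  have lower: "\<Phi> x \<ge> - K\<^sup>2" for x
  proof -
    have "Re (f x) \<le> K * norm x" using bd[of x] complex_Re_le_cmod order_trans by blast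
    moreover have "0 \<le> (norm x - K)\<^sup>2" by simp
    ultimately show ?thesis unfolding \<Phi>_def power2_diff by (simp add: mult.commute mult.left_commute)
  qed
  define I where "I = Inf (range \<Phi>)"
  have bdd: "bdd_below (range \<Phi>)" using lower by (intro bdd_belowI[of _ "- K\<^sup>2"]) auto
  have Ile: "I \<le> \<Phi> x" for x unfolding I_def by (rule cInf_lower) (auto simp: bdd)
  have "\<exists>x. \<Phi> x < I + inverse (Suc n)" for n
  proof -
    have "Inf (range \<Phi>) < I + inverse (Suc n)" unfolding I_def by simp
    then show ?thesis by (subst (asm) cInf_less_iff) (auto simp: bdd)
  qed
  then obtain X where X: "\<And>n. \<Phi> (X n) < I + inverse (Suc n)" by metis
  \<comment> \<open>Parallelogram law: \<open>I\<close> bounds \<open>\<Phi>\<close> at the midpoint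
    from below, so two near-minimisers are close to each other.\<close>
  have para: "(norm (x - y))\<^sup>2 \<le> 2 * (\<Phi> x - I) + 2 * (\<Phi> y - I)" for x y
  proof -
    have "(norm ((1/2) *\<^sub>R (x + y)))\<^sup>2 = (norm (x + y))\<^sup>2 / 4"
      by (simp add: power_divide)
    then have "\<Phi> ((1/2) *\<^sub>R (x + y)) = (norm (x + y))\<^sup>2 / 4 - Re (f x) - Re (f y)"
      unfolding \<Phi>_def fR add by (simp add: field_simps)
    with Ile[of "(1/2) *\<^sub>R (x + y)"] have "I \<le> (norm (x + y))\<^sup>2 / 4 - Re (f x) - Re (f y)" by simp
    then show ?thesis
      unfolding \<Phi>_def norm_add_sq norm_diff_sq by (simp add: field_simps)
  qed
  have "Cauchy X"
  proof (rule metric_CauchyI)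
    fix e :: real assume e: "e > 0"
    obtain M where M: "inverse (real (Suc M)) < e\<^sup>2 / 4"
      using reals_Archimedean[of "e\<^sup>2 / 4"] e by auto
    show "\<exists>M. \<forall>m\<ge>M. \<forall>n\<ge>M. dist (X m) (X n) < e"
    proof (intro exI[of _ M] allI impI)
      fix m n assume mn: "M \<le> m" "M \<le> n"
      have "inverse (real (Suc m)) \<le> inverse (real (Suc M))" "inverse (real (Suc n)) \<le> inverse (real (Suc M))"
        using mn by simp_all
      then have "(norm (X m - X n))\<^sup>2 < e\<^sup>2"
        using para[of "X m" "X n"] X[of m] X[of n] M unfolding mult_2 by argo
      then show "dist (X m) (X n) < e"
        unfolding dist_norm using e by (simp add: power2_less_imp_less)
    qed
  qed
  then obtain y where y: "X \<longlonglongrightarrow> y" by (meson convergent_def Cauchy_convergent)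
  have blf: "bounded_linear f"
    by (rule bounded_linear_intro[where K = K])
      (simp_all add: add fR bd mult.commute scaleR_conv_of_real)
  have "(\<lambda>n. \<Phi> (X n)) \<longlonglongrightarrow> \<Phi> y"
    unfolding \<Phi>_def by (intro tendsto_intros y bounded_linear.tendsto[OF blf])
  moreover have "(\<lambda>n. I + inverse (Suc n)) \<longlonglongrightarrow> I + 0"
    by (intro tendsto_intros LIMSEQ_inverse_real_of_nat)
  ultimately have min: "\<Phi> y \<le> I"
    using X by (intro LIMSEQ_le[of "\<lambda>n. \<Phi> (X n)"]) (auto intro: less_imp_le)
  have Re_eq: "Re (f h) = Re (cinner y h)" for h
  proof -
    define d where "d = Re (cinner y h) - Re (f h)"
    have "0 \<le> t\<^sup>2 * (norm h)\<^sup>2 + 2 * t * d" for t :: real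
    proof -
      have "\<Phi> y \<le> \<Phi> (y + t *\<^sub>R h)" using min Ile[of "y + t *\<^sub>R h"] by linarith
      then show ?thesis
        unfolding \<Phi>_def norm_add_sq add fR d_def
        by (simp add: cinner_simps algebra_simps power_mult_distrib)
    qed
    note quad = this
    \<comment> \<open>Testing the quadratic at t = - d / a, slightly off its minimiser, keeps the
      denominator positive also for h = 0; the value obtained is negative unless d = 0.\<close>
    define a where "a = (norm h)\<^sup>2 + 1"
    have a: "a > 0" "(norm h)\<^sup>2 = a - 1" unfolding a_def by (simp_all add: add_nonneg_pos)
    have "0 \<le> (- d / a)\<^sup>2 * (a - 1) + 2 * (- d / a) * d"
      using quad[of "- d / a"] by (simp add: a(2))
    also have "\<dots> = - (d\<^sup>2 * (a + 1) / a\<^sup>2)"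
      using a(1) by (simp add: field_simps power2_eq_square)
    finally have "d\<^sup>2 * (a + 1) / a\<^sup>2 \<le> 0" by simp
    then have "d = 0"
      using a(1) by (simp add: divide_le_0_iff mult_le_0_iff)
    then show ?thesis by (simp add: d_def)
  qed
  have "f h = cinner y h" for h
  proof (rule complex_eqI)
    have "Re (f (\<i> *\<^sub>C h)) = Re (cinner y (\<i> *\<^sub>C h))" by (rule Re_eq)
    then show "Im (f h) = Im (cinner y h)" by (simp add: scal cinner_simps)
  qed (rule Re_eq)
  then show ?thesis by blast
qed


subsection \<open>Complex linear operators and adjoints\<close>

lemma bounded_opsD: "T \<in> bounded_ops \<Longrightarrow> T (c *\<^sub>C x) = c *\<^sub>C T x"
  by (simp add: bounded_ops_def)

text \<open>With complex linearity read as commutation with scalars, limits, functional calculus and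
  integrals inherit it by the same argument that keeps them in a commutant.\<close>

lemma bounded_ops_iff_commute: "T \<in> bounded_ops \<longleftrightarrow> (\<forall>c. T o\<^sub>L scal c = scal c o\<^sub>L T)"
  by (auto simp: bounded_ops_def scal_apply intro: blinfun_eqI dest: arg_cong[where f = blinfun_apply] fun_cong)
     (metis blinfun_apply_blinfun_compose scal_apply)

lemma blinfun_compose_assoc: "(A o\<^sub>L B) o\<^sub>L C = A o\<^sub>L (B o\<^sub>L C)"
  by (rule blinfun_eqI) simp

lemma id_blinfun_compose [simp]: "id_blinfun o\<^sub>L A = A" "A o\<^sub>L id_blinfun = A"
  by (rule blinfun_eqI, simp)+

lemmas compose_distribs =
  bounded_bilinear.add_left[OF bounded_bilinear_blinfun_compose]
  bounded_bilinear.add_right[OF bounded_bilinear_blinfun_compose]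
  bounded_bilinear.diff_left[OF bounded_bilinear_blinfun_compose]
  bounded_bilinear.diff_right[OF bounded_bilinear_blinfun_compose]
  bounded_bilinear.scaleR_left[OF bounded_bilinear_blinfun_compose]
  bounded_bilinear.scaleR_right[OF bounded_bilinear_blinfun_compose]
  bounded_bilinear.minus_left[OF bounded_bilinear_blinfun_compose]
  bounded_bilinear.minus_right[OF bounded_bilinear_blinfun_compose]
  bounded_bilinear.zero_left[OF bounded_bilinear_blinfun_compose]
  bounded_bilinear.zero_right[OF bounded_bilinear_blinfun_compose]

lemma scal_in_bounded_ops: "scal c \<in> bounded_ops"
  by (simp add: bounded_ops_def scal_apply scaleC_scaleC mult.commute)

lemma scal_of_real: "scal (of_real r) = r *\<^sub>R id_blinfun"
  by (rule blinfun_eqI) (simp add: scal_apply scaleC_of_real blinfun.scaleR_left)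

lemma scal_mult: "scal (c * d) = scal c o\<^sub>L scal d"
  by (rule blinfun_eqI) (simp add: scal_apply scaleC_scaleC)

lemma scal_add: "scal (c + d) = scal c + scal d"
  by (rule blinfun_eqI) (simp add: scal_apply scaleC_add_left blinfun.add_left)

lemma scal_one [simp]: "scal 1 = id_blinfun"
  by (rule blinfun_eqI) (simp add: scal_apply)

lemma scal_zero [simp]: "scal 0 = 0"
  by (rule blinfun_eqI) (simp add: scal_apply)

lemma scal_minus: "scal (- c) = - scal c"
  by (rule blinfun_eqI) (simp add: scal_apply blinfun.minus_left)

lemma norm_scal_compose: "norm (scal c o\<^sub>L T) = cmod c * norm T"
proof (rule antisym)
  have le: "norm (scal c o\<^sub>L S) \<le> cmod c * norm S" for c and S :: "'a \<Rightarrow>\<^sub>L 'b"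
    by (rule norm_blinfun_bound)
      (auto simp: scal_apply norm_scaleC mult.assoc intro!: mult_left_mono norm_blinfun)
  then show "norm (scal c o\<^sub>L T) \<le> cmod c * norm T" .
  show "cmod c * norm T \<le> norm (scal c o\<^sub>L T)"
  proof (cases "c = 0")
    case False
    have "T = scal (1 / c) o\<^sub>L (scal c o\<^sub>L T)"
      using False by (simp add: blinfun_compose_assoc[symmetric] flip: scal_mult)
    then have "norm T \<le> cmod (1 / c) * norm (scal c o\<^sub>L T)"
      by (metis le)
    then show ?thesis using False by (simp add: norm_divide field_simps)
  qed simp
qed

lemma norm_scal_le: "norm (scal c) \<le> cmod c"
  by (rule norm_blinfun_bound) (auto simp: scal_apply norm_scaleC)

lemma bounded_linear_scal: "bounded_linear (scal :: complex \<Rightarrow> 'a::complex_hilbert_space \<Rightarrow>\<^sub>L 'a)"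
proof (rule bounded_linear_intro[where K = 1])
  show "scal (r *\<^sub>R x) = (r *\<^sub>R scal x :: 'a \<Rightarrow>\<^sub>L 'a)" for r x
    by (simp add: scaleR_conv_of_real scal_mult scal_of_real compose_distribs)
qed (auto simp: scal_add norm_scal_le)

lemma star_unique:
  fixes S T :: "'h::complex_hilbert_space \<Rightarrow>\<^sub>L 'h"
  assumes "S \<in> bounded_ops" "\<And>x y. cinner (T x) y = cinner x (S y)"
  shows "star T = S"
  unfolding star_def
proof (rule the_equality)
  fix S' assume "S' \<in> bounded_ops \<and> (\<forall>x y. cinner (T x) y = cinner x (S' y))"
  then show "S' = S"
    using assms by (intro blinfun_eqI cinner_eq_all) metis
qed (use assms in auto)

lemma adjoint_exists:
  fixes T :: "'h::complex_hilbert_space \<Rightarrow>\<^sub>L 'h"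
  assumes "T \<in> bounded_ops"
  shows "\<exists>S\<in>bounded_ops. \<forall>x y. cinner (T x) y = cinner x (S y)"
proof -
  have "\<exists>z. \<forall>x. cinner y (T x) = cinner z x" for y
  proof (rule Riesz_representation[where K = "norm y * norm T"])
    fix x
    have "cmod (cinner y (T x)) \<le> norm y * norm (T x)" by (rule Cauchy_Schwarz_cinner)
    also have "\<dots> \<le> norm y * (norm T * norm x)" by (intro mult_left_mono norm_blinfun) auto
    finally show "cmod (cinner y (T x)) \<le> norm y * norm T * norm x" by (simp add: mult.assoc)
  qed (simp_all add: blinfun.add_right cinner_simps bounded_opsD[OF assms])
  then obtain s where s: "\<And>y x. cinner y (T x) = cinner (s y) x" by metis
  have s': "cinner (T x) y = cinner x (s y)" for x y
    by (metis s cinner_commute)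
  have add: "s (x + y) = s x + s y" for x y
    by (rule cinner_eq_all) (simp add: s'[symmetric] cinner_simps)
  have sc: "s (c *\<^sub>C x) = c *\<^sub>C s x" for c x
    by (rule cinner_eq_all) (simp add: s'[symmetric] cinner_simps)
  have nrm: "norm (s y) \<le> norm y * norm T" for y
  proof (cases "s y = 0")
    case False
    have "(norm (s y))\<^sup>2 = Re (cinner y (T (s y)))"
      by (simp add: s Re_cinner_self)
    also have "\<dots> \<le> cmod (cinner y (T (s y)))" by (rule complex_Re_le_cmod)
    also have "\<dots> \<le> norm y * norm (T (s y))" by (rule Cauchy_Schwarz_cinner)
    also have "\<dots> \<le> norm y * (norm T * norm (s y))" by (intro mult_left_mono norm_blinfun) auto
    finally show ?thesis using False by (simp add: power2_eq_square)
  qed simp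
  have bl: "bounded_linear s"
    by (rule bounded_linear_intro[where K = "norm T"])
      (simp_all add: add nrm sc flip: scaleC_of_real)
  show ?thesis
    by (rule bexI[of _ "Blinfun s"]) (auto simp: bounded_linear_Blinfun_apply[OF bl] s' bounded_ops_def sc)
qed

lemma
  fixes T :: "'h::complex_hilbert_space \<Rightarrow>\<^sub>L 'h"
  assumes "T \<in> bounded_ops"
  shows star_in_bounded_ops: "star T \<in> bounded_ops"
    and cinner_star_right: "cinner x (star T y) = cinner (T x) y"
proof -
  obtain S where S: "S \<in> bounded_ops" "\<forall>x y. cinner (T x) y = cinner x (S y)"
    using adjoint_exists[OF assms] by auto
  then have "star T = S" by (intro star_unique) auto
  with S show "star T \<in> bounded_ops" "cinner x (star T y) = cinner (T x) y" by auto
qed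

lemma cinner_star_left: "T \<in> bounded_ops \<Longrightarrow> cinner (star T x) y = cinner x (T y)"
  by (metis cinner_star_right cinner_commute)

lemma bounded_ops_closed:
  shows "S \<in> bounded_ops \<Longrightarrow> T \<in> bounded_ops \<Longrightarrow> S + T \<in> bounded_ops"
    and "S \<in> bounded_ops \<Longrightarrow> T \<in> bounded_ops \<Longrightarrow> S - T \<in> bounded_ops"
    and "T \<in> bounded_ops \<Longrightarrow> - T \<in> bounded_ops"
    and "T \<in> bounded_ops \<Longrightarrow> r *\<^sub>R T \<in> bounded_ops"
    and "S \<in> bounded_ops \<Longrightarrow> T \<in> bounded_ops \<Longrightarrow> S o\<^sub>L T \<in> bounded_ops"
    and "id_blinfun \<in> bounded_ops" and "0 \<in> bounded_ops"
  by (simp_all add: bounded_ops_def blinfun.bilinear_simps scaleC_add_right scaleC_diff_right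
      scaleC_scaleC mult.commute flip: scaleC_of_real)

lemma star_star: "T \<in> bounded_ops \<Longrightarrow> star (star T) = T"
  by (rule star_unique) (auto simp: cinner_star_left)

lemma star_compose: "S \<in> bounded_ops \<Longrightarrow> T \<in> bounded_ops \<Longrightarrow> star (S o\<^sub>L T) = star T o\<^sub>L star S"
  by (rule star_unique) (auto simp: cinner_star_right star_in_bounded_ops bounded_ops_closed)

lemma star_add: "S \<in> bounded_ops \<Longrightarrow> T \<in> bounded_ops \<Longrightarrow> star (S + T) = star S + star T"
  by (rule star_unique)
    (auto simp: cinner_star_right star_in_bounded_ops bounded_ops_closed blinfun.bilinear_simps cinner_simps)

lemma star_diff: "S \<in> bounded_ops \<Longrightarrow> T \<in> bounded_ops \<Longrightarrow> star (S - T) = star S - star T"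
  by (rule star_unique)
    (auto simp: cinner_star_right star_in_bounded_ops bounded_ops_closed blinfun.bilinear_simps cinner_simps)

lemma star_scal_compose: "T \<in> bounded_ops \<Longrightarrow> star (scal c o\<^sub>L T) = scal (cnj c) o\<^sub>L star T"
  by (rule star_unique)
    (auto simp: cinner_star_right star_in_bounded_ops bounded_ops_closed scal_in_bounded_ops scal_apply cinner_simps)

lemma star_scaleR: "T \<in> bounded_ops \<Longrightarrow> star (r *\<^sub>R T) = r *\<^sub>R star T"
  by (rule star_unique)
    (auto simp: cinner_star_right star_in_bounded_ops bounded_ops_closed blinfun.bilinear_simps cinner_simps)

lemma norm_star_le: 
  assumes "T \<in> bounded_ops"
  shows "norm (star T) \<le> norm T"
proof (rule norm_blinfun_bound)
  fix y
  show "norm (star T y) \<le> norm T * norm y"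
  proof (cases "star T y = 0")
    case False
    have "(norm (star T y))\<^sup>2 = Re (cinner (T (star T y)) y)"
      by (simp add: Re_cinner_self cinner_star_right[OF assms, symmetric])
    also have "\<dots> \<le> norm (T (star T y)) * norm y"
      by (meson Cauchy_Schwarz_cinner complex_Re_le_cmod order_trans)
    also have "\<dots> \<le> (norm T * norm (star T y)) * norm y" by (intro mult_right_mono norm_blinfun) auto
    finally show ?thesis using False by (simp add: power2_eq_square)
  qed simp
qed simp

lemma norm_star: "T \<in> bounded_ops \<Longrightarrow> norm (star T) = norm T"
  by (metis norm_star_le star_star star_in_bounded_ops antisym)


subsection \<open>Positive operators\<close>

lemma positive_opD:
  assumes "positive_op T"
  shows "T \<in> bounded_ops" "Im (cinner x (T x)) = 0" "Re (cinner x (T x)) \<ge> 0"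
  using assms by (auto simp: positive_op_def complex_nonneg_Reals_iff)

lemma positive_opI:
  "T \<in> bounded_ops \<Longrightarrow> (\<And>x. Im (cinner x (T x)) = 0) \<Longrightarrow> (\<And>x. Re (cinner x (T x)) \<ge> 0) \<Longrightarrow> positive_op T"
  by (auto simp: positive_op_def complex_nonneg_Reals_iff)

text \<open>Polarisation: reality of the form at x + y relates the imaginary parts of its two mixed
  terms, and replacing y by i y relates their real parts.\<close>

lemma self_adjointI:
  assumes T: "T \<in> bounded_ops" and im: "\<And>x. Im (cinner x (T x)) = 0"
  shows "star T = T"
proof (rule star_unique[OF T])
  fix x y
  have *: "Im (cinner x (T y)) + Im (cinner y (T x)) = 0" for x y
    using im[of "x + y"] im[of x] im[of y] by (simp add: blinfun.add_right cinner_simps)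
  have "Re (cinner x (T y)) - Re (cinner y (T x)) = 0"
    using *[of x "\<i> *\<^sub>C y"] by (simp add: bounded_opsD[OF T] cinner_simps)
  with *[of x y] have "cinner x (T y) = cnj (cinner y (T x))"
    by (simp add: complex_eq_iff)
  then show "cinner (T x) y = cinner x (T y)"
    by (metis cinner_commute)
qed

lemma positive_op_star: "positive_op T \<Longrightarrow> star T = T"
  by (intro self_adjointI positive_opD)

text \<open>The norm of a self-adjoint operator is its numerical radius. The vector y is T x
  rescaled to the length of x, so the inner product of T x and y is |T x| |x|, and polarisation
  expresses its real part by the form at x + y and x - y.\<close>

lemma norm_self_adjoint_le:
  assumes T: "T \<in> bounded_ops" "star T = T" and c: "c \<ge> 0"
    and bd: "\<And>x. \<bar>Re (cinner x (T x))\<bar> \<le> c * (norm x)\<^sup>2"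
  shows "norm T \<le> c"
proof (rule norm_blinfun_bound[OF c])
  fix x
  show "norm (T x) \<le> c * norm x"
  proof (cases "T x = 0 \<or> x = 0")
    case False
    define y where "y = (norm x / norm (T x)) *\<^sub>R T x"
    have ny: "norm y = norm x" using False by (simp add: y_def)
    have sym: "Re (cinner x (T y)) = Re (cinner (T x) y)"
      by (metis cinner_star_right T)
    have "4 * Re (cinner (T x) y) = Re (cinner (x + y) (T (x + y))) - Re (cinner (x - y) (T (x - y)))"
      using sym Re_cinner_commute[of "T x" y]
      by (simp add: blinfun.bilinear_simps cinner_simps)
    also have "\<dots> \<le> c * (norm (x + y))\<^sup>2 + c * (norm (x - y))\<^sup>2"
      using bd[of "x + y"] bd[of "x - y"] by linarith
    also have "\<dots> = 4 * c * (norm x)\<^sup>2"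
      by (simp add: norm_add_sq norm_diff_sq ny algebra_simps)
    finally have "Re (cinner (T x) y) \<le> c * (norm x)\<^sup>2" by simp
    moreover have "Re (cinner (T x) y) = norm x * norm (T x)"
      using False by (simp add: y_def cinner_simps Re_cinner_self power2_eq_square)
    ultimately show ?thesis using False by (simp add: power2_eq_square)
  qed (use c in \<open>auto simp: blinfun.zero_right\<close>)
qed

lemma self_adjoint_zeroI:
  assumes T: "T \<in> bounded_ops" and "\<And>x. cinner x (T x) = 0"
  shows "T = 0"
proof -
  have "norm T \<le> 0"
    using assms by (intro norm_self_adjoint_le self_adjointI) auto
  then show ?thesis by simp
qed

lemma abs_Re_cinner_le:
  fixes T :: "'h::complex_hilbert_space \<Rightarrow>\<^sub>L 'h"
  shows "\<bar>Re (cinner x (T x))\<bar> \<le> norm T * (norm x)\<^sup>2"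
proof -
  have "\<bar>Re (cinner x (T x))\<bar> \<le> norm x * norm (T x)"
    by (meson Cauchy_Schwarz_cinner abs_Re_le_cmod order_trans)
  also have "\<dots> \<le> norm x * (norm T * norm x)" by (intro mult_left_mono norm_blinfun) auto
  finally show ?thesis by (simp add: power2_eq_square mult_ac)
qed

lemma positive_op_star_compose:
  assumes "T \<in> bounded_ops" "positive_op S" 
  shows "positive_op (star T o\<^sub>L (S o\<^sub>L T))"
  using assms positive_opD[OF assms(2)]
  by (intro positive_opI) (auto simp: cinner_star_right bounded_ops_closed star_in_bounded_ops)

lemma positive_op_id: "positive_op id_blinfun"
  by (intro positive_opI) (auto simp: bounded_ops_closed cinner_self)

lemma positive_op_square: "T \<in> bounded_ops \<Longrightarrow> positive_op (star T o\<^sub>L T)"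
  using positive_op_star_compose[of T id_blinfun] positive_op_id by simp

lemma positive_op_add: "positive_op S \<Longrightarrow> positive_op T \<Longrightarrow> positive_op (S + T)"
  using positive_opD[of S] positive_opD[of T]
  by (intro positive_opI) (auto simp: bounded_ops_closed blinfun.bilinear_simps cinner_simps)

lemma positive_op_scaleR: "positive_op T \<Longrightarrow> r \<ge> 0 \<Longrightarrow> positive_op (r *\<^sub>R T)"
  using positive_opD[of T]
  by (intro positive_opI) (auto simp: bounded_ops_closed blinfun.bilinear_simps cinner_simps)

lemma positive_op_norm_minus:
  assumes "T \<in> bounded_ops" "star T = T"
  shows "positive_op (norm T *\<^sub>R id_blinfun - T)" "positive_op (norm T *\<^sub>R id_blinfun + T)"
proof -
  have "Im (cinner x (T x)) = 0" for x
    using cinner_star_right[OF assms(1), of x x] assms(2) cinner_commute[of "T x" x] 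
    by (metis complex_In_mult_cnj_zero Im_complex_of_real Reals_cnj_iff complex_is_Real_iff)
  moreover have "\<bar>Re (cinner x (T x))\<bar> \<le> norm T * (norm x)\<^sup>2" for x by (rule abs_Re_cinner_le)
  ultimately show "positive_op (norm T *\<^sub>R id_blinfun - T)" "positive_op (norm T *\<^sub>R id_blinfun + T)"
    using assms
    by (auto intro!: positive_opI simp: bounded_ops_closed blinfun.bilinear_simps cinner_simps cinner_self abs_le_iff) 
      (smt (verit) abs_le_iff)+
qed

section \<open>Continuous functional calculus\<close>

lemma op_power_simps [simp]:
  "op_power T 0 = id_blinfun" "op_power T (Suc n) = T o\<^sub>L op_power T n"
  by (simp_all add: op_power_def)

lemma op_poly_atMost:
  assumes "degree p \<le> n"
  shows "op_poly p T = (\<Sum>i\<le>n. coeff p i *\<^sub>R op_power T i)"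
  unfolding op_poly_def
  by (rule sum.mono_neutral_left) (use assms in \<open>auto simp: coeff_eq_0\<close>)

lemma op_poly_0 [simp]: "op_poly 0 T = 0"
  by (simp add: op_poly_def)

lemma op_poly_add: "op_poly (p + q) T = op_poly p T + op_poly q T"
proof -
  have "degree (p + q) \<le> max (degree p) (degree q)" by (rule degree_add_le_max)
  then show ?thesis
    by (simp add: op_poly_atMost[of _ "max (degree p) (degree q)"] scaleR_add_left sum.distrib)
qed

lemma op_poly_smult: "op_poly (smult c p) T = c *\<^sub>R op_poly p T"
  by (simp add: op_poly_atMost[of _ "degree p"] degree_smult_le scaleR_sum_right)

lemma op_poly_diff: "op_poly (p - q) T = op_poly p T - op_poly q T"
  using op_poly_add[of p "smult (-1) q" T] unfolding op_poly_smult by simp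

lemma op_poly_pCons: "op_poly (pCons c p) T = c *\<^sub>R id_blinfun + (T o\<^sub>L op_poly p T)"
proof -
  have "op_poly (pCons c p) T = (\<Sum>i\<le>Suc (degree p). coeff (pCons c p) i *\<^sub>R op_power T i)"
    by (rule op_poly_atMost) (rule degree_pCons_le)
  also have "\<dots> = c *\<^sub>R id_blinfun + (\<Sum>i\<le>degree p. coeff p i *\<^sub>R (T o\<^sub>L op_power T i))"
    by (subst sum.atMost_Suc_shift) simp
  also have "(\<Sum>i\<le>degree p. coeff p i *\<^sub>R (T o\<^sub>L op_power T i)) = T o\<^sub>L op_poly p T"
    by (simp add: op_poly_def compose_distribs
        bounded_bilinear.sum_right[OF bounded_bilinear_blinfun_compose])
  finally show ?thesis .
qed

lemma op_poly_mult: "op_poly (p * q) T = op_poly p T o\<^sub>L op_poly q T"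
proof (induction p)
  case (pCons c p)
  then show ?case
    by (simp add: op_poly_add op_poly_smult op_poly_pCons compose_distribs blinfun_compose_assoc)
qed (simp add: compose_distribs)

lemma op_poly_commute:
  assumes "S o\<^sub>L T = T o\<^sub>L S"
  shows "S o\<^sub>L op_poly p T = op_poly p T o\<^sub>L S"
proof (induction p)
  case (pCons c p)
  have "S o\<^sub>L (T o\<^sub>L op_poly p T) = (T o\<^sub>L op_poly p T) o\<^sub>L S"
    by (metis assms blinfun_compose_assoc pCons.IH)
  then show ?case
    by (simp add: op_poly_pCons compose_distribs)
qed (simp add: compose_distribs)

lemma op_poly_bounded_ops: "T \<in> bounded_ops \<Longrightarrow> op_poly p T \<in> bounded_ops"
  using op_poly_commute[of "scal _" T] by (auto simp: bounded_ops_iff_commute)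

lemma op_poly_self_adjoint:
  assumes "T \<in> bounded_ops" "star T = T"
  shows "star (op_poly p T) = op_poly p T"
proof (induction p)
  case 0
  show ?case using star_scaleR[of id_blinfun 0] bounded_ops_closed by simp
next
  case (pCons c p)
  have "star (id_blinfun :: 'a \<Rightarrow>\<^sub>L 'a) = id_blinfun"
    by (rule positive_op_star[OF positive_op_id])
  then show ?case
    using assms pCons.IH op_poly_commute[of T T p]
    by (simp add: op_poly_pCons star_add star_scaleR star_compose bounded_ops_closed op_poly_bounded_ops)
qed

text \<open>Complex coefficients are allowed because polynomials are later split at a root, which
  need not be real. The Horner form turns the algebraic identities into inductions over
  \<open>pCons\<close>.\<close>

definition op_cpoly :: "complex poly \<Rightarrow> ('h::complex_hilbert_space \<Rightarrow>\<^sub>L 'h) \<Rightarrow> ('h \<Rightarrow>\<^sub>L 'h)" where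
  "op_cpoly p T = fold_coeffs (\<lambda>c S. scal c + (T o\<^sub>L S)) p 0"

lemma op_cpoly_0 [simp]: "op_cpoly 0 T = 0"
  by (simp add: op_cpoly_def)

lemma op_cpoly_pCons: "op_cpoly (pCons c p) T = scal c + (T o\<^sub>L op_cpoly p T)"
  by (cases "c = 0 \<and> p = 0") (auto simp: op_cpoly_def compose_distribs)

lemma op_cpoly_add: "op_cpoly (p + q) T = op_cpoly p T + op_cpoly q T"
  by (induction p q rule: poly_induct2) (simp_all add: op_cpoly_pCons scal_add compose_distribs)

lemma op_cpoly_smult:
  assumes "T \<in> bounded_ops"
  shows "op_cpoly (smult c p) T = scal c o\<^sub>L op_cpoly p T"
proof (induction p)
  case (pCons d p)
  have "T o\<^sub>L (scal c o\<^sub>L op_cpoly p T) = scal c o\<^sub>L (T o\<^sub>L op_cpoly p T)"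
    using assms by (metis blinfun_compose_assoc bounded_ops_iff_commute)
  then show ?case using pCons
    by (simp add: op_cpoly_pCons scal_mult compose_distribs)
qed (simp add: compose_distribs)

lemma op_cpoly_of_real: "op_cpoly (map_poly of_real p) T = op_poly p T"
  by (induction p) (simp_all add: op_cpoly_pCons op_poly_pCons map_poly_pCons scal_of_real)

text \<open>The values of the form on unit vectors lie in [0, \<open>norm T\<close>], and z has
  positive distance from this interval; the three cases are z off the real axis, to the left of the
  interval and to its right.\<close>

lemma positive_op_minus_scalar_bounded_below:
  fixes T :: "'h::complex_hilbert_space \<Rightarrow>\<^sub>L 'h"
  assumes T: "positive_op T" and z: "\<And>t. t \<in> {0..norm T} \<Longrightarrow> z \<noteq> of_real t"
  shows "\<exists>c>0. \<forall>x. c * norm x \<le> norm (T x - z *\<^sub>C x)"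
proof -
  have "\<exists>c>0. \<forall>x. c * (norm x)\<^sup>2 \<le> cmod (cinner x (T x - z *\<^sub>C x))"
  proof -
    have eq: "cinner x (T x - z *\<^sub>C x) = of_real (Re (cinner x (T x))) - z * of_real ((norm x)\<^sup>2)" for x
      using positive_opD(2)[OF T, of x] by (simp add: cinner_simps cinner_self complex_eq_iff)
    consider "Im z \<noteq> 0" | "Im z = 0" "Re z < 0" | "Im z = 0" "Re z > norm T"
      using z[of "Re z"] by (fastforce simp: complex_eq_iff)
    then show ?thesis
    proof cases
      case 1
      have "\<bar>Im z\<bar> * (norm x)\<^sup>2 \<le> cmod (cinner x (T x - z *\<^sub>C x))" for x
        using abs_Im_le_cmod[of "cinner x (T x - z *\<^sub>C x)"] unfolding eq by (simp add: abs_mult)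
      with 1 show ?thesis by (intro exI[of _ "\<bar>Im z\<bar>"]) auto
    next
      case 2
      have "(- Re z) * (norm x)\<^sup>2 \<le> cmod (cinner x (T x - z *\<^sub>C x))" for x
        using complex_Re_le_cmod[of "cinner x (T x - z *\<^sub>C x)"] positive_opD(3)[OF T, of x]
        unfolding eq by simp
      with 2 show ?thesis by (intro exI[of _ "- Re z"]) auto
    next
      case 3
      have "(Re z - norm T) * (norm x)\<^sup>2 \<le> cmod (cinner x (T x - z *\<^sub>C x))" for x
      proof -
        have "(Re z - norm T) * (norm x)\<^sup>2 \<le> - Re (cinner x (T x - z *\<^sub>C x))"
          using abs_Re_cinner_le[of x T] unfolding eq by (simp add: algebra_simps)
        also have "\<dots> \<le> cmod (cinner x (T x - z *\<^sub>C x))"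
          using abs_Re_le_cmod[of "cinner x (T x - z *\<^sub>C x)"] by linarith
        finally show ?thesis .
      qed
      with 3 show ?thesis by (intro exI[of _ "Re z - norm T"]) auto
    qed
  qed
  then obtain c where c: "c > 0" "\<And>x. c * (norm x)\<^sup>2 \<le> cmod (cinner x (T x - z *\<^sub>C x))" by auto
  have "c * norm x \<le> norm (T x - z *\<^sub>C x)" for x
  proof (cases "x = 0")
    case False
    have "c * (norm x)\<^sup>2 \<le> norm x * norm (T x - z *\<^sub>C x)"
      using c(2)[of x] Cauchy_Schwarz_cinner order_trans by blast
    then show ?thesis using False by (simp add: power2_eq_square)
  qed simp
  with c(1) show ?thesis by blast
qed

text \<open>A substitute for spectral mapping: over the complex numbers p splits into linear
  factors, no root lies in [0, \<open>norm T\<close>], and a composition of operators bounded below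
  is bounded below. This property, weaker than invertibility, is the one that the norm estimate for
  polynomials uses.\<close>

lemma op_cpoly_bounded_below:
  fixes T :: "'h::complex_hilbert_space \<Rightarrow>\<^sub>L 'h"
  assumes T: "positive_op T"
  shows "p \<noteq> 0 \<Longrightarrow> (\<And>t. t \<in> {0..norm T} \<Longrightarrow> poly p (of_real t) \<noteq> 0) \<Longrightarrow>
    \<exists>c>0. \<forall>x. c * norm x \<le> norm (op_cpoly p T x)"
proof (induction "degree p" arbitrary: p)
  case 0
  then obtain a where a: "p = [:a:]" by (metis degree_eq_zeroE)
  with 0 have "a \<noteq> 0" by auto
  then show ?case
    by (intro exI[of _ "cmod a"])
      (auto simp: a op_cpoly_pCons compose_distribs scal_apply norm_scaleC blinfun.bilinear_simps)
next
  case (Suc n)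
  have "\<not> (\<exists>a l. a \<noteq> 0 \<and> l = 0 \<and> p = pCons a l)" using Suc.hyps(2) by auto
  then obtain z where z: "poly p z = 0" using fundamental_theorem_of_algebra_alt by blast
  then obtain q where q: "p = [:-z, 1:] * q" by (metis dvdE poly_eq_0_iff_dvd)
  have q0: "q \<noteq> 0" using Suc q by auto
  have "degree p = Suc (degree q)"
    unfolding q using q0 by (subst degree_mult_eq) auto
  then have "n = degree q" using Suc by simp
  moreover have "poly q (of_real t) \<noteq> 0" if "t \<in> {0..norm T}" for t
    using Suc.prems(2)[OF that] q by auto
  ultimately obtain c where c: "c > 0" "\<And>x. c * norm x \<le> norm (op_cpoly q T x)"
    using Suc.hyps(1)[of q] q0 by auto
  have "z \<noteq> of_real t" if "t \<in> {0..norm T}" for t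
    using Suc.prems(2)[OF that] z by auto
  then obtain d where d: "d > 0" "\<And>x. d * norm x \<le> norm (T x - z *\<^sub>C x)"
    using positive_op_minus_scalar_bounded_below[OF T, of z] by blast
  have "p = pCons 0 q + smult (- z) q" unfolding q by simp
  then have eq: "op_cpoly p T x = T (op_cpoly q T x) - z *\<^sub>C op_cpoly q T x" for x
    by (simp only: op_cpoly_add) (simp add: op_cpoly_pCons op_cpoly_smult[OF positive_opD(1)[OF T]] scal_apply
        blinfun.bilinear_simps scal_minus del: smult_minus_left)
  have "d * c * norm x \<le> norm (op_cpoly p T x)" for x
  proof -
    have "d * (c * norm x) \<le> d * norm (op_cpoly q T x)"
      using c d by (intro mult_left_mono) auto
    also have "\<dots> \<le> norm (op_cpoly p T x)" unfolding eq by (rule d(2))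
    finally show ?thesis by simp
  qed
  then show ?case using c d by (intro exI[of _ "d * c"]) auto
qed

text \<open>If the norm \<open>\<nu>\<close> of the self-adjoint operator \<open>p(T)\<close> exceeded the supremum of \<open>\<bar>p\<bar>\<close>, then both
  \<open>p(T) - \<nu>\<close> and \<open>p(T) + \<nu>\<close> would be bounded below, which is impossible.\<close>

lemma norm_op_poly_le:
  fixes T :: "'h::complex_hilbert_space \<Rightarrow>\<^sub>L 'h"
  assumes T: "positive_op T" and le: "\<And>t. t \<in> {0..norm T} \<Longrightarrow> \<bar>poly p t\<bar> \<le> c"
  shows "norm (op_poly p T) \<le> c"
proof (rule ccontr)
  define S where "S = op_poly p T"
  define \<nu> where "\<nu> = norm S"
  assume "\<not> norm (op_poly p T) \<le> c"
  then have \<nu>: "c < \<nu>" by (simp add: \<nu>_def S_def)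
  have "0 \<le> c" using le[of 0] by simp
  then have \<nu>0: "\<nu> > 0" using \<nu> by simp
  have S: "S \<in> bounded_ops" "star S = S"
    unfolding S_def using T by (simp_all add: op_poly_bounded_ops op_poly_self_adjoint positive_opD positive_op_star)
  have *: "\<exists>\<delta>>0. \<forall>x. \<delta> * norm x \<le> norm (S x + r *\<^sub>R x)" if r: "\<bar>r\<bar> = \<nu>" for r
  proof -
    define P where "P = map_poly of_real p + [:complex_of_real r:]"
    have eval: "poly P (of_real t) = of_real (poly p t + r)" for t
      unfolding P_def by (induction p) (auto simp: map_poly_pCons algebra_simps)
    have ne: "poly P (of_real t) \<noteq> 0" if "t \<in> {0..norm T}" for t
      unfolding eval of_real_eq_0_iff using le[OF that] \<nu> r by (simp add: abs_if split: if_splits)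
    have "P \<noteq> 0" using ne[of 0] by auto
    moreover have "op_cpoly P T x = S x + r *\<^sub>R x" for x
      by (simp add: P_def op_cpoly_add op_cpoly_of_real op_cpoly_pCons compose_distribs S_def
          blinfun.bilinear_simps scal_apply scaleC_of_real)
    ultimately show ?thesis using op_cpoly_bounded_below[OF T, of P] ne by simp
  qed
  obtain d where d: "d > 0" "\<And>x. d * norm x \<le> norm (S x + \<nu> *\<^sub>R x)" using *[of \<nu>] \<nu>0 by auto
  obtain e where e: "e > 0" "\<And>x. e * norm x \<le> norm (S x + (-\<nu>) *\<^sub>R x)" using *[of "-\<nu>"] \<nu>0 by auto
  define \<delta> where "\<delta> = e * d"
  have \<delta>: "\<delta> > 0" using d e by (simp add: \<delta>_def)
  \<comment> \<open>The norm of S S x - \<open>\<nu>\<^sup>2\<close> x is at least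
    \<open>\<delta>\<close> |x|. Squaring this and estimating |S S x| by \<open>\<nu>\<close> |S x|
    bounds |S x| by \<open>\<kappa>\<close> |x|; as \<open>\<kappa>\<close> < \<open>\<nu>\<close>,
    this contradicts the definition of \<open>\<nu>\<close> as the norm.\<close>
  define \<kappa> where "\<kappa> = sqrt (max 0 (\<nu>\<^sup>2 - \<delta>\<^sup>2 / \<nu>\<^sup>2))"
  have "norm S \<le> \<kappa>"
  proof (rule norm_blinfun_bound)
    fix x
    have "\<delta> * norm x \<le> e * norm (S x + \<nu> *\<^sub>R x)"
      unfolding \<delta>_def mult.assoc using d(2)[of x] e(1) by (intro mult_left_mono) auto
    also have "\<dots> \<le> norm (S (S x + \<nu> *\<^sub>R x) + (-\<nu>) *\<^sub>R (S x + \<nu> *\<^sub>R x))" by (rule e(2))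
    also have "S (S x + \<nu> *\<^sub>R x) + (-\<nu>) *\<^sub>R (S x + \<nu> *\<^sub>R x) = S (S x) - \<nu>\<^sup>2 *\<^sub>R x"
      by (simp add: blinfun.bilinear_simps algebra_simps power2_eq_square)
    finally have "(\<delta> * norm x)\<^sup>2 \<le> (norm (S (S x) - \<nu>\<^sup>2 *\<^sub>R x))\<^sup>2"
      using \<delta> by (intro power_mono) auto
    also have "\<dots> = (norm (S (S x)))\<^sup>2 + (\<nu>\<^sup>2 * norm x)\<^sup>2 - 2 * \<nu>\<^sup>2 * Re (cinner (S (S x)) x)"
      by (simp add: norm_diff_sq cinner_simps)
    also have "Re (cinner (S (S x)) x) = (norm (S x))\<^sup>2"
      by (metis Re_cinner_self cinner_star_right S)
    also have "(norm (S (S x)))\<^sup>2 \<le> (\<nu> * norm (S x))\<^sup>2"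
      unfolding \<nu>_def by (intro power_mono norm_blinfun) auto
    finally have "\<nu>\<^sup>2 * (norm (S x))\<^sup>2 \<le> (\<nu>\<^sup>2 * \<nu>\<^sup>2 - \<delta>\<^sup>2) * (norm x)\<^sup>2"
      by (simp add: power_mult_distrib algebra_simps power2_eq_square)
    then have "(norm (S x))\<^sup>2 \<le> (\<nu>\<^sup>2 - \<delta>\<^sup>2 / \<nu>\<^sup>2) * (norm x)\<^sup>2"
      using \<nu>0 by (simp add: field_simps)
    also have "\<dots> \<le> max 0 (\<nu>\<^sup>2 - \<delta>\<^sup>2 / \<nu>\<^sup>2) * (norm x)\<^sup>2"
      by (intro mult_right_mono) auto
    also have "\<dots> = (\<kappa> * norm x)\<^sup>2" by (simp add: \<kappa>_def power_mult_distrib)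
    finally show "norm (S x) \<le> \<kappa> * norm x"
      by (rule power2_le_imp_le) (simp add: \<kappa>_def)
  qed (simp add: \<kappa>_def)
  then have "\<nu>\<^sup>2 \<le> \<kappa>\<^sup>2" unfolding \<nu>_def by (intro power_mono) auto
  also have "\<kappa>\<^sup>2 = max 0 (\<nu>\<^sup>2 - \<delta>\<^sup>2 / \<nu>\<^sup>2)" by (simp add: \<kappa>_def)
  also have "\<dots> < \<nu>\<^sup>2" using \<nu>0 \<delta> by simp
  finally show False by simp
qed

lemma polynomial_approximation:
  fixes f :: "real \<Rightarrow> real"
  assumes "continuous_on {a..b} f"
  shows "\<exists>p. uniform_limit {a..b} (\<lambda>n. poly (p n)) f sequentially"
proof -
  have "\<exists>p. \<forall>x\<in>{a..b}. \<bar>f x - poly p x\<bar> < inverse (Suc n)" for n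
  proof -
    obtain g where g: "real_polynomial_function g" "\<And>x. x \<in> {a..b} \<Longrightarrow> \<bar>f x - g x\<bar> < inverse (Suc n)"
      using Stone_Weierstrass_real_polynomial_function[OF compact_Icc assms, of "inverse (Suc n)"] by auto
    then obtain c m where "g = (\<lambda>x. \<Sum>i\<le>m. c i * x ^ i)"
      unfolding real_polynomial_function_iff_sum by blast
    then have "g = poly (\<Sum>i\<le>m. monom (c i) i)" by (auto simp: poly_sum poly_monom)
    with g(2) show ?thesis by blast
  qed
  then obtain p where p: "\<And>n x. x \<in> {a..b} \<Longrightarrow> \<bar>f x - poly (p n) x\<bar> < inverse (Suc n)" by metis
  have "uniform_limit {a..b} (\<lambda>n. poly (p n)) f sequentially"
  proof (rule uniform_limitI)
    fix e :: real assume "e > 0"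
    then have "eventually (\<lambda>n. inverse (real (Suc n)) < e) sequentially"
      using LIMSEQ_inverse_real_of_nat order_tendstoD(2) by blast
    then show "\<forall>\<^sub>F n in sequentially. \<forall>x\<in>{a..b}. dist (poly (p n) x) (f x) < e"
      proof eventually_elim
      case (elim n)
      show ?case
        using less_trans[OF p elim] by (auto simp: dist_real_def abs_minus_commute)
    qed
  qed
  then show ?thesis by blast
qed

text \<open>By \<open>norm_op_poly_le\<close>, evaluation at T is a contraction from the supremum
  norm on [0, \<open>norm T\<close>]. Hence uniform approximation gives Cauchy sequences, and any
  two approximating sequences share their limit, which is what the definite description in
  \<open>cont_calculus\<close> requires.\<close>

lemma op_poly_tendsto_cont_calculus:
  fixes T :: "'h::complex_hilbert_space \<Rightarrow>\<^sub>L 'h"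
  assumes T: "positive_op T" and f: "continuous_on {0..norm T} f"
    and p: "uniform_limit {0..norm T} (\<lambda>n. poly (p n)) f sequentially"
  shows "(\<lambda>n. op_poly (p n) T) \<longlonglongrightarrow> cont_calculus f T"
proof -
  have close: "norm (op_poly p T - op_poly q T) \<le> e"
    if "\<And>x. x \<in> {0..norm T} \<Longrightarrow> dist (poly p x) (poly q x) \<le> e" for p q e
    using norm_op_poly_le[OF T, of "p - q" e] that by (simp add: op_poly_diff dist_real_def)
  have half: "\<forall>\<^sub>F n in sequentially. \<forall>x\<in>{0..norm T}. dist (poly (p n) x) (f x) < e / 2"
    if "uniform_limit {0..norm T} (\<lambda>n. poly (p n)) f sequentially" "e > 0" for p and e :: real
    using uniform_limitD[OF that(1), of "e / 2"] that(2) by simp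
  obtain q where q: "uniform_limit {0..norm T} (\<lambda>n. poly (q n)) f sequentially"
    using polynomial_approximation[OF f] by blast
  have "Cauchy (\<lambda>n. op_poly (q n) T)"
  proof (rule metric_CauchyI)
    fix e :: real assume e: "e > 0"
    obtain M where M: "\<And>n x. n \<ge> M \<Longrightarrow> x \<in> {0..norm T} \<Longrightarrow> dist (poly (q n) x) (f x) < e / 2 / 2"
      using half[OF q, of "e/2"] e unfolding eventually_sequentially by (auto simp del: atLeastAtMost_iff)
    have "dist (op_poly (q m) T) (op_poly (q n) T) < e" if "m \<ge> M" "n \<ge> M" for m n
    proof -
      have "norm (op_poly (q m) T - op_poly (q n) T) \<le> e / 2"
      proof (rule close)
        fix x assume x: "x \<in> {0..norm T}"
        show "dist (poly (q m) x) (poly (q n) x) \<le> e / 2"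
          using M[OF that(1) x] M[OF that(2) x] dist_triangle2[of "poly (q m) x" "poly (q n) x" "f x"]
          by simp
      qed
      then show ?thesis using e by (simp add: dist_norm)
    qed
    then show "\<exists>M. \<forall>m\<ge>M. \<forall>n\<ge>M. dist (op_poly (q m) T) (op_poly (q n) T) < e" by blast
  qed
  then obtain S where S: "(\<lambda>n. op_poly (q n) T) \<longlonglongrightarrow> S"
    by (meson convergent_def Cauchy_convergent)
  have lim: "(\<lambda>n. op_poly (p n) T) \<longlonglongrightarrow> S"
    if p: "uniform_limit {0..norm T} (\<lambda>n. poly (p n)) f sequentially" for p
  proof -
    have "(\<lambda>n. op_poly (p n) T - op_poly (q n) T) \<longlonglongrightarrow> 0"
    proof (rule tendstoI)
      fix e :: real assume e: "e > 0"
      then have e4: "e / 2 > 0" by simp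
      show "\<forall>\<^sub>F n in sequentially. dist (op_poly (p n) T - op_poly (q n) T) 0 < e"
        using half[OF p e4] half[OF q e4]
      proof eventually_elim
        case (elim n)
        have "norm (op_poly (p n) T - op_poly (q n) T) \<le> e / 2"
        proof (rule close)
          fix x assume x: "x \<in> {0..norm T}"
          show "dist (poly (p n) x) (poly (q n) x) \<le> e / 2"
            using elim[rule_format, OF x] dist_triangle2[of "poly (p n) x" "poly (q n) x" "f x"]
            by (smt (verit) elim(1) elim(2) x field_sum_of_halves)
        qed
        then show ?case using e by simp
      qed
    qed
    from tendsto_add[OF this S] show ?thesis by simp
  qed
  have "cont_calculus f T = S"
    unfolding cont_calculus_def
  proof (rule the_equality)
    fix S' assume "\<forall>p. uniform_limit {0..norm T} (\<lambda>n. poly (p n)) f sequentially \<longrightarrow> (\<lambda>n. op_poly (p n) T) \<longlonglongrightarrow> S'"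
    with q have "(\<lambda>n. op_poly (q n) T) \<longlonglongrightarrow> S'" by blast
    then show "S' = S" using S LIMSEQ_unique by blast
  qed (use lim in blast)
  then show ?thesis using lim[OF p] by simp
qed

section \<open>Algebraic and order properties of the continuous calculus\<close>

lemma commute_limit:
  fixes X :: "nat \<Rightarrow> 'h::complex_hilbert_space \<Rightarrow>\<^sub>L 'h"
  assumes "X \<longlonglongrightarrow> Y" "\<And>n. S o\<^sub>L X n = X n o\<^sub>L S"
  shows "S o\<^sub>L Y = Y o\<^sub>L S"
proof -
  have "(\<lambda>n. S o\<^sub>L X n) \<longlonglongrightarrow> (S o\<^sub>L Y)" "(\<lambda>n. X n o\<^sub>L S) \<longlonglongrightarrow> (Y o\<^sub>L S)"
    by (intro bounded_bilinear.tendsto[OF bounded_bilinear_blinfun_compose] assms tendsto_const)+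
  then show ?thesis using assms(2) LIMSEQ_unique by auto
qed

lemma bounded_ops_limit: "X \<longlonglongrightarrow> Y \<Longrightarrow> (\<And>n. X n \<in> bounded_ops) \<Longrightarrow> Y \<in> bounded_ops"
  using commute_limit[of X Y "scal _"] by (auto simp: bounded_ops_iff_commute)

context
  fixes T :: "'h::complex_hilbert_space \<Rightarrow>\<^sub>L 'h"
  assumes T: "positive_op T"
begin

lemma cont_calculus_commute:
  assumes f: "continuous_on {0..norm T} f" and "S o\<^sub>L T = T o\<^sub>L S"
  shows "S o\<^sub>L cont_calculus f T = cont_calculus f T o\<^sub>L S"
proof -
  obtain p where p: "uniform_limit {0..norm T} (\<lambda>n. poly (p n)) f sequentially"
    using polynomial_approximation[OF f] by blast
  show ?thesis
    by (rule commute_limit[OF op_poly_tendsto_cont_calculus[OF T f p]])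
      (rule op_poly_commute[OF assms(2)])
qed

lemma cont_calculus_bounded_ops:
  "continuous_on {0..norm T} f \<Longrightarrow> cont_calculus f T \<in> bounded_ops"
  using cont_calculus_commute[of f "scal _"] positive_opD(1)[OF T] by (auto simp: bounded_ops_iff_commute)

lemma cont_calculus_self_adjoint:
  assumes f: "continuous_on {0..norm T} f"
  shows "star (cont_calculus f T) = cont_calculus f T"
proof (rule star_unique[OF cont_calculus_bounded_ops[OF f]])
  fix x y
  obtain p where p: "uniform_limit {0..norm T} (\<lambda>n. poly (p n)) f sequentially"
    using polynomial_approximation[OF f] by blast
  note lim = op_poly_tendsto_cont_calculus[OF T f p]
  have "(\<lambda>n. cinner (op_poly (p n) T x) y) \<longlonglongrightarrow> cinner (cont_calculus f T x) y"
    "(\<lambda>n. cinner x (op_poly (p n) T y)) \<longlonglongrightarrow> cinner x (cont_calculus f T y)"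
    by (intro bounded_bilinear.tendsto[OF bounded_bilinear_cinner] tendsto_const blinfun.tendsto lim)+
  moreover have "cinner (op_poly (p n) T x) y = cinner x (op_poly (p n) T y)" for n
    by (metis cinner_star_right op_poly_bounded_ops op_poly_self_adjoint T positive_opD(1) positive_op_star)
  ultimately show "cinner (cont_calculus f T x) y = cinner x (cont_calculus f T y)"
    using LIMSEQ_unique by auto
qed

lemma cont_calculus_eqI:
  assumes f: "continuous_on {0..norm T} f"
    and p: "uniform_limit {0..norm T} (\<lambda>n. poly (p n)) f sequentially"
    and "(\<lambda>n. op_poly (p n) T) \<longlonglongrightarrow> S"
  shows "cont_calculus f T = S"
  using op_poly_tendsto_cont_calculus[OF T f p] assms(3) LIMSEQ_unique by blast

lemma cont_calculus_poly: "cont_calculus (poly p) T = op_poly p T"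
  by (rule cont_calculus_eqI[where p = "\<lambda>_. p"])
    (auto intro!: uniform_limit_const continuous_intros)

lemma cont_calculus_cong:
  assumes "continuous_on {0..norm T} f" "\<And>x. x \<in> {0..norm T} \<Longrightarrow> f x = g x"
  shows "cont_calculus f T = cont_calculus g T"
proof -
  obtain p where p: "uniform_limit {0..norm T} (\<lambda>n. poly (p n)) f sequentially"
    using polynomial_approximation[OF assms(1)] by blast
  then have p': "uniform_limit {0..norm T} (\<lambda>n. poly (p n)) g sequentially"
    unfolding uniform_limit_iff using assms(2) by auto
  have g: "continuous_on {0..norm T} g" using assms continuous_on_cong by metis
  show ?thesis
    by (rule cont_calculus_eqI[OF assms(1) p op_poly_tendsto_cont_calculus[OF T g p']])
qed

lemma cont_calculus_const: "cont_calculus (\<lambda>_. c) T = c *\<^sub>R id_blinfun"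
proof -
  have "poly [:c:] = (\<lambda>_. c)" by auto
  then show ?thesis
    using cont_calculus_poly[of "[:c:]"] by (simp add: op_poly_pCons compose_distribs)
qed

lemma cont_calculus_ident: "cont_calculus (\<lambda>x. x) T = T"
proof -
  have "poly [:0, 1:] = (\<lambda>x :: real. x)" by auto
  then show ?thesis
    using cont_calculus_poly[of "[:0, 1:]"] by (simp add: op_poly_pCons compose_distribs)
qed

lemma cont_calculus_add:
  assumes f: "continuous_on {0..norm T} f" and g: "continuous_on {0..norm T} g"
  shows "cont_calculus (\<lambda>x. f x + g x) T = cont_calculus f T + cont_calculus g T"
proof -
  obtain p q where p: "uniform_limit {0..norm T} (\<lambda>n. poly (p n)) f sequentially"
    and q: "uniform_limit {0..norm T} (\<lambda>n. poly (q n)) g sequentially"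
    using polynomial_approximation[OF f] polynomial_approximation[OF g] by blast
  have "(\<lambda>n. op_poly (p n + q n) T) \<longlonglongrightarrow> cont_calculus f T + cont_calculus g T"
    unfolding op_poly_add
    by (intro tendsto_add op_poly_tendsto_cont_calculus T f g p q)
  then show ?thesis
    using uniform_limit_add[OF p q]
    by (intro cont_calculus_eqI[where p = "\<lambda>n. p n + q n"])
      (auto intro!: continuous_intros f g simp: uniform_limit_iff)
qed

lemma cont_calculus_mult:
  assumes f: "continuous_on {0..norm T} f" and g: "continuous_on {0..norm T} g"
  shows "cont_calculus (\<lambda>x. f x * g x) T = cont_calculus f T o\<^sub>L cont_calculus g T"
proof -
  obtain p q where p: "uniform_limit {0..norm T} (\<lambda>n. poly (p n)) f sequentially"
    and q: "uniform_limit {0..norm T} (\<lambda>n. poly (q n)) g sequentially"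
    using polynomial_approximation[OF f] polynomial_approximation[OF g] by blast
  have "(\<lambda>n. op_poly (p n * q n) T) \<longlonglongrightarrow> (cont_calculus f T o\<^sub>L cont_calculus g T)"
    unfolding op_poly_mult
    by (intro bounded_bilinear.tendsto[OF bounded_bilinear_blinfun_compose]
        op_poly_tendsto_cont_calculus T f g p q)
  moreover have "uniform_limit {0..norm T} (\<lambda>n x. poly (p n) x * poly (q n) x) (\<lambda>x. f x * g x) sequentially"
    by (intro uniform_lim_mult p q compact_imp_bounded compact_continuous_image f g) auto
  ultimately show ?thesis
    by (intro cont_calculus_eqI[where p = "\<lambda>n. p n * q n"])
      (auto intro!: continuous_intros f g simp: uniform_limit_iff)
qed

text \<open>With g the square root of f, the operator f(T) is the square of the self-adjoint
  g(T).\<close>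

lemma cont_calculus_nonneg:
  assumes f: "continuous_on {0..norm T} f" and "\<And>x. x \<in> {0..norm T} \<Longrightarrow> f x \<ge> 0"
  shows "positive_op (cont_calculus f T)"
proof -
  define g where "g x = sqrt (f x)" for x
  have g: "continuous_on {0..norm T} g" unfolding g_def by (intro continuous_intros f)
  have "cont_calculus f T = cont_calculus (\<lambda>x. g x * g x) T"
    by (rule cont_calculus_cong[OF f]) (simp add: g_def assms(2))
  also have "\<dots> = star (cont_calculus g T) o\<^sub>L cont_calculus g T"
    by (simp add: cont_calculus_mult g cont_calculus_self_adjoint)
  finally show ?thesis using positive_op_square cont_calculus_bounded_ops[OF g] by metis
qed

lemma norm_cont_calculus_le:
  assumes f: "continuous_on {0..norm T} f" and le: "\<And>x. x \<in> {0..norm T} \<Longrightarrow> \<bar>f x\<bar> \<le> c"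
  shows "norm (cont_calculus f T) \<le> c"
proof (rule norm_self_adjoint_le)
  fix x
  have "positive_op (cont_calculus (\<lambda>x. c + f x) T)" "positive_op (cont_calculus (\<lambda>x. c + (-1) * f x) T)"
    by (intro cont_calculus_nonneg continuous_intros f; use le in \<open>force simp: abs_le_iff\<close>)+
  moreover have "cont_calculus (\<lambda>x. (-1) * f x) T = (-1) *\<^sub>R cont_calculus f T"
    unfolding cont_calculus_mult[OF continuous_on_const f] cont_calculus_const by (simp add: compose_distribs)
  ultimately have "positive_op (c *\<^sub>R id_blinfun + cont_calculus f T)"
    "positive_op (c *\<^sub>R id_blinfun + (-1) *\<^sub>R cont_calculus f T)"
    using cont_calculus_add[OF continuous_on_const f] cont_calculus_const
      cont_calculus_add[OF continuous_on_const continuous_on_mult[OF continuous_on_const f], of c "-1"]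
    by metis+
  from positive_opD(3)[OF this(1), of x] positive_opD(3)[OF this(2), of x]
  show "\<bar>Re (cinner x (cont_calculus f T x))\<bar> \<le> c * (norm x)\<^sup>2"
    by (simp add: blinfun.bilinear_simps cinner_simps cinner_self)
qed (use f le[of 0] in \<open>auto intro: cont_calculus_bounded_ops cont_calculus_self_adjoint\<close>)

end


section \<open>Improper integrals of Banach space valued functions\<close>

text \<open>Operator valued integrals are gauge integrals, since the operator norm topology is in
  general not separable. The restriction on \<open>S\<close> makes its intersection with an interval
  an interval again, where continuity gives integrability; domination extends this to all of
  \<open>S\<close>.\<close>

lemma integrable_on_dominated:
  fixes f :: "real \<Rightarrow> 'b::banach"
  assumes S: "S = UNIV \<or> S = {0..}" and f: "continuous_on S f"
    and le: "\<And>x. x \<in> S \<Longrightarrow> norm (f x) \<le> g x" and g: "g integrable_on S"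
  shows "f integrable_on S"
proof (rule integrable_on_all_intervals_integrable_bound[OF _ le g])
  fix a b :: real
  have "{0..} \<inter> {a..b} = {max 0 a..b}" "UNIV \<inter> {a..b} = {a..b}" by auto
  then have "\<exists>c d. S \<inter> {a..b} = {c..d}"
    using S by blast
  then obtain c d where cd: "S \<inter> {a..b} = {c..d}" by blast
  have "f integrable_on {c..d}"
    by (rule integrable_continuous_real, rule continuous_on_subset[OF f]) (use cd in blast)
  then have "f integrable_on S \<inter> cbox a b" using cd by simp
  then show "(\<lambda>x. if x \<in> S then f x else 0) integrable_on cbox a b"
    by (simp add: integrable_restrict_Int)
qed

lemma integral_atLeast_limit:
  fixes f :: "real \<Rightarrow> 'b::banach"
  assumes "f integrable_on {0..}"
  shows "(\<lambda>n. integral {0..real n} f) \<longlonglongrightarrow> integral {0..} f"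
proof (rule LIMSEQ_I)
  fix e :: real assume "e > 0"
  have "(f has_integral integral {0..} f) {0..}" using assms by (rule integrable_integral)
  moreover have "\<not> (\<exists>a b. {0 :: real..} = cbox a b)"
  proof (intro notI, elim exE)
    fix a b :: real assume eq: "{0..} = cbox a b"
    have "max 0 (b + 1) \<in> {0::real..}" by simp
    then show False unfolding eq by simp
  qed
  ultimately obtain B where B: "B > 0"
    "\<And>a b. ball 0 B \<subseteq> cbox a b \<Longrightarrow>
      \<exists>z. ((\<lambda>x. if x \<in> {0..} then f x else 0) has_integral z) (cbox a b) \<and> norm (z - integral {0..} f) < e"
    using has_integral_altD \<open>e > 0\<close> by blast
  show "\<exists>n0. \<forall>n\<ge>n0. norm (integral {0..real n} f - integral {0..} f) < e"
  proof (intro exI allI impI)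
    fix n assume n: "nat \<lceil>B\<rceil> \<le> n"
    have "ball 0 B \<subseteq> cbox (- real n) (real n)"
      using n by (auto simp: dist_real_def abs_le_iff)
    then obtain z where z: "((\<lambda>x. if x \<in> {0..} then f x else 0) has_integral z) (cbox (- real n) (real n))"
      "norm (z - integral {0..} f) < e" using B(2) by blast
    have "{0..} \<inter> cbox (- real n) (real n) = {0..real n}" by auto
    with z(1) have "(f has_integral z) {0..real n}"
      by (simp only: has_integral_restrict_Int)
    with z(2) show "norm (integral {0..real n} f - integral {0..} f) < e"
      by (simp add: integral_unique)
  qed
qed


section \<open>Traces on von Neumann algebras\<close>

locale semifinite_algebra =
  fixes N :: "('h::complex_hilbert_space \<Rightarrow>\<^sub>L 'h) set" and \<tau> :: "('h \<Rightarrow>\<^sub>L 'h) \<Rightarrow> ennreal"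
  assumes vN: "von_Neumann_algebra N" and trace: "fns_trace N \<tau>"
begin

text \<open>The double commutant condition as a membership test: closure of \<open>N\<close> under
  an operation reduces to commuting with each element of \<open>commutant N\<close>, which sums,
  products, norm limits and integrals preserve.\<close>

lemma N_iff: "X \<in> N \<longleftrightarrow> X \<in> bounded_ops \<and> (\<forall>S\<in>commutant N. X o\<^sub>L S = S o\<^sub>L X)"
  using vN unfolding von_Neumann_algebra_def commutant_def by blast

lemma N_bounded_ops: "X \<in> N \<Longrightarrow> X \<in> bounded_ops"
  by (simp add: N_iff)

lemma commutant_bounded_ops: "S \<in> commutant N \<Longrightarrow> S \<in> bounded_ops"
  by (simp add: commutant_def)

lemma N_add: "X \<in> N \<Longrightarrow> Y \<in> N \<Longrightarrow> X + Y \<in> N"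
  and N_diff: "X \<in> N \<Longrightarrow> Y \<in> N \<Longrightarrow> X - Y \<in> N"
  and N_minus: "X \<in> N \<Longrightarrow> - X \<in> N"
  and N_scaleR: "X \<in> N \<Longrightarrow> r *\<^sub>R X \<in> N"
  and N_id: "id_blinfun \<in> N"
  and N_zero: "0 \<in> N"
  by (simp_all add: N_iff bounded_ops_closed compose_distribs)

lemma N_compose: "X \<in> N \<Longrightarrow> Y \<in> N \<Longrightarrow> X o\<^sub>L Y \<in> N"
  unfolding N_iff using bounded_ops_closed(5) blinfun_compose_assoc by metis

lemma N_scal: "scal c \<in> N"
  using commutant_bounded_ops scal_in_bounded_ops by (auto simp: N_iff bounded_ops_iff_commute)

lemma N_star: "X \<in> N \<Longrightarrow> star X \<in> N"
  using vN by (simp add: von_Neumann_algebra_def)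

lemma N_limit: "X \<longlonglongrightarrow> Y \<Longrightarrow> (\<And>n. X n \<in> N) \<Longrightarrow> Y \<in> N"
  unfolding N_iff using commute_limit bounded_ops_limit by metis

lemmas N_closed = N_add N_diff N_minus N_scaleR N_id N_zero N_compose N_scal N_star

lemma N_sum: "(\<And>i. i \<in> I \<Longrightarrow> X i \<in> N) \<Longrightarrow> sum X I \<in> N"
  by (induction I rule: infinite_finite_induct) (auto intro: N_closed)

lemma N_cont_calculus:
  assumes "positive_op T" "T \<in> N" "continuous_on {0..norm T} f"
  shows "cont_calculus f T \<in> N"
  unfolding N_iff
  using cont_calculus_commute[OF assms(1,3)] cont_calculus_bounded_ops[OF assms(1,3)] assms(2)
  by (metis N_iff)

lemma N_integral:
  assumes F: "F integrable_on S" "\<And>x. x \<in> S \<Longrightarrow> F x \<in> N"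
  shows "integral S F \<in> N"
proof -
  have comm: "integral S F o\<^sub>L A = A o\<^sub>L integral S F" if "\<And>x. x \<in> S \<Longrightarrow> F x o\<^sub>L A = A o\<^sub>L F x" for A
  proof -
    have "integral S F o\<^sub>L A = integral S (\<lambda>x. F x o\<^sub>L A)"
      using integral_linear[OF F(1) bounded_bilinear.bounded_linear_left[OF bounded_bilinear_blinfun_compose, of A]]
      by (simp add: o_def)
    also have "\<dots> = integral S (\<lambda>x. A o\<^sub>L F x)"
      by (rule integral_cong) (rule that)
    also have "\<dots> = A o\<^sub>L integral S F"
      using integral_linear[OF F(1) bounded_bilinear.bounded_linear_right[OF bounded_bilinear_blinfun_compose, of A]]
      by (simp add: o_def)
    finally show ?thesis .
  qed
  show ?thesis
    unfolding N_iff bounded_ops_iff_commute[of "integral S F"]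
    using F(2) comm unfolding N_iff bounded_ops_iff_commute by blast
qed


subsection \<open>Linear extension of the trace\<close>

definition fin :: "('h \<Rightarrow>\<^sub>L 'h) set" where
  "fin = {X \<in> pos_cone N. \<tau> X < \<infinity>}"

definition tr :: "('h \<Rightarrow>\<^sub>L 'h) \<Rightarrow> real" where
  "tr X = enn2real (\<tau> X)"

text \<open>The domain on which the description in \<open>trace_ext\<close> denotes. Elsewhere its
  value is arbitrary, so the linearity laws for \<open>Tr\<close> carry this condition.\<close>

definition trace_class :: "('h \<Rightarrow>\<^sub>L 'h) \<Rightarrow> bool" where
  "trace_class X \<longleftrightarrow> (\<exists>X\<^sub>1 X\<^sub>2 Y\<^sub>1 Y\<^sub>2. {X\<^sub>1, X\<^sub>2, Y\<^sub>1, Y\<^sub>2} \<subseteq> fin \<and>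
     X = (X\<^sub>1 - X\<^sub>2) + (scal \<i> o\<^sub>L (Y\<^sub>1 - Y\<^sub>2)))"

abbreviation Tr :: "('h \<Rightarrow>\<^sub>L 'h) \<Rightarrow> complex" where
  "Tr \<equiv> trace_ext N \<tau>"

lemma pos_coneI: "X \<in> N \<Longrightarrow> positive_op X \<Longrightarrow> X \<in> pos_cone N"
  and pos_coneD: "X \<in> pos_cone N \<Longrightarrow> X \<in> N" "X \<in> pos_cone N \<Longrightarrow> positive_op X"
  by (auto simp: pos_cone_def)

lemma finD: "X \<in> fin \<Longrightarrow> X \<in> N" "X \<in> fin \<Longrightarrow> positive_op X" "X \<in> fin \<Longrightarrow> X \<in> pos_cone N"
  "X \<in> fin \<Longrightarrow> \<tau> X < \<infinity>"
  by (auto simp: fin_def pos_cone_def)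

lemma \<tau>_add: "X \<in> pos_cone N \<Longrightarrow> Y \<in> pos_cone N \<Longrightarrow> \<tau> (X + Y) = \<tau> X + \<tau> Y"
  and \<tau>_scaleR: "X \<in> pos_cone N \<Longrightarrow> c \<ge> 0 \<Longrightarrow> \<tau> (c *\<^sub>R X) = ennreal c * \<tau> X"
  and \<tau>_star: "X \<in> N \<Longrightarrow> \<tau> (star X o\<^sub>L X) = \<tau> (X o\<^sub>L star X)"
  using trace by (simp_all add: fns_trace_def)

lemma \<tau>_mono:
  assumes "X \<in> pos_cone N" "Y \<in> N" "positive_op (Y - X)"
  shows "\<tau> X \<le> \<tau> Y"
proof -
  have "\<tau> (X + (Y - X)) = \<tau> X + \<tau> (Y - X)"
    using assms by (intro \<tau>_add pos_coneI N_closed) (auto simp: pos_coneD)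
  then show ?thesis by simp
qed

lemma fin_add: "X \<in> fin \<Longrightarrow> Y \<in> fin \<Longrightarrow> X + Y \<in> fin"
  by (auto simp: fin_def \<tau>_add pos_cone_def positive_op_add N_closed)

lemma fin_scaleR: "X \<in> fin \<Longrightarrow> c \<ge> 0 \<Longrightarrow> c *\<^sub>R X \<in> fin"
  by (auto simp: fin_def \<tau>_scaleR pos_cone_def positive_op_scaleR N_closed ennreal_mult_less_top)

lemma fin_zero: "0 \<in> fin"
proof -
  have *: "(0 :: 'h \<Rightarrow>\<^sub>L 'h) \<in> pos_cone N"
    using positive_op_scaleR[OF positive_op_id, of 0] by (auto intro!: pos_coneI N_closed)
  then have "\<tau> (0 *\<^sub>R 0) = ennreal 0 * \<tau> 0" by (rule \<tau>_scaleR) simp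
  with * show ?thesis by (simp add: fin_def)
qed

lemma tr_add: "X \<in> fin \<Longrightarrow> Y \<in> fin \<Longrightarrow> tr (X + Y) = tr X + tr Y"
  by (simp add: fin_def tr_def \<tau>_add enn2real_plus)

lemma tr_scaleR: "X \<in> fin \<Longrightarrow> c \<ge> 0 \<Longrightarrow> tr (c *\<^sub>R X) = c * tr X"
  by (simp add: fin_def tr_def \<tau>_scaleR enn2real_mult)

lemma tr_nonneg: "tr X \<ge> 0"
  by (simp add: tr_def)

lemma tr_diff_eq:
  assumes "{X, X', Y, Y'} \<subseteq> fin" "X - X' = Y - Y'"
  shows "tr X - tr X' = tr Y - tr Y'"
proof -
  have "X + Y' = Y + X'" using assms(2) by (simp add: algebra_simps)
  then have "tr X + tr Y' = tr Y + tr X'" using assms(1) by (metis insert_subset tr_add)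
  then show ?thesis by simp
qed

text \<open>The difference of the two decompositions is A + i B, where A and B have real quadratic
  forms. Since the form of A + i B vanishes, so do those of A and B, and an operator with vanishing
  form is zero.\<close>

lemma hermitian_decomposition_unique:
  assumes "{X\<^sub>1, X\<^sub>2, Y\<^sub>1, Y\<^sub>2, X\<^sub>1', X\<^sub>2', Y\<^sub>1', Y\<^sub>2'} \<subseteq> fin"
    and eq: "(X\<^sub>1 - X\<^sub>2) + (scal \<i> o\<^sub>L (Y\<^sub>1 - Y\<^sub>2)) = (X\<^sub>1' - X\<^sub>2') + (scal \<i> o\<^sub>L (Y\<^sub>1' - Y\<^sub>2'))"
  shows "X\<^sub>1 - X\<^sub>2 = X\<^sub>1' - X\<^sub>2'" "Y\<^sub>1 - Y\<^sub>2 = Y\<^sub>1' - Y\<^sub>2'"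
proof -
  define A where "A = (X\<^sub>1 - X\<^sub>2) - (X\<^sub>1' - X\<^sub>2')"
  define B where "B = (Y\<^sub>1 - Y\<^sub>2) - (Y\<^sub>1' - Y\<^sub>2')"
  have pos: "\<And>X. X \<in> {X\<^sub>1, X\<^sub>2, Y\<^sub>1, Y\<^sub>2, X\<^sub>1', X\<^sub>2', Y\<^sub>1', Y\<^sub>2'} \<Longrightarrow> positive_op X"
    using assms(1) finD(2) by blast
  have bo: "A \<in> bounded_ops" "B \<in> bounded_ops"
    unfolding A_def B_def by (intro bounded_ops_closed positive_opD(1) pos; simp)+
  have im: "Im (cinner x (A x)) = 0" "Im (cinner x (B x)) = 0" for x
    unfolding A_def B_def using pos[THEN positive_opD(2), of _ x]
    by (simp_all add: blinfun.bilinear_simps cinner_simps)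
  have AB: "A + (scal \<i> o\<^sub>L B) = 0"
    using eq unfolding A_def B_def by (simp add: compose_distribs algebra_simps)
  have "cinner x (A x) + \<i> * cinner x (B x) = 0" for x
  proof -
    have "cinner x ((A + (scal \<i> o\<^sub>L B)) x) = 0" unfolding AB by simp
    then show ?thesis by (simp add: blinfun.bilinear_simps cinner_simps scal_apply)
  qed
  note sum0 = this
  have "cinner x (A x) = 0 \<and> cinner x (B x) = 0" for x
    using im[of x] sum0[of x] by (auto simp: complex_eq_iff)
  then have "A = 0" "B = 0" using bo self_adjoint_zeroI by blast+
  then show "X\<^sub>1 - X\<^sub>2 = X\<^sub>1' - X\<^sub>2'" "Y\<^sub>1 - Y\<^sub>2 = Y\<^sub>1' - Y\<^sub>2'" by (simp_all add: A_def B_def)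
qed

lemma Tr_eq:
  assumes "{X\<^sub>1, X\<^sub>2, Y\<^sub>1, Y\<^sub>2} \<subseteq> fin"
  shows "Tr ((X\<^sub>1 - X\<^sub>2) + (scal \<i> o\<^sub>L (Y\<^sub>1 - Y\<^sub>2))) = Complex (tr X\<^sub>1 - tr X\<^sub>2) (tr Y\<^sub>1 - tr Y\<^sub>2)"
  unfolding trace_ext_def fin_def[symmetric] tr_def[symmetric]
proof (rule the_equality)
  fix z
  assume "\<exists>X\<^sub>1' X\<^sub>2' Y\<^sub>1' Y\<^sub>2'. {X\<^sub>1', X\<^sub>2', Y\<^sub>1', Y\<^sub>2'} \<subseteq> fin \<and>
    X\<^sub>1 - X\<^sub>2 + (scal \<i> o\<^sub>L (Y\<^sub>1 - Y\<^sub>2)) = X\<^sub>1' - X\<^sub>2' + (scal \<i> o\<^sub>L (Y\<^sub>1' - Y\<^sub>2')) \<and>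
    z = Complex (tr X\<^sub>1' - tr X\<^sub>2') (tr Y\<^sub>1' - tr Y\<^sub>2')"
  then obtain X\<^sub>1' X\<^sub>2' Y\<^sub>1' Y\<^sub>2' where *: "{X\<^sub>1', X\<^sub>2', Y\<^sub>1', Y\<^sub>2'} \<subseteq> fin"
    "X\<^sub>1 - X\<^sub>2 + (scal \<i> o\<^sub>L (Y\<^sub>1 - Y\<^sub>2)) = X\<^sub>1' - X\<^sub>2' + (scal \<i> o\<^sub>L (Y\<^sub>1' - Y\<^sub>2'))"
    "z = Complex (tr X\<^sub>1' - tr X\<^sub>2') (tr Y\<^sub>1' - tr Y\<^sub>2')" by blast
  have "X\<^sub>1 - X\<^sub>2 = X\<^sub>1' - X\<^sub>2'" "Y\<^sub>1 - Y\<^sub>2 = Y\<^sub>1' - Y\<^sub>2'"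
    by (rule hermitian_decomposition_unique[OF _ *(2)]; use assms *(1) in blast)+
  then have "tr X\<^sub>1 - tr X\<^sub>2 = tr X\<^sub>1' - tr X\<^sub>2'" "tr Y\<^sub>1 - tr Y\<^sub>2 = tr Y\<^sub>1' - tr Y\<^sub>2'"
    using assms *(1) by (auto intro!: tr_diff_eq)
  with *(3) show "z = Complex (tr X\<^sub>1 - tr X\<^sub>2) (tr Y\<^sub>1 - tr Y\<^sub>2)" by simp
qed (use assms in blast)

lemma tr_zero: "tr 0 = 0"
  using tr_scaleR[OF fin_zero, of 0] by simp

lemma Tr_fin: "X \<in> fin \<Longrightarrow> Tr X = of_real (tr X)"
  using Tr_eq[of X 0 0 0] fin_zero by (simp add: compose_distribs complex_eq_iff tr_zero)

lemma trace_class_fin: "X \<in> fin \<Longrightarrow> trace_class X"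
  unfolding trace_class_def
  by (intro exI[of _ X] exI[of _ 0]) (simp add: fin_zero compose_distribs)

lemma
  assumes "trace_class X" "trace_class Y"
  shows trace_class_add: "trace_class (X + Y)" and Tr_add: "Tr (X + Y) = Tr X + Tr Y"
proof -
  obtain X\<^sub>1 X\<^sub>2 X\<^sub>3 X\<^sub>4 where X: "{X\<^sub>1, X\<^sub>2, X\<^sub>3, X\<^sub>4} \<subseteq> fin" "X = (X\<^sub>1 - X\<^sub>2) + (scal \<i> o\<^sub>L (X\<^sub>3 - X\<^sub>4))"
    using assms(1) unfolding trace_class_def by blast
  obtain Y\<^sub>1 Y\<^sub>2 Y\<^sub>3 Y\<^sub>4 where Y: "{Y\<^sub>1, Y\<^sub>2, Y\<^sub>3, Y\<^sub>4} \<subseteq> fin" "Y = (Y\<^sub>1 - Y\<^sub>2) + (scal \<i> o\<^sub>L (Y\<^sub>3 - Y\<^sub>4))"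
    using assms(2) unfolding trace_class_def by blast
  have eq: "X + Y = ((X\<^sub>1 + Y\<^sub>1) - (X\<^sub>2 + Y\<^sub>2)) + (scal \<i> o\<^sub>L ((X\<^sub>3 + Y\<^sub>3) - (X\<^sub>4 + Y\<^sub>4)))"
    unfolding X(2) Y(2) by (simp add: compose_distribs algebra_simps)
  have fin: "{X\<^sub>1 + Y\<^sub>1, X\<^sub>2 + Y\<^sub>2, X\<^sub>3 + Y\<^sub>3, X\<^sub>4 + Y\<^sub>4} \<subseteq> fin"
    using X(1) Y(1) by (simp add: fin_add)
  show "trace_class (X + Y)" unfolding trace_class_def using eq fin by blast
  show "Tr (X + Y) = Tr X + Tr Y"
    unfolding eq Tr_eq[OF fin] unfolding X(2) Y(2) Tr_eq[OF X(1)] Tr_eq[OF Y(1)]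
    using X(1) Y(1) by (simp add: complex_eq_iff tr_add)
qed

lemma
  assumes "trace_class X"
  shows trace_class_scaleR: "trace_class (r *\<^sub>R X)" and Tr_scaleR: "Tr (r *\<^sub>R X) = of_real r * Tr X"
    and trace_class_i: "trace_class (scal \<i> o\<^sub>L X)" and Tr_i: "Tr (scal \<i> o\<^sub>L X) = \<i> * Tr X"
proof -
  obtain X\<^sub>1 X\<^sub>2 X\<^sub>3 X\<^sub>4 where X: "{X\<^sub>1, X\<^sub>2, X\<^sub>3, X\<^sub>4} \<subseteq> fin" "X = (X\<^sub>1 - X\<^sub>2) + (scal \<i> o\<^sub>L (X\<^sub>3 - X\<^sub>4))"
    using assms unfolding trace_class_def by blast
  have "scal \<i> o\<^sub>L scal \<i> = (- id_blinfun :: 'h \<Rightarrow>\<^sub>L 'h)"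
    by (simp add: scal_minus flip: scal_mult)
  then have "scal \<i> o\<^sub>L (scal \<i> o\<^sub>L Z) = - Z" for Z :: "'h \<Rightarrow>\<^sub>L 'h"
    by (simp add: compose_distribs flip: blinfun_compose_assoc)
  then have eqi: "scal \<i> o\<^sub>L X = (X\<^sub>4 - X\<^sub>3) + (scal \<i> o\<^sub>L (X\<^sub>1 - X\<^sub>2))"
    unfolding X(2) by (simp add: compose_distribs algebra_simps)
  have fini: "{X\<^sub>4, X\<^sub>3, X\<^sub>1, X\<^sub>2} \<subseteq> fin" using X(1) by blast
  show "trace_class (scal \<i> o\<^sub>L X)" unfolding trace_class_def using eqi fini by blast
  show "Tr (scal \<i> o\<^sub>L X) = \<i> * Tr X"
    unfolding eqi Tr_eq[OF fini] unfolding X(2) Tr_eq[OF X(1)] by (simp add: complex_eq_iff)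
  have "trace_class (r *\<^sub>R X) \<and> Tr (r *\<^sub>R X) = of_real r * Tr X"
  proof (cases "r \<ge> 0")
    case True
    have eq: "r *\<^sub>R X = (r *\<^sub>R X\<^sub>1 - r *\<^sub>R X\<^sub>2) + (scal \<i> o\<^sub>L (r *\<^sub>R X\<^sub>3 - r *\<^sub>R X\<^sub>4))"
      unfolding X(2) by (simp add: compose_distribs algebra_simps)
    have fin: "{r *\<^sub>R X\<^sub>1, r *\<^sub>R X\<^sub>2, r *\<^sub>R X\<^sub>3, r *\<^sub>R X\<^sub>4} \<subseteq> fin"
      using X(1) True by (simp add: fin_scaleR)
    have "Tr (r *\<^sub>R X) = of_real r * Tr X"
      unfolding eq Tr_eq[OF fin] unfolding X(2) Tr_eq[OF X(1)]
      using X(1) True by (simp add: complex_eq_iff tr_scaleR algebra_simps)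
    moreover have "trace_class (r *\<^sub>R X)" unfolding trace_class_def using eq fin by blast
    ultimately show ?thesis by blast
  next
    \<comment> \<open>The weight is homogeneous for nonnegative scalars only, so a negative scalar
      is handled by exchanging the positive and the negative parts.\<close>
    case False
    then have r: "- r \<ge> 0" by simp
    have eq: "r *\<^sub>R X = ((-r) *\<^sub>R X\<^sub>2 - (-r) *\<^sub>R X\<^sub>1) + (scal \<i> o\<^sub>L ((-r) *\<^sub>R X\<^sub>4 - (-r) *\<^sub>R X\<^sub>3))"
      unfolding X(2) by (simp add: compose_distribs algebra_simps)
    have fin: "{(-r) *\<^sub>R X\<^sub>2, (-r) *\<^sub>R X\<^sub>1, (-r) *\<^sub>R X\<^sub>4, (-r) *\<^sub>R X\<^sub>3} \<subseteq> fin"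
      using X(1) fin_scaleR[OF _ r] by blast
    have "tr ((-r) *\<^sub>R Z) = - r * tr Z" if "Z \<in> fin" for Z using tr_scaleR[OF that r] .
    then have "Tr (r *\<^sub>R X) = of_real r * Tr X"
      unfolding eq Tr_eq[OF fin] unfolding X(2) Tr_eq[OF X(1)]
      using X(1) by (simp add: complex_eq_iff algebra_simps del: scaleR_minus_left)
    moreover have "trace_class (r *\<^sub>R X)" unfolding trace_class_def using eq fin by blast
    ultimately show ?thesis by blast
  qed
  then show "trace_class (r *\<^sub>R X)" "Tr (r *\<^sub>R X) = of_real r * Tr X" by blast+
qed

lemma
  assumes "trace_class X"
  shows trace_class_scal: "trace_class (scal c o\<^sub>L X)" and Tr_scal: "Tr (scal c o\<^sub>L X) = c * Tr X"
proof -
  have "scal c = scal (of_real (Re c)) + (scal \<i> o\<^sub>L scal (of_real (Im c)))"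
    unfolding scal_add[symmetric] scal_mult[symmetric] by (metis complex_eq)
  then have "scal c = Re c *\<^sub>R id_blinfun + Im c *\<^sub>R (scal \<i> :: 'h \<Rightarrow>\<^sub>L 'h)"
    by (simp add: scal_of_real compose_distribs)
  then have eq: "scal c o\<^sub>L X = Re c *\<^sub>R X + (scal \<i> o\<^sub>L (Im c *\<^sub>R X))"
    by (simp add: compose_distribs)
  show "trace_class (scal c o\<^sub>L X)"
    unfolding eq by (intro trace_class_add trace_class_i trace_class_scaleR assms)
  have "Tr (scal c o\<^sub>L X) = of_real (Re c) * Tr X + \<i> * (of_real (Im c) * Tr X)"
    unfolding eq by (simp add: Tr_add Tr_i Tr_scaleR trace_class_i trace_class_scaleR assms)
  also have "\<dots> = c * Tr X" by (metis complex_eq distrib_right mult.assoc)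
  finally show "Tr (scal c o\<^sub>L X) = c * Tr X" .
qed

lemma
  assumes "trace_class X" "trace_class Y"
  shows trace_class_diff: "trace_class (X - Y)" and Tr_diff: "Tr (X - Y) = Tr X - Tr Y"
  using trace_class_add[OF assms(1) trace_class_scaleR[OF assms(2), of "-1"]]
    Tr_add[OF assms(1) trace_class_scaleR[OF assms(2), of "-1"]] Tr_scaleR[OF assms(2), of "-1"]
  by simp_all

lemma
  assumes "\<And>i. i \<in> I \<Longrightarrow> trace_class (X i)"
  shows trace_class_sum: "trace_class (sum X I)" and Tr_sum: "Tr (sum X I) = (\<Sum>i\<in>I. Tr (X i))"
proof -
  have "Tr 0 = 0" using Tr_fin[OF fin_zero] tr_zero by simp
  then have "trace_class (sum X I) \<and> Tr (sum X I) = (\<Sum>i\<in>I. Tr (X i))"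
    using assms
    by (induction I rule: infinite_finite_induct)
      (auto simp: trace_class_add Tr_add trace_class_fin[OF fin_zero])
  then show "trace_class (sum X I)" "Tr (sum X I) = (\<Sum>i\<in>I. Tr (X i))" by auto
qed


subsection \<open>Bounded functionals from operators of finite trace\<close>

definition compress :: "('h \<Rightarrow>\<^sub>L 'h) \<Rightarrow> ('h \<Rightarrow>\<^sub>L 'h) \<Rightarrow> ('h \<Rightarrow>\<^sub>L 'h)" where
  "compress S X = S o\<^sub>L (X o\<^sub>L S)"

lemma compress_linear: "compress S (X + Y) = compress S X + compress S Y"
  "compress S (X - Y) = compress S X - compress S Y"
  "compress S (r *\<^sub>R X) = r *\<^sub>R compress S X"
  by (simp_all add: compress_def compose_distribs)

lemma compress_scal: "S \<in> bounded_ops \<Longrightarrow> compress S (scal c o\<^sub>L X) = scal c o\<^sub>L compress S X"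
  unfolding compress_def by (metis blinfun_compose_assoc bounded_ops_iff_commute)

text \<open>The self-adjoint Hilbert-Schmidt operators relative to \<open>\<tau>\<close>.\<close>

definition hs :: "('h \<Rightarrow>\<^sub>L 'h) \<Rightarrow> bool" where
  "hs S \<longleftrightarrow> S \<in> N \<and> star S = S \<and> \<tau> (S o\<^sub>L S) < \<infinity>"

lemma hsD: "hs S \<Longrightarrow> S \<in> N" "hs S \<Longrightarrow> star S = S" "hs S \<Longrightarrow> S \<in> bounded_ops"
  by (auto simp: hs_def N_bounded_ops)

lemma positive_compress: "S \<in> N \<Longrightarrow> star S = S \<Longrightarrow> positive_op X \<Longrightarrow> positive_op (compress S X)"
  using positive_op_star_compose[of S X] by (simp add: compress_def N_bounded_ops)

lemma compress_pos_cone: "S \<in> N \<Longrightarrow> star S = S \<Longrightarrow> X \<in> pos_cone N \<Longrightarrow> compress S X \<in> pos_cone N"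
  by (rule pos_coneI) (simp_all add: compress_def N_compose positive_compress[unfolded compress_def] pos_coneD)

text \<open>A positive X is at most \<open>norm X\<close> times the identity; compressing this
  inequality by S gives S X S at most \<open>norm X\<close> times S S, and \<open>\<tau>\<close> is
  monotone.\<close>

lemma
  assumes S: "hs S" and X: "X \<in> pos_cone N"
  shows compress_fin: "compress S X \<in> fin" and tr_compress_le: "tr (compress S X) \<le> norm X * tr (S o\<^sub>L S)"
proof -
  have SS: "S o\<^sub>L S \<in> pos_cone N"
    using S positive_op_square[of S] by (intro pos_coneI) (simp_all add: hsD N_compose)
  have "positive_op (compress S (norm X *\<^sub>R id_blinfun - X))"
    using S pos_coneD(2)[OF X]
    by (intro positive_compress positive_op_norm_minus) (simp_all add: hsD positive_op_star positive_opD)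
  then have "positive_op (norm X *\<^sub>R (S o\<^sub>L S) - compress S X)"
    by (simp add: compress_linear) (simp add: compress_def)
  then have "\<tau> (compress S X) \<le> \<tau> (norm X *\<^sub>R (S o\<^sub>L S))"
    using S X SS by (intro \<tau>_mono compress_pos_cone) (simp_all add: hsD N_scaleR pos_coneD)
  also have "\<dots> = ennreal (norm X) * \<tau> (S o\<^sub>L S)" using SS by (simp add: \<tau>_scaleR)
  finally have le: "\<tau> (compress S X) \<le> ennreal (norm X) * \<tau> (S o\<^sub>L S)" .
  have fin: "ennreal (norm X) * \<tau> (S o\<^sub>L S) < \<infinity>"
    using S by (simp add: hs_def ennreal_mult_less_top)
  with le have "\<tau> (compress S X) < \<infinity>" by (rule le_less_trans)
  then show "compress S X \<in> fin" using S X by (simp add: fin_def compress_pos_cone hsD)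
  show "tr (compress S X) \<le> norm X * tr (S o\<^sub>L S)"
    unfolding tr_def using enn2real_mono[OF le] fin by (simp add: enn2real_mult)
qed

text \<open>The trace is in general unbounded for the operator norm, but this compressed functional
  is bounded by a multiple of \<open>tr (S o\<^sub>L S)\<close>; exchanges of trace and integral are
  made through it.\<close>

definition ftr :: "('h \<Rightarrow>\<^sub>L 'h) \<Rightarrow> ('h \<Rightarrow>\<^sub>L 'h) \<Rightarrow> complex" where
  "ftr S X = Tr (compress S X)"

text \<open>X splits into a real and an imaginary self-adjoint part, and a self-adjoint H is half
  the difference of the positive operators \<open>norm H\<close> + H and \<open>norm H\<close> - H,
  to which the estimate on the positive cone applies. The constant 4 is generous.\<close>

lemma
  assumes S: "hs S" and X: "X \<in> N"
  shows trace_class_compress: "trace_class (compress S X)"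
    and norm_ftr_le: "norm (ftr S X) \<le> (4 * tr (S o\<^sub>L S)) * norm X"
proof -
  have *: "trace_class (compress S H) \<and> norm (ftr S H) \<le> 2 * tr (S o\<^sub>L S) * norm H"
    if H: "H \<in> N" "star H = H" for H
  proof -
    define U where "U = norm H *\<^sub>R id_blinfun + H"
    define V where "V = norm H *\<^sub>R id_blinfun - H"
    have UV: "U \<in> pos_cone N" "V \<in> pos_cone N"
      unfolding U_def V_def using positive_op_norm_minus[OF N_bounded_ops[OF H(1)] H(2)]
      by (auto intro!: pos_coneI N_closed H)
    have nid: "norm (id_blinfun :: 'h \<Rightarrow>\<^sub>L 'h) \<le> 1" by (rule norm_blinfun_id_le)
    have "norm U \<le> norm H * norm (id_blinfun :: 'h \<Rightarrow>\<^sub>L 'h) + norm H"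
      "norm V \<le> norm H * norm (id_blinfun :: 'h \<Rightarrow>\<^sub>L 'h) + norm H"
      unfolding U_def V_def using norm_triangle_ineq norm_triangle_ineq4 by (metis abs_norm_cancel norm_scaleR)+
    then have nUV: "norm U \<le> 2 * norm H" "norm V \<le> 2 * norm H"
      using mult_left_mono[OF nid, of "norm H"] by simp_all
    have H_eq: "compress S H = (1/2) *\<^sub>R (compress S U - compress S V)"
      unfolding compress_linear(3)[symmetric] compress_linear(2)[symmetric]
      by (simp add: U_def V_def flip: scaleR_2)
    note tcs = trace_class_fin[OF compress_fin[OF S UV(1)]] trace_class_fin[OF compress_fin[OF S UV(2)]]
    have "trace_class (compress S H)"
      unfolding H_eq by (intro trace_class_diff trace_class_scaleR tcs)
    moreover have "ftr S H = of_real ((tr (compress S U) - tr (compress S V)) / 2)"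
      unfolding ftr_def H_eq
      by (simp add: Tr_scaleR Tr_diff trace_class_diff tcs Tr_fin compress_fin[OF S] UV)
    moreover have "\<bar>tr (compress S U) - tr (compress S V)\<bar> \<le> 2 * norm H * tr (S o\<^sub>L S)"
    proof -
      have "tr (compress S U) \<le> 2 * norm H * tr (S o\<^sub>L S)" "tr (compress S V) \<le> 2 * norm H * tr (S o\<^sub>L S)"
        using tr_compress_le[OF S UV(1)] tr_compress_le[OF S UV(2)]
          mult_right_mono[OF nUV(1) tr_nonneg] mult_right_mono[OF nUV(2) tr_nonneg] order_trans by blast+
      then show ?thesis using tr_nonneg[of "compress S U"] tr_nonneg[of "compress S V"] by linarith
    qed
    ultimately show ?thesis
      using mult_nonneg_nonneg[OF norm_ge_zero[of H] tr_nonneg[of "S o\<^sub>L S"]] 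
      by (simp only: norm_of_real) (simp add: mult_ac)
  qed
  define H where "H = (1/2) *\<^sub>R (X + star X)"
  define K where "K = (scal (- \<i> / 2) o\<^sub>L (X - star X))"
  have bX: "X \<in> bounded_ops" "star X \<in> bounded_ops" using X N_star N_bounded_ops by blast+
  have HN: "H \<in> N" and KN: "K \<in> N" unfolding H_def K_def by (intro N_closed X)+
  have Hs: "star H = H" unfolding H_def using bX
    by (simp add: star_scaleR star_add star_star bounded_ops_closed add.commute)
  have Ks: "star K = K"
    unfolding K_def using bX
    by (subst star_scal_compose) (auto simp: star_diff star_star bounded_ops_closed compose_distribs scal_minus)
  have XHK: "X = H + (scal \<i> o\<^sub>L K)"
  proof -
    have "scal \<i> o\<^sub>L K = scal (of_real (1/2)) o\<^sub>L (X - star X)"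
      unfolding K_def by (simp flip: blinfun_compose_assoc scal_mult)
    also have "\<dots> = (1/2) *\<^sub>R (X - star X)" unfolding scal_of_real by (simp add: compose_distribs scaleR_diff_right)
    finally show ?thesis unfolding H_def by (simp add: scaleR_diff_right scaleR_add_right) (simp flip: scaleR_add_left)
  qed
  have nH: "norm H \<le> norm X" unfolding H_def using norm_triangle_ineq[of X "star X"] norm_star[OF bX(1)] by simp
  have nK: "norm K \<le> norm X" unfolding K_def norm_scal_compose
    using norm_triangle_ineq4[of X "star X"] norm_star[OF bX(1)] by (simp add: norm_divide)
  have eq: "compress S X = compress S H + (scal \<i> o\<^sub>L compress S K)"
    by (subst XHK) (simp add: compress_linear compress_scal hsD S)
  show "trace_class (compress S X)"
    unfolding eq by (intro trace_class_add trace_class_i) (use * HN KN Hs Ks in auto)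
  have "ftr S X = ftr S H + \<i> * ftr S K"
    unfolding ftr_def eq using *[OF HN Hs] *[OF KN Ks] by (simp add: Tr_add Tr_i trace_class_i)
  then have "norm (ftr S X) \<le> norm (ftr S H) + norm (ftr S K)"
    using norm_triangle_ineq[of "ftr S H" "\<i> * ftr S K"] by (simp add: norm_mult)
  also have "\<dots> \<le> 2 * tr (S o\<^sub>L S) * norm X + 2 * tr (S o\<^sub>L S) * norm X"
    using *[OF HN Hs] *[OF KN Ks] mult_left_mono[OF nH, of "2 * tr (S o\<^sub>L S)"] mult_left_mono[OF nK, of "2 * tr (S o\<^sub>L S)"]
      tr_nonneg[of "S o\<^sub>L S"] by linarith
  finally show "norm (ftr S X) \<le> (4 * tr (S o\<^sub>L S)) * norm X" by (simp add: mult_ac)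
qed

lemma ftr_linear:
  assumes "hs S" "X \<in> N" "Y \<in> N"
  shows "ftr S (X + Y) = ftr S X + ftr S Y" "ftr S (r *\<^sub>R X) = of_real r * ftr S X"
    "ftr S (scal c o\<^sub>L X) = c * ftr S X"
  unfolding ftr_def using assms
  by (simp_all add: compress_linear compress_scal hsD Tr_add Tr_scal Tr_scaleR trace_class_compress)

lemma ftr_diff: "hs S \<Longrightarrow> X \<in> N \<Longrightarrow> Y \<in> N \<Longrightarrow> ftr S (X - Y) = ftr S X - ftr S Y"
  using ftr_linear(1)[of S "X - Y" Y] by (simp add: N_closed)

lemma ftr_sum: 
  assumes "hs S" "\<And>i. i \<in> I \<Longrightarrow> X i \<in> N" 
  shows "ftr S (sum X I) = (\<Sum>i\<in>I. ftr S (X i))"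
proof -
  have "ftr S 0 = 0" using ftr_linear(2)[OF assms(1) N_zero N_zero, of 0] by simp
  then show ?thesis using assms(2)
    by (induction I rule: infinite_finite_induct) (simp_all add: ftr_linear assms(1) N_sum)
qed

lemma ftr_continuous:
  assumes S: "hs S" and F: "continuous_on A F" "\<And>x. x \<in> A \<Longrightarrow> F x \<in> N"
  shows "continuous_on A (\<lambda>x. ftr S (F x))"
  unfolding continuous_on_def
proof
  fix x assume x: "x \<in> A"
  have "((\<lambda>y. F y - F x) \<longlongrightarrow> 0) (at x within A)"
    using F(1) x LIM_zero by (auto simp: continuous_on_def)
  then have "((\<lambda>y. ftr S (F y) - ftr S (F x)) \<longlongrightarrow> 0) (at x within A)"
  proof (rule Lim_null_comparison[rotated, OF tendsto_mult_right_zero[OF tendsto_norm_zero, of _ _ "4 * tr (S o\<^sub>L S)"]])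
    show "\<forall>\<^sub>F y in at x within A. norm (ftr S (F y) - ftr S (F x)) \<le> 4 * tr (S o\<^sub>L S) * norm (F y - F x)"
      unfolding eventually_at_filter
      by (rule always_eventually)
        (metis F(2) x N_diff S ftr_diff norm_ftr_le)
  qed
  then show "((\<lambda>y. ftr S (F y)) \<longlongrightarrow> ftr S (F x)) (at x within A)" by (rule LIM_zero_cancel)
qed

text \<open>\<open>ftr S\<close> is known to be bounded and linear on \<open>N\<close> only, so it
  is not a bounded linear map on the whole operator space that could simply be moved through the
  integral. Instead \<open>ftr S (P u)\<close>, with \<open>P\<close> the primitive of
  \<open>F\<close>, is differentiated in u, and the fundamental theorem of calculus is
  applied.\<close>

lemma ftr_integral_Icc:
  fixes F :: "real \<Rightarrow> 'h \<Rightarrow>\<^sub>L 'h"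
  assumes S: "hs S" and F: "continuous_on {0..b} F" "\<And>x. x \<in> {0..b} \<Longrightarrow> F x \<in> N" and b: "b \<ge> 0"
  shows "integral {0..b} (\<lambda>x. ftr S (F x)) = ftr S (integral {0..b} F)"
proof -
  define P where "P u = integral {0..u} F" for u
  have PN: "P u \<in> N" if "u \<in> {0..b}" for u
    unfolding P_def
    by (rule N_integral[OF integrable_continuous_real[OF continuous_on_subset[OF F(1)]]])
      (use that F(2) in \<open>auto\<close>)
  have "((\<lambda>u. ftr S (P u)) has_vector_derivative ftr S (F u)) (at u within {0..b})" if u: "u \<in> {0..b}" for u
  proof -
    have "(P has_vector_derivative F u) (at u within {0..b})"
      unfolding P_def by (rule integral_has_vector_derivative[OF F(1) u])
    then have "((\<lambda>y. (1 / norm (y - u)) *\<^sub>R (P y - (P u + (y - u) *\<^sub>R F u))) \<longlongrightarrow> 0) (at u within {0..b})"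
      by (simp add: has_vector_derivative_def has_derivative_within)
    then have "((\<lambda>y. (1 / norm (y - u)) *\<^sub>R (ftr S (P y) - (ftr S (P u) + (y - u) *\<^sub>R ftr S (F u)))) \<longlongrightarrow> 0)
      (at u within {0..b})"
    proof (rule Lim_null_comparison[rotated, OF tendsto_mult_right_zero[OF tendsto_norm_zero, of _ _ "4 * tr (S o\<^sub>L S)"]])
      have "norm ((1 / norm (y - u)) *\<^sub>R (ftr S (P y) - (ftr S (P u) + (y - u) *\<^sub>R ftr S (F u))))
        \<le> 4 * tr (S o\<^sub>L S) * norm ((1 / norm (y - u)) *\<^sub>R (P y - (P u + (y - u) *\<^sub>R F u)))"
        if y: "y \<in> {0..b}" for y
      proof -
        have N: "P y - (P u + (y - u) *\<^sub>R F u) \<in> N" by (intro N_closed PN y u F(2))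
        have "ftr S (P y) - (ftr S (P u) + (y - u) *\<^sub>R ftr S (F u)) = ftr S (P y - (P u + (y - u) *\<^sub>R F u))"
          using PN[OF y] PN[OF u] F(2)[OF u]
          by (simp add: ftr_diff ftr_linear S N_closed scaleR_conv_of_real)
        also have "norm \<dots> \<le> 4 * tr (S o\<^sub>L S) * norm (P y - (P u + (y - u) *\<^sub>R F u))"
          by (rule norm_ftr_le[OF S N])
        finally show ?thesis by (simp add: divide_right_mono)
      qed
      then show "\<forall>\<^sub>F y in at u within {0..b}.
        norm ((1 / norm (y - u)) *\<^sub>R (ftr S (P y) - (ftr S (P u) + (y - u) *\<^sub>R ftr S (F u))))
        \<le> 4 * tr (S o\<^sub>L S) * norm ((1 / norm (y - u)) *\<^sub>R (P y - (P u + (y - u) *\<^sub>R F u)))"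
        unfolding eventually_at_filter by (intro always_eventually) blast
    qed
    then show ?thesis
      by (simp add: has_vector_derivative_def has_derivative_within bounded_linear_scaleR_left)
  qed
  then have "((\<lambda>x. ftr S (F x)) has_integral ftr S (P b) - ftr S (P 0)) {0..b}"
    by (intro fundamental_theorem_of_calculus b) 
  moreover have "ftr S (P 0) = 0"
    unfolding P_def using ftr_linear(2)[OF S N_zero N_zero, of 0] by simp
  ultimately show ?thesis unfolding P_def by (simp add: integral_unique)
qed

lemma ftr_integral:
  fixes F :: "real \<Rightarrow> 'h \<Rightarrow>\<^sub>L 'h"
  assumes S: "hs S" and F: "continuous_on {0..} F" "\<And>x. x \<ge> 0 \<Longrightarrow> F x \<in> N"
    and le: "\<And>x. x \<ge> 0 \<Longrightarrow> norm (F x) \<le> g x" and g: "g integrable_on {0..}"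
  shows "integral {0..} (\<lambda>x. ftr S (F x)) = ftr S (integral {0..} F)"
    "(\<lambda>x. ftr S (F x)) integrable_on {0..}"
proof -
  have Fi: "F integrable_on {0..}"
    by (rule integrable_on_dominated[where g = g]) (use le F(1) g in auto)
  show fi: "(\<lambda>x. ftr S (F x)) integrable_on {0..}"
  proof (rule integrable_on_dominated)
    show "continuous_on {0..} (\<lambda>x. ftr S (F x))" by (rule ftr_continuous[OF S F(1)]) (use F(2) in auto)
    show "(\<lambda>x. (4 * tr (S o\<^sub>L S)) * g x) integrable_on {0..}" using integrable_cmul[OF g, of "4 * tr (S o\<^sub>L S)"] by simp
    show "norm (ftr S (F x)) \<le> (4 * tr (S o\<^sub>L S)) * g x" if "x \<in> {0..}" for x
      using norm_ftr_le[OF S F(2)[of x]] that mult_left_mono[OF le[of x], of "4 * tr (S o\<^sub>L S)"] tr_nonneg[of "S o\<^sub>L S"]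
      by simp
  qed simp
  have FN: "integral {0..} F \<in> N" by (rule N_integral[OF Fi]) (use F(2) in auto)
  have FnN: "integral {0..real n} F \<in> N" for n
    by (rule N_integral) (auto intro!: integrable_continuous_real continuous_on_subset[OF F(1)] F(2))
  have "(\<lambda>n. integral {0..real n} F - integral {0..} F) \<longlonglongrightarrow> 0"
    using LIM_zero[OF integral_atLeast_limit[OF Fi]] .
  then have "(\<lambda>n. ftr S (integral {0..real n} F) - ftr S (integral {0..} F)) \<longlonglongrightarrow> 0"
  proof (rule Lim_null_comparison[rotated, OF tendsto_mult_right_zero[OF tendsto_norm_zero, of _ _ "4 * tr (S o\<^sub>L S)"]])
    show "\<forall>\<^sub>F n in sequentially. norm (ftr S (integral {0..real n} F) - ftr S (integral {0..} F))
       \<le> 4 * tr (S o\<^sub>L S) * norm (integral {0..real n} F - integral {0..} F)"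
      by (rule always_eventually) (metis FN FnN N_diff S ftr_diff norm_ftr_le)
  qed
  then have "(\<lambda>n. ftr S (integral {0..real n} F)) \<longlonglongrightarrow> ftr S (integral {0..} F)" by (rule LIM_zero_cancel)
  moreover have "ftr S (integral {0..real n} F) = integral {0..real n} (\<lambda>x. ftr S (F x))" for n
    by (rule ftr_integral_Icc[symmetric, OF S]) (auto intro!: continuous_on_subset[OF F(1)] F(2))
  moreover note integral_atLeast_limit[OF fi]
  ultimately show "integral {0..} (\<lambda>x. ftr S (F x)) = ftr S (integral {0..} F)"
    using LIMSEQ_unique by auto
qed

end


subsection \<open>Cyclicity of the trace under the integral\<close>

lemma cinner_integral:
  fixes F :: "real \<Rightarrow> 'h::complex_hilbert_space \<Rightarrow>\<^sub>L 'h"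
  assumes "F integrable_on A"
  shows "cinner x (integral A F y) = integral A (\<lambda>t. cinner x (F t y))"
    "(\<lambda>t. cinner x (F t y)) integrable_on A"
proof -
  have bl: "bounded_linear (\<lambda>X. cinner x (blinfun_apply X y))"
    by (rule bounded_linear_compose[OF bounded_bilinear.bounded_linear_right[OF bounded_bilinear_cinner]
          blinfun.bounded_linear_left])
  show "cinner x (integral A F y) = integral A (\<lambda>t. cinner x (F t y))"
    using integral_linear[OF assms bl] by (simp add: o_def)
  show "(\<lambda>t. cinner x (F t y)) integrable_on A"
    using integrable_linear[OF assms bl] by (simp add: o_def)
qed

lemma integral_compose_left:
  fixes F :: "real \<Rightarrow> 'a::real_normed_vector \<Rightarrow>\<^sub>L 'b::banach" and B :: "'b \<Rightarrow>\<^sub>L 'c::banach"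
  shows "F integrable_on A \<Longrightarrow> integral A (\<lambda>x. B o\<^sub>L F x) = B o\<^sub>L integral A F"
  using integral_linear[OF _ bounded_bilinear.bounded_linear_right[OF bounded_bilinear_blinfun_compose, of B]]
  by (simp add: o_def)

lemma integrable_compose_left:
  fixes F :: "real \<Rightarrow> 'a::real_normed_vector \<Rightarrow>\<^sub>L 'b::banach" and B :: "'b \<Rightarrow>\<^sub>L 'c::banach"
  shows "F integrable_on A \<Longrightarrow> (\<lambda>x. B o\<^sub>L F x) integrable_on A"
  using integrable_linear[OF _ bounded_bilinear.bounded_linear_right[OF bounded_bilinear_blinfun_compose, of B]]
  by (simp add: o_def)

lemmas continuous_on_compose_ops = bounded_bilinear.continuous_on[OF bounded_bilinear_blinfun_compose]

lemma continuous_on_star: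
  assumes F: "continuous_on A F" "\<And>x. x \<in> A \<Longrightarrow> F x \<in> bounded_ops"
  shows "continuous_on A (\<lambda>x. star (F x))"
  unfolding continuous_on_def
proof
  fix x assume x: "x \<in> A"
  have "((\<lambda>y. F y - F x) \<longlongrightarrow> 0) (at x within A)"
    using F(1) x LIM_zero by (auto simp: continuous_on_def)
  then have "((\<lambda>y. star (F y) - star (F x)) \<longlongrightarrow> 0) (at x within A)"
  proof (rule Lim_null_comparison[rotated, OF tendsto_norm_zero])
    show "\<forall>\<^sub>F y in at x within A. norm (star (F y) - star (F x)) \<le> norm (F y - F x)"
      unfolding eventually_at_filter
      by (rule always_eventually) (metis F(2) x bounded_ops_closed(2) norm_star_le star_diff)
  qed
  then show "((\<lambda>y. star (F y)) \<longlongrightarrow> star (F x)) (at x within A)" by (rule LIM_zero_cancel)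
qed

lemma norm_compose_mono:
  "norm A \<le> a \<Longrightarrow> norm B \<le> b \<Longrightarrow> norm (A o\<^sub>L B) \<le> a * b"
  by (meson mult_mono norm_blinfun_compose norm_ge_zero order_trans)

context semifinite_algebra
begin

lemma positive_integral:
  fixes F :: "real \<Rightarrow> 'h \<Rightarrow>\<^sub>L 'h"
  assumes F: "F integrable_on A" "\<And>x. x \<in> A \<Longrightarrow> F x \<in> pos_cone N"
  shows "integral A F \<in> pos_cone N"
proof (rule pos_coneI)
  show N: "integral A F \<in> N" by (rule N_integral) (use F pos_coneD in auto)
  have pos: "positive_op (F t)" if "t \<in> A" for t using F(2)[OF that] by (rule pos_coneD)
  show "positive_op (integral A F)"
  proof (rule positive_opI[OF N_bounded_ops[OF N]])
    fix x
    have i: "(\<lambda>t. cinner x (F t x)) integrable_on A" by (rule cinner_integral[OF F(1)])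
    have "Im (cinner x (integral A F x)) = integral A (\<lambda>t. Im (cinner x (F t x)))"
      using integral_linear[OF i bounded_linear_Im] cinner_integral(1)[OF F(1)] by (simp add: o_def)
    also have "\<dots> = integral A (\<lambda>t. 0)"
      by (rule integral_cong) (use pos positive_opD in auto)
    finally show "Im (cinner x (integral A F x)) = 0" by simp
    have "Re (cinner x (integral A F x)) = integral A (\<lambda>t. Re (cinner x (F t x)))"
      using integral_linear[OF i bounded_linear_Re] cinner_integral(1)[OF F(1)] by (simp add: o_def)
    also have "\<dots> \<ge> 0"
      using integrable_linear[OF i bounded_linear_Re] pos positive_opD(3)
      by (intro integral_nonneg) (auto simp: o_def)
    finally show "Re (cinner x (integral A F x)) \<ge> 0" .
  qed
qed

text \<open>Normality of \<open>\<tau>\<close> speaks of directed families and least upper bounds.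
  Pointwise convergence of the increasing quadratic forms identifies \<open>Y\<close> as the least
  upper bound of the sequence.\<close>

lemma trace_normal_sequence:
  assumes X: "\<And>n. X n \<in> pos_cone N" and inc: "\<And>n. positive_op (X (Suc n) - X n)"
    and Y: "Y \<in> pos_cone N" and lim: "\<And>x. (\<lambda>n. Re (cinner x (X n x))) \<longlonglongrightarrow> Re (cinner x (Y x))"
  shows "\<tau> Y = (SUP n. \<tau> (X n))"
proof -
  have diffI: "op_le A B" if "A \<in> pos_cone N" "B \<in> pos_cone N" "\<And>x. Re (cinner x (A x)) \<le> Re (cinner x (B x))" for A B
    unfolding op_le_def
    using positive_opD[OF pos_coneD(2)[OF that(1)]] positive_opD[OF pos_coneD(2)[OF that(2)]] that(3)
    by (intro positive_opI) (auto simp: bounded_ops_closed blinfun.bilinear_simps cinner_simps)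
  have mono: "incseq (\<lambda>n. Re (cinner x (X n x)))" for x
    using positive_opD(3)[OF inc, of x] by (intro incseq_SucI) (simp add: blinfun.bilinear_simps cinner_simps)
  have 1: "\<forall>A\<in>range X. \<forall>B\<in>range X. \<exists>C\<in>range X. op_le A C \<and> op_le B C"
  proof (clarify, rename_tac i j)
    fix i j
    show "\<exists>C\<in>range X. op_le (X i) C \<and> op_le (X j) C"
      using mono by (intro bexI[of _ "X (max i j)"] conjI diffI X) (auto simp: incseq_def)
  qed
  have 2: "\<forall>A\<in>range X. op_le A Y"
    using incseq_le[OF mono lim] by (auto intro!: diffI X Y)
  have 3: "\<forall>U\<in>pos_cone N. (\<forall>A\<in>range X. op_le A U) \<longrightarrow> op_le Y U"
  proof (intro ballI impI diffI Y)
    fix U x assume U: "U \<in> pos_cone N" "\<forall>A\<in>range X. op_le A U"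
    have "Re (cinner x (X n x)) \<le> Re (cinner x (U x))" for n
      using U(2) positive_opD(3)[of "U - X n" x] by (auto simp: op_le_def blinfun.bilinear_simps cinner_simps)
    then show "Re (cinner x (Y x)) \<le> Re (cinner x (U x))"
      using LIMSEQ_le_const2[OF lim] by blast
  qed
  have "\<tau> Y = (SUP A\<in>range X. \<tau> A)"
    using trace X Y 1 2 3 unfolding fns_trace_def by (elim conjE allE[of _ "range X"] allE[of _ Y]) blast
  then show ?thesis by (simp add: image_image)
qed

lemma \<tau>_fin: "X \<in> fin \<Longrightarrow> \<tau> X = ennreal (tr X)"
  by (simp add: tr_def fin_def)

text \<open>The tracial identity for Z = S A f, whose two products with its adjoint are the two
  compressed operators.\<close>

lemma compress_compose_star:
  assumes "S \<in> N" "star S = S" "A \<in> N" "f \<in> N" "star f = f"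
  shows "\<tau> (compress f (star A o\<^sub>L ((S o\<^sub>L S) o\<^sub>L A))) = \<tau> (compress S (A o\<^sub>L ((f o\<^sub>L f) o\<^sub>L star A)))"
proof -
  define Z where "Z = S o\<^sub>L (A o\<^sub>L f)"
  have b: "S \<in> bounded_ops" "A \<in> bounded_ops" "f \<in> bounded_ops" using assms N_bounded_ops by auto
  have Z: "Z \<in> N" unfolding Z_def by (intro N_compose assms)
  have sZ: "star Z = f o\<^sub>L (star A o\<^sub>L S)"
    unfolding Z_def using b assms
    by (simp add: star_compose bounded_ops_closed blinfun_compose_assoc)
  have "star Z o\<^sub>L Z = compress f (star A o\<^sub>L ((S o\<^sub>L S) o\<^sub>L A))"
    "Z o\<^sub>L star Z = compress S (A o\<^sub>L ((f o\<^sub>L f) o\<^sub>L star A))"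
    unfolding sZ by (simp_all add: Z_def compress_def blinfun_compose_assoc)
  then show ?thesis using \<tau>_star[OF Z] by simp
qed

end

text \<open>An approximate unit of finite trace. It allows operators not yet known to have finite
  trace to be compared through the bounded functionals \<open>ftr (f n)\<close>, after which n tends
  to infinity by normality.\<close>

locale semifinite_algebra_approx_unit = semifinite_algebra +
  fixes f :: "nat \<Rightarrow> 'a \<Rightarrow>\<^sub>L 'a"
  assumes hs_f: "hs (f n)"
    and f_mono: "positive_op ((f (Suc n) o\<^sub>L f (Suc n)) - (f n o\<^sub>L f n))"
    and f_le: "positive_op (id_blinfun - (f n o\<^sub>L f n))"
    and f_lim: "(\<lambda>n. Re (cinner x ((f n o\<^sub>L f n) x))) \<longlonglongrightarrow> (norm x)\<^sup>2"
begin

lemma f_pos: "f n o\<^sub>L f n \<in> pos_cone N"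
  using positive_op_square[of "f n"] hsD[OF hs_f, of n] by (intro pos_coneI N_compose) auto

lemma f_form_le: "Re (cinner x ((f n o\<^sub>L f n) x)) \<le> (norm x)\<^sup>2"
  using positive_opD(3)[OF f_le, of x] by (simp add: blinfun.bilinear_simps cinner_simps Re_cinner_self)

lemma f_form_nonneg: "Re (cinner x ((f n o\<^sub>L f n) x)) \<ge> 0"
  using positive_opD(3)[OF pos_coneD(2)[OF f_pos]] .

text \<open>With Y the square root of X, the trace of f X f equals that of Y f f Y. The latter
  operators increase with n, whereas f X f itself need not, and normality applies to them.\<close>

lemma trace_eq_SUP_compress:
  assumes X: "X \<in> pos_cone N"
  shows "\<tau> X = (SUP n. \<tau> (compress (f n) X))"
proof -
  define Y where "Y = cont_calculus sqrt X"
  have pX: "positive_op X" and XN: "X \<in> N" using X pos_coneD by auto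
  have c: "continuous_on {0..norm X} sqrt" by (intro continuous_intros)
  have Y: "Y \<in> N" "star Y = Y" unfolding Y_def
    by (auto intro: N_cont_calculus[OF pX XN c] cont_calculus_self_adjoint[OF pX c])
  have "cont_calculus (\<lambda>x. sqrt x * sqrt x) X = cont_calculus (\<lambda>x. x) X"
    by (rule cont_calculus_cong[OF pX]) (auto intro!: continuous_intros)
  then have YY: "Y o\<^sub>L Y = X"
    unfolding Y_def using cont_calculus_mult[OF pX c c] cont_calculus_ident[OF pX] by simp
  have "\<tau> X = (SUP n. \<tau> (compress Y (f n o\<^sub>L f n)))"
  proof (rule trace_normal_sequence[OF _ _ X])
    show "compress Y (f n o\<^sub>L f n) \<in> pos_cone N" for n
      by (intro compress_pos_cone Y f_pos)
    show "positive_op (compress Y (f (Suc n) o\<^sub>L f (Suc n)) - compress Y (f n o\<^sub>L f n))" for n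
      unfolding compress_linear(2)[symmetric] by (intro positive_compress Y f_mono)
    show "(\<lambda>n. Re (cinner x (compress Y (f n o\<^sub>L f n) x))) \<longlonglongrightarrow> Re (cinner x (X x))" for x
    proof -
      have *: "cinner x (Y y) = cinner (Y x) y" for y using cinner_star_right[of Y x y] Y N_bounded_ops by simp
      have "Re (cinner x (X x)) = (norm (Y x))\<^sup>2"
        unfolding YY[symmetric] by (simp add: * Re_cinner_self)
      then show ?thesis using f_lim[of "Y x"] by (simp add: compress_def *)
    qed
  qed
  moreover have "\<tau> (compress Y (f n o\<^sub>L f n)) = \<tau> (compress (f n) X)" for n
    using compress_compose_star[OF Y N_id, of "f n"] hsD[OF hs_f, of n]
    by (simp add: YY positive_op_star[OF positive_op_id])
  ultimately show ?thesis by simp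
qed

text \<open>Cyclicity for an integral of positive operators. At fixed n, compression by
  \<open>f n\<close> makes everything finite: \<open>ftr (f n)\<close> enters the integral, the
  tracial identity is applied pointwise, and \<open>ftr S\<close> leaves the integral. Normality
  then removes \<open>f n\<close> on both sides, and finiteness of the right-hand side shows that
  the integral of \<open>G\<close> has finite trace.\<close>

lemma trace_integral_star_square:
  fixes Y :: "real \<Rightarrow> 'a \<Rightarrow>\<^sub>L 'a"
  assumes S: "hs S" and Y: "continuous_on {0..} Y" "\<And>x. x \<ge> 0 \<Longrightarrow> Y x \<in> N"
    and le: "\<And>x. x \<ge> 0 \<Longrightarrow> (norm (Y x))\<^sup>2 \<le> g x" and g: "g integrable_on {0..}"
  defines "G \<equiv> \<lambda>x. star (Y x) o\<^sub>L ((S o\<^sub>L S) o\<^sub>L Y x)" and "Q \<equiv> \<lambda>x. Y x o\<^sub>L star (Y x)"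
  shows "G integrable_on {0..}" "Q integrable_on {0..}" "integral {0..} G \<in> fin"
    "tr (integral {0..} G) = tr (compress S (integral {0..} Q))" 
    "integral {0..} Q \<in> pos_cone N"
proof -
  have bY: "Y x \<in> bounded_ops" if "x \<ge> 0" for x using Y(2)[OF that] N_bounded_ops by blast
  have sY: "continuous_on {0..} (\<lambda>x. star (Y x))" by (rule continuous_on_star) (use Y bY in auto)
  have sYN: "star (Y x) \<in> N" if "x \<ge> 0" for x using Y(2)[OF that] N_star by blast
  define R where "R n x = Y x o\<^sub>L ((f n o\<^sub>L f n) o\<^sub>L star (Y x))" for n x
  have Gc: "continuous_on {0..} G" unfolding G_def
    by (intro continuous_on_compose_ops continuous_on_const sY Y)
  have Qc: "continuous_on {0..} Q" unfolding Q_def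
    by (intro continuous_on_compose_ops continuous_on_const sY Y)
  have Rc: "continuous_on {0..} (R n)" for n unfolding R_def
    by (intro continuous_on_compose_ops continuous_on_const sY Y)
  have SS: "S o\<^sub>L S \<in> pos_cone N"
    using S positive_op_square[of S] by (intro pos_coneI) (simp_all add: hsD N_compose)
  have Gp: "G x \<in> pos_cone N" if "x \<ge> 0" for x
    unfolding G_def using Y(2)[OF that] bY[OF that] SS hsD(1)[OF S]
    by (intro pos_coneI N_closed positive_op_star_compose) (auto simp: pos_coneD)
  have pos: "A o\<^sub>L (B o\<^sub>L star A) \<in> pos_cone N" if "A \<in> N" "B \<in> pos_cone N" for A B
    using positive_op_star_compose[of "star A" B] that N_bounded_ops[OF that(1)] star_in_bounded_ops[of A]
    by (intro pos_coneI N_closed) (auto simp: pos_coneD star_star)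
  have Rp: "R n x \<in> pos_cone N" if "x \<ge> 0" for n x
    unfolding R_def by (intro pos Y(2) that f_pos)
  have "id_blinfun \<in> pos_cone N" by (intro pos_coneI N_id positive_op_id)
  then have Qp: "Q x \<in> pos_cone N" if "x \<ge> 0" for x
    unfolding Q_def using pos[OF Y(2)[OF that], of id_blinfun] by simp
  have nsY: "norm (star (Y x)) = norm (Y x)" if "x \<ge> 0" for x using norm_star[OF bY[OF that]] .
  have Gb: "norm (G x) \<le> norm (S o\<^sub>L S) * g x" if "x \<ge> 0" for x
  proof -
    have "norm (G x) \<le> norm (Y x) * (norm (S o\<^sub>L S) * norm (Y x))"
      unfolding G_def by (intro norm_compose_mono) (auto simp: nsY that)
    also have "\<dots> = norm (S o\<^sub>L S) * (norm (Y x))\<^sup>2" by (simp add: power2_eq_square)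
    also have "\<dots> \<le> norm (S o\<^sub>L S) * g x" by (intro mult_left_mono le that) auto
    finally show ?thesis .
  qed
  have Qb: "norm (Q x) \<le> g x" if "x \<ge> 0" for x
  proof -
    have "norm (Q x) \<le> norm (Y x) * norm (Y x)"
      unfolding Q_def by (intro norm_compose_mono) (auto simp: nsY that)
    then show ?thesis using le[OF that] by (simp add: power2_eq_square)
  qed
  have Rb: "norm (R n x) \<le> norm (f n o\<^sub>L f n) * g x" if "x \<ge> 0" for n x
  proof -
    have "norm (R n x) \<le> norm (Y x) * (norm (f n o\<^sub>L f n) * norm (Y x))"
      unfolding R_def by (intro norm_compose_mono) (auto simp: nsY that)
    also have "\<dots> = norm (f n o\<^sub>L f n) * (norm (Y x))\<^sup>2" by (simp add: power2_eq_square)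
    also have "\<dots> \<le> norm (f n o\<^sub>L f n) * g x" by (intro mult_left_mono le that) auto
    finally show ?thesis .
  qed
  have gm: "(\<lambda>x. c * g x) integrable_on {0..}" for c using integrable_cmul[OF g, of c] by simp
  show Gi: "G integrable_on {0..}" by (rule integrable_on_dominated[OF _ Gc _ gm]) (use Gb in auto)
  show Qi: "Q integrable_on {0..}" by (rule integrable_on_dominated[OF _ Qc _ g]) (use Qb in auto)
  have Ri: "R n integrable_on {0..}" for n by (rule integrable_on_dominated[OF _ Rc _ gm]) (use Rb in auto)
  have GI: "integral {0..} G \<in> pos_cone N" by (rule positive_integral[OF Gi]) (use Gp in auto)
  have RI: "integral {0..} (R n) \<in> pos_cone N" for n by (rule positive_integral[OF Ri]) (use Rp in auto)
  show QI: "integral {0..} Q \<in> pos_cone N" by (rule positive_integral[OF Qi]) (use Qp in auto)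
  have eq: "\<tau> (compress (f n) (integral {0..} G)) = \<tau> (compress S (integral {0..} (R n)))" for n
  proof -
    have pw: "ftr (f n) (G x) = ftr S (R n x)" if "x \<ge> 0" for x
    proof -
      have "\<tau> (compress (f n) (G x)) = \<tau> (compress S (R n x))"
        unfolding G_def R_def by (rule compress_compose_star) (use S hs_f hsD Y(2) that in auto)
      then show ?thesis
        unfolding ftr_def using Tr_fin compress_fin[OF hs_f Gp[OF that]] compress_fin[OF S Rp[OF that]]
        by (simp add: tr_def)
    qed
    have "of_real (tr (compress (f n) (integral {0..} G))) = ftr (f n) (integral {0..} G)"
      unfolding ftr_def by (rule Tr_fin[symmetric, OF compress_fin[OF hs_f GI]])
    also have "\<dots> = integral {0..} (\<lambda>x. ftr (f n) (G x))"
      by (rule ftr_integral(1)[symmetric, OF hs_f Gc _ Gb gm]) (use Gp pos_coneD in auto)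
    also have "\<dots> = integral {0..} (\<lambda>x. ftr S (R n x))"
      by (rule integral_cong) (use pw in auto)
    also have "\<dots> = ftr S (integral {0..} (R n))"
      by (rule ftr_integral(1)[OF S Rc _ Rb gm]) (use Rp pos_coneD in auto)
    also have "\<dots> = of_real (tr (compress S (integral {0..} (R n))))"
      unfolding ftr_def by (rule Tr_fin[OF compress_fin[OF S RI]])
    finally show ?thesis
      using \<tau>_fin[OF compress_fin[OF hs_f GI]] \<tau>_fin[OF compress_fin[OF S RI]] by simp
  qed
  \<comment> \<open>The sequence increases because the squares of \<open>f n\<close> do, and its
    quadratic forms converge by dominated convergence along the half line.\<close>
  have "\<tau> (compress S (integral {0..} Q)) = (SUP n. \<tau> (compress S (integral {0..} (R n))))"
  proof (rule trace_normal_sequence)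
    show "compress S (integral {0..} (R n)) \<in> pos_cone N" for n
      by (intro compress_pos_cone RI) (use S hsD in auto)
    show "compress S (integral {0..} Q) \<in> pos_cone N"
      by (intro compress_pos_cone QI) (use S hsD in auto)
    show "positive_op (compress S (integral {0..} (R (Suc n))) - compress S (integral {0..} (R n)))" for n
    proof -
      have "integral {0..} (R (Suc n)) - integral {0..} (R n) = integral {0..} (\<lambda>x. R (Suc n) x - R n x)"
        by (rule integral_diff[symmetric, OF Ri Ri])
      also have "\<dots> \<in> pos_cone N"
      proof (rule positive_integral)
        show "(\<lambda>x. R (Suc n) x - R n x) integrable_on {0..}" by (intro integrable_diff Ri)
        fix x :: real assume "x \<in> {0..}"
        then have x: "x \<ge> 0" by simp
        have "R (Suc n) x - R n x = Y x o\<^sub>L (((f (Suc n) o\<^sub>L f (Suc n)) - (f n o\<^sub>L f n)) o\<^sub>L star (Y x))"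
          by (simp add: R_def compose_distribs)
        also have "\<dots> \<in> pos_cone N"
          by (intro pos Y(2) x pos_coneI f_mono N_diff pos_coneD(1)[OF f_pos])
        finally show "R (Suc n) x - R n x \<in> pos_cone N" .
      qed
      finally show ?thesis
        unfolding compress_linear(2)[symmetric]
        by (intro positive_compress pos_coneD(2)) (use S hsD in auto)
    qed
    fix v
    define w where "w x = star (Y x) (S v)" for x
    have bS: "S \<in> bounded_ops" "star S = S" using S hsD by auto
    have form: "Re (cinner v (compress S (integral {0..} F) v)) = integral {0..} (\<lambda>x. Re (cinner (S v) (F x (S v))))"
      "(\<lambda>x. Re (cinner (S v) (F x (S v)))) integrable_on {0..}"
      if "F integrable_on {0..}" for F :: "real \<Rightarrow> 'a \<Rightarrow>\<^sub>L 'a"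
    proof -
      have "cinner v (compress S (integral {0..} F) v) = cinner (S v) (integral {0..} F (S v))"
        using cinner_star_right[OF bS(1)] bS(2) by (simp add: compress_def)
      then show "Re (cinner v (compress S (integral {0..} F) v)) = integral {0..} (\<lambda>x. Re (cinner (S v) (F x (S v))))"
        using integral_linear[OF cinner_integral(2)[OF that] bounded_linear_Re] cinner_integral(1)[OF that]
        by (simp add: o_def)
      show "(\<lambda>x. Re (cinner (S v) (F x (S v)))) integrable_on {0..}"
        using integrable_linear[OF cinner_integral(2)[OF that] bounded_linear_Re] by (simp add: o_def)
    qed
    have R_form: "Re (cinner (S v) (R n x (S v))) = Re (cinner (w x) ((f n o\<^sub>L f n) (w x)))" if "x \<ge> 0" for n x
      unfolding R_def w_def using cinner_star_left[OF bY[OF that]] by simp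
    have Q_form: "Re (cinner (S v) (Q x (S v))) = (norm (w x))\<^sup>2" if "x \<ge> 0" for x
      unfolding Q_def w_def using cinner_star_left[OF bY[OF that]] by (simp flip: Re_cinner_self)
    have "(\<lambda>n. integral {0..} (\<lambda>x. Re (cinner (S v) (R n x (S v))))) \<longlonglongrightarrow>
      integral {0..} (\<lambda>x. Re (cinner (S v) (Q x (S v))))"
    proof (rule dominated_convergence(2))
      show "(\<lambda>x. Re (cinner (S v) (R n x (S v)))) integrable_on {0..}" for n by (rule form(2)[OF Ri])
      show "(\<lambda>x. (norm (S v))\<^sup>2 * g x) integrable_on {0..}" by (rule gm)
      fix x :: real assume "x \<in> {0..}"
      then have x: "x \<ge> 0" by simp
      show "(\<lambda>n. Re (cinner (S v) (R n x (S v)))) \<longlonglongrightarrow> Re (cinner (S v) (Q x (S v)))"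
        unfolding R_form[OF x] Q_form[OF x] by (rule f_lim)
      have "(norm (w x))\<^sup>2 \<le> (norm (star (Y x)) * norm (S v))\<^sup>2"
        unfolding w_def by (intro power_mono norm_blinfun) auto
      also have "\<dots> \<le> (norm (S v))\<^sup>2 * g x"
        using le[OF x] nsY[OF x] by (simp add: power_mult_distrib mult.commute[of _ "(norm (S v))\<^sup>2"] mult_left_mono)
      finally have "(norm (w x))\<^sup>2 \<le> (norm (S v))\<^sup>2 * g x" .
      then show "norm (Re (cinner (S v) (R n x (S v)))) \<le> (norm (S v))\<^sup>2 * g x" for n
        unfolding R_form[OF x] using f_form_le[of "w x" n] f_form_nonneg[of "w x" n] by simp
    qed
    then show "(\<lambda>n. Re (cinner v (compress S (integral {0..} (R n)) v))) \<longlonglongrightarrow> Re (cinner v (compress S (integral {0..} Q) v))"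
      unfolding form(1)[OF Ri] form(1)[OF Qi] .
  qed
  then have tau: "\<tau> (integral {0..} G) = \<tau> (compress S (integral {0..} Q))"
    unfolding trace_eq_SUP_compress[OF GI] eq by simp
  then show "tr (integral {0..} G) = tr (compress S (integral {0..} Q))" by (simp add: tr_def)
  show "integral {0..} G \<in> fin"
    using tau compress_fin[OF S QI] GI by (simp add: fin_def)
qed

lemma scal_assoc: "scal c o\<^sub>L (scal d o\<^sub>L A) = scal (c * d) o\<^sub>L A"
  by (simp add: scal_mult blinfun_compose_assoc)

lemma scal_sum: "(\<Sum>k\<in>K. scal (c k) o\<^sub>L A) = scal (\<Sum>k\<in>K. c k) o\<^sub>L A"
  by (induction K rule: infinite_finite_induct) (simp_all add: scal_add compose_distribs)

lemma move_scal: "A \<in> bounded_ops \<Longrightarrow> A o\<^sub>L (scal c o\<^sub>L B) = scal c o\<^sub>L (A o\<^sub>L B)"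
  by (metis blinfun_compose_assoc bounded_ops_iff_commute)

text \<open>Polarization: \<open>4 C S\<^sup>2 E\<close> is the sum of \<open>z Y\<^sub>z\<^sup>* S\<^sup>2 Y\<^sub>z\<close> over \<open>z\<^sup>4 = 1\<close>, where
  \<open>Y\<^sub>z = E + z C\<^sup>*\<close>, and \<open>4 E C\<close> is the sum of \<open>z Y\<^sub>z Y\<^sub>z\<^sup>*\<close>.\<close>

theorem trace_integral_cyclic:
  fixes C E :: "real \<Rightarrow> 'a \<Rightarrow>\<^sub>L 'a"
  assumes S: "hs S" and C: "continuous_on {0..} C" "\<And>x. x \<ge> 0 \<Longrightarrow> C x \<in> N"
    and E: "continuous_on {0..} E" "\<And>x. x \<ge> 0 \<Longrightarrow> E x \<in> N"
    and Cle: "\<And>x. x \<ge> 0 \<Longrightarrow> (norm (C x))\<^sup>2 \<le> g x" and Ele: "\<And>x. x \<ge> 0 \<Longrightarrow> (norm (E x))\<^sup>2 \<le> g x"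
    and g: "g integrable_on {0..}"
  shows "trace_class (integral {0..} (\<lambda>x. C x o\<^sub>L ((S o\<^sub>L S) o\<^sub>L E x)))"
    "Tr (integral {0..} (\<lambda>x. C x o\<^sub>L ((S o\<^sub>L S) o\<^sub>L E x))) = integral {0..} (\<lambda>x. ftr S (E x o\<^sub>L C x))"
    "(\<lambda>x. C x o\<^sub>L ((S o\<^sub>L S) o\<^sub>L E x)) integrable_on {0..}"
proof -
  define z where "z k = \<i> ^ k" for k :: nat
  define Y where "Y k x = E x + (scal (z k) o\<^sub>L star (C x))" for k x
  define G where "G k x = star (Y k x) o\<^sub>L ((S o\<^sub>L S) o\<^sub>L Y k x)" for k x
  define Q where "Q k x = Y k x o\<^sub>L star (Y k x)" for k x
  have bC: "C x \<in> bounded_ops" "star (C x) \<in> bounded_ops" and bE: "E x \<in> bounded_ops" "star (E x) \<in> bounded_ops" if "x \<ge> 0" for x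
    using C(2)[OF that] E(2)[OF that] N_bounded_ops N_star by auto
  have bS: "S \<in> bounded_ops" using S hsD by auto
  have cz: "z k * cnj (z k) = 1" "cmod (z k) = 1" for k
    unfolding z_def by (simp_all add: norm_power flip: power_mult_distrib)
  \<comment> \<open>These two sums cancel the terms of weight z and z^2 in the expansions below; the
    mixed terms, of weight z times its conjugate, survive.\<close>
  have sums: "(\<Sum>k<4. z k) = 0" "(\<Sum>k<4. z k * z k) = 0"
    by (simp_all add: z_def eval_nat_numeral)
  have sY: "star (Y k x) = star (E x) + (scal (cnj (z k)) o\<^sub>L C x)" if "x \<ge> 0" for k x
    unfolding Y_def using bC[OF that] bE[OF that]
    by (simp add: star_add star_scal_compose star_star bounded_ops_closed scal_in_bounded_ops)
  have Yc: "continuous_on {0..} (Y k)" for k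
    unfolding Y_def by (intro continuous_intros continuous_on_compose_ops continuous_on_star C E) (use bC in auto)
  have YN: "Y k x \<in> N" if "x \<ge> 0" for k x
    unfolding Y_def by (intro N_closed C(2) E(2) that)
  have Yle: "(norm (Y k x))\<^sup>2 \<le> 4 * g x" if x: "x \<ge> 0" for k x
  proof -
    have "norm (Y k x) \<le> norm (E x) + norm (C x)"
      unfolding Y_def using norm_triangle_ineq[of "E x" "scal (z k) o\<^sub>L star (C x)"] norm_star[OF bC(1)[OF x]]
      by (simp add: norm_scal_compose cz)
    then have "(norm (Y k x))\<^sup>2 \<le> (norm (E x) + norm (C x))\<^sup>2" by (intro power_mono) auto
    also have "\<dots> \<le> 2 * (norm (E x))\<^sup>2 + 2 * (norm (C x))\<^sup>2"
      using zero_le_power2[of "norm (E x) - norm (C x)"] by (simp add: power2_diff power2_sum)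
    also have "\<dots> \<le> 4 * g x" using Cle[OF x] Ele[OF x] by simp
    finally show ?thesis .
  qed
  have g4: "(\<lambda>x. 4 * g x) integrable_on {0..}" using integrable_cmul[OF g, of 4] by simp
  note core = trace_integral_star_square[OF S Yc YN Yle g4, folded G_def Q_def]
  have G_sum: "(\<Sum>k<4. scal (z k) o\<^sub>L G k x) = 4 *\<^sub>R (C x o\<^sub>L ((S o\<^sub>L S) o\<^sub>L E x))" if x: "x \<ge> 0" for x
  proof -
    note b = bC[OF x] bE[OF x] bS
    define A where "A = (star (E x) o\<^sub>L ((S o\<^sub>L S) o\<^sub>L E x)) + (C x o\<^sub>L ((S o\<^sub>L S) o\<^sub>L star (C x)))"
    define B where "B = star (E x) o\<^sub>L ((S o\<^sub>L S) o\<^sub>L star (C x))"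
    have "scal (z k) o\<^sub>L G k x = (scal (z k) o\<^sub>L A) + (scal (z k * z k) o\<^sub>L B) + (C x o\<^sub>L ((S o\<^sub>L S) o\<^sub>L E x))" for k
    proof -
      have "scal (z k) o\<^sub>L G k x = (scal (z k) o\<^sub>L (star (E x) o\<^sub>L ((S o\<^sub>L S) o\<^sub>L E x))) + (scal (z k * z k) o\<^sub>L B)
        + (scal (z k * cnj (z k)) o\<^sub>L (C x o\<^sub>L ((S o\<^sub>L S) o\<^sub>L E x)))
        + (scal (z k * cnj (z k) * z k) o\<^sub>L (C x o\<^sub>L ((S o\<^sub>L S) o\<^sub>L star (C x))))"
        unfolding G_def sY[OF x] unfolding B_def Y_def
        using b by (simp add: compose_distribs move_scal scal_assoc blinfun_compose_assoc bounded_ops_closed mult_ac add_ac)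
      then show ?thesis unfolding cz A_def by (simp add: compose_distribs add_ac)
    qed
    then have "(\<Sum>k<4. scal (z k) o\<^sub>L G k x) = (scal (\<Sum>k<4. z k) o\<^sub>L A) + (scal (\<Sum>k<4. z k * z k) o\<^sub>L B)
       + (\<Sum>k<4::nat. C x o\<^sub>L ((S o\<^sub>L S) o\<^sub>L E x))"
      unfolding scal_sum[symmetric] by (simp add: sum.distrib)
    then show ?thesis unfolding sums by (simp add: compose_distribs sum_constant_scaleR)
  qed
  have Q_sum: "(\<Sum>k<4. scal (z k) o\<^sub>L Q k x) = 4 *\<^sub>R (E x o\<^sub>L C x)" if x: "x \<ge> 0" for x
  proof -
    note b = bC[OF x] bE[OF x] bS
    define A where "A = (E x o\<^sub>L star (E x)) + (star (C x) o\<^sub>L C x)"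
    define B where "B = star (C x) o\<^sub>L star (E x)"
    have "scal (z k) o\<^sub>L Q k x = (scal (z k) o\<^sub>L A) + (scal (z k * z k) o\<^sub>L B) + (E x o\<^sub>L C x)" for k
    proof -
      have "scal (z k) o\<^sub>L Q k x = (scal (z k) o\<^sub>L (E x o\<^sub>L star (E x))) + (scal (z k * z k) o\<^sub>L B)
        + (scal (z k * cnj (z k)) o\<^sub>L (E x o\<^sub>L C x))
        + (scal (z k * cnj (z k) * z k) o\<^sub>L (star (C x) o\<^sub>L C x))"
        unfolding Q_def sY[OF x] unfolding B_def Y_def
        using b by (simp add: compose_distribs move_scal scal_assoc blinfun_compose_assoc bounded_ops_closed mult_ac add_ac)
      then show ?thesis unfolding cz A_def by (simp add: compose_distribs add_ac)
    qed
    then have "(\<Sum>k<4. scal (z k) o\<^sub>L Q k x) = (scal (\<Sum>k<4. z k) o\<^sub>L A) + (scal (\<Sum>k<4. z k * z k) o\<^sub>L B)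
       + (\<Sum>k<4::nat. E x o\<^sub>L C x)"
      unfolding scal_sum[symmetric] by (simp add: sum.distrib)
    then show ?thesis unfolding sums by (simp add: compose_distribs sum_constant_scaleR)
  qed
  have "integral {0..} (\<lambda>x. (1/4) *\<^sub>R (\<Sum>k<4. scal (z k) o\<^sub>L G k x)) = (1/4) *\<^sub>R (\<Sum>k<4. scal (z k) o\<^sub>L integral {0..} (G k))"
    "(\<lambda>x. (1/4) *\<^sub>R (\<Sum>k<4. scal (z k) o\<^sub>L G k x)) integrable_on {0..}"
    using core(1) by (simp_all add: integral_sum integrable_compose_left integral_compose_left integrable_sum integrable_cmul)
  moreover have "(1/4) *\<^sub>R (\<Sum>k<4. scal (z k) o\<^sub>L G k x) = C x o\<^sub>L ((S o\<^sub>L S) o\<^sub>L E x)" if "x \<in> {0..}" for x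
    using G_sum[of x] that by simp
  ultimately have GI: "integral {0..} (\<lambda>x. C x o\<^sub>L ((S o\<^sub>L S) o\<^sub>L E x)) = (1/4) *\<^sub>R (\<Sum>k<4. scal (z k) o\<^sub>L integral {0..} (G k))"
    and "(\<lambda>x. C x o\<^sub>L ((S o\<^sub>L S) o\<^sub>L E x)) integrable_on {0..}"
    using integral_cong[of "{0..}" "\<lambda>x. (1/4) *\<^sub>R (\<Sum>k<4. scal (z k) o\<^sub>L G k x)" "\<lambda>x. C x o\<^sub>L ((S o\<^sub>L S) o\<^sub>L E x)"]
     integrable_cong[of "{0..}" "\<lambda>x. (1/4) *\<^sub>R (\<Sum>k<4. scal (z k) o\<^sub>L G k x)" "\<lambda>x. C x o\<^sub>L ((S o\<^sub>L S) o\<^sub>L E x)"]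
    by simp_all
  then show "(\<lambda>x. C x o\<^sub>L ((S o\<^sub>L S) o\<^sub>L E x)) integrable_on {0..}" by blast
  have Ei: "(\<lambda>x. E x o\<^sub>L C x) integrable_on {0..}"
    and EI: "4 *\<^sub>R integral {0..} (\<lambda>x. E x o\<^sub>L C x) = (\<Sum>k<4. scal (z k) o\<^sub>L integral {0..} (Q k))"
  proof -
    have 1: "(\<lambda>x. (1/4) *\<^sub>R (\<Sum>k<4. scal (z k) o\<^sub>L Q k x)) integrable_on {0..}"
      "integral {0..} (\<lambda>x. (\<Sum>k<4. scal (z k) o\<^sub>L Q k x)) = (\<Sum>k<4. scal (z k) o\<^sub>L integral {0..} (Q k))"
      using core(2) by (simp_all add: integral_sum integrable_compose_left integral_compose_left integrable_sum integrable_cmul)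
    have 2: "(1/4) *\<^sub>R (\<Sum>k<4. scal (z k) o\<^sub>L Q k x) = E x o\<^sub>L C x" if "x \<in> {0..}" for x
      using Q_sum[of x] that by simp
    show "(\<lambda>x. E x o\<^sub>L C x) integrable_on {0..}"
      by (rule integrable_eq[OF 1(1) 2])
    have "integral {0..} (\<lambda>x. (\<Sum>k<4. scal (z k) o\<^sub>L Q k x)) = integral {0..} (\<lambda>x. 4 *\<^sub>R (E x o\<^sub>L C x))"
      by (rule integral_cong) (use Q_sum in auto)
    then show "4 *\<^sub>R integral {0..} (\<lambda>x. E x o\<^sub>L C x) = (\<Sum>k<4. scal (z k) o\<^sub>L integral {0..} (Q k))"
      using 1(2) by simp
  qed
  have ECc: "continuous_on {0..} (\<lambda>x. E x o\<^sub>L C x)" by (intro continuous_on_compose_ops C E)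
  have ECN: "E x o\<^sub>L C x \<in> N" if "x \<ge> 0" for x by (intro N_compose C(2) E(2) that)
  have ECb: "norm (E x o\<^sub>L C x) \<le> g x" if x: "x \<ge> 0" for x
  proof -
    have "norm (E x o\<^sub>L C x) \<le> norm (E x) * norm (C x)" by (rule norm_blinfun_compose)
    also have "\<dots> \<le> ((norm (E x))\<^sup>2 + (norm (C x))\<^sup>2) / 2"
      using zero_le_power2[of "norm (E x) - norm (C x)"] by (simp add: power2_diff)
    also have "\<dots> \<le> g x" using Cle[OF x] Ele[OF x] by simp
    finally show ?thesis .
  qed
  have QN: "integral {0..} (Q k) \<in> N" for k using core(5) pos_coneD by blast
  have tc: "trace_class (scal (z k) o\<^sub>L integral {0..} (G k))" for k
    by (intro trace_class_scal trace_class_fin core(3))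
  then have tcs: "trace_class (\<Sum>k<4. scal (z k) o\<^sub>L integral {0..} (G k))" by (intro trace_class_sum)
  show "trace_class (integral {0..} (\<lambda>x. C x o\<^sub>L ((S o\<^sub>L S) o\<^sub>L E x)))"
    unfolding GI by (intro trace_class_scaleR tcs)
  have "Tr (integral {0..} (\<lambda>x. C x o\<^sub>L ((S o\<^sub>L S) o\<^sub>L E x))) = (1/4) * (\<Sum>k<4. z k * of_real (tr (integral {0..} (G k))))"
    unfolding GI Tr_scaleR[OF tcs] Tr_sum[OF tc] by (simp add: Tr_scal trace_class_fin core(3) Tr_fin)
  also have "\<dots> = (1/4) * (\<Sum>k<4. z k * ftr S (integral {0..} (Q k)))"
  proof -
    have "of_real (tr (integral {0..} (G k))) = ftr S (integral {0..} (Q k))" for k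
      using core(4)[of k] Tr_fin[OF compress_fin[OF S core(5)[of k]]] by (simp add: ftr_def)
    then show ?thesis by simp
  qed
  also have "(\<Sum>k<4. z k * ftr S (integral {0..} (Q k))) = ftr S (\<Sum>k<4. scal (z k) o\<^sub>L integral {0..} (Q k))"
    using QN by (simp add: ftr_sum S N_closed ftr_linear(3)[OF S _ N_zero])
  also have "\<dots> = 4 * ftr S (integral {0..} (\<lambda>x. E x o\<^sub>L C x))"
    unfolding EI[symmetric] using ftr_linear(2)[OF S N_integral[OF Ei] N_zero, of 4] ECN by simp
  also have "ftr S (integral {0..} (\<lambda>x. E x o\<^sub>L C x)) = integral {0..} (\<lambda>x. ftr S (E x o\<^sub>L C x))"
    by (rule ftr_integral(1)[symmetric, OF S ECc ECN ECb g])
  finally show "Tr (integral {0..} (\<lambda>x. C x o\<^sub>L ((S o\<^sub>L S) o\<^sub>L E x))) = integral {0..} (\<lambda>x. ftr S (E x o\<^sub>L C x))"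
    by simp
qed

end


section \<open>Mellin transforms on the half line\<close>

abbreviation pos :: "real \<Rightarrow> real" where
  "pos \<equiv> indicator {0<..}"

lemma integrable_lborel_nonneg:
  fixes f :: "real \<Rightarrow> real"
  assumes [measurable]: "f \<in> borel_measurable borel" "S \<in> sets borel"
    and nonneg: "\<And>x. x \<in> S \<Longrightarrow> 0 \<le> f x" and f: "f integrable_on S"
  shows "integrable lborel (\<lambda>x. indicator S x * f x)"
proof -
  have "f absolutely_integrable_on S"
    using nonneg f by (rule nonnegative_absolutely_integrable_1[rotated])
  then have "integrable lebesgue (\<lambda>x. indicator S x * f x)"
    by (simp add: set_integrable_def)
  then show ?thesis by (subst (asm) integrable_completion) simp_all
qed

text \<open>Translates between gauge integrals, in which the cocycles are written, and Lebesgue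
  integrals, to which Fubini's theorem is applied. The point 0, where complex powers may be
  singular, is dropped.\<close>

lemma half_line_integral:
  fixes f :: "real \<Rightarrow> complex"
  assumes "integrable lborel (\<lambda>x. pos x *\<^sub>R f x)"
  shows "integral {0..} f = (\<integral>x. pos x *\<^sub>R f x \<partial>lborel)" "f integrable_on {0..}"
proof -
  have eq: "{0<..} - {0..} = ({} :: real set)" "{0..} - {0<..} = {0 :: real}" by auto
  have neg: "negligible {x \<in> {0<..} - {0..}. f x \<noteq> 0}" "negligible {x \<in> {0..} - {0<..}. f x \<noteq> 0}"
    unfolding eq by (auto intro: negligible_subset[of "{0}"])
  have s: "set_integrable lborel {0<..} f" using assms by (simp add: set_integrable_def)
  show "integral {0..} f = (\<integral>x. pos x *\<^sub>R f x \<partial>lborel)"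
    using set_borel_integral_eq_integral(2)[OF s] integral_spike_set[OF neg]
    by (simp add: set_lebesgue_integral_def)
  show "f integrable_on {0..}"
    using set_borel_integral_eq_integral(1)[OF s] integrable_spike_set[OF _ neg] by blast
qed

lemma integrable_powr_beta:
  assumes "b > -1" "p > b + 1"
  shows "integrable lborel (\<lambda>x. pos x * (x powr b * (1 + x) powr - p))"
proof (rule Bochner_Integration.integrable_bound)
  have 1: "integrable lborel (\<lambda>x. indicator {0..1} x * (x powr b))"
    by (rule integrable_lborel_nonneg) (use assms integrable_on_powr_from_0[of b 1] in auto)
  have 2: "integrable lborel (\<lambda>x. indicator {1..} x * (x powr (b - p)))"
    by (rule integrable_lborel_nonneg) (use assms has_integral_powr_to_inf[of "b - p" 1] in auto)
  show "integrable lborel (\<lambda>x. indicator {0..1} x * (x powr b) + indicator {1..} x * (x powr (b - p)))"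
    by (intro Bochner_Integration.integrable_add 1 2)
  show "AE x in lborel. norm (pos x * (x powr b * (1 + x) powr - p))
    \<le> norm (indicator {0..1} x * (x powr b) + indicator {1..} x * (x powr (b - p)))"
  proof (rule AE_I2)
    fix x :: real
    have p: "p > 0" using assms by simp
    consider "x \<le> 0" | "0 < x" "x < 1" | "x \<ge> 1" by linarith
    then show "norm (pos x * (x powr b * (1 + x) powr - p))
      \<le> norm (indicator {0..1} x * (x powr b) + indicator {1..} x * (x powr (b - p)))"
    proof cases
      case 2
      have "(1 + x) powr - p \<le> (1 + x) powr 0" using 2 p by (intro powr_mono) auto
      then show ?thesis using 2 by (simp add: mult_left_le abs_mult)
    next
      case 3
      have "(1 + x) powr - p \<le> x powr - p" using 3 p by (intro powr_mono2') auto
      then have "x powr b * (1 + x) powr - p \<le> x powr b * x powr - p" by (intro mult_left_mono) auto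
      also have "\<dots> = x powr (b - p)" using 3 by (simp flip: powr_add)
      finally show ?thesis using 3 by (auto simp: indicator_def)
    qed auto
  qed
qed measurable

lemma integrable_abs_powr:
  assumes "p > (1 :: real)"
  shows "integrable lborel (\<lambda>v :: real. (1 + \<bar>v\<bar>) powr - p)"
proof -
  define h where "h x = pos x * ((1 + x) powr - p)" for x
  have "integrable lborel (\<lambda>x. pos x * (x powr 0 * (1 + x) powr - p))"
    using assms by (intro integrable_powr_beta) auto
  moreover have "pos x * (x powr 0 * (1 + x) powr - p) = h x" for x
    by (auto simp: h_def indicator_def)
  ultimately have h: "integrable lborel h" by simp
  have h': "integrable lborel (\<lambda>x. h (0 + (-1) * x))"
    using lborel_integrable_real_affine_iff[of "-1" h 0] h by simp
  have i: "integrable lborel (\<lambda>x. h x + h (0 + (-1) * x))"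
    by (rule Bochner_Integration.integrable_add[OF h h'])
  have ae: "AE x in lborel. h x + h (0 + (-1) * x) = (1 + \<bar>x\<bar>) powr - p"
    using AE_lborel_singleton[of 0] by eventually_elim (auto simp: h_def indicator_def)
  show ?thesis by (rule integrable_cong_AE_imp[OF i _ ae]) measurable
qed

section \<open>Gamma integrals and their substitutions\<close>

lemma norm_of_real_powr: "x > 0 \<Longrightarrow> cmod (complex_of_real x powr u) = x powr Re u"
  by (simp add: norm_powr_real_powr)

lemma of_real_powr_mult: "x > 0 \<Longrightarrow> y > 0 \<Longrightarrow>
  complex_of_real (x * y) powr u = complex_of_real x powr u * complex_of_real y powr u"
  by (simp add: powr_times_real)

text \<open>Euler's integral for Gamma under the scaling x to t x.\<close>

lemma Laplace_powr:
  assumes b: "Re b > 0" and t: "t > 0"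
  shows "integrable lborel (\<lambda>x. pos x *\<^sub>R (of_real x powr (b - 1) * of_real (exp (- (t * x)))))" (is ?I)
    and "(\<integral>x. pos x *\<^sub>R (of_real x powr (b - 1) * of_real (exp (- (t * x)))) \<partial>lborel)
      = Gamma b * of_real t powr (- b)" (is ?V)
proof -
  define f where "f x = pos x *\<^sub>R (complex_of_real x powr (b - 1) * of_real (exp (- x)))" for x
  have "(\<lambda>x. complex_of_real x powr (b - 1) / of_real (exp x)) absolutely_integrable_on {0<..}"
    using absolutely_integrable_Gamma_integral'[OF b] .
  then have "integrable lebesgue f"
    by (simp add: set_integrable_def f_def[abs_def] exp_minus divide_inverse)
  then have f: "integrable lborel f" by (subst (asm) integrable_completion) (simp_all add: f_def[abs_def])
  have "set_integrable lborel {0<..} (\<lambda>x. complex_of_real x powr (b - 1) * of_real (exp (- x)))"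
    using f by (simp add: set_integrable_def f_def[abs_def])
  from set_borel_integral_eq_integral(2)[OF this]
  have "integral\<^sup>L lborel f = integral {0<..} (\<lambda>x. complex_of_real x powr (b - 1) * of_real (exp (- x)))"
    by (simp add: set_lebesgue_integral_def f_def[abs_def])
  also have "\<dots> = Gamma b"
    using Gamma_integral_complex'[OF b] by (simp add: integral_unique exp_minus divide_inverse)
  finally have Gam: "integral\<^sup>L lborel f = Gamma b" .
  define g where "g x = pos x *\<^sub>R (of_real x powr (b - 1) * complex_of_real (exp (- (t * x))))" for x
  have eq: "f (0 + t * x) = of_real t powr (b - 1) * g x" for x
    using t of_real_powr_mult[of t x "b - 1"] by (auto simp: f_def g_def indicator_def zero_less_mult_iff)
  have t0: "complex_of_real t powr (b - 1) \<noteq> 0" using t by simp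
  have "integrable lborel (\<lambda>x. f (0 + t * x))"
    using f t by (subst lborel_integrable_real_affine_iff) auto
  then have "integrable lborel (\<lambda>x. inverse (of_real t powr (b - 1)) * (of_real t powr (b - 1) * g x))"
    unfolding eq by (rule integrable_mult_right)
  moreover have "inverse (of_real t powr (b - 1)) * (of_real t powr (b - 1) * g x) = g x" for x
    unfolding mult.assoc[symmetric] using t0 by simp
  ultimately have "integrable lborel g" by simp
  then show ?I unfolding g_def .
  have "Gamma b = \<bar>t\<bar> *\<^sub>R (\<integral>x. f (0 + t * x) \<partial>lborel)"
    using lborel_integral_real_affine[of t f 0] t Gam by simp
  also have "\<dots> = of_real t * (of_real t powr (b - 1) * integral\<^sup>L lborel g)"
    unfolding eq using t by (simp add: scaleR_conv_of_real)
  also have "of_real t * (of_real t powr (b - 1) * z) = complex_of_real t powr b * z" for z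
    using t by (simp add: powr_diff)
  finally have "integral\<^sup>L lborel g = Gamma b * of_real t powr (- b)" using t by (simp add: powr_minus field_simps)
  then show ?V unfolding g_def .
qed

lemma Laplace_powr_real:
  assumes b: "b > 0" and t: "t > 0"
  shows "integrable lborel (\<lambda>x. pos x * (x powr (b - 1) * exp (- (t * x))))" (is ?I)
    and "(\<integral>x. pos x * (x powr (b - 1) * exp (- (t * x))) \<partial>lborel) = Gamma b * t powr (- b)" (is ?V)
proof -
  have eq: "pos x *\<^sub>R (of_real x powr (of_real b - 1) * of_real (exp (- (t * x)))) =
    complex_of_real (pos x * (x powr (b - 1) * exp (- (t * x))))" for x
    using powr_of_real[of x "b - 1"] by (auto simp: indicator_def)
  have r: "Re (of_real b) > 0" using b by simp
  note L = Laplace_powr[OF r t, unfolded eq]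
  show ?I using L(1) by (simp only: complex_of_real_integrable_eq)
  have "complex_of_real (\<integral>x. pos x * (x powr (b - 1) * exp (- (t * x))) \<partial>lborel) = complex_of_real (Gamma b * t powr (- b))"
    using L(2) t unfolding integral_complex_of_real
    by (simp add: Gamma_complex_of_real powr_of_real[of t "- b", symmetric])
  then show ?V by (simp only: of_real_eq_iff)
qed

lemma square_powr: 
  assumes "s > (0 :: real)"
  shows "(s\<^sup>2) powr c = s powr (2 * c)"
proof -
  have "s\<^sup>2 = s powr 2" using assms by simp
  then show ?thesis by (simp only: powr_powr)
qed

text \<open>Euler's integral at (m + 1) / 2 under the substitution x = s^2. It is the integral over
  s that remains when the fractional integration formula is tested on an exponential.\<close>

lemma Gaussian_moment:
  "integrable lborel (\<lambda>s. pos s * (s ^ m * exp (- s\<^sup>2)))"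
  "(\<integral>s. pos s * (s ^ m * exp (- s\<^sup>2)) \<partial>lborel) = Gamma ((real m + 1) / 2) / 2"
proof -
  define b where "b = (real m + 1) / 2"
  define f where "f t = t powr (b - 1) * exp (- t) / 2" for t :: real
  have b: "b > 0" by (simp add: b_def)
  have L: "integrable lborel (\<lambda>x. pos x * f x)" "(\<integral>x. pos x * f x \<partial>lborel) = Gamma b / 2"
    using Laplace_powr_real[OF b, of 1] by (simp_all add: f_def)
  have s: "set_integrable lborel {0<..} f" using L(1) by (simp add: set_integrable_def)
  have "f absolutely_integrable_on {0<..}"
    using s L(1) by (simp add: set_integrable_def integrable_completion)
  moreover have "integral {0<..} f = Gamma b / 2"
    using set_borel_integral_eq_integral(2)[OF s] L(2) by (simp add: set_lebesgue_integral_def)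
  moreover have im: "(\<lambda>s. s\<^sup>2) ` {0<..} = {0 :: real<..}"
  proof (intro equalityI subsetI)
    fix x :: real assume "x \<in> {0<..}"
    then show "x \<in> (\<lambda>s. s\<^sup>2) ` {0<..}" by (intro image_eqI[of _ _ "sqrt x"]) auto
  qed auto
  moreover have inj: "inj_on (\<lambda>s. s\<^sup>2) {0 :: real<..}" by (auto intro!: inj_onI simp: power2_eq_iff_nonneg)
  moreover have der: "((\<lambda>s. s\<^sup>2) has_field_derivative 2 * s) (at s within {0<..})" for s :: real
    by (auto intro!: derivative_eq_intros)
  ultimately have A: "(\<lambda>s. \<bar>2 * s\<bar> * f (s\<^sup>2)) absolutely_integrable_on {0<..} \<and>
      integral {0<..} (\<lambda>s. \<bar>2 * s\<bar> * f (s\<^sup>2)) = Gamma b / 2"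
    using has_absolute_integral_change_of_variables_1'[of "{0<..}" "\<lambda>s. s\<^sup>2" "\<lambda>s. 2 * s" f "Gamma b / 2"] by simp
  have eq: "\<bar>2 * s\<bar> * f (s\<^sup>2) = s ^ m * exp (- s\<^sup>2)" if "s > 0" for s
  proof -
    have "s * (s\<^sup>2) powr (b - 1) = s powr 1 * s powr (2 * (b - 1))"
      using that by (simp add: square_powr)
    also have "\<dots> = s powr real m" unfolding powr_add[symmetric] by (simp add: b_def field_simps)
    also have "\<dots> = s ^ m" using that by (rule powr_realpow)
    finally show ?thesis using that by (simp add: f_def)
  qed
  have eq': "indicator {0<..} s *\<^sub>R (\<bar>2 * s\<bar> * f (s\<^sup>2)) = pos s * (s ^ m * exp (- s\<^sup>2))" for s
    using eq[of s] by (auto simp: indicator_def)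
  have "integrable lebesgue (\<lambda>s. pos s * (s ^ m * exp (- s\<^sup>2)))"
    using A unfolding set_integrable_def eq' by simp
  then show I: "integrable lborel (\<lambda>s. pos s * (s ^ m * exp (- s\<^sup>2)))"
    by (subst (asm) integrable_completion) simp_all
  have "set_integrable lborel {0<..} (\<lambda>s :: real. s ^ m * exp (- s\<^sup>2))"
    unfolding set_integrable_def real_scaleR_def by (rule I)
  from set_borel_integral_eq_integral(2)[OF this]
  have "(\<integral>s. pos s * (s ^ m * exp (- s\<^sup>2)) \<partial>lborel) = integral {0<..} (\<lambda>s. s ^ m * exp (- s\<^sup>2))"
    by (simp add: set_lebesgue_integral_def)
  also have "\<dots> = integral {0<..} (\<lambda>s. \<bar>2 * s\<bar> * f (s\<^sup>2))"
    by (rule integral_cong) (use eq in auto)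
  also have "\<dots> = Gamma b / 2" using A by simp
  finally show "(\<integral>s. pos s * (s ^ m * exp (- s\<^sup>2)) \<partial>lborel) = Gamma ((real m + 1) / 2) / 2"
    by (simp add: b_def)
qed

text \<open>Substituting y = x + s^2, exchanging the order of integration and then scaling s = sqrt
  y \<open>\<sigma>\<close> in the inner integral separates a power of y from a constant
  \<open>c\<close> that does not depend on \<open>\<rho>\<close>.\<close>

lemma
  fixes \<rho> :: "real \<Rightarrow> complex"
  assumes u: "Re u > -1" and [measurable]: "\<rho> \<in> borel_measurable borel"
    and le: "\<And>y. y > 0 \<Longrightarrow> cmod (\<rho> y) \<le> K * (1 + y) powr - p"
    and p: "p > Re u + 1 + (real m + 1) / 2"
  defines "c \<equiv> (\<integral>\<sigma>. (pos \<sigma> * pos (1 - \<sigma>\<^sup>2) * \<sigma> ^ m) *\<^sub>R (complex_of_real (1 - \<sigma>\<^sup>2) powr u) \<partial>lborel)"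
  shows half_line_fractional_integrable:
      "integrable lborel (\<lambda>s. (pos s * s ^ m) *\<^sub>R (\<integral>x. pos x *\<^sub>R (of_real x powr u * \<rho> (x + s\<^sup>2)) \<partial>lborel))"
    and half_line_fractional_integral_aux:
      "(\<integral>s. (pos s * s ^ m) *\<^sub>R (\<integral>x. pos x *\<^sub>R (of_real x powr u * \<rho> (x + s\<^sup>2)) \<partial>lborel) \<partial>lborel)
    = c * (\<integral>y. pos y *\<^sub>R (of_real y powr (u + (of_nat m + 1) / 2) * \<rho> y) \<partial>lborel)"
proof -
  define F where "F s y = (pos s * pos (y - s\<^sup>2) * s ^ m) *\<^sub>R (complex_of_real (y - s\<^sup>2) powr u * \<rho> y)" for s y
  \<comment> \<open>The decay p is divided so that p1 makes the integral over x converge and p2 the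
    one over s; the excess of p is shared equally.\<close>
  obtain p1 p2 where pp: "p = p1 + p2" "p1 > Re u + 1" "2 * p2 > real m + 1"
  proof -
    define e where "e = (p - (Re u + 1 + (real m + 1) / 2)) / 2"
    show ?thesis
      by (rule that[of "Re u + 1 + e" "(real m + 1) / 2 + e"]) (use p in \<open>auto simp: e_def field_simps\<close>)
  qed
  have p2: "p2 > 0" using pp(3) by simp
  have "0 \<le> K * 2 powr - p" using order_trans[OF norm_ge_zero le[of 1]] by simp
  moreover have "2 powr - p > 0" by simp
  ultimately have K: "K \<ge> 0" by (metis not_less mult_neg_pos)
  define I where "I = (\<integral>x. pos x * (x powr Re u * (1 + x) powr - p1) \<partial>lborel)"
  have beta: "integrable lborel (\<lambda>x. pos x * (x powr Re u * (1 + x) powr - p1))"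
    by (rule integrable_powr_beta) (use u pp in auto)
  have bound: "cmod (pos x *\<^sub>R (of_real x powr u * \<rho> (x + s\<^sup>2)))
     \<le> (K * (1 + s\<^sup>2) powr - p2) * (pos x * (x powr Re u * (1 + x) powr - p1))" for x s
  proof (cases "x > 0")
    case True
    have "(1 + (x + s\<^sup>2)) powr - p = (1 + (x + s\<^sup>2)) powr - p1 * (1 + (x + s\<^sup>2)) powr - p2"
      unfolding pp(1) powr_add[symmetric] by simp
    also have "\<dots> \<le> (1 + x) powr - p1 * (1 + s\<^sup>2) powr - p2"
      using True u pp p2 by (intro mult_mono powr_mono2') (auto intro: add_pos_nonneg)
    finally have "K * (1 + (x + s\<^sup>2)) powr - p \<le> K * ((1 + x) powr - p1 * (1 + s\<^sup>2) powr - p2)"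
      using K by (rule mult_left_mono)
    moreover have "cmod (\<rho> (x + s\<^sup>2)) \<le> K * (1 + (x + s\<^sup>2)) powr - p"
      using True by (intro le) (simp add: add_pos_nonneg)
    ultimately have "x powr Re u * cmod (\<rho> (x + s\<^sup>2)) \<le> x powr Re u * (K * ((1 + x) powr - p1 * (1 + s\<^sup>2) powr - p2))"
      by (intro mult_left_mono) auto
    then show ?thesis using True by (simp add: norm_mult norm_of_real_powr mult_ac)
  qed simp
  have inner: "integrable lborel (\<lambda>x. pos x *\<^sub>R (of_real x powr u * \<rho> (x + s\<^sup>2)))" for s
    by (rule Bochner_Integration.integrable_bound[OF integrable_mult_right[OF beta, of "K * (1 + s\<^sup>2) powr - p2"]])
      (use bound[of _ s] in \<open>auto intro!: AE_I2 order_trans[OF _ abs_ge_self]\<close>)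
  have F_shift: "F s (s\<^sup>2 + 1 * x) = (pos s * s ^ m) *\<^sub>R (pos x *\<^sub>R (of_real x powr u * \<rho> (x + s\<^sup>2)))" for s x
    by (auto simp: F_def indicator_def add.commute)
  have F_int: "integrable lborel (F s)" for s
  proof -
    have "integrable lborel (\<lambda>x. F s (s\<^sup>2 + 1 * x))"
      unfolding F_shift by (intro integrable_scaleR_right inner)
    then show ?thesis using lborel_integrable_real_affine_iff[of 1 "F s" "s\<^sup>2"] by simp
  qed
  have F_val: "(\<integral>y. F s y \<partial>lborel) = (pos s * s ^ m) *\<^sub>R (\<integral>x. pos x *\<^sub>R (of_real x powr u * \<rho> (x + s\<^sup>2)) \<partial>lborel)" for s
    using lborel_integral_real_affine[of 1 "F s" "s\<^sup>2"] unfolding F_shift by (simp del: scaleR_scaleR)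
  have F_norm: "(\<integral>y. cmod (F s y) \<partial>lborel) \<le> (K * I * 2 powr p2) * (pos s * (s powr real m * (1 + s) powr - (2 * p2)))" for s
  proof (cases "s > 0")
    case True
    have "(\<integral>y. cmod (F s y) \<partial>lborel) = (\<integral>x. cmod (F s (s\<^sup>2 + 1 * x)) \<partial>lborel)"
      using lborel_integral_real_affine[of 1 "\<lambda>y. cmod (F s y)" "s\<^sup>2"] by simp
    also have "\<dots> = (\<integral>x. s ^ m * cmod (pos x *\<^sub>R (of_real x powr u * \<rho> (x + s\<^sup>2))) \<partial>lborel)"
      unfolding F_shift using True by (intro Bochner_Integration.integral_cong) (auto simp: abs_mult)
    also have "\<dots> \<le> (\<integral>x. s ^ m * ((K * (1 + s\<^sup>2) powr - p2) * (pos x * (x powr Re u * (1 + x) powr - p1))) \<partial>lborel)"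
      using True by (intro integral_mono integrable_mult_right integrable_norm inner beta mult_left_mono bound) auto
    also have "\<dots> = s ^ m * (K * (1 + s\<^sup>2) powr - p2 * I)" by (simp add: I_def)
    also have "\<dots> \<le> s ^ m * (K * (2 powr p2 * (1 + s) powr - (2 * p2)) * I)"
    proof -
      have "(1 + s)\<^sup>2 / 2 \<le> 1 + s\<^sup>2" using zero_le_power2[of "1 - s"] by (simp add: power2_sum power2_diff)
      then have "(1 + s\<^sup>2) powr - p2 \<le> ((1 + s)\<^sup>2 / 2) powr - p2" 
        using True p2 by (intro powr_mono2') auto
      also have "\<dots> = (1 + s) powr (2 * - p2) / 2 powr - p2" using True by (simp add: powr_divide square_powr)
      also have "\<dots> = 2 powr p2 * (1 + s) powr - (2 * p2)" by (simp add: powr_minus field_simps)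
      finally have "(1 + s\<^sup>2) powr - p2 \<le> 2 powr p2 * (1 + s) powr - (2 * p2)" .
      moreover have "I \<ge> 0" unfolding I_def by (intro integral_nonneg_AE AE_I2) auto
      ultimately show ?thesis using K True by (intro mult_left_mono mult_right_mono) auto
    qed
    finally show ?thesis using True by (simp add: powr_realpow mult_ac)
  qed (simp add: F_def)
  have F_meas [measurable]: "(\<lambda>(s, y). F s y) \<in> borel_measurable (lborel \<Otimes>\<^sub>M lborel)"
    unfolding F_def by measurable
  have joint: "integrable (lborel \<Otimes>\<^sub>M lborel) (\<lambda>(s, y). F s y)"
  proof (rule lborel_pair.Fubini_integrable)
    show "integrable lborel (\<lambda>s. \<integral>y. cmod (case (s, y) of (s, y) \<Rightarrow> F s y) \<partial>lborel)"
    proof (rule Bochner_Integration.integrable_bound)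
      show "integrable lborel (\<lambda>s. (K * I * 2 powr p2) * (pos s * (s powr real m * (1 + s) powr - (2 * p2))))"
        using pp(3) by (intro integrable_mult_right integrable_powr_beta) auto
      show "AE s in lborel. norm (\<integral>y. cmod (case (s, y) of (s, y) \<Rightarrow> F s y) \<partial>lborel)
        \<le> norm ((K * I * 2 powr p2) * (pos s * (s powr real m * (1 + s) powr - (2 * p2))))"
        using F_norm by (intro AE_I2) (auto intro!: order_trans[OF _ abs_ge_self] simp: abs_of_nonneg integral_nonneg_AE)
    qed measurable
  qed (use F_int in auto)
  have swap: "(\<integral>s. (\<integral>y. F s y \<partial>lborel) \<partial>lborel) = (\<integral>y. (\<integral>s. F s y \<partial>lborel) \<partial>lborel)"
    using joint by (rule lborel_pair.Fubini_integral[symmetric])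
  have G_val: "(\<integral>s. F s y \<partial>lborel) = c * (pos y *\<^sub>R (of_real y powr (u + (of_nat m + 1) / 2) * \<rho> y))" for y
  proof (cases "y > 0")
    case True
    \<comment> \<open>The scale of the substitution s = r \<open>\<sigma>\<close>. One factor r
      comes from the differential and m of them from s^m; together they are y powr ((m + 1) /
      2).\<close>
    define r where "r = sqrt y"
    have r: "r > 0" "r\<^sup>2 = y" using True by (auto simp: r_def)
    have pw: "complex_of_real y powr (u + (of_nat m + 1) / 2) = of_real (r * r ^ m) * of_real y powr u"
    proof -
      have "complex_of_real y powr ((of_nat m + 1) / 2) = of_real (y powr ((real m + 1) / 2))"
        using True by (simp flip: powr_of_real)
      also have "y powr ((real m + 1) / 2) = r powr (2 * ((real m + 1) / 2))"
        unfolding r(2)[symmetric] by (rule square_powr[OF r(1)])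
      also have "2 * ((real m + 1) / 2) = real m + 1" by (simp add: field_simps)
      also have "r powr (real m + 1) = r * r ^ m" using r(1) by (simp add: powr_add powr_realpow)
      finally show ?thesis using True by (simp add: powr_add)
    qed
    have "F (0 + r * \<sigma>) y = (of_real (r ^ m) * of_real y powr u * \<rho> y) *
       ((pos \<sigma> * pos (1 - \<sigma>\<^sup>2) * \<sigma> ^ m) *\<^sub>R (complex_of_real (1 - \<sigma>\<^sup>2) powr u))" for \<sigma>
    proof -
      have "y - (r * \<sigma>)\<^sup>2 = y * (1 - \<sigma>\<^sup>2)" using r by (simp add: power_mult_distrib algebra_simps)
      then show ?thesis
        using r True of_real_powr_mult[of y "1 - \<sigma>\<^sup>2" u]
        by (auto simp: F_def indicator_def zero_less_mult_iff power_mult_distrib scaleR_conv_of_real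
            simp del: of_real_mult of_real_diff of_real_power) (simp add: mult_ac)?
    qed
    note F_scale = this
    have "(\<integral>s. F s y \<partial>lborel) = \<bar>r\<bar> *\<^sub>R ((of_real (r ^ m) * of_real y powr u * \<rho> y) * c)"
      using lborel_integral_real_affine[of r "\<lambda>s. F s y" 0] r
      unfolding F_scale integral_mult_right_zero c_def by simp
    then show ?thesis using r True unfolding pw by (simp add: scaleR_conv_of_real mult_ac)
  next
    case False
    have "F s y = 0" for s
    proof -
      have "\<not> y - s\<^sup>2 > 0" using False by (smt (verit) zero_le_power2)
      then show ?thesis by (simp add: F_def)
    qed
    then show ?thesis using False by simp
  qed
  show "(\<integral>s. (pos s * s ^ m) *\<^sub>R (\<integral>x. pos x *\<^sub>R (of_real x powr u * \<rho> (x + s\<^sup>2)) \<partial>lborel) \<partial>lborel)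
    = c * (\<integral>y. pos y *\<^sub>R (of_real y powr (u + (of_nat m + 1) / 2) * \<rho> y) \<partial>lborel)"
    using swap unfolding F_val G_val integral_mult_right_zero .
  show "integrable lborel (\<lambda>s. (pos s * s ^ m) *\<^sub>R (\<integral>x. pos x *\<^sub>R (of_real x powr u * \<rho> (x + s\<^sup>2)) \<partial>lborel))"
    using lborel_pair.integrable_fst[OF joint] unfolding F_val .
qed

text \<open>The constant \<open>c\<close> is the same for every \<open>\<rho>\<close>, so it is
  evaluated on exp (- y), where all the integrals are Gamma integrals.\<close>

lemma half_line_fractional_integral:
  fixes \<rho> :: "real \<Rightarrow> complex"
  assumes u: "Re u > -1" and \<rho>: "\<rho> \<in> borel_measurable borel"
    and le: "\<And>y. y > 0 \<Longrightarrow> cmod (\<rho> y) \<le> K * (1 + y) powr - p"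
    and p: "p > Re u + 1 + (real m + 1) / 2"
  shows "(\<integral>s. (pos s * s ^ m) *\<^sub>R (\<integral>x. pos x *\<^sub>R (of_real x powr u * \<rho> (x + s\<^sup>2)) \<partial>lborel) \<partial>lborel)
    = Gamma ((of_nat m + 1) / 2) / 2 * Gamma (u + 1) * rGamma (u + 1 + (of_nat m + 1) / 2) *
      (\<integral>y. pos y *\<^sub>R (of_real y powr (u + (of_nat m + 1) / 2) * \<rho> y) \<partial>lborel)"
proof -
  define c where "c = (\<integral>\<sigma>. (pos \<sigma> * pos (1 - \<sigma>\<^sup>2) * \<sigma> ^ m) *\<^sub>R (complex_of_real (1 - \<sigma>\<^sup>2) powr u) \<partial>lborel)"
  define b where "b = u + 1 + (of_nat m + 1) / 2"
  have "(real m + 1) / 2 > 0" by simp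
  moreover have "Re b = Re u + 1 + (real m + 1) / 2" by (simp add: b_def)
  ultimately have b: "Re b > 0" using u by linarith
  define E where "E y = complex_of_real (exp (- y))" for y
  \<comment> \<open>An order of decay large enough for the hypothesis on p. The exponential has it
    because (1 + y)^n / n! is a single term of the series for exp (1 + y).\<close>
  define n where "n = nat \<lceil>Re b + 1\<rceil>"
  have n: "real n > Re b" unfolding n_def using b by linarith
  have E_le: "cmod (E y) \<le> (fact n * exp 1) * (1 + y) powr - real n" if "y > 0" for y
  proof -
    have "(1 + y) ^ n / fact n \<le> exp (1 + y)"
    proof -
      have "sum (\<lambda>k. (1 + y) ^ k /\<^sub>R fact k) {n} \<le> (\<Sum>k. (1 + y) ^ k /\<^sub>R fact k)"
        using that by (intro sum_le_suminf summable_exp_generic) auto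
      then show ?thesis by (simp add: exp_def field_simps)
    qed
    then have "exp (- y) * (1 + y) ^ n \<le> exp (- y) * (fact n * exp (1 + y))"
      by (intro mult_left_mono) (simp_all add: field_simps)
    also have "\<dots> = fact n * (exp (- y) * exp (1 + y))" by simp
    also have "exp (- y) * exp (1 + y) = exp 1" unfolding exp_add[symmetric] by simp
    finally show ?thesis
      using that by (simp add: E_def powr_minus powr_realpow field_simps)
  qed
  have A1: "(\<integral>s. (pos s * s ^ m) *\<^sub>R (\<integral>x. pos x *\<^sub>R (of_real x powr u * E (x + s\<^sup>2)) \<partial>lborel) \<partial>lborel)
    = c * (\<integral>y. pos y *\<^sub>R (of_real y powr (u + (of_nat m + 1) / 2) * E y) \<partial>lborel)"
    unfolding c_def
    by (rule half_line_fractional_integral_aux[OF u _ E_le]) (use n in \<open>auto simp: E_def b_def\<close>)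
  have A2: "(\<integral>y. pos y *\<^sub>R (of_real y powr (u + (of_nat m + 1) / 2) * E y) \<partial>lborel) = Gamma b"
    using Laplace_powr(2)[OF b, of 1] by (simp add: b_def E_def add_ac)
  have A3: "(\<integral>x. pos x *\<^sub>R (of_real x powr u * E (x + s\<^sup>2)) \<partial>lborel) = Gamma (u + 1) * of_real (exp (- s\<^sup>2))" for s
  proof -
    have eq: "pos x *\<^sub>R (of_real x powr u * E (x + s\<^sup>2)) =
      of_real (exp (- s\<^sup>2)) * (pos x *\<^sub>R (of_real x powr (u + 1 - 1) * of_real (exp (- (1 * x)))))" for x
    proof -
      have "exp (- (x + s\<^sup>2)) = exp (- s\<^sup>2) * exp (- (1 * x))" unfolding exp_add[symmetric] by simp
      then have "E (x + s\<^sup>2) = of_real (exp (- s\<^sup>2)) * of_real (exp (- (1 * x)))"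
        unfolding E_def by (simp only: of_real_mult)
      then show ?thesis by (simp add: mult_ac)
    qed
    have "Re (u + 1) > 0" using u by simp
    from Laplace_powr(2)[OF this zero_less_one] show ?thesis
      unfolding eq integral_mult_right_zero by simp
  qed
  have A4: "(\<integral>s. (pos s * s ^ m) *\<^sub>R (Gamma (u + 1) * of_real (exp (- s\<^sup>2))) \<partial>lborel)
    = Gamma (u + 1) * of_real (Gamma ((real m + 1) / 2) / 2)"
  proof -
    have "(pos s * s ^ m) *\<^sub>R (Gamma (u + 1) * of_real (exp (- s\<^sup>2))) = Gamma (u + 1) * of_real (pos s * (s ^ m * exp (- s\<^sup>2)))" for s
      by (simp add: scaleR_conv_of_real mult_ac)
    then show ?thesis
      by (simp only: integral_mult_right_zero integral_complex_of_real Gaussian_moment(2))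
  qed
  have A5: "of_real (Gamma ((real m + 1) / 2) / 2) = Gamma ((of_nat m + 1) / 2 :: complex) / 2"
    using Gamma_complex_of_real[of "(real m + 1) / 2"] by simp
  have "Gamma (u + 1) * (Gamma ((of_nat m + 1) / 2) / 2) = c * Gamma b"
    using A1 unfolding A2 A3 A4 A5 .
  moreover have "Gamma b \<noteq> 0" using b by (auto simp: Gamma_eq_zero_iff elim!: nonpos_Ints_cases)
  ultimately have "c = Gamma ((of_nat m + 1) / 2) / 2 * Gamma (u + 1) * rGamma b"
    by (simp add: rGamma_inverse_Gamma field_simps)
  moreover have "(\<integral>s. (pos s * s ^ m) *\<^sub>R (\<integral>x. pos x *\<^sub>R (of_real x powr u * \<rho> (x + s\<^sup>2)) \<partial>lborel) \<partial>lborel)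
    = c * (\<integral>y. pos y *\<^sub>R (of_real y powr (u + (of_nat m + 1) / 2) * \<rho> y) \<partial>lborel)"
    unfolding c_def by (rule half_line_fractional_integral_aux[OF u \<rho> le p])
  ultimately show ?thesis by (simp add: b_def)
qed

text \<open>Up to the factor k!, the function 1 / (l + x)^(k + 1) is the Laplace integral over t of
  t^k exp (- t (l + x)). Exchanging the two integrals leaves one Gamma integral in x and one in
  t.\<close>

lemma Beta_type_integral_real:
  assumes w: "Re w < 0" and k: "Re w + real k > -1" and l: "l > 0"
  shows "(\<integral>x. pos x *\<^sub>R (of_real x powr (w + of_nat k) / of_real (l + x) ^ Suc k) \<partial>lborel)
    = of_real l powr w * (Gamma (w + of_nat k + 1) * Gamma (- w) / fact k)"
proof -
  define F where "F x t = (pos x * pos t) *\<^sub>R (of_real x powr (w + of_nat k) * complex_of_real (t ^ k * exp (- (t * (l + x)))))" for x t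
  have [measurable]: "(\<lambda>(x, t). F x t) \<in> borel_measurable (lborel \<Otimes>\<^sub>M lborel)"
    unfolding F_def by measurable
  have wk: "Re (w + of_nat k + 1) > 0" using k by simp
  have kk: "Re (of_nat k + 1 :: complex) > 0" by simp
  have eq_x: "F x t = (pos t * (t ^ k * exp (- (t * l)))) *\<^sub>R (pos x *\<^sub>R (of_real x powr (w + of_nat k + 1 - 1) * of_real (exp (- (t * x)))))" for x t
  proof -
    have "exp (- (t * (l + x))) = exp (- (t * l)) * exp (- (t * x))"
      unfolding exp_add[symmetric] by (simp add: distrib_left)
    then show ?thesis by (simp add: F_def scaleR_conv_of_real mult_ac)
  qed
  have tpk: "complex_of_real (t ^ k) = of_real t powr (of_nat k + 1 - 1)" if "t > 0" for t
    using that by simp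
  have eq_t: "F x t = (pos x *\<^sub>R of_real x powr (w + of_nat k)) * (pos t *\<^sub>R (of_real t powr (of_nat k + 1 - 1) * of_real (exp (- ((l + x) * t)))))" for x t
    using tpk[of t] by (auto simp: F_def indicator_def mult.commute[of t])
  have int_x: "integrable lborel (\<lambda>x. F x t)" for t
  proof (cases "t > 0")
    case True
    then show ?thesis unfolding eq_x by (intro integrable_scaleR_right Laplace_powr(1) wk)
  qed (simp add: F_def)
  have "integrable (lborel \<Otimes>\<^sub>M lborel) (\<lambda>(t, x). F x t)"
  proof (rule lborel_pair.Fubini_integrable)
    have eqn: "(\<integral>x. cmod (F x t) \<partial>lborel) = Gamma (Re w + real k + 1) * (pos t * (t powr (- Re w - 1) * exp (- (l * t))))" for t
    proof (cases "t > 0")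
      case True
      have "cmod (F x t) = (t ^ k * exp (- (t * l))) * (pos x * (x powr (Re w + real k + 1 - 1) * exp (- (t * x))))" for x
        unfolding eq_x using True l by (cases "x > 0") (simp_all add: norm_mult norm_of_real_powr)
      then have "(\<integral>x. cmod (F x t) \<partial>lborel) = (t ^ k * exp (- (t * l))) * (Gamma (Re w + real k + 1) * t powr - (Re w + real k + 1))"
        using Laplace_powr_real(2)[of "Re w + real k + 1" t] True k by simp
      also have "t ^ k * exp (- (t * l)) * (Gamma (Re w + real k + 1) * t powr - (Re w + real k + 1))
         = Gamma (Re w + real k + 1) * ((t powr real k * t powr - (Re w + real k + 1)) * exp (- (l * t)))"
        using True by (simp add: powr_realpow mult_ac)
      also have "t powr real k * t powr - (Re w + real k + 1) = t powr (- Re w - 1)"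
        unfolding powr_add[symmetric] by simp
      finally show ?thesis using True by simp
    qed (simp add: F_def)
    show "integrable lborel (\<lambda>t. \<integral>x. cmod (case (t, x) of (t, x) \<Rightarrow> F x t) \<partial>lborel)"
      unfolding prod.case eqn
      by (intro integrable_mult_right Laplace_powr_real) (use w l in auto)
    show "AE t in lborel. integrable lborel (\<lambda>x. case (t, x) of (t, x) \<Rightarrow> F x t)"
      using int_x by simp
  qed measurable
  then have swap: "(\<integral>x. (\<integral>t. F x t \<partial>lborel) \<partial>lborel) = (\<integral>t. (\<integral>x. F x t \<partial>lborel) \<partial>lborel)"
    by (rule lborel_pair.Fubini_integral)
  have v_t: "(\<integral>t. F x t \<partial>lborel) = fact k * (pos x *\<^sub>R (of_real x powr (w + of_nat k) / of_real (l + x) ^ Suc k))" for x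
  proof (cases "x > 0")
    case True
    then have lx: "l + x > 0" using l by simp
    have "of_real (l + x) powr - (of_nat k + 1 :: complex) = inverse (of_real (l + x) powr of_nat (Suc k))"
      by (simp only: powr_minus) (simp add: add.commute)
    also have "\<dots> = inverse (of_real (l + x) ^ Suc k)"
      by (subst powr_complexpow) (use lx in \<open>simp_all only: of_real_eq_0_iff\<close>)
    finally have pw: "of_real (l + x) powr - (of_nat k + 1 :: complex) = inverse (of_real (l + x) ^ Suc k)" .
    have G: "Gamma (of_nat k + 1 :: complex) = fact k" using Gamma_fact[of k] by (simp add: add.commute)
    have "(\<integral>t. F x t \<partial>lborel) = (pos x *\<^sub>R of_real x powr (w + of_nat k)) *
      (\<integral>t. pos t *\<^sub>R (of_real t powr (of_nat k + 1 - 1) * of_real (exp (- ((l + x) * t)))) \<partial>lborel)"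
      unfolding eq_t by (rule integral_mult_right_zero)
    also have "\<dots> = (pos x *\<^sub>R of_real x powr (w + of_nat k)) * (fact k * inverse (of_real (l + x) ^ Suc k))"
      unfolding Laplace_powr(2)[OF kk lx] pw G ..
    finally show ?thesis by (simp only: divide_inverse scaleR_conv_of_real mult_ac)
  qed (simp add: F_def)
  have v_x: "(\<integral>x. F x t \<partial>lborel) = Gamma (w + of_nat k + 1) * (pos t *\<^sub>R (of_real t powr (- w - 1) * of_real (exp (- (l * t)))))" for t
  proof (cases "t > 0")
    case True
    have "complex_of_real (t ^ k) * of_real t powr - (w + of_nat k + 1) = of_real t powr of_nat k * of_real t powr - (w + of_nat k + 1)"
      using True by simp
    also have "\<dots> = of_real t powr (- w - 1)"
      using True unfolding powr_add[symmetric] by simp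
    finally have pw: "complex_of_real (t ^ k) * of_real t powr - (w + of_nat k + 1) = of_real t powr (- w - 1)" .
    have "(\<integral>x. F x t \<partial>lborel) = (t ^ k * exp (- (t * l))) *\<^sub>R (Gamma (w + of_nat k + 1) * of_real t powr - (w + of_nat k + 1))"
      unfolding eq_x integral_scaleR_right Laplace_powr(2)[OF wk True] using True by simp
    also have "\<dots> = Gamma (w + of_nat k + 1) * ((complex_of_real (t ^ k) * of_real t powr - (w + of_nat k + 1)) * of_real (exp (- (l * t))))"
      by (simp add: scaleR_conv_of_real mult_ac)
    finally show ?thesis using True unfolding pw by simp
  qed (simp add: F_def)
  have mw: "Re (- w) > 0" using w by simp
  have "fact k * (\<integral>x. pos x *\<^sub>R (of_real x powr (w + of_nat k) / of_real (l + x) ^ Suc k) \<partial>lborel)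
    = Gamma (w + of_nat k + 1) * (Gamma (- w) * of_real l powr - (- w))"
    using swap unfolding v_t v_x integral_mult_right_zero Laplace_powr(2)[OF mw l] .
  then show ?thesis by (simp only: minus_minus) (simp add: field_simps del: power_Suc of_real_add)
qed


section \<open>From vertical lines to the negative half line\<close>

lemma integral_UNIV_limit:
  fixes f :: "real \<Rightarrow> 'b::banach"
  assumes "f integrable_on UNIV"
  shows "(\<lambda>n. integral {- real n..real n} f) \<longlonglongrightarrow> integral UNIV f"
proof (rule LIMSEQ_I)
  fix e :: real assume "e > 0"
  have "(f has_integral integral UNIV f) UNIV" using assms by (rule integrable_integral)
  moreover have "\<not> (\<exists>a b. (UNIV :: real set) = cbox a b)"
    using not_compact_UNIV[where 'a = real] compact_cbox by metis
  ultimately obtain B where B: "B > 0"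
    "\<And>a b. ball 0 B \<subseteq> cbox a b \<Longrightarrow>
      \<exists>z. ((\<lambda>x. if x \<in> UNIV then f x else 0) has_integral z) (cbox a b) \<and> norm (z - integral UNIV f) < e"
    using has_integral_altD \<open>e > 0\<close> by blast
  show "\<exists>n0. \<forall>n\<ge>n0. norm (integral {- real n..real n} f - integral UNIV f) < e"
  proof (intro exI allI impI)
    fix n assume n: "nat \<lceil>B\<rceil> \<le> n"
    have "ball 0 B \<subseteq> cbox (- real n) (real n)"
      using n by (auto simp: dist_real_def abs_le_iff)
    then obtain z where z: "((\<lambda>x. if x \<in> UNIV then f x else 0) has_integral z) (cbox (- real n) (real n))"
      "norm (z - integral UNIV f) < e" using B(2) by blast
    from z(1) have "(f has_integral z) {- real n..real n}" by simp
    with z(2) show "norm (integral {- real n..real n} f - integral UNIV f) < e"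
      by (simp add: integral_unique)
  qed
qed

text \<open>At 0 the logarithm is singular, so continuity there is read off the modulus x powr Re
  u.\<close>

lemma continuous_on_of_real_powr:
  assumes "Re u > 0"
  shows "continuous_on {0..} (\<lambda>x. complex_of_real x powr u)"
  unfolding continuous_on_def
proof
  fix x :: real assume x: "x \<in> {0..}"
  show "((\<lambda>x. complex_of_real x powr u) \<longlongrightarrow> complex_of_real x powr u) (at x within {0..})"
  proof (cases "x = 0")
    case False
    then have "isCont (\<lambda>x. complex_of_real x powr u) x"
      using x by (intro continuous_intros) (auto simp: complex_nonpos_Reals_iff)
    then show ?thesis using continuous_at_imp_continuous_at_within continuous_within by blast
  next
    case True
    have "continuous_on {0..} (\<lambda>x :: real. x powr Re u)"
      using assms by (intro continuous_on_powr') (auto intro!: continuous_intros)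
    then have "((\<lambda>x. x powr Re u) \<longlongrightarrow> 0 powr Re u) (at x within {0..})"
      unfolding continuous_on_def True by (rule bspec) simp
    then have "((\<lambda>x. x powr Re u) \<longlongrightarrow> 0) (at x within {0..})" by simp
    then have "((\<lambda>x. complex_of_real x powr u) \<longlongrightarrow> 0) (at x within {0..})"
      by (rule Lim_null_comparison[rotated])
        (auto simp: eventually_at_filter norm_powr_real_powr intro!: always_eventually)
    then show ?thesis using True assms by simp
  qed
qed

lemma Beta_type_integrand_bound:
  assumes "Re w < 0" "x \<ge> 1" "Re l > 0"
  shows "cmod (of_real x powr (w + of_nat k) / (l + of_real x) ^ Suc k) \<le> x powr (Re w - 1)"
proof -
  have x: "x > 0" using assms by simp
  have "x \<le> Re (l + of_real x)" using assms by simp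
  also have "\<dots> \<le> cmod (l + of_real x)" by (rule complex_Re_le_cmod)
  finally have xl: "x \<le> cmod (l + of_real x)" .
  then have "x ^ Suc k \<le> cmod (l + of_real x) ^ Suc k" using x by (intro power_mono) auto
  then have "x powr (Re w + k) / cmod (l + of_real x) ^ Suc k \<le> x powr (Re w + k) / x ^ Suc k"
    using x less_le_trans[OF x xl] by (intro divide_left_mono mult_pos_pos zero_less_power) auto
  also have "\<dots> = x powr (Re w + k) / x powr (real k + 1)" using x powr_realpow[OF x, of "Suc k"] by (simp add: add.commute)
  also have "\<dots> = x powr (Re w - 1)" unfolding powr_diff[symmetric] by simp
  finally show ?thesis using x by (simp add: norm_divide norm_power norm_mult norm_of_real_powr)
qed

lemma Beta_type_integrand_continuous:
  assumes "Re (w + of_nat k) > 0" "Re l > 0"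
  shows "continuous_on {0..} (\<lambda>x. of_real x powr (w + of_nat k) / (l + of_real x) ^ Suc k)"
proof -
  have "l + of_real x \<noteq> 0" if "x \<in> {0..}" for x
    using assms that by (auto simp: complex_eq_iff)
  then show ?thesis
    by (intro continuous_intros continuous_on_of_real_powr[OF assms(1)]) auto
qed

lemma Beta_type_integrable:
  assumes w: "Re w < 0" "Re w + real k > 0" and l: "Re l > 0"
  shows "(\<lambda>x. of_real x powr (w + of_nat k) / (l + of_real x) ^ Suc k) integrable_on {0..}"
proof -
  let ?f = "\<lambda>x. of_real x powr (w + of_nat k) / (l + of_real x) ^ Suc k"
  have c: "continuous_on {0..} ?f" by (rule Beta_type_integrand_continuous) (use w l in auto)
  have "bounded (?f ` {0..1})"
    by (intro compact_imp_bounded compact_continuous_image continuous_on_subset[OF c]) auto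
  then obtain B where B: "\<And>x. x \<in> {0..1} \<Longrightarrow> cmod (?f x) \<le> B" unfolding bounded_iff by blast
  have B0: "B \<ge> 0" using B[of 0] norm_ge_zero order_trans by fastforce
  define g where "g x = (if x \<le> 1 then B else x powr (Re w - 1))" for x
  have "g integrable_on {0..1}"
    by (rule integrable_eq[of "\<lambda>_. B"]) (auto simp: g_def)
  moreover have "g integrable_on {1..}"
  proof -
    have "(\<lambda>x. x powr (Re w - 1)) integrable_on {1..}"
      using has_integral_powr_to_inf[of "Re w - 1" 1] w by auto
    then show ?thesis
      by (rule integrable_spike_finite[of "{1}", rotated 2]) (auto simp: g_def)
  qed
  moreover have "{0..1} \<inter> {1..} = {1::real}" "{0..} = {0..1} \<union> {1::real..}" by auto
  ultimately have gi: "g integrable_on {0..}"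
    by (metis integrable_Un negligible_sing)
  show ?thesis
    by (rule integrable_on_dominated[OF _ c _ gi])
      (use B Beta_type_integrand_bound[OF w(1) _ l] in \<open>auto simp: g_def\<close>)
qed

text \<open>The truncated integrals are holomorphic by differentiation under the integral sign, and
  the tails beyond n are at most n^(Re w) / (- Re w), uniformly in l.\<close>

lemma Beta_type_integral_holomorphic:
  assumes w: "Re w < 0" "Re w + real k > 0"
  shows "(\<lambda>l. integral {0..} (\<lambda>x. of_real x powr (w + of_nat k) / (l + of_real x) ^ Suc k)) holomorphic_on {l. Re l > 0}"
proof (rule holomorphic_uniform_sequence)
  let ?f = "\<lambda>l x. of_real x powr (w + of_nat k) / (l + of_real x) ^ Suc k"
  let ?U = "{l. Re l > 0}"
  show op: "open ?U" by (rule open_halfspace_Re_gt)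
  have wk: "Re (w + of_nat k) > 0" using w by simp
  have nz: "l + of_real x \<noteq> 0" if "Re l > 0" "x \<ge> 0" for l x
    using that by (auto simp: complex_eq_iff)
  show "(\<lambda>l. integral {0..real n} (?f l)) holomorphic_on ?U" for n
  proof -
    have "(\<lambda>l. integral (cbox 0 (real n)) (?f l)) holomorphic_on ?U"
    proof (rule leibniz_rule_holomorphic)
      fix l x assume lx: "l \<in> ?U" "x \<in> cbox 0 (real n)"
      show "((\<lambda>l. ?f l x) has_field_derivative
          (0 * (l + of_real x) ^ Suc k - of_real x powr (w + of_nat k) * (of_nat (Suc k) * (l + of_real x) ^ k)) / ((l + of_real x) ^ Suc k * (l + of_real x) ^ Suc k)) (at l within ?U)"
      proof (rule DERIV_divide[OF DERIV_const])
        have "((\<lambda>l. l + complex_of_real x) has_field_derivative 1) (at l within ?U)"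
          by (auto intro!: derivative_eq_intros)
        from DERIV_power[OF this, of "Suc k"]
        show "((\<lambda>l. (l + complex_of_real x) ^ Suc k) has_field_derivative of_nat (Suc k) * (l + of_real x) ^ k) (at l within ?U)"
          by (simp del: power_Suc of_nat_Suc)
        show "(l + complex_of_real x) ^ Suc k \<noteq> 0" using nz[of l x] lx by (simp del: power_Suc)
      qed
    next
      show "?f l integrable_on cbox 0 (real n)" if "l \<in> ?U" for l
        unfolding cbox_interval
        by (rule integrable_continuous_real, rule continuous_on_subset[OF Beta_type_integrand_continuous[OF wk]])
          (use that in auto)
    next
      have c1: "continuous_on (?U \<times> cbox 0 (real n)) (\<lambda>p. complex_of_real (snd p) powr (w + of_nat k))"
        by (rule continuous_on_compose2[OF continuous_on_of_real_powr[OF wk]]) (auto intro!: continuous_intros)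
      show "continuous_on (?U \<times> cbox 0 (real n)) (\<lambda>(l, x). (0 * (l + of_real x) ^ Suc k - of_real x powr (w + of_nat k) * (of_nat (Suc k) * (l + of_real x) ^ k)) / ((l + of_real x) ^ Suc k * (l + of_real x) ^ Suc k))"
        unfolding case_prod_beta
        by (intro c1 continuous_on_divide continuous_on_mult continuous_on_diff continuous_on_const
            continuous_on_power continuous_on_add continuous_on_of_real continuous_on_fst
            continuous_on_snd continuous_on_id ballI) (use nz in \<open>auto simp: mem_Times_iff\<close>)
    next
      show "convex ?U" by (rule convex_halfspace_Re_gt)
    qed
    then show ?thesis by simp
  qed
  have aux: "cmod (a - c) = cmod b" if "a + b = c" for a b c :: complex
    using that[symmetric] by simp
  have tail: "cmod (integral {0..real n} (?f l) - integral {0..} (?f l)) \<le> real n powr Re w / (- Re w)"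
    if l: "Re l > 0" and n: "n \<ge> 1" for l n
  proof -
    have bd: "cmod (integral {0..real n} (?f l) - integral {0..real N} (?f l)) \<le> real n powr Re w / (- Re w)" if N: "N \<ge> n" for N
    proof -
      have c: "continuous_on {0..real N} (?f l)" 
        by (rule continuous_on_subset[OF Beta_type_integrand_continuous[OF wk l]]) auto
      have "integral {0..real n} (?f l) + integral {real n..real N} (?f l) = integral {0..real N} (?f l)"
        by (rule Henstock_Kurzweil_Integration.integral_combine) (use N integrable_continuous_real[OF c] in auto)
      then have "cmod (integral {0..real n} (?f l) - integral {0..real N} (?f l)) = cmod (integral {real n..real N} (?f l))"
        by (rule aux)
      also have "\<dots> \<le> integral {real n..real N} (\<lambda>x. x powr (Re w - 1))"
      proof (rule integral_norm_bound_integral)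
        show "?f l integrable_on {real n..real N}"
          by (rule integrable_continuous_real, rule continuous_on_subset[OF c]) auto
        show "(\<lambda>x. x powr (Re w - 1)) integrable_on {real n..real N}"
          using n by (intro integrable_continuous_real continuous_intros) auto
        show "cmod (?f l x) \<le> x powr (Re w - 1)" if "x \<in> {real n..real N}" for x
          by (rule Beta_type_integrand_bound[OF w(1) _ l]) (use that n in auto)
      qed
      also have "\<dots> = real N powr Re w / Re w - real n powr Re w / Re w"
      proof (rule integral_unique, rule fundamental_theorem_of_calculus)
        show "((\<lambda>x. x powr Re w / Re w) has_vector_derivative x powr (Re w - 1)) (at x within {real n..real N})"
          if "x \<in> {real n..real N}" for x
          using that n w unfolding has_real_derivative_iff_has_vector_derivative[symmetric]
          by (auto intro!: derivative_eq_intros)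
      qed (use N in auto)
      also have "\<dots> \<le> real n powr Re w / (- Re w)"
        using w by (simp add: divide_le_0_iff)
      finally show ?thesis .
    qed
    have lim: "(\<lambda>N. cmod (integral {0..real n} (?f l) - integral {0..real N} (?f l)))
      \<longlonglongrightarrow> cmod (integral {0..real n} (?f l) - integral {0..} (?f l))"
      by (intro tendsto_intros integral_atLeast_limit Beta_type_integrable w l)
    show ?thesis
      by (rule LIMSEQ_le_const2[OF lim], rule exI[of _ n]) (use bd in blast)
  qed
  fix l assume "l \<in> ?U"
  then obtain d where d: "d > 0" "cball l d \<subseteq> ?U" using op open_contains_cball by blast
  have "uniform_limit (cball l d) (\<lambda>n l. integral {0..real n} (?f l)) (\<lambda>l. integral {0..} (?f l)) sequentially"
  proof (rule uniform_limitI)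
    fix e :: real assume e: "e > 0"
    have "(\<lambda>n. real n powr Re w / (- Re w)) \<longlonglongrightarrow> 0 / (- Re w)"
      using w by (intro tendsto_divide tendsto_const tendsto_neg_powr filterlim_real_sequentially) auto
    then have "\<forall>\<^sub>F n in sequentially. real n powr Re w / (- Re w) < e"
      using e by (intro order_tendstoD) auto
    then show "\<forall>\<^sub>F n in sequentially. \<forall>l'\<in>cball l d. dist (integral {0..real n} (?f l')) (integral {0..} (?f l')) < e"
      using eventually_ge_at_top[of 1]
    proof eventually_elim
      case (elim n)
      then show ?case using tail[OF _ elim(2)] d(2) by (force simp: dist_norm)
    qed
  qed
  then show "\<exists>d>0. cball l d \<subseteq> ?U \<and> uniform_limit (cball l d) (\<lambda>n l. integral {0..real n} (?f l)) (\<lambda>l. integral {0..} (?f l)) sequentially"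
    using d by blast
qed

text \<open>Both sides are holomorphic in l on the right half plane and agree for positive l, so the
  identity theorem applies.\<close>

lemma Beta_type_integral:
  assumes w: "Re w < 0" "Re w + real k > 0" and l: "Re l > 0"
  shows "integral {0..} (\<lambda>x. of_real x powr (w + of_nat k) / (l + of_real x) ^ Suc k)
    = l powr w * (Gamma (w + of_nat k + 1) * Gamma (- w) / fact k)"
proof -
  let ?K = "\<lambda>l. integral {0..} (\<lambda>x. of_real x powr (w + of_nat k) / (l + of_real x) ^ Suc k)"
  define G where "G = Gamma (w + of_nat k + 1) * Gamma (- w) / fact k"
  have real: "?K (of_real t) = of_real t powr w * G" if t: "t > 0" for t
  proof -
    have r: "Re (of_real t) > 0" using t by simp
    let ?f = "\<lambda>x. of_real x powr (w + of_nat k) / (of_real t + of_real x) ^ Suc k"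
    have b: "cmod (?f x) = x powr (Re w + k) / (t + x) ^ Suc k" if "x > 0" for x
      using that t unfolding of_real_add[symmetric]
      by (simp add: norm_divide norm_mult norm_power norm_of_real_powr del: of_real_add)
    have "integrable lborel (\<lambda>x. pos x *\<^sub>R ?f x)"
    proof (rule Bochner_Integration.integrable_bound)
      have "integrable lborel (\<lambda>x. pos x * (x powr (Re w + k) * (1 + x) powr - real (Suc k)))"
        using w by (intro integrable_powr_beta) auto
      then show "integrable lborel (\<lambda>x. (1 / min 1 t ^ Suc k) * (pos x * (x powr (Re w + k) * (1 + x) powr - real (Suc k))))"
        by (rule integrable_mult_right)
      show "AE x in lborel. norm (pos x *\<^sub>R ?f x) \<le> norm ((1 / min 1 t ^ Suc k) * (pos x * (x powr (Re w + k) * (1 + x) powr - real (Suc k))))"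
      proof (rule AE_I2)
        fix x :: real
        show "norm (pos x *\<^sub>R ?f x) \<le> norm ((1 / min 1 t ^ Suc k) * (pos x * (x powr (Re w + k) * (1 + x) powr - real (Suc k))))"
        proof (cases "x > 0")
          case True
          \<comment> \<open>Compares t + x with a multiple of 1 + x, so that
            \<open>integrable_powr_beta\<close> provides the majorant.\<close>
          have "min 1 t * (1 + x) \<le> t + x" 
          proof -
            have "min 1 t * x \<le> 1 * x" using True by (intro mult_right_mono) auto
            moreover have "min 1 t \<le> t" by (rule min.cobounded2)
            ultimately show ?thesis unfolding distrib_left mult_1_right mult_1_left by (rule add_mono[rotated])
          qed
          then have "(min 1 t * (1 + x)) ^ Suc k \<le> (t + x) ^ Suc k" using True t by (intro power_mono) auto
          then have "x powr (Re w + k) / (t + x) ^ Suc k \<le> x powr (Re w + k) / (min 1 t * (1 + x)) ^ Suc k"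
            using True t by (intro divide_left_mono mult_pos_pos zero_less_power) auto
          also have "\<dots> = (1 / min 1 t ^ Suc k) * (x powr (Re w + k) * (1 + x) powr - real (Suc k))"
            using True by (simp only: powr_minus powr_realpow add_pos_pos zero_less_one power_mult_distrib) (simp add: divide_inverse)
          finally show ?thesis using True b[OF True] t by (simp del: power_Suc of_nat_Suc)
        qed simp
      qed
    qed measurable
    from half_line_integral(1)[OF this] show ?thesis
      using Beta_type_integral_real[OF w(1) _ t, of k] w unfolding G_def by simp
  qed
  have "?K l - l powr w * G = 0"
  proof (rule analytic_continuation[where f = "\<lambda>l. ?K l - l powr w * G" and S = "{l. Re l > 0}"
        and U = "complex_of_real ` {0<..}" and \<xi> = 1])
    show "(\<lambda>l. ?K l - l powr w * G) holomorphic_on {l. Re l > 0}"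
      by (intro holomorphic_intros Beta_type_integral_holomorphic w) (auto simp: complex_nonpos_Reals_iff)
    show "open {l. Re l > 0}" by (rule open_halfspace_Re_gt)
    show "connected {l. Re l > 0}" by (intro convex_connected convex_halfspace_Re_gt)
    show "complex_of_real ` {0<..} \<subseteq> {l. Re l > 0}" by auto
    show "(1 :: complex) \<in> {l. Re l > 0}" by simp
    show "1 islimpt complex_of_real ` {0<..}"
      unfolding islimpt_sequential
    proof (intro exI[of _ "\<lambda>n. complex_of_real (1 + inverse (real (Suc n)))"] conjI allI)
      show "complex_of_real (1 + inverse (real (Suc n))) \<in> complex_of_real ` {0<..} - {1}" for n
        using of_real_eq_1_iff[of "1 + inverse (real (Suc n))", where 'a = complex]
        by (auto simp del: of_real_add of_real_inverse of_real_of_nat_eq of_nat_Suc intro!: imageI add_pos_pos)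
      have "(\<lambda>n. complex_of_real (1 + inverse (real (Suc n)))) \<longlonglongrightarrow> of_real (1 + 0)"
        by (intro tendsto_intros LIMSEQ_inverse_real_of_nat)
      then show "(\<lambda>n. complex_of_real (1 + inverse (real (Suc n)))) \<longlonglongrightarrow> 1" by simp
    qed
    show "?K z - z powr w * G = 0" if "z \<in> complex_of_real ` {0<..}" for z
      using that real by auto
    show "l \<in> {l. Re l > 0}" using l by simp
  qed
  then show ?thesis by (simp add: G_def)
qed


text \<open>\<open>\<zeta> k\<close> is the \<open>k\<close>-th derivative of a function that decays of order \<open>p\<close>.\<close>

definition decaying :: "nat \<Rightarrow> (nat \<Rightarrow> complex \<Rightarrow> complex) \<Rightarrow> bool" where
  "decaying p \<zeta> \<longleftrightarrow>
     (\<forall>k z. Re z < 1 \<longrightarrow> (\<zeta> k has_field_derivative \<zeta> (Suc k) z) (at z)) \<and>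
     (\<forall>k. \<exists>C. \<forall>z. Re z \<le> 1 / 2 \<longrightarrow> cmod (\<zeta> k z) \<le> C / (1 + cmod z) ^ (p + k))"

lemma decayingD:
  fixes \<zeta> :: "nat \<Rightarrow> complex \<Rightarrow> complex"
  assumes "decaying p \<zeta>"
  shows "Re z < 1 \<Longrightarrow> (\<zeta> k has_field_derivative \<zeta> (Suc k) z) (at z)"
  using assms unfolding decaying_def by blast

lemma decaying_bound:
  fixes \<zeta> :: "nat \<Rightarrow> complex \<Rightarrow> complex"
  assumes "decaying p \<zeta>"
  obtains C where "C \<ge> 0" "\<And>z. Re z \<le> 1 / 2 \<Longrightarrow> cmod (\<zeta> k z) \<le> C / (1 + cmod z) ^ (p + k)"
proof -
  obtain C where C: "\<And>z. Re z \<le> 1 / 2 \<Longrightarrow> cmod (\<zeta> k z) \<le> C / (1 + cmod z) ^ (p + k)"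
    using assms unfolding decaying_def by blast
  have "C \<ge> 0" using C[of 0] norm_ge_zero[of "\<zeta> k 0"] by (simp del: norm_ge_zero)
  with C that show ?thesis by blast
qed

lemma decaying_continuous:
  fixes \<zeta> :: "nat \<Rightarrow> complex \<Rightarrow> complex"
  assumes "decaying p \<zeta>" 
  shows "continuous_on {z. Re z < 1} (\<zeta> k)"
  using decayingD[OF assms] by (intro continuous_at_imp_continuous_on) (auto intro: DERIV_isCont)

lemma decaying_weaken:
  fixes \<zeta> :: "nat \<Rightarrow> complex \<Rightarrow> complex"
  assumes "decaying p \<zeta>" "p' \<le> p"
  shows "decaying p' \<zeta>"
  unfolding decaying_def
proof (intro conjI allI impI)
  fix k
  obtain C where C: "C \<ge> 0" "\<And>z. Re z \<le> 1 / 2 \<Longrightarrow> cmod (\<zeta> k z) \<le> C / (1 + cmod z) ^ (p + k)"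
    using decaying_bound[OF assms(1)] by blast
  have "cmod (\<zeta> k z) \<le> C / (1 + cmod z) ^ (p' + k)" if "Re z \<le> 1 / 2" for z
  proof -
    have "C / (1 + cmod z) ^ (p + k) \<le> C / (1 + cmod z) ^ (p' + k)"
      using C(1) assms(2) by (intro divide_left_mono power_increasing mult_pos_pos zero_less_power) (auto intro: add_pos_nonneg)
    with C(2)[OF that] show ?thesis by linarith
  qed
  then show "\<exists>C. \<forall>z. Re z \<le> 1 / 2 \<longrightarrow> cmod (\<zeta> k z) \<le> C / (1 + cmod z) ^ (p' + k)" by blast
qed (use decayingD[OF assms(1)] in auto)

lemma deriv_decaying:
  fixes \<zeta> :: "nat \<Rightarrow> complex \<Rightarrow> complex"
  assumes "decaying p \<zeta>" "Re z < 1"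
  shows "(deriv ^^ k) (\<zeta> 0) z = \<zeta> k z"
proof -
  have "\<forall>z. Re z < 1 \<longrightarrow> (deriv ^^ k) (\<zeta> 0) z = \<zeta> k z"
  proof (induction k)
    case (Suc k)
    show ?case
    proof (intro allI impI)
      fix z :: complex assume z: "Re z < 1"
      have "\<forall>\<^sub>F w in nhds z. w \<in> {w. Re w < 1}"
        using z by (intro eventually_nhds_in_open open_halfspace_Re_lt) auto
      then have "\<forall>\<^sub>F w in nhds z. (deriv ^^ k) (\<zeta> 0) w = \<zeta> k w"
        by eventually_elim (use Suc in auto)
      then have "deriv ((deriv ^^ k) (\<zeta> 0)) z = deriv (\<zeta> k) z"
        by (rule deriv_cong_ev) simp
      also have "\<dots> = \<zeta> (Suc k) z" by (rule DERIV_imp_deriv[OF decayingD[OF assms(1) z]])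
      finally show "(deriv ^^ Suc k) (\<zeta> 0) z = \<zeta> (Suc k) z" by simp
    qed
  qed simp
  then show ?thesis using assms(2) by blast
qed

section \<open>Cauchy's formula along a vertical line\<close>

lemma line_distance:
  assumes "0 < \<alpha>" "\<alpha> < 1" "x \<ge> 0"
  shows "\<alpha> / 2 * (1 + \<bar>v\<bar>) \<le> cmod (Complex \<alpha> v + of_real x)" "\<alpha> / 2 * (1 + x) \<le> cmod (Complex \<alpha> v + of_real x)"
    "cmod (Complex \<alpha> v + of_real x) > 0"
proof -
  have 1: "\<alpha> + x \<le> cmod (Complex \<alpha> v + of_real x)" using complex_Re_le_cmod[of "Complex \<alpha> v + of_real x"] by simp
  have 2: "\<bar>v\<bar> \<le> cmod (Complex \<alpha> v + of_real x)" using abs_Im_le_cmod[of "Complex \<alpha> v + of_real x"] by simp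
  show "cmod (Complex \<alpha> v + of_real x) > 0" using 1 assms by linarith
  have "\<alpha> * \<bar>v\<bar> \<le> 1 * \<bar>v\<bar>" using assms by (intro mult_right_mono) auto
  moreover have "\<alpha> \<le> cmod (Complex \<alpha> v + of_real x)" using 1 assms by linarith
  ultimately show "\<alpha> / 2 * (1 + \<bar>v\<bar>) \<le> cmod (Complex \<alpha> v + of_real x)" using 2 by (simp add: distrib_left)
  have "\<alpha> * x \<le> 1 * x" using assms by (intro mult_right_mono) auto
  then show "\<alpha> / 2 * (1 + x) \<le> cmod (Complex \<alpha> v + of_real x)" using 1 assms by (simp add: distrib_left)
qed

lemma continuous_on_line:
  fixes \<zeta> :: "nat \<Rightarrow> complex \<Rightarrow> complex"
  assumes "decaying p \<zeta>" "\<alpha> < 1"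
  shows "continuous_on UNIV (\<lambda>v. \<zeta> k (Complex \<alpha> v))"
proof -
  have "continuous_on UNIV (\<lambda>v. Complex \<alpha> v)"
    unfolding Complex_eq by (intro continuous_intros)
  then show ?thesis
    by (rule continuous_on_compose2[OF decaying_continuous[OF assms(1), of k]]) (use assms in auto)
qed

lemma Cauchy_line_integrable:
  fixes \<zeta> :: "nat \<Rightarrow> complex \<Rightarrow> complex"
  assumes \<zeta>: "decaying p \<zeta>" and p: "p \<ge> 1" and \<alpha>: "0 < \<alpha>" "\<alpha> < 1 / 2" and x: "x \<ge> 0"
  shows "integrable lborel (\<lambda>v. \<zeta> 0 (Complex \<alpha> v) / (Complex \<alpha> v + of_real x) ^ Suc k)"
proof -
  obtain C where C: "C \<ge> 0" "\<And>z. Re z \<le> 1 / 2 \<Longrightarrow> cmod (\<zeta> 0 z) \<le> C / (1 + cmod z) ^ (1 + 0)"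
    using decaying_bound[OF decaying_weaken[OF \<zeta> p]] by blast
  have dist: "\<alpha> / 2 * (1 + \<bar>v\<bar>) \<le> cmod (Complex \<alpha> v + of_real x)" "\<alpha> / 2 \<le> cmod (Complex \<alpha> v + of_real x)"
    "Complex \<alpha> v + of_real x \<noteq> 0" for v
  proof -
    show 1: "\<alpha> / 2 * (1 + \<bar>v\<bar>) \<le> cmod (Complex \<alpha> v + of_real x)"
      using line_distance(1)[OF \<alpha>(1) _ x] \<alpha>(2) by simp
    have "\<alpha> / 2 * 1 \<le> \<alpha> / 2 * (1 + \<bar>v\<bar>)" using \<alpha> by (intro mult_left_mono) auto
    with 1 show "\<alpha> / 2 \<le> cmod (Complex \<alpha> v + of_real x)" by linarith
    show "Complex \<alpha> v + of_real x \<noteq> 0" using \<alpha> x by (auto simp: complex_eq_iff)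
  qed
  have cont: "continuous_on UNIV (\<lambda>v. \<zeta> 0 (Complex \<alpha> v) / (Complex \<alpha> v + of_real x) ^ Suc k)"
    using dist(3) \<alpha>
    by (intro continuous_intros continuous_on_line[OF \<zeta>]) (auto simp: Complex_eq intro!: continuous_intros)
  show ?thesis
  proof (rule Bochner_Integration.integrable_bound)
    show "integrable lborel (\<lambda>v. (C / ((\<alpha> / 2) * (\<alpha> / 2) ^ k)) * (1 + \<bar>v\<bar>) powr - 2)"
      by (intro integrable_mult_right integrable_abs_powr) auto
    show "(\<lambda>v. \<zeta> 0 (Complex \<alpha> v) / (Complex \<alpha> v + of_real x) ^ Suc k) \<in> borel_measurable lborel"
      using borel_measurable_continuous_onI[OF cont] by simp
    show "AE v in lborel. norm (\<zeta> 0 (Complex \<alpha> v) / (Complex \<alpha> v + of_real x) ^ Suc k)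
      \<le> norm ((C / ((\<alpha> / 2) * (\<alpha> / 2) ^ k)) * (1 + \<bar>v\<bar>) powr - 2)"
    proof (rule AE_I2)
      fix v :: real
      have 1: "cmod (\<zeta> 0 (Complex \<alpha> v)) \<le> C / (1 + \<bar>v\<bar>)"
      proof -
        have "cmod (\<zeta> 0 (Complex \<alpha> v)) \<le> C / (1 + cmod (Complex \<alpha> v))" using C(2)[of "Complex \<alpha> v"] \<alpha> by simp
        also have "\<dots> \<le> C / (1 + \<bar>v\<bar>)"
          using C(1) abs_Im_le_cmod[of "Complex \<alpha> v"] by (intro divide_left_mono mult_pos_pos) (auto intro: add_pos_nonneg)
        finally show ?thesis .
      qed
      have 2: "(\<alpha> / 2 * (1 + \<bar>v\<bar>)) * (\<alpha> / 2) ^ k \<le> cmod (Complex \<alpha> v + of_real x) ^ Suc k"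
        unfolding power_Suc using dist[of v] \<alpha> by (intro mult_mono[OF dist(1)] power_mono) auto
      have "norm (\<zeta> 0 (Complex \<alpha> v) / (Complex \<alpha> v + of_real x) ^ Suc k) \<le> (C / (1 + \<bar>v\<bar>)) / ((\<alpha> / 2 * (1 + \<bar>v\<bar>)) * (\<alpha> / 2) ^ k)"
        unfolding norm_divide norm_power using 1 2 \<alpha> C(1) by (intro frac_le) auto
      also have "\<dots> = (C / ((\<alpha> / 2) * (\<alpha> / 2) ^ k)) * (1 + \<bar>v\<bar>) powr - 2"
        by (simp add: powr_minus field_simps power2_eq_square add_nonneg_eq_0_iff)
      finally show "norm (\<zeta> 0 (Complex \<alpha> v) / (Complex \<alpha> v + of_real x) ^ Suc k)
        \<le> norm ((C / ((\<alpha> / 2) * (\<alpha> / 2) ^ k)) * (1 + \<bar>v\<bar>) powr - 2)"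
        by (rule order_trans) (simp only: real_norm_def abs_ge_self)
    qed
  qed
qed

text \<open>The line is closed to the left, where \<open>\<zeta> 0\<close> is holomorphic and
  decays, by rectangles of size R. The only pole inside is at -x, of order at most k + 1. On the
  other three sides the integrand is O(1 / R^2), so they contribute O(1 / R).\<close>

lemma Cauchy_formula_line:
  fixes \<zeta> :: "nat \<Rightarrow> complex \<Rightarrow> complex"
  assumes \<zeta>: "decaying p \<zeta>" and p: "p \<ge> 1" and \<alpha>: "0 < \<alpha>" "\<alpha> < 1 / 2" and x: "x \<ge> 0"
  shows "(\<integral>v. \<zeta> 0 (Complex \<alpha> v) / (Complex \<alpha> v + of_real x) ^ Suc k \<partial>lborel) = 2 * pi / fact k * \<zeta> k (- of_real x)"
proof -
  define z where "z = - complex_of_real x"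
  define \<phi> where "\<phi> l = \<zeta> 0 l / (l - z) ^ Suc k" for l
  define S where "S = {l :: complex. Re l < 1}"
  obtain C where C: "C \<ge> 0" "\<And>z. Re z \<le> 1 / 2 \<Longrightarrow> cmod (\<zeta> 0 z) \<le> C / (1 + cmod z) ^ (1 + 0)"
    using decaying_bound[OF decaying_weaken[OF \<zeta> p]] by blast
  have S: "open S" "convex S" unfolding S_def by (rule open_halfspace_Re_lt convex_halfspace_Re_lt)+
  have zS: "z \<in> S" unfolding S_def z_def using x by simp
  have hol: "\<zeta> 0 holomorphic_on S"
    unfolding S_def using decayingD[OF \<zeta>] by (auto simp: holomorphic_on_open open_halfspace_Re_lt)
  have hol\<phi>: "\<phi> holomorphic_on S - {z}"
    unfolding \<phi>_def by (intro holomorphic_intros holomorphic_on_subset[OF hol]) auto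
  \<comment> \<open>For R at least 2 x + 2 the distance to the pole is at least R / 2, which is at
    least 1; hence the denominator is at least R / 2 for every k.\<close>
  have rest: "cmod (contour_integral (linepath a b) \<phi>) \<le> (4 * C / R\<^sup>2) * (2 * R)"
    if R: "R \<ge> 2 * x + 2" and len: "cmod (b - a) \<le> 2 * R"
      and far: "\<And>l. l \<in> closed_segment a b \<Longrightarrow> R \<le> cmod l" "\<And>l. l \<in> closed_segment a b \<Longrightarrow> Re l \<le> 1 / 2"
    for a b R
  proof -
    have R0: "R \<ge> 2" "R / 2 \<ge> 1" using R x by auto
    have pt: "cmod (\<phi> l) \<le> 4 * C / R\<^sup>2 \<and> l \<in> S - {z}" if l: "l \<in> closed_segment a b" for l
    proof -
      have "R - x \<le> cmod (l - z)"
        using norm_triangle_ineq2[of l z] far(1)[OF l] x by (simp add: z_def)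
      then have d: "R / 2 \<le> cmod (l - z)" using R by linarith
      have "(R / 2) ^ 1 \<le> (R / 2) ^ Suc k" using R0 by (intro power_increasing) auto
      also have "\<dots> \<le> cmod (l - z) ^ Suc k" using d R0 by (intro power_mono) auto
      finally have dk: "R / 2 \<le> cmod (l - z) ^ Suc k" by simp
      have "cmod (\<zeta> 0 l) \<le> C / (1 + cmod l)" using C(2)[of l] far(2)[OF l] by simp
      also have "\<dots> \<le> C / R" using far(1)[OF l] R0 C(1) by (intro divide_left_mono mult_pos_pos) auto
      finally have "cmod (\<phi> l) \<le> (C / R) / (R / 2)"
        unfolding \<phi>_def norm_divide norm_power using dk R0 C(1) by (intro frac_le) auto
      also have "\<dots> \<le> 4 * C / R\<^sup>2" using C(1) R0 by (simp add: power2_eq_square divide_right_mono)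
      finally show ?thesis using d R0 far(2)[OF l] by (auto simp: S_def)
    qed
    have "cmod (contour_integral (linepath a b) \<phi>) \<le> (4 * C / R\<^sup>2) * cmod (b - a)"
    proof (rule contour_integral_bound_linepath)
      show "\<phi> contour_integrable_on linepath a b"
        by (rule contour_integrable_continuous_linepath)
          (rule continuous_on_subset[OF holomorphic_on_imp_continuous_on[OF hol\<phi>]], use pt in blast)
    qed (use pt C(1) in auto)
    also have "\<dots> \<le> (4 * C / R\<^sup>2) * (2 * R)" using len C(1) by (intro mult_left_mono) auto
    finally show ?thesis .
  qed
  have main: "cmod (\<i> * integral {- R..R} (\<lambda>v. \<phi> (Complex \<alpha> v)) - 2 * pi * \<i> * (\<zeta> k z / fact k)) \<le> 24 * C / R"
    if R: "R \<ge> 2 * x + 2" for R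
  proof -
    have R0: "R \<ge> 2" using R x by simp
    define a1 a2 a3 a4 where "a1 = Complex (- R) (- R)" and "a2 = Complex \<alpha> (- R)" and "a3 = Complex \<alpha> R" and "a4 = Complex (- R) R"
    have rp: "rectpath a1 a3 = linepath a1 a2 +++ linepath a2 a3 +++ linepath a3 a4 +++ linepath a4 a1"
      by (simp add: rectpath_def Let_def a1_def a2_def a3_def a4_def)
    have zbox: "z \<in> box a1 a3" using x R \<alpha> R0 by (auto simp: z_def a1_def a3_def in_box_complex_iff)
    have sub: "path_image (rectpath a1 a3) \<subseteq> S - {z}"
    proof -
      have pe: "path_image (rectpath a1 a3) = cbox a1 a3 - box a1 a3"
        by (rule path_image_rectpath_cbox_minus_box) (use R0 \<alpha> in \<open>auto simp: a1_def a3_def\<close>)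
      show ?thesis
      proof
        fix l assume "l \<in> path_image (rectpath a1 a3)"
        then have l: "l \<in> cbox a1 a3" "l \<noteq> z" using zbox unfolding pe by blast+
        have "Re l \<le> \<alpha>" using l(1) by (simp add: in_cbox_complex_iff a3_def)
        then show "l \<in> S - {z}" using l(2) \<alpha> by (simp add: S_def)
      qed
    qed
    have "contour_integral (rectpath a1 a3) \<phi> = 2 * pi * \<i> * (\<Sum>q\<in>{z}. winding_number (rectpath a1 a3) q * residue \<phi> q)"
    proof (rule Residue_theorem[OF S(1) convex_connected[OF S(2)]])
      show "\<forall>q. q \<notin> S \<longrightarrow> winding_number (rectpath a1 a3) q = 0"
        using sub by (intro allI impI winding_number_zero_outside[OF _ S(2)]) auto
    qed (use hol\<phi> sub in auto)
    also have "\<dots> = 2 * pi * \<i> * residue \<phi> z" using winding_number_rectpath[OF zbox] by simp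
    also have "residue \<phi> z = (deriv ^^ k) (\<zeta> 0) z / fact k"
      unfolding \<phi>_def by (rule residue_holomorphic_over_power[OF S(1) zS hol])
    also have "(deriv ^^ k) (\<zeta> 0) z = \<zeta> k z" by (rule deriv_decaying[OF \<zeta>]) (use zS in \<open>simp add: S_def\<close>)
    finally have total: "contour_integral (rectpath a1 a3) \<phi> = 2 * pi * \<i> * (\<zeta> k z / fact k)" .
    have ci: "\<phi> contour_integrable_on linepath u v" if "path_image (linepath u v) \<subseteq> path_image (rectpath a1 a3)" for u v
      by (rule contour_integrable_continuous_linepath, rule continuous_on_subset[OF holomorphic_on_imp_continuous_on[OF hol\<phi>]])
        (use that sub in auto)
    have pim: "path_image (rectpath a1 a3) = path_image (linepath a1 a2) \<union> path_image (linepath a2 a3) \<union> path_image (linepath a3 a4) \<union> path_image (linepath a4 a1)"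
      unfolding rp by (simp add: path_image_join Un_assoc)
    have cis: "\<phi> contour_integrable_on linepath a1 a2" "\<phi> contour_integrable_on linepath a2 a3"
      "\<phi> contour_integrable_on linepath a3 a4" "\<phi> contour_integrable_on linepath a4 a1"
      by (rule ci, use pim in blast)+
    have split: "contour_integral (rectpath a1 a3) \<phi> = contour_integral (linepath a1 a2) \<phi> + (contour_integral (linepath a2 a3) \<phi>
      + (contour_integral (linepath a3 a4) \<phi> + contour_integral (linepath a4 a1) \<phi>))"
      unfolding rp using cis by (simp add: contour_integrable_joinI)
    have vert: "contour_integral (linepath a2 a3) \<phi> = \<i> * integral {- R..R} (\<lambda>v. \<phi> (Complex \<alpha> v))"
      by (rule contour_integral_linepath_same_Re) (use R0 in \<open>auto simp: a2_def a3_def\<close>)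
    have seg1: "R \<le> cmod l \<and> Re l \<le> 1 / 2" if "l \<in> closed_segment a1 a2" for l
    proof -
      have "Im l = - R" "Re l \<le> \<alpha>"
        using that R0 \<alpha> by (auto simp: closed_segment_same_Im a1_def a2_def closed_segment_eq_real_ivl)
      then show ?thesis using abs_Im_le_cmod[of l] \<alpha> by linarith
    qed
    have seg3: "R \<le> cmod l \<and> Re l \<le> 1 / 2" if "l \<in> closed_segment a3 a4" for l
    proof -
      have "Im l = R" "Re l \<le> \<alpha>"
        using that R0 \<alpha> by (auto simp: closed_segment_same_Im a3_def a4_def closed_segment_eq_real_ivl)
      then show ?thesis using abs_Im_le_cmod[of l] \<alpha> by linarith
    qed
    have seg4: "R \<le> cmod l \<and> Re l \<le> 1 / 2" if "l \<in> closed_segment a4 a1" for l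
    proof -
      have "Re l = - R"
        using that R0 \<alpha> by (auto simp: closed_segment_same_Re a1_def a4_def closed_segment_eq_real_ivl)
      then show ?thesis using abs_Re_le_cmod[of l] R0 by linarith
    qed
    have len: "cmod (a2 - a1) \<le> 2 * R" "cmod (a4 - a3) \<le> 2 * R" "cmod (a1 - a4) \<le> 2 * R"
      using R0 \<alpha> cmod_le[of "a2 - a1"] cmod_le[of "a4 - a3"] cmod_le[of "a1 - a4"]
      by (simp_all add: a1_def a2_def a3_def a4_def)
    define B where "B = (4 * C / R\<^sup>2) * (2 * R)"
    have bs: "cmod (contour_integral (linepath a1 a2) \<phi>) \<le> B" "cmod (contour_integral (linepath a3 a4) \<phi>) \<le> B"
      "cmod (contour_integral (linepath a4 a1) \<phi>) \<le> B"
      unfolding B_def by (rule rest[OF R]; use len seg1 seg3 seg4 in blast)+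
    have "\<i> * integral {- R..R} (\<lambda>v. \<phi> (Complex \<alpha> v)) - 2 * pi * \<i> * (\<zeta> k z / fact k)
      = - (contour_integral (linepath a1 a2) \<phi> + contour_integral (linepath a3 a4) \<phi> + contour_integral (linepath a4 a1) \<phi>)"
      using total split vert by (simp add: algebra_simps)
    also have "cmod \<dots> \<le> B + B + B"
      unfolding norm_minus_cancel by (intro order_trans[OF norm_triangle_ineq] add_mono bs)
    also have "B + B + B = 24 * C / R" using R0 by (simp add: B_def power2_eq_square)
    finally show ?thesis .
  qed
  have int: "integrable lborel (\<lambda>v. \<phi> (Complex \<alpha> v))"
    using Cauchy_line_integrable[OF assms, of k] by (simp add: \<phi>_def z_def)
  have hk: "(\<lambda>v. \<phi> (Complex \<alpha> v)) integrable_on UNIV"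
    using has_integral_integral_lborel[OF int] by blast
  have "(\<lambda>n. \<i> * integral {- real n..real n} (\<lambda>v. \<phi> (Complex \<alpha> v)) - 2 * pi * \<i> * (\<zeta> k z / fact k))
     \<longlonglongrightarrow> \<i> * integral UNIV (\<lambda>v. \<phi> (Complex \<alpha> v)) - 2 * pi * \<i> * (\<zeta> k z / fact k)"
    by (intro tendsto_intros integral_UNIV_limit hk)
  moreover have "(\<lambda>n. \<i> * integral {- real n..real n} (\<lambda>v. \<phi> (Complex \<alpha> v)) - 2 * pi * \<i> * (\<zeta> k z / fact k)) \<longlonglongrightarrow> 0"
  proof (rule Lim_null_comparison)
    show "(\<lambda>n. 24 * C / real n) \<longlonglongrightarrow> 0" by (rule lim_const_over_n)
    show "\<forall>\<^sub>F n in sequentially. cmod (\<i> * integral {- real n..real n} (\<lambda>v. \<phi> (Complex \<alpha> v)) - 2 * pi * \<i> * (\<zeta> k z / fact k)) \<le> 24 * C / real n"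
      using eventually_ge_at_top[of "nat \<lceil>2 * x + 2\<rceil>"] by eventually_elim (rule main, linarith)
  qed
  ultimately have "\<i> * integral UNIV (\<lambda>v. \<phi> (Complex \<alpha> v)) - 2 * pi * \<i> * (\<zeta> k z / fact k) = 0"
    by (rule LIMSEQ_unique)
  then have "\<i> * (integral UNIV (\<lambda>v. \<phi> (Complex \<alpha> v)) - 2 * pi * (\<zeta> k z / fact k)) = 0"
    by (simp only: right_diff_distrib mult_ac)
  then have "integral UNIV (\<lambda>v. \<phi> (Complex \<alpha> v)) - 2 * pi * (\<zeta> k z / fact k) = 0"
    unfolding mult_eq_0_iff using complex_i_not_zero by blast
  then have "integral UNIV (\<lambda>v. \<phi> (Complex \<alpha> v)) = 2 * pi * (\<zeta> k z / fact k)"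
    by (rule iffD2[OF eq_iff_diff_eq_0])
  then show ?thesis
    using integral_lborel[OF int] by (simp add: \<phi>_def z_def)
qed


text \<open>Interpolates between two lower bounds of one distance, so that the decay of the kernel
  can be shared between the variables v and x.\<close>

lemma powr_split_bound:
  fixes d :: real
  assumes "0 < c" "c * A \<le> d" "c * B \<le> d" "A > 0" "B > 0" "0 \<le> \<delta>" "\<delta> \<le> real n"
  shows "c ^ n * (A powr \<delta> * B powr (real n - \<delta>)) \<le> d ^ n"
proof -
  have d: "d > 0" using assms(1-4) by (meson less_le_trans mult_pos_pos)
  have "c ^ n * (A powr \<delta> * B powr (real n - \<delta>)) = (c * A) powr \<delta> * (c * B) powr (real n - \<delta>)"
    using assms by (simp add: powr_mult powr_realpow[symmetric] powr_diff powr_add[symmetric] field_simps)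
  also have "\<dots> \<le> d powr \<delta> * d powr (real n - \<delta>)"
    using assms by (intro mult_mono powr_mono2) auto
  also have "\<dots> = d ^ n" using d by (simp add: powr_add[symmetric] powr_realpow)
  finally show ?thesis .
qed

lemma Gamma_nonzero_right_half_plane: "Re z > 0 \<Longrightarrow> Gamma (z :: complex) \<noteq> 0"
  by (metis Gamma_eq_zero_iff nonpos_Ints_cases Re_complex_of_real of_real_of_int_eq of_int_le_0_iff not_less)

text \<open>Fubini for x powr (w + k) \<open>\<zeta> 0 z\<close> / (z + x)^(k + 1) with z on the
  line. Integrating over x first produces z powr w by the Beta type integral; integrating over z
  first produces the k-th derivative at -x by Cauchy's formula.\<close>

lemma line_integral_eq_half_line_neg:
  fixes \<zeta> :: "nat \<Rightarrow> complex \<Rightarrow> complex" and w :: complex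
  assumes \<zeta>: "decaying p \<zeta>" and p: "p \<ge> 1" and \<alpha>: "0 < \<alpha>" "\<alpha> < 1 / 2"
    and w: "Re w < 0" "Re w + real k > 0"
  shows "integral UNIV (\<lambda>v. Complex \<alpha> v powr w * \<zeta> 0 (Complex \<alpha> v))
    = 2 * pi * rGamma (- w) * rGamma (w + of_nat k + 1) * integral {0..} (\<lambda>x. of_real x powr (w + of_nat k) * \<zeta> k (- of_real x))"
proof -
  define F where "F v x = pos x *\<^sub>R (of_real x powr (w + of_nat k) * (\<zeta> 0 (Complex \<alpha> v) / (Complex \<alpha> v + of_real x) ^ Suc k))" for v x
  obtain C where C: "C \<ge> 0" "\<And>z. Re z \<le> 1 / 2 \<Longrightarrow> cmod (\<zeta> 0 z) \<le> C / (1 + cmod z) ^ (1 + 0)"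
    using decaying_bound[OF decaying_weaken[OF \<zeta> p]] by blast
  have [measurable]: "(\<lambda>v. \<zeta> 0 (Complex \<alpha> v)) \<in> borel_measurable borel"
    by (rule borel_measurable_continuous_onI[OF continuous_on_line[OF \<zeta>]]) (use \<alpha> in simp)
  have [measurable]: "(\<lambda>v. Complex \<alpha> v) \<in> borel_measurable borel"
    unfolding Complex_eq by measurable
  have Fm [measurable]: "(\<lambda>(v, x). F v x) \<in> borel_measurable (lborel \<Otimes>\<^sub>M lborel)"
    unfolding F_def by measurable
  \<comment> \<open>Half of the available room: in v the majorant has decay of order 1 +
    \<open>\<delta>\<close>, and in x its exponents at infinity add up to Re w / 2 - 1, which is
    below -1.\<close>
  define \<delta> where "\<delta> = - Re w / 2"
  have \<delta>: "\<delta> > 0" "\<delta> \<le> real (Suc k)" using w by (auto simp: \<delta>_def)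
  define c where "c = \<alpha> / 2"
  have c: "c > 0" using \<alpha> by (simp add: c_def)
  define g where "g v = (C / c ^ Suc k) * (1 + \<bar>v\<bar>) powr - (1 + \<delta>)" for v :: real
  define h where "h x = pos x * (x powr (Re w + k) * (1 + x) powr - (real (Suc k) - \<delta>))" for x
  have g: "integrable lborel g" unfolding g_def
    using \<delta> by (intro integrable_mult_right integrable_abs_powr) auto
  have h: "integrable lborel h" unfolding h_def
    by (intro integrable_powr_beta) (use w in \<open>auto simp: \<delta>_def\<close>)
  have g0: "g v \<ge> 0" for v unfolding g_def using C c by simp
  have h0: "h x \<ge> 0" for x unfolding h_def by simp
  have bound: "cmod (F v x) \<le> g v * h x" for v x
  proof (cases "x > 0")
    case True
    have d: "c * (1 + \<bar>v\<bar>) \<le> cmod (Complex \<alpha> v + of_real x)" "c * (1 + x) \<le> cmod (Complex \<alpha> v + of_real x)"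
      using line_distance[of \<alpha> x v] \<alpha> True unfolding c_def by auto
    have 1: "cmod (\<zeta> 0 (Complex \<alpha> v)) \<le> C / (1 + \<bar>v\<bar>)"
    proof -
      have "cmod (\<zeta> 0 (Complex \<alpha> v)) \<le> C / (1 + cmod (Complex \<alpha> v))" using C(2)[of "Complex \<alpha> v"] \<alpha> by simp
      also have "\<dots> \<le> C / (1 + \<bar>v\<bar>)"
        using C(1) abs_Im_le_cmod[of "Complex \<alpha> v"] by (intro divide_left_mono mult_pos_pos) (auto intro: add_pos_nonneg)
      finally show ?thesis .
    qed
    have 2: "c ^ Suc k * ((1 + \<bar>v\<bar>) powr \<delta> * (1 + x) powr (real (Suc k) - \<delta>)) \<le> cmod (Complex \<alpha> v + of_real x) ^ Suc k"
      by (rule powr_split_bound[OF c d]) (use True \<delta> in auto)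
    have 3: "0 < c ^ Suc k * ((1 + \<bar>v\<bar>) powr \<delta> * (1 + x) powr (real (Suc k) - \<delta>))"
      using c True by (simp add: add_nonneg_eq_0_iff)
    have "cmod (\<zeta> 0 (Complex \<alpha> v) / (Complex \<alpha> v + of_real x) ^ Suc k)
      \<le> (C / (1 + \<bar>v\<bar>)) / (c ^ Suc k * ((1 + \<bar>v\<bar>) powr \<delta> * (1 + x) powr (real (Suc k) - \<delta>)))"
      unfolding norm_divide norm_power by (rule frac_le[OF _ 1 3 2]) (use C in auto)
    also have "\<dots> = (C / c ^ Suc k) * ((1 + \<bar>v\<bar>) powr - (1 + \<delta>) * (1 + x) powr - (real (Suc k) - \<delta>))"
    proof -
      have "(1 + \<bar>v\<bar>) powr - (1 + \<delta>) = inverse ((1 + \<bar>v\<bar>) * (1 + \<bar>v\<bar>) powr \<delta>)"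
        unfolding powr_minus powr_add by simp
      then show ?thesis unfolding powr_minus[of "1 + x"] by (simp add: divide_inverse mult_ac)
    qed
    finally have "x powr (Re w + k) * cmod (\<zeta> 0 (Complex \<alpha> v) / (Complex \<alpha> v + of_real x) ^ Suc k)
      \<le> x powr (Re w + k) * ((C / c ^ Suc k) * ((1 + \<bar>v\<bar>) powr - (1 + \<delta>) * (1 + x) powr - (real (Suc k) - \<delta>)))"
      by (rule mult_left_mono) simp
    moreover have "cmod (F v x) = x powr (Re w + k) * cmod (\<zeta> 0 (Complex \<alpha> v) / (Complex \<alpha> v + of_real x) ^ Suc k)"
      using True by (simp add: F_def norm_mult norm_of_real_powr del: times_divide_eq_right power_Suc)
    moreover have "x powr (Re w + k) * ((C / c ^ Suc k) * ((1 + \<bar>v\<bar>) powr - (1 + \<delta>) * (1 + x) powr - (real (Suc k) - \<delta>))) = g v * h x"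
      using True by (simp add: g_def h_def del: power_Suc of_nat_Suc)
    ultimately show ?thesis by simp
  qed (simp add: F_def h_def)
  have "integrable (lborel \<Otimes>\<^sub>M lborel) (\<lambda>(v, x). F v x)"
  proof (rule Bochner_Integration.integrable_bound)
    show "integrable (lborel \<Otimes>\<^sub>M lborel) (\<lambda>(v, x). g v * h x)"
    proof (rule lborel_pair.Fubini_integrable)
      have [measurable]: "g \<in> borel_measurable borel" "h \<in> borel_measurable borel" using g h by auto
      show "(\<lambda>(v, x). g v * h x) \<in> borel_measurable (lborel \<Otimes>\<^sub>M lborel)" by measurable
      have "(\<integral>x. norm (g v * h x) \<partial>lborel) = g v * integral\<^sup>L lborel h" for v
        using g0 h0 by (simp add: abs_mult)
      then show "integrable lborel (\<lambda>v. \<integral>x. norm (case (v, x) of (v, x) \<Rightarrow> g v * h x) \<partial>lborel)"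
        using g by simp
      show "AE v in lborel. integrable lborel (\<lambda>x. case (v, x) of (v, x) \<Rightarrow> g v * h x)"
        using h by simp
    qed
    show "AE p in lborel \<Otimes>\<^sub>M lborel. norm (case p of (v, x) \<Rightarrow> F v x) \<le> norm (case p of (v, x) \<Rightarrow> g v * h x)"
      using bound g0 h0 by (intro AE_I2) (auto simp: abs_mult)
  qed (rule Fm)
  then have swap: "(\<integral>x. (\<integral>v. F v x \<partial>lborel) \<partial>lborel) = (\<integral>v. (\<integral>x. F v x \<partial>lborel) \<partial>lborel)"
    and int1: "integrable lborel (\<lambda>x. \<integral>v. F v x \<partial>lborel)" and int2: "integrable lborel (\<lambda>v. \<integral>x. F v x \<partial>lborel)"
    using lborel_pair.Fubini_integral lborel_pair.integrable_fst' lborel_pair.integrable_snd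
    by (auto dest: lborel_pair.integrable_fst')
  define G where "G = Gamma (w + of_nat k + 1) * Gamma (- w) / fact k"
  have inner_x: "(\<integral>x. F v x \<partial>lborel) = G * (Complex \<alpha> v powr w * \<zeta> 0 (Complex \<alpha> v))" for v
  proof -
    define f where "f x = of_real x powr (w + of_nat k) / (Complex \<alpha> v + of_real x) ^ Suc k" for x
    have F_eq: "F v x = \<zeta> 0 (Complex \<alpha> v) * (pos x *\<^sub>R f x)" for x
      by (simp add: F_def f_def)
    have fc: "continuous_on {0..} f" unfolding f_def
      by (rule Beta_type_integrand_continuous) (use w \<alpha> in auto)
    have "integrable lborel (\<lambda>x. pos x *\<^sub>R f x)"
    proof (rule Bochner_Integration.integrable_bound)
      show "integrable lborel (\<lambda>x. (1 / c ^ Suc k) * (pos x * (x powr (Re w + k) * (1 + x) powr - real (Suc k))))"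
        by (intro integrable_mult_right integrable_powr_beta) (use w in auto)
      show "(\<lambda>x. pos x *\<^sub>R f x) \<in> borel_measurable lborel" unfolding f_def by measurable
      show "AE x in lborel. norm (pos x *\<^sub>R f x) \<le> norm ((1 / c ^ Suc k) * (pos x * (x powr (Re w + k) * (1 + x) powr - real (Suc k))))"
      proof (rule AE_I2)
        fix x :: real
        show "norm (pos x *\<^sub>R f x) \<le> norm ((1 / c ^ Suc k) * (pos x * (x powr (Re w + k) * (1 + x) powr - real (Suc k))))"
        proof (cases "x > 0")
          case True
          have "(c * (1 + x)) ^ Suc k \<le> cmod (Complex \<alpha> v + of_real x) ^ Suc k"
            using line_distance(2)[of \<alpha> x v] \<alpha> True c unfolding c_def by (intro power_mono) auto
          moreover have "0 < (c * (1 + x)) ^ Suc k" using c True by (intro zero_less_power mult_pos_pos) auto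
          ultimately have "x powr (Re w + k) / cmod (Complex \<alpha> v + of_real x) ^ Suc k \<le> x powr (Re w + k) / (c * (1 + x)) ^ Suc k"
            by (intro frac_le) auto
          also have "\<dots> = (1 / c ^ Suc k) * (x powr (Re w + k) * (1 + x) powr - real (Suc k))"
            using True by (simp only: powr_minus powr_realpow add_pos_pos zero_less_one power_mult_distrib) (simp add: divide_inverse)
          finally show ?thesis
            using True c by (simp add: f_def norm_divide norm_power norm_of_real_powr del: power_Suc of_nat_Suc)
        qed simp
      qed
    qed
    from half_line_integral(1)[OF this]
    have "(\<integral>x. pos x *\<^sub>R f x \<partial>lborel) = Complex \<alpha> v powr w * G"
      using Beta_type_integral[OF w, of "Complex \<alpha> v"] \<alpha> by (simp add: f_def G_def)
    then show ?thesis unfolding F_eq integral_mult_right_zero by simp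
  qed
  have inner_v: "(\<integral>v. F v x \<partial>lborel) = (2 * pi / fact k) * (pos x *\<^sub>R (of_real x powr (w + of_nat k) * \<zeta> k (- of_real x)))" for x
  proof (cases "x > 0")
    case True
    have F_eq: "F v x = of_real x powr (w + of_nat k) * (\<zeta> 0 (Complex \<alpha> v) / (Complex \<alpha> v + of_real x) ^ Suc k)" for v
      using True by (simp add: F_def)
    show ?thesis
      unfolding F_eq integral_mult_right_zero
      using Cauchy_formula_line[OF \<zeta> p \<alpha>, of x k] True by (simp del: power_Suc)
  qed (simp add: F_def)
  have "Re (- w) > 0" "Re (w + of_nat k + 1) > 0" using w by auto
  then have "Gamma (- w) \<noteq> 0" "Gamma (w + of_nat k + 1) \<noteq> 0"
    using Gamma_nonzero_right_half_plane by blast+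
  then have G0: "G \<noteq> 0" and G_inv: "rGamma (- w) * rGamma (w + of_nat k + 1) = 1 / (fact k * G)"
    by (simp_all add: G_def rGamma_inverse_Gamma field_simps)
  have intL: "integrable lborel (\<lambda>v. Complex \<alpha> v powr w * \<zeta> 0 (Complex \<alpha> v))"
  proof -
    have "integrable lborel (\<lambda>v. inverse G * (G * (Complex \<alpha> v powr w * \<zeta> 0 (Complex \<alpha> v))))"
      using int2 unfolding inner_x by (rule integrable_mult_right)
    then show ?thesis using G0 by (simp add: mult.assoc[symmetric])
  qed
  have intR: "integrable lborel (\<lambda>x. pos x *\<^sub>R (of_real x powr (w + of_nat k) * \<zeta> k (- of_real x)))"
  proof -
    have "integrable lborel (\<lambda>x. (fact k / (2 * pi)) * ((2 * pi / fact k) * (pos x *\<^sub>R (of_real x powr (w + of_nat k) * \<zeta> k (- of_real x)))))"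
      using int1 unfolding inner_v by (rule integrable_mult_right)
    then show ?thesis by (simp add: mult.assoc[symmetric])
  qed
  have "(2 * pi / fact k) * integral {0..} (\<lambda>x. of_real x powr (w + of_nat k) * \<zeta> k (- of_real x))
    = G * integral UNIV (\<lambda>v. Complex \<alpha> v powr w * \<zeta> 0 (Complex \<alpha> v))"
    using swap unfolding inner_x inner_v integral_mult_right_zero half_line_integral(1)[OF intR] integral_lborel[OF intL] by simp
  then have lhs: "integral UNIV (\<lambda>v. Complex \<alpha> v powr w * \<zeta> 0 (Complex \<alpha> v))
    = (1 / G) * ((2 * pi / fact k) * integral {0..} (\<lambda>x. of_real x powr (w + of_nat k) * \<zeta> k (- of_real x)))"
    using G0 by simp
  have "(1 / G) * ((2 * pi / fact k) * z) = 2 * pi * (rGamma (- w) * rGamma (w + of_nat k + 1)) * z" for z :: complex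
    unfolding G_inv by (simp add: field_simps)
  then show ?thesis unfolding lhs by (simp only: mult.assoc)
qed


section \<open>Extension to exponents with nonnegative real part\<close>

lemma integrable_on_half_line_powr:
  assumes "e > 1"
  shows "(\<lambda>x :: real. (1 + x) powr - e) integrable_on {0..}"
proof -
  have "set_integrable lborel {0..} (\<lambda>v :: real. (1 + \<bar>v\<bar>) powr - e)"
    unfolding set_integrable_def by (rule integrable_mult_indicator[OF _ integrable_abs_powr[OF assms]]) simp
  then have "(\<lambda>v :: real. (1 + \<bar>v\<bar>) powr - e) integrable_on {0..}"
    by (rule set_borel_integral_eq_integral(1))
  then show ?thesis by (rule integrable_eq) auto
qed

text \<open>The derivatives of z times \<open>\<zeta> 0 z\<close> by Leibniz, at the cost of one
  order of decay. At j = 0 the truncated index j - 1 is harmless because its coefficient is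
  0.\<close>

lemma decaying_mult_ident:
  fixes \<zeta> :: "nat \<Rightarrow> complex \<Rightarrow> complex"
  assumes \<zeta>: "decaying (Suc p) \<zeta>"
  shows "decaying p (\<lambda>j z. z * \<zeta> j z + of_nat j * \<zeta> (j - 1) z)"
  unfolding decaying_def
proof (intro conjI allI impI)
  fix j and z :: complex assume z: "Re z < 1"
  note d = decayingD[OF \<zeta> z]
  have "((\<lambda>z. z * \<zeta> j z + of_nat j * \<zeta> (j - 1) z) has_field_derivative
    (1 * \<zeta> j z + \<zeta> (Suc j) z * z) + of_nat j * \<zeta> (Suc (j - 1)) z) (at z)"
    by (intro DERIV_add DERIV_mult DERIV_ident DERIV_cmult d)
  then show "((\<lambda>z. z * \<zeta> j z + of_nat j * \<zeta> (j - 1) z) has_field_derivative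
    z * \<zeta> (Suc j) z + of_nat (Suc j) * \<zeta> (Suc j - 1) z) (at z)"
    by (rule back_subst[where P = "\<lambda>D. (_ has_field_derivative D) _"]) (cases j; simp add: algebra_simps)
next
  fix j
  obtain C where C: "C \<ge> 0" "\<And>z. Re z \<le> 1 / 2 \<Longrightarrow> cmod (\<zeta> j z) \<le> C / (1 + cmod z) ^ (Suc p + j)"
    using decaying_bound[OF \<zeta>] by blast
  obtain C' where C': "C' \<ge> 0" "\<And>z. Re z \<le> 1 / 2 \<Longrightarrow> cmod (\<zeta> (j - 1) z) \<le> C' / (1 + cmod z) ^ (Suc p + (j - 1))"
    using decaying_bound[OF \<zeta>] by blast
  have "cmod (z * \<zeta> j z + of_nat j * \<zeta> (j - 1) z) \<le> (C + real j * C') / (1 + cmod z) ^ (p + j)" if z: "Re z \<le> 1 / 2" for z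
  proof -
    have pos: "(1 + cmod z) ^ n > 0" for n by (intro zero_less_power add_pos_nonneg) auto
    have "cmod z * cmod (\<zeta> j z) \<le> (1 + cmod z) * (C / (1 + cmod z) ^ (Suc p + j))"
      using C(2)[OF z] by (intro mult_mono) auto
    also have "\<dots> = C / (1 + cmod z) ^ (p + j)"
    proof -
      have "t * (C / t ^ (Suc p + j)) = C / t ^ (p + j)" if "t > 0" for t :: real using that by simp
      then show ?thesis using pos[of 1] by simp
    qed
    finally have 1: "cmod z * cmod (\<zeta> j z) \<le> C / (1 + cmod z) ^ (p + j)" .
    have 2: "real j * cmod (\<zeta> (j - 1) z) \<le> real j * (C' / (1 + cmod z) ^ (p + j))"
    proof (cases "j = 0")
      case False
      then have e: "Suc p + (j - 1) = p + j" by simp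
      show ?thesis using C'(2)[OF z] unfolding e by (rule mult_left_mono) simp
    qed simp
    have "cmod (z * \<zeta> j z + of_nat j * \<zeta> (j - 1) z) \<le> cmod z * cmod (\<zeta> j z) + real j * cmod (\<zeta> (j - 1) z)"
      using norm_triangle_ineq[of "z * \<zeta> j z" "of_nat j * \<zeta> (j - 1) z"] by (simp add: norm_mult)
    with 1 2 show ?thesis by (simp add: add_divide_distrib)
  qed
  then show "\<exists>C. \<forall>z. Re z \<le> 1 / 2 \<longrightarrow> cmod (z * \<zeta> j z + of_nat j * \<zeta> (j - 1) z) \<le> C / (1 + cmod z) ^ (p + j)"
    by blast
qed

lemma decaying_half_line:
  fixes \<zeta> :: "nat \<Rightarrow> complex \<Rightarrow> complex" and u :: complex
  assumes \<zeta>: "decaying p \<zeta>" and u: "Re u > 0" "Re u + 1 < real (p + k)"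
  shows "(\<lambda>x. of_real x powr u * \<zeta> k (- of_real x)) integrable_on {0..}"
    "continuous_on {0..} (\<lambda>x. of_real x powr u * \<zeta> k (- of_real x))"
proof -
  obtain C where C: "C \<ge> 0" "\<And>z. Re z \<le> 1 / 2 \<Longrightarrow> cmod (\<zeta> k z) \<le> C / (1 + cmod z) ^ (p + k)"
    using decaying_bound[OF \<zeta>] by blast
  show c: "continuous_on {0..} (\<lambda>x. of_real x powr u * \<zeta> k (- of_real x))"
  proof (intro continuous_on_mult continuous_on_of_real_powr u)
    show "continuous_on {0..} (\<lambda>x. \<zeta> k (- of_real x))"
      by (rule continuous_on_compose2[OF decaying_continuous[OF \<zeta>, of k]]) (auto intro!: continuous_intros)
  qed
  show "(\<lambda>x. of_real x powr u * \<zeta> k (- of_real x)) integrable_on {0..}"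
  proof (rule integrable_on_dominated[OF _ c])
    have "(\<lambda>x :: real. (1 + x) powr - (real (p + k) - Re u)) integrable_on {0..}"
      by (rule integrable_on_half_line_powr) (use u in simp)
    from integrable_cmul[OF this, of C]
    show "(\<lambda>x. C * (1 + x) powr - (real (p + k) - Re u)) integrable_on {0..}" by simp
    fix x :: real assume "x \<in> {0..}"
    then have x: "x \<ge> 0" by simp
    have "cmod (complex_of_real x powr u) \<le> (1 + x) powr Re u"
      using x u by (simp add: norm_powr_real_powr powr_mono2)
    moreover have "cmod (\<zeta> k (- of_real x)) \<le> C / (1 + x) ^ (p + k)"
      using C(2)[of "- of_real x"] x by simp
    ultimately have "cmod (of_real x powr u * \<zeta> k (- of_real x)) \<le> (1 + x) powr Re u * (C / (1 + x) ^ (p + k))"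
      unfolding norm_mult by (intro mult_mono) auto
    also have "\<dots> = C * ((1 + x) powr Re u / (1 + x) powr real (p + k))"
      using x powr_realpow[of "1 + x" "p + k"] by (simp del: of_nat_add)
    also have "\<dots> = C * (1 + x) powr - (real (p + k) - Re u)"
      unfolding powr_diff[symmetric] by simp
    finally show "cmod (of_real x powr u * \<zeta> k (- of_real x)) \<le> C * (1 + x) powr - (real (p + k) - Re u)" .
  qed simp
qed

text \<open>Both boundary terms vanish: at 0 because Re u is positive, at infinity because Re u < p
  + k.\<close>

lemma half_line_by_parts:
  fixes \<zeta> :: "nat \<Rightarrow> complex \<Rightarrow> complex" and u :: complex
  assumes \<zeta>: "decaying p \<zeta>" and u: "Re u > 1" "Re u < real (p + k)"
  shows "u * integral {0..} (\<lambda>x. of_real x powr (u - 1) * \<zeta> k (- of_real x))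
    = integral {0..} (\<lambda>x. of_real x powr u * \<zeta> (Suc k) (- of_real x))"
proof -
  define A where "A x = of_real x powr (u - 1) * \<zeta> k (- of_real x)" for x
  define B where "B x = of_real x powr u * \<zeta> (Suc k) (- of_real x)" for x
  define H where "H x = of_real x powr u * \<zeta> k (- of_real x)" for x
  have A: "A integrable_on {0..}" unfolding A_def by (rule decaying_half_line[OF \<zeta>]) (use u in auto)
  have B: "B integrable_on {0..}" unfolding B_def by (rule decaying_half_line[OF \<zeta>]) (use u in auto)
  have Hc: "continuous_on {0..} H"
    unfolding H_def
  proof (intro continuous_on_mult continuous_on_of_real_powr)
    show "continuous_on {0..} (\<lambda>x. \<zeta> k (- of_real x))"
      by (rule continuous_on_compose2[OF decaying_continuous[OF \<zeta>, of k]]) (auto intro!: continuous_intros)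
  qed (use u in auto)
  have der: "(H has_vector_derivative u * A x - B x) (at x)" if x: "x > 0" for x
  proof -
    have 1: "((\<lambda>z. z powr u * \<zeta> k (- z)) has_field_derivative
      (u * of_real x powr (u - 1)) * \<zeta> k (- of_real x) + (\<zeta> (Suc k) (- of_real x) * (- 1)) * of_real x powr u) (at (of_real x))"
    proof (rule DERIV_mult)
      show "((\<lambda>z. z powr u) has_field_derivative u * of_real x powr (u - 1)) (at (of_real x))"
        by (rule has_field_derivative_powr) (use x in \<open>auto simp: complex_nonpos_Reals_iff\<close>)
      show "((\<lambda>z. \<zeta> k (- z)) has_field_derivative \<zeta> (Suc k) (- of_real x) * (- 1)) (at (of_real x))"
        by (rule DERIV_chain2[OF decayingD[OF \<zeta>]]) (use x in \<open>auto intro!: derivative_eq_intros\<close>)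
    qed
    have 2: "(of_real has_vector_derivative 1) (at x)"
      using has_vector_derivative_of_real[OF DERIV_ident[of "at x"]] by simp
    from field_vector_diff_chain_at[OF 2 1]
    show ?thesis by (simp add: o_def H_def[abs_def] A_def B_def algebra_simps)
  qed
  have H_le: "\<exists>C. \<forall>x\<ge>0. cmod (H x) \<le> C * (1 + x) powr (Re u - real (p + k))"
  proof -
    obtain C where C: "C \<ge> 0" "\<And>z. Re z \<le> 1 / 2 \<Longrightarrow> cmod (\<zeta> k z) \<le> C / (1 + cmod z) ^ (p + k)"
      using decaying_bound[OF \<zeta>] by blast
    have "cmod (H x) \<le> C * (1 + x) powr (Re u - real (p + k))" if x: "x \<ge> 0" for x
    proof -
      have "cmod (complex_of_real x powr u) \<le> (1 + x) powr Re u"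
        using x u by (simp add: norm_powr_real_powr powr_mono2)
      moreover have "cmod (\<zeta> k (- of_real x)) \<le> C / (1 + x) ^ (p + k)"
        using C(2)[of "- of_real x"] x by simp
      ultimately have "cmod (H x) \<le> (1 + x) powr Re u * (C / (1 + x) ^ (p + k))"
        unfolding H_def norm_mult by (intro mult_mono) auto
      also have "\<dots> = C * ((1 + x) powr Re u / (1 + x) powr real (p + k))"
        using x powr_realpow[of "1 + x" "p + k"] by (simp del: of_nat_add)
      finally show ?thesis unfolding powr_diff[symmetric] .
    qed
    then show ?thesis by blast
  qed
  then obtain C where C: "\<And>x. x \<ge> 0 \<Longrightarrow> cmod (H x) \<le> C * (1 + x) powr (Re u - real (p + k))" by blast
  have Ai: "(\<lambda>x. u * A x) integrable_on {0..}" using A by (rule integrable_on_mult_right)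
  have fin: "integral {0..real n} (\<lambda>x. u * A x - B x) = H (real n)" for n
  proof -
    have "((\<lambda>x. u * A x - B x) has_integral H (real n) - H 0) {0..real n}"
      by (rule fundamental_theorem_of_calculus_interior)
        (auto intro!: der continuous_on_subset[OF Hc])
    moreover have "H 0 = 0" using u by (simp add: H_def)
    ultimately show ?thesis by (simp add: integral_unique)
  qed
  have "(\<lambda>n. H (real n)) \<longlonglongrightarrow> integral {0..} (\<lambda>x. u * A x - B x)"
    using integral_atLeast_limit[OF integrable_diff[OF Ai B]] unfolding fin .
  moreover have "(\<lambda>n. H (real n)) \<longlonglongrightarrow> 0"
  proof (rule Lim_null_comparison)
    show "\<forall>\<^sub>F n in sequentially. cmod (H (real n)) \<le> C * (1 + real n) powr (Re u - real (p + k))"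
      by (intro always_eventually allI C) simp
    have "filterlim (\<lambda>n. 1 + real n) at_top sequentially"
      by (intro filterlim_tendsto_add_at_top[OF tendsto_const] filterlim_real_sequentially)
    then have "(\<lambda>n. C * (1 + real n) powr (Re u - real (p + k))) \<longlonglongrightarrow> C * 0"
      by (intro tendsto_mult tendsto_const tendsto_neg_powr) (use u in auto)
    then show "(\<lambda>n. C * (1 + real n) powr (Re u - real (p + k))) \<longlonglongrightarrow> 0" by simp
  qed
  ultimately have "integral {0..} (\<lambda>x. u * A x - B x) = 0" by (rule LIMSEQ_unique)
  then have "u * integral {0..} A - integral {0..} B = 0"
    using Henstock_Kurzweil_Integration.integral_diff[OF Ai B] by simp
  then show ?thesis unfolding A_def[abs_def] B_def[abs_def] by simp
qed

text \<open>The Beta type integral requires Re w < 0. The induction step moves a factor z from the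
  power into the function, lowering w by 1 and using up one order of decay; integration by parts
  brings the half line integral back to the original function.\<close>

theorem line_integral_eq_half_line:
  fixes \<zeta> :: "nat \<Rightarrow> complex \<Rightarrow> complex" and w :: complex
  assumes "decaying (Suc p) \<zeta>" and \<alpha>: "0 < \<alpha>" "\<alpha> < 1 / 2"
    and "Re w < real p" "Re w + real k > real p"
  shows "integral UNIV (\<lambda>v. Complex \<alpha> v powr w * \<zeta> 0 (Complex \<alpha> v))
    = 2 * pi * rGamma (- w) * rGamma (w + of_nat k + 1) * integral {0..} (\<lambda>x. of_real x powr (w + of_nat k) * \<zeta> k (- of_real x))"
  using assms(1,4,5)
proof (induction p arbitrary: \<zeta> w)
  case 0
  then show ?case using line_integral_eq_half_line_neg[of 1 \<zeta> \<alpha> w k] \<alpha> by simp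
next
  case (Suc p)
  note \<zeta> = Suc.prems(1) and w = Suc.prems(2,3)
  define \<zeta>' where "\<zeta>' j z = z * \<zeta> j z + of_nat j * \<zeta> (j - 1) z" for j z
  have \<zeta>': "decaying (Suc p) \<zeta>'" unfolding \<zeta>'_def by (rule decaying_mult_ident[OF \<zeta>])
  obtain j where k: "k = Suc j" using w by (cases k) auto
  define u where "u = w + of_nat k"
  have Re_u: "Re u = Re w + real k" by (simp add: u_def)
  have u: "Re u > 1" using w Re_u by simp
  then have u0: "u \<noteq> 0" by auto
  define J where "J = integral {0..} (\<lambda>x. of_real x powr u * \<zeta> k (- of_real x))"
  define J' where "J' = integral {0..} (\<lambda>x. of_real x powr (u - 1) * \<zeta> j (- of_real x))"
  have parts: "u * J' = J"
    unfolding J_def J'_def k by (rule half_line_by_parts[OF \<zeta>]) (use u w Re_u k in auto)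
  have i1: "(\<lambda>x. of_real x powr u * \<zeta> k (- of_real x)) integrable_on {0..}"
    by (rule decaying_half_line[OF \<zeta>]) (use u w Re_u in auto)
  have i2: "(\<lambda>x. of_real x powr (u - 1) * \<zeta> j (- of_real x)) integrable_on {0..}"
    by (rule decaying_half_line[OF \<zeta>]) (use u w Re_u k in auto)
  have "integral {0..} (\<lambda>x. of_real x powr (u - 1) * \<zeta>' k (- of_real x)) =
    integral {0..} (\<lambda>x. of_nat k * (of_real x powr (u - 1) * \<zeta> j (- of_real x)) - of_real x powr u * \<zeta> k (- of_real x))"
  proof (rule integral_cong)
    fix x :: real assume "x \<in> {0..}"
    then have "of_real x powr (u - 1) * of_real x = complex_of_real x powr u"
      using u by (cases "x = 0") (auto simp: powr_diff)
    then show "of_real x powr (u - 1) * \<zeta>' k (- of_real x) =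
       of_nat k * (of_real x powr (u - 1) * \<zeta> j (- of_real x)) - of_real x powr u * \<zeta> k (- of_real x)"
      by (simp add: \<zeta>'_def k algebra_simps)
  qed
  also have "\<dots> = of_nat k * J' - J"
    unfolding J_def J'_def
    using Henstock_Kurzweil_Integration.integral_diff[OF integrable_on_mult_right[OF i2, of "of_nat k"] i1] by simp
  also have "\<dots> = (of_nat k - u) * J'" unfolding parts[symmetric] by (simp only: left_diff_distrib)
  also have "\<dots> = (- w / u) * J"
    using u0 unfolding parts[symmetric] by (simp add: u_def)
  finally have rhs: "integral {0..} (\<lambda>x. of_real x powr (u - 1) * \<zeta>' k (- of_real x)) = (- w / u) * J" .
  have "Re (w - 1) < real p" "Re (w - 1) + real k > real p" using w by auto
  from Suc.IH[OF \<zeta>' this]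
  have e1: "integral UNIV (\<lambda>v. Complex \<alpha> v powr (w - 1) * \<zeta>' 0 (Complex \<alpha> v)) =
    2 * pi * rGamma (- (w - 1)) * rGamma (w - 1 + of_nat k + 1) * ((- w / u) * J)"
    using rhs by (simp add: u_def algebra_simps)
  have e2: "Complex \<alpha> v powr (w - 1) * \<zeta>' 0 (Complex \<alpha> v) = Complex \<alpha> v powr w * \<zeta> 0 (Complex \<alpha> v)" for v
    using \<alpha> by (simp add: \<zeta>'_def powr_diff complex_eq_iff)
  have e3: "2 * pi * rGamma (- (w - 1)) * rGamma (w - 1 + of_nat k + 1) * ((- w / u) * J)
    = 2 * pi * ((- w) * rGamma (- w + 1)) * (rGamma u / u) * J"
    by (simp add: u_def algebra_simps)
  \<comment> \<open>The recurrence of the reciprocal Gamma function, at - w and at u, absorbs the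
    factor - w / u left by the integration by parts.\<close>
  have e4: "(- w) * rGamma (- w + 1) = rGamma (- w)" by (rule rGamma_plus1)
  have e5: "rGamma u / u = rGamma (u + 1)" using rGamma_plus1[of u] u0 by (simp add: field_simps)
  show ?case using e1 unfolding e2 e3 e4 e5 by (simp only: u_def J_def)
qed


section \<open>Resolvents of the squared operator\<close>

locale spectral_triple =
  fixes N \<A> :: "('h::complex_hilbert_space \<Rightarrow>\<^sub>L 'h) set" and \<tau> :: "('h \<Rightarrow>\<^sub>L 'h) \<Rightarrow> ennreal"
    and D :: "'h op_graph"
  assumes triple: "semifinite_spectral_triple N \<tau> \<A> D"
begin

sublocale semifinite_algebra N \<tau>
  using triple by unfold_locales (auto simp: semifinite_spectral_triple_def)

section \<open>The graph of the self-adjoint operator and the inversion of its square\<close>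

lemma D_dense: "closure (Domain D) = UNIV" and D_adjoint: "adjoint_graph D = D"
  using triple by (auto simp: semifinite_spectral_triple_def self_adjoint_def)

lemma D_symmetric:
  assumes "(x, y) \<in> D" "(x', y') \<in> D"
  shows "cinner y x' = cinner x y'"
proof -
  have "(x', y') \<in> adjoint_graph D" using assms(2) D_adjoint by simp
  then show ?thesis using assms(1) by (auto simp: adjoint_graph_def)
qed

text \<open>\<open>D\<close> is just a set of pairs; its linearity comes from equality with its
  adjoint graph, which is cut out by linear conditions.\<close>

lemma D_add: "(x, y) \<in> D \<Longrightarrow> (x', y') \<in> D \<Longrightarrow> (x + x', y + y') \<in> D"
  by (subst D_adjoint[symmetric])
    (auto simp: adjoint_graph_def cinner_simps D_symmetric)

lemma D_scaleC: "(x, y) \<in> D \<Longrightarrow> (c *\<^sub>C x, c *\<^sub>C y) \<in> D"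
  by (subst D_adjoint[symmetric])
    (auto simp: adjoint_graph_def cinner_simps D_symmetric)

lemma D_minus: "(x, y) \<in> D \<Longrightarrow> (- x, - y) \<in> D"
  using D_scaleC[of x y "-1"] by simp

lemma D_diff: "(x, y) \<in> D \<Longrightarrow> (x', y') \<in> D \<Longrightarrow> (x - x', y - y') \<in> D"
  using D_add[of x y "- x'" "- y'"] D_minus[of x' y'] by simp

lemma Domain_orthogonal:
  assumes "\<And>x. x \<in> Domain D \<Longrightarrow> cinner x z = 0"
  shows "z = 0"
proof -
  have "continuous_on UNIV (\<lambda>x. cinner x z)"
    by (intro bounded_bilinear.continuous_on[OF bounded_bilinear_cinner] continuous_intros)
  then have "closed {x. cinner x z = 0}"
    using closed_Collect_eq[of "\<lambda>x. cinner x z" "\<lambda>_. 0"] by auto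
  then have "closure (Domain D) \<subseteq> {x. cinner x z = 0}"
    using assms by (intro closure_minimal) auto
  then have "cinner z z = 0" using D_dense by auto
  then show ?thesis by (simp add: cinner_self)
qed

text \<open>A pair (0, z) in \<open>D\<close> forces z to be orthogonal to the dense domain, hence
  zero.\<close>

lemma D_unique: "(x, y) \<in> D \<Longrightarrow> (x, y') \<in> D \<Longrightarrow> y = y'"
proof -
  assume "(x, y) \<in> D" "(x, y') \<in> D"
  then have *: "(0, y - y') \<in> D" using D_diff[of x y x y'] by simp
  have "y - y' = 0"
  proof (rule Domain_orthogonal)
    fix a assume "a \<in> Domain D"
    then obtain b where "(a, b) \<in> D" by blast
    from D_symmetric[OF this *] show "cinner a (y - y') = 0" by simp
  qed
  then show ?thesis by simp
qed

lemma compact_ideal_subset: "compact_ideal N \<tau> \<subseteq> N"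
proof -
  have "closed N"
    unfolding closed_sequential_limits using N_limit by blast
  then have "closed_ideal N N"
    unfolding closed_ideal_def by (auto intro: N_closed)
  then show ?thesis unfolding compact_ideal_def by blast
qed

lemma D_resolvent:
  assumes "w \<notin> \<real>"
  obtains T where "T \<in> N" "\<And>y. (T y, w *\<^sub>C T y - y) \<in> D" "\<And>x u. (x, u) \<in> D \<Longrightarrow> T (w *\<^sub>C x - u) = x"
proof -
  obtain T where T: "T \<in> compact_ideal N \<tau>" "graph_of T = (scalar_minus w D)\<inverse>"
    using triple assms unfolding semifinite_spectral_triple_def by blast
  have "(T y, w *\<^sub>C T y - y) \<in> D" for y
  proof -
    have "(y, T y) \<in> (scalar_minus w D)\<inverse>" unfolding T(2)[symmetric] graph_of_def by blast
    then obtain u where "(T y, u) \<in> D" "y = w *\<^sub>C T y - u" unfolding scalar_minus_def by auto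
    then show ?thesis by (metis diff_diff_eq2 add_diff_cancel_left' add.commute diff_add_cancel)
  qed
  moreover have "T (w *\<^sub>C x - u) = x" if "(x, u) \<in> D" for x u
  proof -
    have "(w *\<^sub>C x - u, x) \<in> graph_of T" unfolding T(2) scalar_minus_def using that by auto
    then show ?thesis by (auto simp: graph_of_def)
  qed
  ultimately show ?thesis using that T(1) compact_ideal_subset by blast
qed

lemma csqrt_nonreal:
  assumes "Re z < 1"
  shows "csqrt (z - 1) \<notin> \<real>" "- csqrt (z - 1) \<notin> \<real>"
proof -
  show *: "csqrt (z - 1) \<notin> \<real>"
  proof
    assume "csqrt (z - 1) \<in> \<real>"
    then obtain r where "csqrt (z - 1) = of_real r" by (auto elim: Reals_cases)
    then have "z - 1 = of_real (r\<^sup>2)" by (metis power2_csqrt of_real_power)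
    then have "Re (z - 1) = r\<^sup>2" by simp
    then show False using assms zero_le_power2[of r] by simp
  qed
  then show "- csqrt (z - 1) \<notin> \<real>" by (simp add: Reals_minus_iff)
qed

text \<open>R is the inverse of z - 1 - D^2, expressed through the graph; the vector u is D R y.
  Density of the range is recorded because the approximate unit is first shown to converge on the
  range of a resolvent.\<close>

definition is_res :: "complex \<Rightarrow> ('h \<Rightarrow>\<^sub>L 'h) \<Rightarrow> bool" where
  "is_res z R \<longleftrightarrow> R \<in> N \<and> (\<forall>y. \<exists>u. (R y, u) \<in> D \<and> (u, (z - 1) *\<^sub>C R y - y) \<in> D) \<and>
     (\<forall>x u v. (x, u) \<in> D \<longrightarrow> (u, v) \<in> D \<longrightarrow> R ((z - 1) *\<^sub>C x - v) = x) \<and>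
     closure (range (blinfun_apply R)) = UNIV"

text \<open>Factor z - 1 - D^2 as (w - D) (w + D) with w^2 = z - 1. For Re z < 1 both w and - w are
  non-real, so each factor is inverted by a resolvent of \<open>D\<close>. As \<open>T2\<close>
  inverts - (w + D), the composition carries a minus sign.\<close>

lemma is_res_exists:
  assumes z: "Re z < 1"
  shows "\<exists>R. is_res z R"
proof -
  define w where "w = csqrt (z - 1)"
  have w: "w \<notin> \<real>" "- w \<notin> \<real>" using csqrt_nonreal[OF z] by (auto simp: w_def)
  have w2: "w * w = z - 1" unfolding w_def by (metis power2_csqrt power2_eq_square)
  obtain T1 where T1: "T1 \<in> N" "\<And>y. (T1 y, w *\<^sub>C T1 y - y) \<in> D" "\<And>x u. (x, u) \<in> D \<Longrightarrow> T1 (w *\<^sub>C x - u) = x"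
    using D_resolvent[OF w(1)] by blast
  obtain T2 where T2: "T2 \<in> N" "\<And>y. (T2 y, (- w) *\<^sub>C T2 y - y) \<in> D" "\<And>x u. (x, u) \<in> D \<Longrightarrow> T2 ((- w) *\<^sub>C x - u) = x"
    using D_resolvent[OF w(2)] by blast
  define R where "R = - (T2 o\<^sub>L T1)"
  have R: "R y = T2 (T1 (- y))" for y by (simp add: R_def blinfun.bilinear_simps)
  have "R \<in> N" unfolding R_def by (intro N_closed T1 T2)
  moreover have "\<exists>u. (R y, u) \<in> D \<and> (u, (z - 1) *\<^sub>C R y - y) \<in> D" for y
  proof -
    define p where "p = T1 (- y)"
    have p: "(p, w *\<^sub>C p + y) \<in> D" using T1(2)[of "- y"] by (simp add: p_def)
    have x: "(R y, (- w) *\<^sub>C R y - p) \<in> D" using T2(2)[of p] by (simp add: R p_def)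
    have "((- w) *\<^sub>C R y - p, (- w) *\<^sub>C ((- w) *\<^sub>C R y - p) - (w *\<^sub>C p + y)) \<in> D"
      by (rule D_diff[OF D_scaleC[OF x] p])
    moreover have "(- w) *\<^sub>C ((- w) *\<^sub>C R y - p) - (w *\<^sub>C p + y) = (z - 1) *\<^sub>C R y - y"
      by (simp add: scaleC_diff_right scaleC_add_right scaleC_scaleC flip: w2)
    ultimately show ?thesis using x by metis
  qed
  moreover have "R ((z - 1) *\<^sub>C x - v) = x" if xu: "(x, u) \<in> D" and uv: "(u, v) \<in> D" for x u v
  proof -
    define p where "p = (- w) *\<^sub>C x - u"
    have p: "(p, (- w) *\<^sub>C u - v) \<in> D" unfolding p_def by (rule D_diff[OF D_scaleC[OF xu] uv])
    have e: "w *\<^sub>C p - ((- w) *\<^sub>C u - v) = - ((z - 1) *\<^sub>C x - v)"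
      by (simp add: p_def scaleC_diff_right scaleC_scaleC flip: w2)
    have "T1 (- ((z - 1) *\<^sub>C x - v)) = p" using T1(3)[OF p] unfolding e .
    then show ?thesis unfolding R using T2(3)[OF xu] by (simp add: p_def)
  qed
  moreover have "closure (range (blinfun_apply R)) = UNIV"
  proof -
    have r1: "range (blinfun_apply T1) = Domain D"
    proof (intro equalityI subsetI)
      fix x assume "x \<in> Domain D"
      then obtain u where "(x, u) \<in> D" by blast
      from T1(3)[OF this] show "x \<in> range (blinfun_apply T1)" by (metis rangeI)
    qed (use T1(2) in blast)
    have r2: "Domain D \<subseteq> range (blinfun_apply T2)"
    proof
      fix x assume "x \<in> Domain D"
      then obtain u where "(x, u) \<in> D" by blast
      from T2(3)[OF this] show "x \<in> range (blinfun_apply T2)" by (metis rangeI)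
    qed
    have "range (blinfun_apply R) = T2 ` range (blinfun_apply T1)"
    proof (intro equalityI subsetI)
      fix x assume "x \<in> T2 ` range (blinfun_apply T1)"
      then obtain y where "x = T2 (T1 y)" by blast
      then have "x = R (- y)" by (simp add: R)
      then show "x \<in> range (blinfun_apply R)" by blast
    qed (auto simp: R)
    then have eq: "range (blinfun_apply R) = T2 ` Domain D" using r1 by simp
    \<comment> \<open>Continuity of \<open>T2\<close> carries the density of the domain over to its
      image.\<close>
    have "T2 ` closure (Domain D) \<subseteq> closure (T2 ` Domain D)"
      by (rule image_closure_subset) (auto intro!: closure_subset[THEN subsetD] linear_continuous_on blinfun.bounded_linear_right)
    then have "Domain D \<subseteq> closure (T2 ` Domain D)" using r2 D_dense by blast
    then have "closure (Domain D) \<subseteq> closure (T2 ` Domain D)" by (rule closure_minimal) simp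
    then show ?thesis unfolding eq using D_dense by blast
  qed
  ultimately show ?thesis unfolding is_res_def by blast
qed

definition Rz :: "complex \<Rightarrow> ('h \<Rightarrow>\<^sub>L 'h)" where
  "Rz z = (SOME R. is_res z R)"

lemma is_res_Rz: "Re z < 1 \<Longrightarrow> is_res z (Rz z)"
  unfolding Rz_def by (rule someI_ex) (rule is_res_exists)

lemma
  assumes z: "Re z < 1"
  shows Rz_N: "Rz z \<in> N" and Rz_bounded_ops: "Rz z \<in> bounded_ops"
    and Rz_range: "\<exists>u. (Rz z y, u) \<in> D \<and> (u, (z - 1) *\<^sub>C Rz z y - y) \<in> D"
    and Rz_left: "(x, u) \<in> D \<Longrightarrow> (u, v) \<in> D \<Longrightarrow> Rz z ((z - 1) *\<^sub>C x - v) = x"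
    and Rz_dense: "closure (range (blinfun_apply (Rz z))) = UNIV"
  using is_res_Rz[OF z] N_bounded_ops unfolding is_res_def by blast+

lemma bounded_inverse_eq:
  assumes "graph_of T = G\<inverse>"
  shows "bounded_inverse G = T"
  unfolding bounded_inverse_def
proof (rule the_equality)
  fix S assume "graph_of S = G\<inverse>"
  then have eq: "graph_of S = graph_of T" using assms by simp
  have "(x, S x) \<in> graph_of S" for x by (auto simp: graph_of_def)
  then have "S x = T x" for x unfolding eq by (auto simp: graph_of_def)
  then show "S = T" by (rule blinfun_eqI)
qed (rule assms)

text \<open>Replacing 1 by 1 + s^2 only shifts the spectral parameter, so the single family
  \<open>Rz\<close> serves all s.\<close>

lemma resolvent_eq:
  assumes "Re z < 1 + s\<^sup>2"
  shows "resolvent D s z = Rz (z - of_real (s\<^sup>2))"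
  unfolding resolvent_def
proof (rule bounded_inverse_eq)
  define z' where "z' = z - of_real (s\<^sup>2)"
  have z': "Re z' < 1" using assms by (simp add: z'_def)
  have alg: "z *\<^sub>C x - (complex_of_real (1 + s\<^sup>2) *\<^sub>C x + v) = (z' - 1) *\<^sub>C x - v" for x v
    by (simp add: z'_def scaleC_diff_left scaleC_add_left algebra_simps)
  have gen: "(scalar_minus z (scalar_plus c G))\<inverse> = {(z *\<^sub>C x - (c *\<^sub>C x + v), x) | x v. (x, v) \<in> G}"
    for c and G :: "'h op_graph"
    unfolding scalar_minus_def scalar_plus_def by auto
  have "(scalar_minus z (scalar_plus (complex_of_real (1 + s\<^sup>2)) (D O D)))\<inverse> = {((z' - 1) *\<^sub>C x - v, x) | x v. (x, v) \<in> D O D}"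
    unfolding gen alg ..
  also have "\<dots> = graph_of (Rz z')"
  proof (intro equalityI subsetI)
    fix p assume "p \<in> {((z' - 1) *\<^sub>C x - v, x) | x v. (x, v) \<in> D O D}"
    then show "p \<in> graph_of (Rz z')" using Rz_left[OF z'] by (fastforce simp: graph_of_def)
  next
    fix p assume "p \<in> graph_of (Rz z')"
    then obtain y where p: "p = (y, Rz z' y)" by (auto simp: graph_of_def)
    obtain u where "(Rz z' y, u) \<in> D" "(u, (z' - 1) *\<^sub>C Rz z' y - y) \<in> D" using Rz_range[OF z'] by blast
    then have "(Rz z' y, (z' - 1) *\<^sub>C Rz z' y - y) \<in> D O D" by blast
    moreover have "y = (z' - 1) *\<^sub>C Rz z' y - ((z' - 1) *\<^sub>C Rz z' y - y)" by simp
    ultimately show "p \<in> {((z' - 1) *\<^sub>C x - v, x) | x v. (x, v) \<in> D O D}" unfolding p by blast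
  qed
  finally show "graph_of (Rz (z - of_real (s\<^sup>2))) = (scalar_minus z (scalar_plus (complex_of_real (1 + s\<^sup>2)) (D O D)))\<inverse>"
    by (simp add: z'_def)
qed

lemma bounded_inverse_one_plus_square: "bounded_inverse (scalar_plus 1 (D O D)) = - Rz 0"
proof (rule bounded_inverse_eq, intro equalityI subsetI)
  fix p assume "p \<in> graph_of (- Rz 0)"
  then obtain y where p: "p = (y, Rz 0 (- y))" by (auto simp: graph_of_def blinfun.bilinear_simps)
  obtain u where "(Rz 0 (- y), u) \<in> D" "(u, (0 - 1) *\<^sub>C Rz 0 (- y) - (- y)) \<in> D" using Rz_range[of 0 "- y"] by auto
  then have "(Rz 0 (- y), y - Rz 0 (- y)) \<in> D O D" by (auto simp: algebra_simps)
  moreover have "y = 1 *\<^sub>C Rz 0 (- y) + (y - Rz 0 (- y))" by simp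
  ultimately show "p \<in> (scalar_plus 1 (D O D))\<inverse>" unfolding p scalar_plus_def by blast
next
  fix p assume "p \<in> (scalar_plus 1 (D O D))\<inverse>"
  then obtain x u v where p: "p = (1 *\<^sub>C x + v, x)" "(x, u) \<in> D" "(u, v) \<in> D" unfolding scalar_plus_def by auto
  have "Rz 0 (- (x + v)) = x" using Rz_left[OF _ p(2,3), of 0] by simp
  then show "p \<in> graph_of (- Rz 0)" unfolding p(1) by (auto simp: graph_of_def blinfun.bilinear_simps)
qed

text \<open>Symmetry of \<open>D\<close> turns the term with D^2 into a negative square, so the real
  and the imaginary part of this number each control |R y|^2; the two norm estimates follow from it
  by Cauchy-Schwarz.\<close>

lemma Rz_form:
  assumes z: "Re z < 1"
  shows "\<exists>u :: 'h. cinner (Rz z y) y = (z - 1) * of_real ((norm (Rz z y))\<^sup>2) - of_real ((norm u)\<^sup>2)"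
proof -
  obtain u where u: "(Rz z y, u) \<in> D" "(u, (z - 1) *\<^sub>C Rz z y - y) \<in> D" using Rz_range[OF z] by blast
  from D_symmetric[OF u] have "cinner u u = cinner (Rz z y) ((z - 1) *\<^sub>C Rz z y - y)" .
  then have "cinner (Rz z y) y = (z - 1) * of_real ((norm (Rz z y))\<^sup>2) - of_real ((norm u)\<^sup>2)"
    by (simp add: cinner_simps cinner_self algebra_simps)
  then show ?thesis by blast
qed

lemma
  assumes z: "Re z < 1"
  shows norm_Rz_Re: "(1 - Re z) * norm (Rz z) \<le> 1" and norm_Rz_Im: "\<bar>Im z\<bar> * norm (Rz z) \<le> 1"
proof -
  have *: "(1 - Re z) * norm (Rz z y) \<le> norm y \<and> \<bar>Im z\<bar> * norm (Rz z y) \<le> norm y" for y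
  proof (cases "Rz z y = 0")
    case False
    define x where "x = Rz z y"
    obtain u :: 'h where u: "cinner x y = (z - 1) * of_real ((norm x)\<^sup>2) - of_real ((norm u)\<^sup>2)"
      using Rz_form[OF z] unfolding x_def by blast
    have le: "cmod (cinner x y) \<le> norm x * norm y" by (rule Cauchy_Schwarz_cinner)
    have "(1 - Re z) * (norm x)\<^sup>2 \<le> - Re (cinner x y)" unfolding u by (simp add: algebra_simps)
    also have "\<dots> \<le> norm x * norm y" using le abs_Re_le_cmod[of "cinner x y"] by linarith
    finally have 1: "(1 - Re z) * (norm x)\<^sup>2 \<le> norm x * norm y" .
    have "\<bar>Im z\<bar> * (norm x)\<^sup>2 = \<bar>Im (cinner x y)\<bar>" unfolding u by (simp add: abs_mult)
    also have "\<dots> \<le> norm x * norm y" using le abs_Im_le_cmod[of "cinner x y"] by linarith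
    finally have 2: "\<bar>Im z\<bar> * (norm x)\<^sup>2 \<le> norm x * norm y" .
    have "norm x > 0" using False by (simp add: x_def)
    with 1 2 show ?thesis by (simp add: x_def power2_eq_square mult.left_commute)
  qed simp
  have pos: "1 - Re z > 0" using z by simp
  have "norm (Rz z) \<le> 1 / (1 - Re z)"
    by (rule norm_blinfun_bound) (use * pos in \<open>auto simp: field_simps\<close>)
  then show "(1 - Re z) * norm (Rz z) \<le> 1" using pos by (simp add: field_simps)
  show "\<bar>Im z\<bar> * norm (Rz z) \<le> 1"
  proof (cases "Im z = 0")
    case False
    have "norm (Rz z) \<le> 1 / \<bar>Im z\<bar>"
      by (rule norm_blinfun_bound) (use * False in \<open>auto simp: field_simps\<close>)
    then show ?thesis using False by (simp add: field_simps)
  qed simp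
qed

text \<open>For Re z at most 1 / 2, the number 1 + |Re z| is at most 3 (1 - Re z). Together with the
  bound for the imaginary part this gives 4 = 3 + 1.\<close>

lemma norm_Rz_le:
  assumes "Re z \<le> 1 / 2"
  shows "norm (Rz z) \<le> 4 / (1 + cmod z)"
proof -
  have z: "Re z < 1" using assms by simp
  have "1 + cmod z \<le> 1 + \<bar>Re z\<bar> + \<bar>Im z\<bar>" using cmod_le[of z] by simp
  also have "1 + \<bar>Re z\<bar> \<le> 3 * (1 - Re z)" using assms by (simp add: abs_if)
  finally have "(1 + cmod z) * norm (Rz z) \<le> (3 * (1 - Re z) + \<bar>Im z\<bar>) * norm (Rz z)"
    by (intro mult_right_mono) auto
  also have "\<dots> = 3 * ((1 - Re z) * norm (Rz z)) + \<bar>Im z\<bar> * norm (Rz z)" by (simp add: algebra_simps)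
  also have "\<dots> \<le> 4" using norm_Rz_Re[OF z] norm_Rz_Im[OF z] by linarith
  finally show ?thesis by (simp add: field_simps add_pos_nonneg)
qed

lemma resolvent_identity:
  assumes "Re z < 1" "Re w < 1"
  shows "Rz z - Rz w = scal (w - z) o\<^sub>L (Rz z o\<^sub>L Rz w)"
proof (rule blinfun_eqI)
  fix y
  define x where "x = Rz w y"
  obtain u where u: "(x, u) \<in> D" "(u, (w - 1) *\<^sub>C x - y) \<in> D" using Rz_range[OF assms(2)] unfolding x_def by blast
  have e: "(z - 1) *\<^sub>C x - ((w - 1) *\<^sub>C x - y) = y + (z - w) *\<^sub>C x"
    by (simp add: scaleC_diff_left)
  have "Rz z (y + (z - w) *\<^sub>C x) = x" using Rz_left[OF assms(1) u] unfolding e .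
  then have "Rz z y + (z - w) *\<^sub>C Rz z x = x"
    by (simp add: blinfun.add_right bounded_opsD[OF Rz_bounded_ops[OF assms(1)]])
  then show "(Rz z - Rz w) y = (scal (w - z) o\<^sub>L (Rz z o\<^sub>L Rz w)) y"
    by (simp add: blinfun.bilinear_simps scal_apply x_def scaleC_diff_left algebra_simps)
qed

lemma Rz_commute:
  assumes "Re z < 1" "Re w < 1"
  shows "Rz z o\<^sub>L Rz w = Rz w o\<^sub>L Rz z"
proof (cases "z = w")
  case False
  have "scal (w - z) o\<^sub>L (Rz z o\<^sub>L Rz w) = scal (w - z) o\<^sub>L (Rz w o\<^sub>L Rz z)"
    using resolvent_identity[OF assms] resolvent_identity[OF assms(2,1)]
    by (metis (no_types, lifting) minus_diff_eq scal_minus bounded_bilinear.minus_left[OF bounded_bilinear_blinfun_compose])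
  then have "scal (1 / (w - z)) o\<^sub>L (scal (w - z) o\<^sub>L (Rz z o\<^sub>L Rz w)) = scal (1 / (w - z)) o\<^sub>L (scal (w - z) o\<^sub>L (Rz w o\<^sub>L Rz z))"
    by simp
  then show ?thesis using False by (simp flip: blinfun_compose_assoc scal_mult)
qed simp


subsection \<open>Complex derivatives of operator valued functions\<close>

text \<open>Complex differentiability: the real derivative has to be h to h F'. The complex number h
  acts through \<open>scal\<close> because the operator type carries only real scalar
  multiplication.\<close>

definition cderiv :: "(complex \<Rightarrow> 'h \<Rightarrow>\<^sub>L 'h) \<Rightarrow> ('h \<Rightarrow>\<^sub>L 'h) \<Rightarrow> complex \<Rightarrow> bool" where
  "cderiv F F' z \<longleftrightarrow> (F has_derivative (\<lambda>h. scal h o\<^sub>L F')) (at z)"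

lemma cderiv_const: "cderiv (\<lambda>_. A) 0 z"
  unfolding cderiv_def by (simp add: compose_distribs)

lemma cderiv_scaleR: "cderiv F F' z \<Longrightarrow> cderiv (\<lambda>z. r *\<^sub>R F z) (r *\<^sub>R F') z"
  unfolding cderiv_def by (drule has_derivative_scaleR_right[of _ _ _ r]) (simp add: compose_distribs)

lemma cderiv_add: "cderiv F F' z \<Longrightarrow> cderiv G G' z \<Longrightarrow> cderiv (\<lambda>z. F z + G z) (F' + G') z"
  unfolding cderiv_def by (drule (1) has_derivative_add) (simp add: compose_distribs)

lemma cderiv_sum:
  "(\<And>i. i \<in> I \<Longrightarrow> cderiv (F i) (F' i) z) \<Longrightarrow> cderiv (\<lambda>z. \<Sum>i\<in>I. F i z) (\<Sum>i\<in>I. F' i) z"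
proof (induction I rule: infinite_finite_induct)
  case (insert i I)
  then show ?case using cderiv_add[of "F i" "F' i" z "\<lambda>z. \<Sum>i\<in>I. F i z"] by simp
qed (simp_all add: cderiv_const)

lemma cderiv_compose:
  assumes F: "cderiv F F' z" and G: "cderiv G G' z" and b: "F z \<in> bounded_ops"
  shows "cderiv (\<lambda>z. F z o\<^sub>L G z) ((F' o\<^sub>L G z) + (F z o\<^sub>L G')) z"
proof -
  have "((\<lambda>z. F z o\<^sub>L G z) has_derivative (\<lambda>h. (F z o\<^sub>L (scal h o\<^sub>L G')) + ((scal h o\<^sub>L F') o\<^sub>L G z))) (at z)"
    using bounded_bilinear.FDERIV[OF bounded_bilinear_blinfun_compose] F G unfolding cderiv_def by blast
  moreover have "(F z o\<^sub>L (scal h o\<^sub>L G')) + ((scal h o\<^sub>L F') o\<^sub>L G z) = scal h o\<^sub>L ((F' o\<^sub>L G z) + (F z o\<^sub>L G'))" for h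
  proof -
    have "F z o\<^sub>L (scal h o\<^sub>L G') = scal h o\<^sub>L (F z o\<^sub>L G')"
      using b by (metis blinfun_compose_assoc bounded_ops_iff_commute)
    then show ?thesis by (simp add: compose_distribs blinfun_compose_assoc)
  qed
  ultimately show ?thesis unfolding cderiv_def by simp
qed

lemma cderiv_continuous: "cderiv F F' z \<Longrightarrow> isCont F z"
  unfolding cderiv_def by (rule has_derivative_continuous)

lemma cderiv_cinner:
  assumes "cderiv F F' z"
  shows "((\<lambda>z. cinner x (F z y)) has_field_derivative cinner x (F' y)) (at z)"
proof -
  have bl: "bounded_linear (\<lambda>X. cinner x (blinfun_apply X y))"
    by (rule bounded_linear_compose[OF bounded_bilinear.bounded_linear_right[OF bounded_bilinear_cinner]
          blinfun.bounded_linear_left])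
  have "((\<lambda>z. cinner x (F z y)) has_derivative (\<lambda>h. cinner x ((scal h o\<^sub>L F') y))) (at z)"
    using bounded_linear.has_derivative[OF bl] assms unfolding cderiv_def by blast
  then show ?thesis
    by (simp add: has_field_derivative_def scal_apply cinner_simps mult.commute[of _ "cinner x (F' y)"])
qed

lemma Rz_continuous:
  assumes z: "Re z < 1"
  shows "isCont Rz z"
proof -
  define d where "d = (1 - Re z) / 2"
  have d: "d > 0" using z by (simp add: d_def)
  have "((\<lambda>w. Rz w - Rz z) \<longlongrightarrow> 0) (at z)"
  proof (rule Lim_null_comparison)
    have "((\<lambda>w. cmod (z - w) * (1 / d * norm (Rz z))) \<longlongrightarrow> cmod (z - z) * (1 / d * norm (Rz z))) (at z)"
      by (intro tendsto_intros)
    then show "((\<lambda>w. cmod (z - w) * (1 / d * norm (Rz z))) \<longlongrightarrow> 0) (at z)" by simp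
    have "\<forall>\<^sub>F w in at z. dist w z < d" using d by (auto simp: eventually_at)
    then show "\<forall>\<^sub>F w in at z. norm (Rz w - Rz z) \<le> cmod (z - w) * (1 / d * norm (Rz z))"
    proof eventually_elim
      case (elim w)
      then have "\<bar>Re (w - z)\<bar> < d" using abs_Re_le_cmod[of "w - z"] by (simp add: dist_norm)
      then have w: "1 - Re w \<ge> d" unfolding d_def by (auto simp: abs_if split: if_splits)
      then have w1: "Re w < 1" using d by simp
      have "d * norm (Rz w) \<le> (1 - Re w) * norm (Rz w)" using w by (intro mult_right_mono) auto
      also have "\<dots> \<le> 1" by (rule norm_Rz_Re[OF w1])
      finally have nw: "norm (Rz w) \<le> 1 / d" using d by (simp add: field_simps)
      have "norm (Rz w - Rz z) = cmod (z - w) * norm (Rz w o\<^sub>L Rz z)"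
        unfolding resolvent_identity[OF w1 z] by (rule norm_scal_compose)
      also have "\<dots> \<le> cmod (z - w) * (1 / d * norm (Rz z))"
        by (intro mult_left_mono norm_compose_mono nw) auto
      finally show ?case .
    qed
  qed
  then show ?thesis unfolding isCont_def by (rule LIM_zero_cancel)
qed

text \<open>By the resolvent identity the remainder at w is (z - w) (R(w) - R(z)) R(z), and
  continuity of the resolvent makes it small of higher order.\<close>

lemma cderiv_Rz:
  assumes z: "Re z < 1"
  shows "cderiv Rz (- (Rz z o\<^sub>L Rz z)) z"
  unfolding cderiv_def has_derivative_within
proof
  show "bounded_linear (\<lambda>h. scal h o\<^sub>L - (Rz z o\<^sub>L Rz z))"
    by (rule bounded_linear_compose[OF bounded_bilinear.bounded_linear_left[OF bounded_bilinear_blinfun_compose] bounded_linear_scal])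
  show "((\<lambda>w. (1 / norm (w - z)) *\<^sub>R (Rz w - (Rz z + (scal (w - z) o\<^sub>L - (Rz z o\<^sub>L Rz z))))) \<longlongrightarrow> 0) (at z)"
  proof (rule Lim_null_comparison)
    have "((\<lambda>w. norm (Rz w - Rz z) * norm (Rz z)) \<longlongrightarrow> norm (Rz z - Rz z) * norm (Rz z)) (at z)"
      using Rz_continuous[OF z] unfolding isCont_def by (intro tendsto_intros)
    then show "((\<lambda>w. norm (Rz w - Rz z) * norm (Rz z)) \<longlongrightarrow> 0) (at z)" by simp
    have "\<forall>\<^sub>F w in at z. w \<in> {w. Re w < 1}"
      using z by (intro eventually_at_in_open' open_halfspace_Re_lt) auto
    moreover have "\<forall>\<^sub>F w in at z. w \<noteq> z" by (simp add: eventually_at_filter)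
    ultimately show "\<forall>\<^sub>F w in at z. norm ((1 / norm (w - z)) *\<^sub>R (Rz w - (Rz z + (scal (w - z) o\<^sub>L - (Rz z o\<^sub>L Rz z)))))
      \<le> norm (Rz w - Rz z) * norm (Rz z)"
    proof eventually_elim
      case (elim w)
      have w: "Re w < 1" using elim by simp
      have s: "scal (w - z) = (- scal (z - w) :: 'h \<Rightarrow>\<^sub>L 'h)" by (simp flip: scal_minus)
      have "Rz w - (Rz z + (scal (w - z) o\<^sub>L - (Rz z o\<^sub>L Rz z))) = (Rz w - Rz z) - (scal (z - w) o\<^sub>L (Rz z o\<^sub>L Rz z))"
        unfolding s by (simp add: compose_distribs)
      also have "\<dots> = scal (z - w) o\<^sub>L ((Rz w - Rz z) o\<^sub>L Rz z)"
        unfolding resolvent_identity[OF w z] by (simp add: compose_distribs flip: resolvent_identity[OF w z])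
      finally have "norm (Rz w - (Rz z + (scal (w - z) o\<^sub>L - (Rz z o\<^sub>L Rz z)))) = cmod (z - w) * norm ((Rz w - Rz z) o\<^sub>L Rz z)"
        by (simp add: norm_scal_compose)
      also have "\<dots> \<le> cmod (z - w) * (norm (Rz w - Rz z) * norm (Rz z))"
        by (intro mult_left_mono norm_blinfun_compose) auto
      finally have le: "norm (Rz w - (Rz z + (scal (w - z) o\<^sub>L - (Rz z o\<^sub>L Rz z)))) \<le> cmod (z - w) * (norm (Rz w - Rz z) * norm (Rz z))" .
      have gen: "1 / cmod (w - z) * n \<le> r" if "n \<le> cmod (z - w) * r" for n r
        using that elim(2) by (simp add: field_simps norm_minus_commute)
      have "\<bar>1 / norm (w - z)\<bar> = 1 / norm (w - z)" by simp
      then show ?case unfolding norm_scaleR using gen[OF le] by metis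
    qed
  qed
qed

section \<open>Derivatives of resolvents and of words\<close>

definition res_deriv :: "nat \<Rightarrow> complex \<Rightarrow> ('h \<Rightarrow>\<^sub>L 'h)" where
  "res_deriv k z = ((-1) ^ k * fact k) *\<^sub>R op_power (Rz z) (Suc k)"

lemma op_power_commute: "A o\<^sub>L B = B o\<^sub>L A \<Longrightarrow> A o\<^sub>L op_power B n = op_power B n o\<^sub>L A"
  by (induction n) (auto, metis blinfun_compose_assoc)

lemma op_power_N: "A \<in> N \<Longrightarrow> op_power A n \<in> N"
  by (induction n) (auto intro: N_closed)

lemma op_power_norm: "norm (op_power A (Suc n)) \<le> norm A ^ Suc n"
proof (induction n)
  case (Suc n)
  then show ?case using norm_compose_mono[OF order_refl, of "op_power A (Suc n)" "norm A ^ Suc n" A] by simp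
qed simp

lemma cderiv_op_power:
  assumes z: "Re z < 1"
  shows "cderiv (\<lambda>z. op_power (Rz z) n) (- real n *\<^sub>R op_power (Rz z) (Suc n)) z"
proof (induction n)
  case 0
  show ?case using cderiv_const by simp
next
  case (Suc n)
  have "cderiv (\<lambda>z. Rz z o\<^sub>L op_power (Rz z) n)
    ((- (Rz z o\<^sub>L Rz z) o\<^sub>L op_power (Rz z) n) + (Rz z o\<^sub>L (- real n *\<^sub>R op_power (Rz z) (Suc n)))) z"
    by (rule cderiv_compose[OF cderiv_Rz[OF z] Suc Rz_bounded_ops[OF z]])
  moreover have "(- (Rz z o\<^sub>L Rz z) o\<^sub>L op_power (Rz z) n) + (Rz z o\<^sub>L (- real n *\<^sub>R op_power (Rz z) (Suc n)))
    = - real (Suc n) *\<^sub>R op_power (Rz z) (Suc (Suc n))"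
    by (simp add: compose_distribs blinfun_compose_assoc algebra_simps)
  ultimately show ?case by simp
qed

lemma cderiv_res_deriv:
  assumes z: "Re z < 1"
  shows "cderiv (res_deriv k) (res_deriv (Suc k) z) z"
proof -
  have "cderiv (\<lambda>z. ((-1) ^ k * fact k) *\<^sub>R op_power (Rz z) (Suc k))
    (((-1) ^ k * fact k) *\<^sub>R (- real (Suc k) *\<^sub>R op_power (Rz z) (Suc (Suc k)))) z"
    by (rule cderiv_scaleR[OF cderiv_op_power[OF z]])
  moreover have "((-1) ^ k * fact k) * - real (Suc k) = (-1) ^ Suc k * fact (Suc k)"
    by (simp add: algebra_simps)
  ultimately show ?thesis unfolding res_deriv_def[abs_def] scaleR_scaleR by metis
qed

lemma res_deriv_N: "Re z < 1 \<Longrightarrow> res_deriv k z \<in> N"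
  unfolding res_deriv_def by (intro N_scaleR op_power_N Rz_N)

lemma norm_res_deriv_le: "\<exists>C\<ge>0. \<forall>z. Re z \<le> 1 / 2 \<longrightarrow> norm (res_deriv k z) \<le> C / (1 + cmod z) ^ Suc k"
proof (intro exI[of _ "fact k * 4 ^ Suc k"] conjI allI impI)
  fix z assume z: "Re z \<le> 1 / 2"
  have "norm (op_power (Rz z) (Suc k)) \<le> (4 / (1 + cmod z)) ^ Suc k"
    by (rule order_trans[OF op_power_norm power_mono[OF norm_Rz_le[OF z]]]) simp
  then have "fact k * norm (op_power (Rz z) (Suc k)) \<le> fact k * (4 / (1 + cmod z)) ^ Suc k"
    by (intro mult_left_mono) auto
  then show "norm (res_deriv k z) \<le> fact k * 4 ^ Suc k / (1 + cmod z) ^ Suc k"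
    unfolding res_deriv_def by (simp add: power_divide abs_mult)
qed simp

text \<open>The k-th derivative of the word in the letters b, written out by the Leibniz rule. The
  explicit sum later shows which resolvent carries a high power.\<close>

primrec word_deriv :: "(nat \<Rightarrow> 'h \<Rightarrow>\<^sub>L 'h) \<Rightarrow> nat \<Rightarrow> nat \<Rightarrow> complex \<Rightarrow> ('h \<Rightarrow>\<^sub>L 'h)" where
  "word_deriv b 0 k z = b 0 o\<^sub>L res_deriv k z"
| "word_deriv b (Suc j) k z =
     (\<Sum>i\<le>k. real (k choose i) *\<^sub>R (word_deriv b j i z o\<^sub>L (b (Suc j) o\<^sub>L res_deriv (k - i) z)))"

lemma word_deriv_N:
  assumes "\<And>j. j \<le> m \<Longrightarrow> b j \<in> N" "Re z < 1"
  shows "j \<le> m \<Longrightarrow> word_deriv b j k z \<in> N"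
proof (induction j arbitrary: k)
  case (Suc j)
  then show ?case by (auto intro!: N_sum N_scaleR N_compose assms res_deriv_N)
qed (auto intro!: N_compose assms res_deriv_N)

text \<open>Pascal's rule in summed form: differentiating the Leibniz sum of order k gives the one
  of order k + 1.\<close>

lemma Leibniz_sum:
  fixes f :: "nat \<Rightarrow> nat \<Rightarrow> 'b::real_vector"
  shows "(\<Sum>i\<le>k. real (k choose i) *\<^sub>R (f (Suc i) (k - i) + f i (Suc (k - i)))) =
    (\<Sum>i\<le>Suc k. real (Suc k choose i) *\<^sub>R f i (Suc k - i))"
proof -
  define X where "X = (\<Sum>i\<le>k. real (k choose i) *\<^sub>R f (Suc i) (k - i))"
  define Y where "Y = (\<Sum>i\<le>k. real (k choose Suc i) *\<^sub>R f (Suc i) (k - i))"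
  have "(\<Sum>i\<le>Suc k. real (Suc k choose i) *\<^sub>R f i (Suc k - i)) = f 0 (Suc k) + (X + Y)"
    by (subst sum.atMost_Suc_shift) (simp add: X_def Y_def scaleR_add_left sum.distrib)
  moreover have "(\<Sum>i\<le>k. real (k choose i) *\<^sub>R f i (Suc (k - i))) = f 0 (Suc k) + Y"
  proof (cases k)
    case 0
    then show ?thesis by (simp add: Y_def)
  next
    case (Suc n)
    have "(\<Sum>i\<le>k. real (k choose i) *\<^sub>R f i (Suc (k - i))) = f 0 (Suc k) + (\<Sum>i\<le>n. real (k choose Suc i) *\<^sub>R f (Suc i) (Suc (k - Suc i)))"
      unfolding Suc by (subst sum.atMost_Suc_shift) simp
    also have "(\<Sum>i\<le>n. real (k choose Suc i) *\<^sub>R f (Suc i) (Suc (k - Suc i))) = (\<Sum>i\<le>n. real (k choose Suc i) *\<^sub>R f (Suc i) (k - i))"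
      by (rule sum.cong) (auto simp: Suc Suc_diff_le)
    also have "\<dots> = Y" by (simp add: Y_def Suc binomial_eq_0)
    finally show ?thesis .
  qed
  ultimately show ?thesis by (simp add: X_def scaleR_add_right sum.distrib)
qed

lemma cderiv_word_deriv:
  assumes b: "\<And>j. j \<le> m \<Longrightarrow> b j \<in> N" and z: "Re z < 1"
  shows "j \<le> m \<Longrightarrow> cderiv (word_deriv b j k) (word_deriv b j (Suc k) z) z"
proof (induction j arbitrary: k)
  case 0
  have "cderiv (\<lambda>z. b 0 o\<^sub>L res_deriv k z) ((0 o\<^sub>L res_deriv k z) + (b 0 o\<^sub>L res_deriv (Suc k) z)) z"
    by (rule cderiv_compose[OF cderiv_const cderiv_res_deriv[OF z]]) (use b N_bounded_ops in auto)
  then show ?case by (simp add: compose_distribs)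
next
  case (Suc j)
  define G where "G k z = b (Suc j) o\<^sub>L res_deriv k z" for k z
  have G: "cderiv (G k) (G (Suc k) z) z" for k
  proof -
    have "cderiv (\<lambda>z. b (Suc j) o\<^sub>L res_deriv k z) ((0 o\<^sub>L res_deriv k z) + (b (Suc j) o\<^sub>L res_deriv (Suc k) z)) z"
      by (rule cderiv_compose[OF cderiv_const cderiv_res_deriv[OF z]]) (use b Suc.prems N_bounded_ops in auto)
    then show ?thesis unfolding G_def by (simp add: compose_distribs)
  qed
  have "cderiv (\<lambda>z. \<Sum>i\<le>k. real (k choose i) *\<^sub>R (word_deriv b j i z o\<^sub>L G (k - i) z))
    (\<Sum>i\<le>k. real (k choose i) *\<^sub>R ((word_deriv b j (Suc i) z o\<^sub>L G (k - i) z) + (word_deriv b j i z o\<^sub>L G (Suc (k - i)) z))) z"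
    using Suc word_deriv_N[OF b z, of j] N_bounded_ops
    by (intro cderiv_sum cderiv_scaleR cderiv_compose G) auto
  then show ?case
    unfolding Leibniz_sum[of k "\<lambda>i l. word_deriv b j i z o\<^sub>L G l z"] by (simp add: G_def)
qed

lemma norm_word_deriv_le:
  "\<exists>C\<ge>0. \<forall>z. Re z \<le> 1 / 2 \<longrightarrow> norm (word_deriv b j k z) \<le> C / (1 + cmod z) ^ (Suc j + k)"
proof (induction j arbitrary: k)
  case 0
  obtain C where C: "C \<ge> 0" "\<And>z. Re z \<le> 1 / 2 \<Longrightarrow> norm (res_deriv k z) \<le> C / (1 + cmod z) ^ Suc k"
    using norm_res_deriv_le by blast
  have "norm (word_deriv b 0 k z) \<le> norm (b 0) * C / (1 + cmod z) ^ (Suc 0 + k)" if "Re z \<le> 1 / 2" for z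
    using norm_compose_mono[OF order_refl C(2)[OF that], of "b 0"] by simp
  then show ?case using C(1) by (intro exI[of _ "norm (b 0) * C"]) auto
next
  case (Suc j)
  obtain C where C: "\<And>i. C i \<ge> 0" "\<And>i z. Re z \<le> 1 / 2 \<Longrightarrow> norm (word_deriv b j i z) \<le> C i / (1 + cmod z) ^ (Suc j + i)"
    using Suc by metis
  obtain C' where C': "\<And>i. C' i \<ge> 0" "\<And>i z. Re z \<le> 1 / 2 \<Longrightarrow> norm (res_deriv i z) \<le> C' i / (1 + cmod z) ^ Suc i"
    using norm_res_deriv_le by metis
  define K where "K = (\<Sum>i\<le>k. real (k choose i) * (C i * (norm (b (Suc j)) * C' (k - i))))"
  have "norm (word_deriv b (Suc j) k z) \<le> K / (1 + cmod z) ^ (Suc (Suc j) + k)" if z: "Re z \<le> 1 / 2" for z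
  proof -
    have "norm (word_deriv b (Suc j) k z) \<le> (\<Sum>i\<le>k. real (k choose i) * (C i * (norm (b (Suc j)) * C' (k - i))) / (1 + cmod z) ^ (Suc (Suc j) + k))"
      unfolding word_deriv.simps
    proof (rule sum_norm_le)
      fix i assume "i \<in> {..k}"
      then have i: "Suc j + i + Suc (k - i) = Suc (Suc j) + k" by simp
      have "norm (word_deriv b j i z o\<^sub>L (b (Suc j) o\<^sub>L res_deriv (k - i) z))
        \<le> (C i / (1 + cmod z) ^ (Suc j + i)) * (norm (b (Suc j)) * (C' (k - i) / (1 + cmod z) ^ Suc (k - i)))"
        by (intro norm_compose_mono C C' z order_refl)
      also have "\<dots> = (C i * (norm (b (Suc j)) * C' (k - i))) / ((1 + cmod z) ^ (Suc j + i) * (1 + cmod z) ^ Suc (k - i))"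
        by (simp only: times_divide_eq_right times_divide_eq_left divide_divide_eq_left mult_ac)
      also have "(1 + cmod z) ^ (Suc j + i) * (1 + cmod z) ^ Suc (k - i) = (1 + cmod z) ^ (Suc (Suc j) + k)"
        unfolding power_add[symmetric] i ..
      finally show "norm (real (k choose i) *\<^sub>R (word_deriv b j i z o\<^sub>L (b (Suc j) o\<^sub>L res_deriv (k - i) z)))
        \<le> real (k choose i) * (C i * (norm (b (Suc j)) * C' (k - i))) / (1 + cmod z) ^ (Suc (Suc j) + k)"
        by (simp add: mult_left_mono del: power_Suc) (metis mult_left_mono of_nat_0_le_iff times_divide_eq_right)?
    qed
    then show ?thesis by (simp add: K_def sum_divide_distrib)
  qed
  moreover have "K \<ge> 0" unfolding K_def using C(1) C'(1) by (intro sum_nonneg mult_nonneg_nonneg) auto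
  ultimately show ?case by blast
qed

text \<open>Each of the m + 1 resolvents in the word contributes one order of decay. Passing to
  matrix elements makes the scalar contour identities available.\<close>

lemma decaying_word:
  assumes b: "\<And>j. j \<le> m \<Longrightarrow> b j \<in> N"
  shows "decaying (Suc m) (\<lambda>k z. cinner x (word_deriv b m k z y))"
  unfolding decaying_def
proof (intro conjI allI impI)
  show "((\<lambda>z. cinner x (word_deriv b m k z y)) has_field_derivative cinner x (word_deriv b m (Suc k) z y)) (at z)"
    if "Re z < 1" for k z
    by (rule cderiv_cinner[OF cderiv_word_deriv[OF b that]]) auto
  fix k
  obtain C where C: "C \<ge> 0" "\<And>z. Re z \<le> 1 / 2 \<Longrightarrow> norm (word_deriv b m k z) \<le> C / (1 + cmod z) ^ (Suc m + k)"
    using norm_word_deriv_le by blast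
  have "cmod (cinner x (word_deriv b m k z y)) \<le> (norm x * norm y * C) / (1 + cmod z) ^ (Suc m + k)" if z: "Re z \<le> 1 / 2" for z
  proof -
    have "cmod (cinner x (word_deriv b m k z y)) \<le> norm x * norm (word_deriv b m k z y)" by (rule Cauchy_Schwarz_cinner)
    also have "\<dots> \<le> norm x * (norm (word_deriv b m k z) * norm y)" by (intro mult_left_mono norm_blinfun) auto
    also have "\<dots> \<le> norm x * (C / (1 + cmod z) ^ (Suc m + k) * norm y)" by (intro mult_left_mono mult_right_mono C z) auto
    finally show ?thesis by (simp add: mult_ac)
  qed
  then show "\<exists>C. \<forall>z. Re z \<le> 1 / 2 \<longrightarrow> cmod (cinner x (word_deriv b m k z y)) \<le> C / (1 + cmod z) ^ (Suc m + k)" by blast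
qed

end


section \<open>Trace class factorization of resolvent words\<close>

lemma (in spectral_triple) positive_minus_Rz: "positive_op (- Rz 0)"
proof (rule positive_opI)
  show "- Rz 0 \<in> bounded_ops" by (intro N_bounded_ops N_minus Rz_N) simp
  fix y
  obtain u :: 'h where u: "cinner (Rz 0 y) y = (0 - 1) * of_real ((norm (Rz 0 y))\<^sup>2) - of_real ((norm u)\<^sup>2)"
    using Rz_form[of 0 y] by auto
  have "cinner y (Rz 0 y) = cnj (cinner (Rz 0 y) y)" by (rule cinner_commute)
  then have e: "cinner y ((- Rz 0) y) = of_real ((norm (Rz 0 y))\<^sup>2 + (norm u)\<^sup>2)"
    unfolding u by (simp add: blinfun.bilinear_simps)
  show "Im (cinner y ((- Rz 0) y)) = 0" "Re (cinner y ((- Rz 0) y)) \<ge> 0" unfolding e by simp_all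
qed

text \<open>\<open>- Rz 0\<close> is the inverse of 1 + D^2, so the condition says that (1 +
  D^2)^(-t) has finite trace; t is half of a summability exponent.\<close>

locale summable_triple = spectral_triple +
  fixes t :: real
  assumes t_pos: "t > 0"
    and trace_power: "\<tau> (cont_calculus (\<lambda>x. x powr t) (- Rz 0)) < \<infinity>"
begin

definition B :: "'a \<Rightarrow>\<^sub>L 'a" where
  "B = - Rz 0"

lemma B_N: "B \<in> N"
  unfolding B_def by (intro N_minus Rz_N) simp

lemma B_positive: "positive_op B"
  unfolding B_def by (rule positive_minus_Rz)

lemma norm_B_le: "norm B \<le> 1"
  using norm_Rz_Re[of 0] by (simp add: B_def)

lemma B_interval: "x \<in> {0..norm B} \<Longrightarrow> 0 \<le> x \<and> x \<le> 1"
  using norm_B_le by auto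

lemma powr_continuous: "e > 0 \<Longrightarrow> continuous_on {0..norm B} (\<lambda>x :: real. x powr e)"
  by (intro continuous_on_powr') (auto intro!: continuous_intros)

definition Bpow :: "real \<Rightarrow> 'a \<Rightarrow>\<^sub>L 'a" where
  "Bpow e = cont_calculus (\<lambda>x. x powr e) B"

lemma Bpow_N: "e > 0 \<Longrightarrow> Bpow e \<in> N"
  unfolding Bpow_def by (intro N_cont_calculus B_positive B_N powr_continuous)

lemma Bpow_add: "e > 0 \<Longrightarrow> e' > 0 \<Longrightarrow> Bpow (e + e') = Bpow e o\<^sub>L Bpow e'"
  unfolding Bpow_def powr_add
  by (rule cont_calculus_mult[OF B_positive]) (auto intro: powr_continuous)

lemma cont_calculus_power:
  assumes f: "continuous_on {0..norm B} f"
  shows "cont_calculus (\<lambda>x. f x ^ n) B = op_power (cont_calculus f B) n"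
proof (induction n)
  case 0
  show ?case using cont_calculus_const[OF B_positive, of 1] by simp
next
  case (Suc n)
  then show ?case using cont_calculus_mult[OF B_positive f continuous_on_power[OF f, of n]] by simp
qed

lemma op_power_B: "n > 0 \<Longrightarrow> op_power B n = Bpow (real n)"
proof -
  assume n: "n > 0"
  have "op_power B n = cont_calculus (\<lambda>x. x ^ n) B"
    using cont_calculus_power[OF continuous_on_id, of n] cont_calculus_ident[OF B_positive] by simp
  also have "\<dots> = Bpow (real n)"
    unfolding Bpow_def
    by (rule cont_calculus_cong[OF B_positive]) (use n in \<open>auto intro!: continuous_intros simp: powr_realpow'\<close>)
  finally show ?thesis .
qed

text \<open>The trace class operator (1 + D^2)^(-t) is split evenly, so that its square root is
  Hilbert-Schmidt.\<close>

definition S :: "'a \<Rightarrow>\<^sub>L 'a" where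
  "S = Bpow (t / 2)"

lemma S_square: "S o\<^sub>L S = Bpow t"
  using Bpow_add[of "t / 2" "t / 2"] t_pos by (simp add: S_def)

lemma hs_S: "hs S"
  unfolding hs_def
proof (intro conjI)
  show "S \<in> N" unfolding S_def using t_pos by (intro Bpow_N) simp
  show "star S = S" unfolding S_def Bpow_def using t_pos
    by (intro cont_calculus_self_adjoint B_positive powr_continuous) simp
  show "\<tau> (S o\<^sub>L S) < \<infinity>" unfolding S_square Bpow_def B_def using trace_power .
qed


subsection \<open>An approximate unit of finite trace\<close>

text \<open>A continuous stand-in for the indicator function of a spectral projection. It lies below
  a multiple of x powr t, which gives finite trace; it increases with n; and it equals 1 from x = 1
  / (n + 1) on.\<close>

definition cut :: "nat \<Rightarrow> real \<Rightarrow> real" where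
  "cut n x = min 1 ((real (Suc n) * x) powr t)"

lemma cut_continuous: "continuous_on {0..norm B} (cut n)"
  unfolding cut_def using t_pos
  by (intro continuous_on_min continuous_on_powr' continuous_intros) auto

definition f :: "nat \<Rightarrow> 'a \<Rightarrow>\<^sub>L 'a" where
  "f n = cont_calculus (\<lambda>x. sqrt (cut n x)) B"

lemma cut_bounds: "0 \<le> cut n x" "cut n x \<le> 1"
  by (simp_all add: cut_def)

lemma f_square: "f n o\<^sub>L f n = cont_calculus (cut n) B"
proof -
  have c: "continuous_on {0..norm B} (\<lambda>x. sqrt (cut n x))" by (intro continuous_intros cut_continuous)
  have "f n o\<^sub>L f n = cont_calculus (\<lambda>x. sqrt (cut n x) * sqrt (cut n x)) B"
    unfolding f_def by (rule cont_calculus_mult[OF B_positive c c, symmetric])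
  also have "(\<lambda>x. sqrt (cut n x) * sqrt (cut n x)) = cut n" using cut_bounds(1) by auto
  finally show ?thesis .
qed

lemma cont_calculus_diff:
  assumes g: "continuous_on {0..norm B} g" and h: "continuous_on {0..norm B} h"
  shows "cont_calculus (\<lambda>x. g x - h x) B = cont_calculus g B - cont_calculus h B"
proof -
  have "cont_calculus g B = cont_calculus (\<lambda>x. (g x - h x) + h x) B" by simp
  also have "\<dots> = cont_calculus (\<lambda>x. g x - h x) B + cont_calculus h B"
    by (rule cont_calculus_add[OF B_positive]) (intro continuous_intros g h)+
  finally show ?thesis by simp
qed

lemma cut_mono: "x \<ge> 0 \<Longrightarrow> cut n x \<le> cut (Suc n) x"
  unfolding cut_def using t_pos by (intro min.mono powr_mono2 mult_right_mono) auto

lemma cut_le: "x \<ge> 0 \<Longrightarrow> cut n x \<le> real (Suc n) powr t * x powr t"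
  unfolding cut_def by (simp add: powr_mult)

lemma cut_near_one:
  assumes "x \<ge> 0"
  shows "\<bar>(1 - cut n x) * x\<bar> \<le> inverse (real (Suc n))"
proof (cases "real (Suc n) * x \<ge> 1")
  case True
  then have "(real (Suc n) * x) powr t \<ge> 1" using t_pos by (intro ge_one_powr_ge_zero) auto
  then show ?thesis by (simp add: cut_def)
next
  case False
  then have "x \<le> inverse (real (Suc n))" by (simp add: field_simps)
  moreover have "\<bar>(1 - cut n x) * x\<bar> \<le> 1 * x"
    unfolding abs_mult using cut_bounds[of n x] assms by (intro mult_mono) auto
  ultimately show ?thesis by simp
qed

lemma f_square_le_one: "positive_op (id_blinfun - (f n o\<^sub>L f n))"
proof -
  have "id_blinfun - (f n o\<^sub>L f n) = cont_calculus (\<lambda>x. 1 - cut n x) B"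
    using cont_calculus_diff[OF continuous_on_const cut_continuous, of 1 n] cont_calculus_const[OF B_positive, of 1]
    by (simp add: f_square)
  then show ?thesis
    using cont_calculus_nonneg[OF B_positive continuous_on_diff[OF continuous_on_const cut_continuous], of 1 n] cut_bounds(2)
    by simp
qed

text \<open>The complements \<open>K n\<close> are contractions, and \<open>K n o\<^sub>L B\<close>
  tends to 0 in norm. As \<open>B\<close> has dense range, \<open>K n x\<close> tends to 0 for every
  x.\<close>

lemma f_square_limit: "(\<lambda>n. Re (cinner x ((f n o\<^sub>L f n) x))) \<longlonglongrightarrow> (norm x)\<^sup>2"
proof -
  define K where "K n = id_blinfun - (f n o\<^sub>L f n)" for n
  have Kcalc: "K n = cont_calculus (\<lambda>x. 1 - cut n x) B" for n
    using cont_calculus_diff[OF continuous_on_const cut_continuous, of 1 n] cont_calculus_const[OF B_positive, of 1]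
    by (simp add: K_def f_square)
  have cK: "continuous_on {0..norm B} (\<lambda>x. 1 - cut n x)" for n by (intro continuous_intros cut_continuous)
  have nK: "norm (K n) \<le> 1" for n
    unfolding Kcalc using cut_bounds by (intro norm_cont_calculus_le[OF B_positive cK]) (auto simp: abs_le_iff)
  have nKB: "norm (K n o\<^sub>L B) \<le> inverse (real (Suc n))" for n
  proof -
    have "K n o\<^sub>L B = cont_calculus (\<lambda>x. (1 - cut n x) * x) B"
      using cont_calculus_mult[OF B_positive cK continuous_on_id] cont_calculus_ident[OF B_positive]
      by (simp add: Kcalc)
    then show ?thesis
      using cut_near_one by (auto intro!: norm_cont_calculus_le[OF B_positive] continuous_intros cut_continuous)
  qed
  have "(\<lambda>n. Re (cinner x (K n x))) \<longlonglongrightarrow> 0"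
  proof (rule LIMSEQ_I)
    fix e :: real assume e: "e > 0"
    define e' where "e' = e / (2 * (norm x + 1))"
    have e': "e' > 0" "norm x * e' < e / 2 \<or> norm x * e' \<le> e / 2" using e by (auto simp: e'_def field_simps add_pos_nonneg)
    have "x \<in> closure (range (blinfun_apply (Rz 0)))" using Rz_dense[of 0] by simp
    then obtain y where y: "dist (Rz 0 y) x < e'" unfolding closure_approachable using e' by blast
    define z where "z = - y"
    have z: "norm (x - B z) < e'" using y by (simp add: B_def z_def blinfun.bilinear_simps dist_norm norm_minus_commute)
    have "(\<lambda>n. norm x * (inverse (real (Suc n)) * norm z)) \<longlonglongrightarrow> norm x * (0 * norm z)"
      by (intro tendsto_intros LIMSEQ_inverse_real_of_nat)
    then have "\<forall>\<^sub>F n in sequentially. norm x * (inverse (real (Suc n)) * norm z) < e / 2"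
      using e by (intro order_tendstoD(2)) auto
    then obtain n0 where n0: "\<And>n. n \<ge> n0 \<Longrightarrow> norm x * (inverse (real (Suc n)) * norm z) < e / 2"
      unfolding eventually_sequentially by blast
    show "\<exists>n0. \<forall>n\<ge>n0. norm (Re (cinner x (K n x)) - 0) < e"
    proof (intro exI allI impI)
      fix n assume n: "n \<ge> n0"
      have "K n x = K n (x - B z) + (K n o\<^sub>L B) z" by (simp add: blinfun.bilinear_simps)
      then have "cmod (cinner x (K n x)) \<le> norm x * norm (K n (x - B z) + (K n o\<^sub>L B) z)"
        by (metis Cauchy_Schwarz_cinner)
      also have "\<dots> \<le> norm x * (1 * norm (x - B z) + inverse (real (Suc n)) * norm z)"
      proof (intro mult_left_mono)
        have "norm (K n (x - B z)) \<le> 1 * norm (x - B z)"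
          by (rule order_trans[OF norm_blinfun mult_right_mono[OF nK]]) simp
        moreover have "norm ((K n o\<^sub>L B) z) \<le> inverse (real (Suc n)) * norm z"
          by (rule order_trans[OF norm_blinfun mult_right_mono[OF nKB]]) simp
        ultimately show "norm (K n (x - B z) + (K n o\<^sub>L B) z) \<le> 1 * norm (x - B z) + inverse (real (Suc n)) * norm z"
          using norm_triangle_ineq[of "K n (x - B z)" "(K n o\<^sub>L B) z"] by linarith
      qed simp
      also have "\<dots> < e"
      proof -
        have "norm x * norm (x - B z) \<le> norm x * e'" using z by (intro mult_left_mono) auto
        then show ?thesis using n0[OF n] e'(2) by (auto simp: distrib_left)
      qed
      finally have "cmod (cinner x (K n x)) < e" .
      then show "norm (Re (cinner x (K n x)) - 0) < e"
        using abs_Re_le_cmod[of "cinner x (K n x)"] by simp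
    qed
  qed
  then have "(\<lambda>n. (norm x)\<^sup>2 - Re (cinner x (K n x))) \<longlonglongrightarrow> (norm x)\<^sup>2 - 0"
    by (intro tendsto_intros)
  then show ?thesis by (simp add: K_def blinfun.bilinear_simps cinner_simps Re_cinner_self)
qed

sublocale semifinite_algebra_approx_unit N \<tau> f
proof
  fix n
  have c: "continuous_on {0..norm B} (\<lambda>x. sqrt (cut n x))" by (intro continuous_intros cut_continuous)
  have fN: "f n \<in> N" unfolding f_def by (intro N_cont_calculus B_positive B_N c)
  have fs: "star (f n) = f n" unfolding f_def by (intro cont_calculus_self_adjoint B_positive c)
  have pos: "positive_op (f n o\<^sub>L f n)"
    using positive_op_square[OF N_bounded_ops[OF fN]] fs by simp
  have dom: "positive_op (real (Suc n) powr t *\<^sub>R Bpow t - (f n o\<^sub>L f n))"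
  proof -
    have pc: "continuous_on {0..norm B} (\<lambda>x. real (Suc n) powr t * x powr t)"
      by (intro continuous_intros powr_continuous t_pos)
    have "cont_calculus (\<lambda>x. real (Suc n) powr t * x powr t) B = real (Suc n) powr t *\<^sub>R Bpow t"
      unfolding Bpow_def cont_calculus_mult[OF B_positive continuous_on_const powr_continuous[OF t_pos]]
        cont_calculus_const[OF B_positive] by (simp add: compose_distribs)
    then have "real (Suc n) powr t *\<^sub>R Bpow t - (f n o\<^sub>L f n) = cont_calculus (\<lambda>x. real (Suc n) powr t * x powr t - cut n x) B"
      using cont_calculus_diff[OF pc cut_continuous, of n] by (simp add: f_square)
    then show ?thesis
      using cont_calculus_nonneg[OF B_positive continuous_on_diff[OF pc cut_continuous], of n] cut_le by simp
  qed
  have BtP: "Bpow t \<in> pos_cone N"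
    using Bpow_N[OF t_pos] cont_calculus_nonneg[OF B_positive powr_continuous[OF t_pos]]
    unfolding Bpow_def by (intro pos_coneI) auto
  have "\<tau> (f n o\<^sub>L f n) \<le> \<tau> (real (Suc n) powr t *\<^sub>R Bpow t)"
    by (rule \<tau>_mono[OF pos_coneI[OF N_compose[OF fN fN] pos] N_scaleR[OF Bpow_N[OF t_pos]] dom])
  also have "\<dots> = ennreal (real (Suc n) powr t) * \<tau> (Bpow t)" using BtP by (intro \<tau>_scaleR) auto
  also have "\<dots> < \<infinity>" using trace_power by (simp add: Bpow_def B_def ennreal_mult_less_top)
  finally show "hs (f n)" unfolding hs_def using fN fs by simp
  show "positive_op ((f (Suc n) o\<^sub>L f (Suc n)) - (f n o\<^sub>L f n))"
  proof -
    have "(f (Suc n) o\<^sub>L f (Suc n)) - (f n o\<^sub>L f n) = cont_calculus (\<lambda>x. cut (Suc n) x - cut n x) B"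
      unfolding f_square by (rule cont_calculus_diff[symmetric]) (rule cut_continuous)+
    then show ?thesis
      using cont_calculus_nonneg[OF B_positive continuous_on_diff[OF cut_continuous cut_continuous], of "Suc n" n] cut_mono by simp
  qed
  show "positive_op (id_blinfun - (f n o\<^sub>L f n))" by (rule f_square_le_one)
next
  show "(\<lambda>n. Re (cinner x ((f n o\<^sub>L f n) x))) \<longlonglongrightarrow> (norm x)\<^sup>2" for x by (rule f_square_limit)
qed


subsection \<open>Powers of the resolvent on the negative half line\<close>

definition P :: "real \<Rightarrow> 'a \<Rightarrow>\<^sub>L 'a" where
  "P x = - Rz (- of_real x)"

lemma P_N: "x \<ge> 0 \<Longrightarrow> P x \<in> N"
  unfolding P_def by (intro N_minus Rz_N) simp

lemma Rz_neg_continuous: "continuous_on {0..} (\<lambda>x. Rz (- of_real x))"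
proof (rule continuous_at_imp_continuous_on, rule ballI)
  fix x :: real assume "x \<in> {0..}"
  then have "isCont Rz (- of_real x)" by (intro Rz_continuous) auto
  then show "isCont (\<lambda>x. Rz (- of_real x)) x"
    by (rule isCont_o2[rotated]) (intro continuous_intros)
qed

lemma P_eq: "x \<ge> 0 \<Longrightarrow> P x = B - x *\<^sub>R (B o\<^sub>L P x)"
  and P_B_commute: "x \<ge> 0 \<Longrightarrow> B o\<^sub>L P x = P x o\<^sub>L B"
proof -
  assume x: "x \<ge> 0"
  have "Rz 0 - Rz (- of_real x) = scal (of_real (- x)) o\<^sub>L (Rz 0 o\<^sub>L Rz (- of_real x))"
    using resolvent_identity[of 0 "- of_real x"] x by simp
  then show "P x = B - x *\<^sub>R (B o\<^sub>L P x)"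
    unfolding scal_of_real by (simp add: P_def B_def compose_distribs algebra_simps)
  show "B o\<^sub>L P x = P x o\<^sub>L B"
    unfolding P_def B_def using Rz_commute[of 0 "- of_real x"] x by (simp add: compose_distribs)
qed

text \<open>The inverse of 1 + x B, as \<open>V_inverse\<close> confirms. In
  \<open>P x = B o\<^sub>L V x\<close> it separates the dependence on x from the operator whose
  powers have finite trace.\<close>

definition V :: "real \<Rightarrow> 'a \<Rightarrow>\<^sub>L 'a" where
  "V x = id_blinfun - x *\<^sub>R P x"

lemma V_N: "x \<ge> 0 \<Longrightarrow> V x \<in> N"
  unfolding V_def by (intro N_diff N_id N_scaleR P_N)

lemma P_factor: "x \<ge> 0 \<Longrightarrow> P x = B o\<^sub>L V x"
  using P_eq[of x] by (simp add: V_def compose_distribs)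

lemma V_B_commute: "x \<ge> 0 \<Longrightarrow> B o\<^sub>L V x = V x o\<^sub>L B"
  using P_B_commute[of x] by (simp add: V_def compose_distribs)

lemma V_inverse: "x \<ge> 0 \<Longrightarrow> (id_blinfun + x *\<^sub>R B) o\<^sub>L V x = id_blinfun"
proof -
  assume x: "x \<ge> 0"
  have "(id_blinfun + x *\<^sub>R B) o\<^sub>L V x = V x + x *\<^sub>R (B o\<^sub>L V x)" by (simp add: compose_distribs)
  also have "\<dots> = V x + x *\<^sub>R P x" using P_factor[OF x] by simp
  finally show ?thesis by (simp add: V_def)
qed

lemma op_power_compose: "A o\<^sub>L C = C o\<^sub>L A \<Longrightarrow> op_power (A o\<^sub>L C) n = op_power A n o\<^sub>L op_power C n"
proof (induction n)
  case (Suc n)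
  have "op_power (A o\<^sub>L C) (Suc n) = A o\<^sub>L ((C o\<^sub>L op_power A n) o\<^sub>L op_power C n)"
    using Suc.IH[OF Suc.prems] by (simp only: op_power_simps blinfun_compose_assoc)
  also have "C o\<^sub>L op_power A n = op_power A n o\<^sub>L C" by (rule op_power_commute) (use Suc.prems in simp)
  finally show ?case by (simp add: blinfun_compose_assoc)
qed simp

lemma op_power_id [simp]: "op_power id_blinfun n = id_blinfun"
  by (induction n) auto

text \<open>What remains of the n-th power of \<open>P x\<close> when \<open>Bpow t\<close>, which
  is S S, is split off; n > t keeps the remaining exponent positive.\<close>

definition E :: "nat \<Rightarrow> real \<Rightarrow> 'a \<Rightarrow>\<^sub>L 'a" where
  "E n x = Bpow (real n - t) o\<^sub>L op_power (V x) n"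

lemma P_power_factor:
  assumes "x \<ge> 0" "real n > t"
  shows "op_power (P x) n = (S o\<^sub>L S) o\<^sub>L E n x"
proof -
  have "n > 0" using assms t_pos by (auto intro: gr0I)
  have "op_power (P x) n = op_power B n o\<^sub>L op_power (V x) n"
    unfolding P_factor[OF assms(1)] by (rule op_power_compose[OF V_B_commute[OF assms(1)]])
  also have "op_power B n = Bpow (t + (real n - t))" using op_power_B[OF \<open>n > 0\<close>] by simp
  also have "\<dots> = Bpow t o\<^sub>L Bpow (real n - t)" by (rule Bpow_add) (use t_pos assms in auto)
  finally show ?thesis by (simp add: S_square E_def blinfun_compose_assoc)
qed

lemma op_power_continuous:
  assumes "continuous_on A F"
  shows "continuous_on A (\<lambda>x. op_power (F x) n)"
proof (induction n)
  case (Suc n)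
  then show ?case using continuous_on_compose_ops[OF assms Suc] by simp
qed simp

lemma E_continuous: "continuous_on {0..} (E n)"
proof -
  have "continuous_on {0..} V"
    unfolding V_def P_def by (intro continuous_intros Rz_neg_continuous)
  then show ?thesis unfolding E_def
    by (intro continuous_on_compose_ops continuous_on_const op_power_continuous)
qed

lemma E_N: "x \<ge> 0 \<Longrightarrow> real n > t \<Longrightarrow> E n x \<in> N"
  unfolding E_def by (intro N_compose Bpow_N op_power_N V_N) auto

text \<open>\<open>E n x\<close> is the calculus of y powr (n - t) / (1 + x y)^n. Since y is at most
  1 on [0, \<open>norm B\<close>], the quotient y / (1 + x y) is at most 1 / (1 + x), and the
  remaining t powers of the denominator are at least 1.\<close>

lemma norm_E_le:
  assumes x: "x \<ge> 0" and n: "real n > t"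
  shows "norm (E n x) \<le> (1 + x) powr - (real n - t)"
proof -
  define h where "h y = y powr (real n - t) / (1 + x * y) ^ n" for y
  have pos: "1 + x * y > 0" if "y \<ge> 0" for y using that x by (simp add: add_pos_nonneg)
  have hc: "continuous_on {0..norm B} h"
    unfolding h_def using n pos
    by (intro continuous_on_divide powr_continuous continuous_intros) (auto simp: less_imp_neq[THEN not_sym])
  have lc: "continuous_on {0..norm B} (\<lambda>y. 1 + x * y)" by (intro continuous_intros)
  have "cont_calculus (\<lambda>y. 1 + x * y) B = id_blinfun + x *\<^sub>R B"
    using cont_calculus_add[OF B_positive continuous_on_const continuous_on_mult[OF continuous_on_const continuous_on_id], of 1 x]
      cont_calculus_mult[OF B_positive continuous_on_const continuous_on_id, of x]
    by (simp add: cont_calculus_const[OF B_positive] cont_calculus_ident[OF B_positive] compose_distribs)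
  then have lin: "cont_calculus (\<lambda>y. (1 + x * y) ^ n) B = op_power (id_blinfun + x *\<^sub>R B) n"
    using cont_calculus_power[OF lc, of n] by simp
  have "cont_calculus (\<lambda>y. h y * (1 + x * y) ^ n) B = Bpow (real n - t)"
    unfolding Bpow_def
  proof (rule cont_calculus_cong[OF B_positive])
    show "continuous_on {0..norm B} (\<lambda>y. h y * (1 + x * y) ^ n)" by (intro continuous_intros hc)
    show "h y * (1 + x * y) ^ n = y powr (real n - t)" if "y \<in> {0..norm B}" for y
      using pos[of y] that by (simp add: h_def)
  qed
  then have "Bpow (real n - t) = cont_calculus h B o\<^sub>L op_power (id_blinfun + x *\<^sub>R B) n"
    using cont_calculus_mult[OF B_positive hc continuous_on_power[OF lc, of n]] lin by simp
  moreover have "op_power (id_blinfun + x *\<^sub>R B) n o\<^sub>L op_power (V x) n = id_blinfun"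
  proof -
    have "(id_blinfun + x *\<^sub>R B) o\<^sub>L V x = V x o\<^sub>L (id_blinfun + x *\<^sub>R B)"
      using V_B_commute[OF x] by (simp add: compose_distribs)
    then show ?thesis using op_power_compose[of "id_blinfun + x *\<^sub>R B" "V x" n] V_inverse[OF x] by simp
  qed
  ultimately have E_eq: "E n x = cont_calculus h B"
    by (simp add: E_def blinfun_compose_assoc)
  show ?thesis
    unfolding E_eq
  proof (rule norm_cont_calculus_le[OF B_positive hc])
    fix y assume "y \<in> {0..norm B}"
    then have y: "0 \<le> y" "y \<le> 1" using B_interval by auto
    have q: "1 + x * y > 0" by (rule pos[OF y(1)])
    have "y * (1 + x) \<le> 1 + x * y" using y by (simp add: distrib_left mult.commute)
    then have "y / (1 + x * y) \<le> 1 / (1 + x)" using q x by (simp add: field_simps)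
    then have "(y / (1 + x * y)) powr (real n - t) \<le> (1 / (1 + x)) powr (real n - t)"
      using n y q by (intro powr_mono2) auto
    also have "\<dots> = (1 + x) powr - (real n - t)" unfolding powr_minus using x by (subst powr_divide) (auto simp: inverse_eq_divide)
    finally have 1: "(y / (1 + x * y)) powr (real n - t) \<le> (1 + x) powr - (real n - t)" .
    have "h y = y powr (real n - t) / (1 + x * y) powr real n"
      using q by (simp add: h_def powr_realpow)
    also have "(1 + x * y) powr real n = (1 + x * y) powr (real n - t) * (1 + x * y) powr t"
      unfolding powr_add[symmetric] by simp
    also have "y powr (real n - t) / ((1 + x * y) powr (real n - t) * (1 + x * y) powr t)
      = (y / (1 + x * y)) powr (real n - t) / (1 + x * y) powr t"
      using y q by (simp add: powr_divide)
    also have "\<dots> \<le> (y / (1 + x * y)) powr (real n - t) / 1"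
      using q x y t_pos by (intro divide_left_mono ge_one_powr_ge_zero) auto
    finally have "h y \<le> (1 + x) powr - (real n - t)" using 1 by simp
    moreover have "h y \<ge> 0" using q by (simp add: h_def)
    ultimately show "\<bar>h y\<bar> \<le> (1 + x) powr - (real n - t)" by simp
  qed
qed


subsection \<open>Functions with a trace class factor\<close>

text \<open>The shape to which \<open>trace_integral_cyclic\<close> applies: S S stands in the
  middle of every summand, the left factor is bounded, and all the decay, of order d, is on the
  right. It is stable under sums and under multiplication by functions on either side.\<close>

definition factored :: "(real \<Rightarrow> 'a \<Rightarrow>\<^sub>L 'a) \<Rightarrow> real \<Rightarrow> bool" where
  "factored F d \<longleftrightarrow> (\<exists>(I :: nat) C G K. K \<ge> 0 \<and>
     (\<forall>i<I. continuous_on {0..} (C i) \<and> continuous_on {0..} (G i) \<and>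
        (\<forall>x\<ge>0. C i x \<in> N \<and> G i x \<in> N \<and> norm (C i x) \<le> K \<and> norm (G i x) \<le> K * (1 + x) powr - d)) \<and>
     (\<forall>x\<ge>0. F x = (\<Sum>i<I. C i x o\<^sub>L ((S o\<^sub>L S) o\<^sub>L G i x))))"

lemma factoredI:
  fixes I :: nat
  assumes "K \<ge> 0"
    and "\<And>i. i < I \<Longrightarrow> continuous_on {0..} (C i) \<and> continuous_on {0..} (G i) \<and>
        (\<forall>x\<ge>0. C i x \<in> N \<and> G i x \<in> N \<and> norm (C i x) \<le> K \<and> norm (G i x) \<le> K * (1 + x) powr - d)"
    and "\<And>x. x \<ge> 0 \<Longrightarrow> F x = (\<Sum>i<I. C i x o\<^sub>L ((S o\<^sub>L S) o\<^sub>L G i x))"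
  shows "factored F d"
  unfolding factored_def
  by (rule exI[of _ I], rule exI[of _ C], rule exI[of _ G], rule exI[of _ K], rule conjI[OF assms(1)],
      rule conjI, intro allI impI, rule assms(2), assumption, intro allI impI, rule assms(3), assumption)

lemma factored_zero: "factored (\<lambda>_. 0) d"
  by (rule factoredI[of 0 0]) auto

lemma factored_add:
  assumes "factored F d" "factored F' d"
  shows "factored (\<lambda>x. F x + F' x) d"
proof -
  obtain I :: nat and C G K where 1: "K \<ge> 0"
    "\<And>i. i < I \<Longrightarrow> continuous_on {0..} (C i) \<and> continuous_on {0..} (G i) \<and>
        (\<forall>x\<ge>0. C i x \<in> N \<and> G i x \<in> N \<and> norm (C i x) \<le> K \<and> norm (G i x) \<le> K * (1 + x) powr - d)"
    "\<And>x. x \<ge> 0 \<Longrightarrow> F x = (\<Sum>i<I. C i x o\<^sub>L ((S o\<^sub>L S) o\<^sub>L G i x))"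
    using assms(1) unfolding factored_def by blast
  obtain I' :: nat and C' G' K' where 2: "K' \<ge> 0"
    "\<And>i. i < I' \<Longrightarrow> continuous_on {0..} (C' i) \<and> continuous_on {0..} (G' i) \<and>
        (\<forall>x\<ge>0. C' i x \<in> N \<and> G' i x \<in> N \<and> norm (C' i x) \<le> K' \<and> norm (G' i x) \<le> K' * (1 + x) powr - d)"
    "\<And>x. x \<ge> 0 \<Longrightarrow> F' x = (\<Sum>i<I'. C' i x o\<^sub>L ((S o\<^sub>L S) o\<^sub>L G' i x))"
    using assms(2) unfolding factored_def by blast
  define C'' where "C'' i = (if i < I then C i else C' (i - I))" for i
  define G'' where "G'' i = (if i < I then G i else G' (i - I))" for i
  define K'' where "K'' = max K K'"
  have K: "K'' \<ge> 0" "K \<le> K''" "K' \<le> K''" using 1(1) by (auto simp: K''_def)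
  have le: "K * p \<le> K'' * p" "K' * p \<le> K'' * p" if "p \<ge> 0" for p using K that by (auto intro: mult_right_mono)
  have "continuous_on {0..} (C'' i) \<and> continuous_on {0..} (G'' i) \<and>
        (\<forall>x\<ge>0. C'' i x \<in> N \<and> G'' i x \<in> N \<and> norm (C'' i x) \<le> K'' \<and> norm (G'' i x) \<le> K'' * (1 + x) powr - d)"
    if i: "i < I + I'" for i
  proof (cases "i < I")
    case True
    show ?thesis unfolding C''_def G''_def if_P[OF True]
    proof (intro conjI allI impI)
      show "norm (C i x) \<le> K''" "norm (G i x) \<le> K'' * (1 + x) powr - d" if "x \<ge> 0" for x
        using 1(2)[OF True] that by (auto intro: order_trans[OF _ K(2)] order_trans[OF _ le(1)])
    qed (use 1(2)[OF True] in blast)+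
  next
    case False
    then have "i - I < I'" using i by linarith
    show ?thesis unfolding C''_def G''_def if_not_P[OF False]
    proof (intro conjI allI impI)
      show "norm (C' (i - I) x) \<le> K''" "norm (G' (i - I) x) \<le> K'' * (1 + x) powr - d" if "x \<ge> 0" for x
        using 2(2)[OF \<open>i - I < I'\<close>] that by (auto intro: order_trans[OF _ K(3)] order_trans[OF _ le(2)])
    qed (use 2(2)[OF \<open>i - I < I'\<close>] in blast)+
  qed
  moreover have "F x + F' x = (\<Sum>i<I + I'. C'' i x o\<^sub>L ((S o\<^sub>L S) o\<^sub>L G'' i x))" if x: "x \<ge> 0" for x
  proof -
    have "(\<Sum>i<I + n. C'' i x o\<^sub>L ((S o\<^sub>L S) o\<^sub>L G'' i x)) =
      (\<Sum>i<I. C i x o\<^sub>L ((S o\<^sub>L S) o\<^sub>L G i x)) + (\<Sum>i<n. C' i x o\<^sub>L ((S o\<^sub>L S) o\<^sub>L G' i x))" for n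
    proof (induction n)
      case 0
      show ?case by (simp add: C''_def G''_def)
    qed (simp add: C''_def G''_def)
    then show ?thesis using 1(3)[OF x] 2(3)[OF x] by simp
  qed
  ultimately show ?thesis by (intro factoredI[OF K(1), of "I + I'" C'' G''])
qed

lemma factored_sum:
  "finite I \<Longrightarrow> (\<And>i. i \<in> I \<Longrightarrow> factored (F i) d) \<Longrightarrow> factored (\<lambda>x. \<Sum>i\<in>I. F i x) d"
proof (induction I rule: finite_induct)
  case (insert i I)
  then show ?case using factored_add[of "F i" d "\<lambda>x. \<Sum>i\<in>I. F i x"] by simp
qed (simp add: factored_zero)

lemma factored_compose:
  assumes F: "factored F d" and H: "continuous_on {0..} H" "\<And>x. x \<ge> 0 \<Longrightarrow> H x \<in> N"
    and H': "continuous_on {0..} H'" "\<And>x. x \<ge> 0 \<Longrightarrow> H' x \<in> N"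
    and le: "\<And>x. x \<ge> 0 \<Longrightarrow> norm (H x) \<le> L * (1 + x) powr - e" "\<And>x. x \<ge> 0 \<Longrightarrow> norm (H' x) \<le> L * (1 + x) powr - e'"
  shows "factored (\<lambda>x. H x o\<^sub>L (F x o\<^sub>L H' x)) (d + e + e')"
proof -
  obtain I :: nat and C G K where 1: "K \<ge> 0"
    "\<And>i. i < I \<Longrightarrow> continuous_on {0..} (C i) \<and> continuous_on {0..} (G i) \<and>
        (\<forall>x\<ge>0. C i x \<in> N \<and> G i x \<in> N \<and> norm (C i x) \<le> K \<and> norm (G i x) \<le> K * (1 + x) powr - d)"
    "\<And>x. x \<ge> 0 \<Longrightarrow> F x = (\<Sum>i<I. C i x o\<^sub>L ((S o\<^sub>L S) o\<^sub>L G i x))"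
    using F unfolding factored_def by blast
  have L: "L \<ge> 0" using order_trans[OF norm_ge_zero le(1)[of 0]] by simp
  \<comment> \<open>The decay of order e of the left multiplier is moved to the right factor by the
    weight (1 + x) powr e, so that \<open>C'\<close> is merely bounded.\<close>
  define C' where "C' i x = (1 + x) powr e *\<^sub>R (H x o\<^sub>L C i x)" for i x
  define G' where "G' i x = (1 + x) powr - e *\<^sub>R (G i x o\<^sub>L H' x)" for i x
  define K' where "K' = max (L * K) (K * L)"
  have cp: "continuous_on {0..} (\<lambda>x :: real. (1 + x) powr c)" for c
    by (intro continuous_on_powr' continuous_intros) auto
  have "continuous_on {0..} (C' i) \<and> continuous_on {0..} (G' i) \<and>
        (\<forall>x\<ge>0. C' i x \<in> N \<and> G' i x \<in> N \<and> norm (C' i x) \<le> K' \<and> norm (G' i x) \<le> K' * (1 + x) powr - (d + e + e'))"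
    if i: "i < I" for i
  proof (intro conjI allI impI)
    note b = 1(2)[OF i]
    show "continuous_on {0..} (C' i)" unfolding C'_def
      using b by (intro continuous_on_scaleR cp continuous_on_compose_ops H) auto
    show "continuous_on {0..} (G' i)" unfolding G'_def
      using b by (intro continuous_on_scaleR cp continuous_on_compose_ops H') auto
    fix x :: real assume x: "x \<ge> 0"
    show "C' i x \<in> N" "G' i x \<in> N" unfolding C'_def G'_def
      using b x by (auto intro!: N_scaleR N_compose H H')
    have "norm (C' i x) \<le> (1 + x) powr e * ((L * (1 + x) powr - e) * K)"
      unfolding C'_def norm_scaleR real_norm_def abs_of_nonneg[OF powr_ge_zero]
      using b x by (intro mult_left_mono norm_compose_mono le(1)[OF x]) auto
    also have "\<dots> = ((1 + x) powr e * (1 + x) powr - e) * (L * K)" by (simp only: mult_ac)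
    also have "(1 + x) powr e * (1 + x) powr - e = 1" unfolding powr_add[symmetric] using x by simp
    finally show "norm (C' i x) \<le> K'" by (simp add: K'_def)
    have "norm (G' i x) \<le> (1 + x) powr - e * ((K * (1 + x) powr - d) * (L * (1 + x) powr - e'))"
      unfolding G'_def norm_scaleR real_norm_def abs_of_nonneg[OF powr_ge_zero]
      using b x by (intro mult_left_mono norm_compose_mono le(2)[OF x]) auto
    also have "\<dots> = (K * L) * ((1 + x) powr - d * (1 + x) powr - e * (1 + x) powr - e')" by (simp only: mult_ac)
    also have "(1 + x) powr - d * (1 + x) powr - e * (1 + x) powr - e' = (1 + x) powr - (d + e + e')"
      unfolding powr_add[symmetric] by simp
    also have "K * L * (1 + x) powr - (d + e + e') \<le> K' * (1 + x) powr - (d + e + e')"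
      by (intro mult_right_mono) (auto simp: K'_def)
    finally show "norm (G' i x) \<le> K' * (1 + x) powr - (d + e + e')" .
  qed
  moreover have "H x o\<^sub>L (F x o\<^sub>L H' x) = (\<Sum>i<I. C' i x o\<^sub>L ((S o\<^sub>L S) o\<^sub>L G' i x))" if x: "x \<ge> 0" for x
  proof -
    have one: "(1 + x) powr e * (1 + x) powr - e = 1" unfolding powr_add[symmetric] using x by simp
    have "C' i x o\<^sub>L ((S o\<^sub>L S) o\<^sub>L G' i x) = H x o\<^sub>L ((C i x o\<^sub>L ((S o\<^sub>L S) o\<^sub>L G i x)) o\<^sub>L H' x)" for i
    proof -
      have "C' i x o\<^sub>L ((S o\<^sub>L S) o\<^sub>L G' i x) = ((1 + x) powr e * (1 + x) powr - e) *\<^sub>R (H x o\<^sub>L ((C i x o\<^sub>L ((S o\<^sub>L S) o\<^sub>L G i x)) o\<^sub>L H' x))"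
        unfolding C'_def G'_def by (simp add: compose_distribs blinfun_compose_assoc mult.commute)
      then show ?thesis unfolding one by simp
    qed
    then show ?thesis unfolding 1(3)[OF x] bounded_bilinear.sum_left[OF bounded_bilinear_blinfun_compose]
      bounded_bilinear.sum_right[OF bounded_bilinear_blinfun_compose] by simp
  qed
  moreover have "K' \<ge> 0" using 1(1) L by (simp add: K'_def)
  ultimately show ?thesis by (intro factoredI[of K' I C' G'])
qed

lemma factored_scaleR:
  assumes "factored F d"
  shows "factored (\<lambda>x. r *\<^sub>R F x) d"
proof -
  have "factored (\<lambda>x. (r *\<^sub>R id_blinfun) o\<^sub>L (F x o\<^sub>L id_blinfun)) (d + 0 + 0)"
    by (rule factored_compose[OF assms, where L = "max (norm (r *\<^sub>R id_blinfun :: 'a \<Rightarrow>\<^sub>L 'a)) (norm (id_blinfun :: 'a \<Rightarrow>\<^sub>L 'a))"])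
      (auto intro!: N_closed)
  then show ?thesis by (simp add: compose_distribs)
qed

lemma res_deriv_neg: "res_deriv k (- of_real x) = (- fact k) *\<^sub>R op_power (P x) (Suc k)"
proof -
  have "op_power (- A) n = (-1) ^ n *\<^sub>R op_power A n" for A :: "'a \<Rightarrow>\<^sub>L 'a" and n
    by (induction n) (auto simp: compose_distribs)
  from this[of "P x" "Suc k"] have "op_power (Rz (- of_real x)) (Suc k) = (-1) ^ Suc k *\<^sub>R op_power (P x) (Suc k)"
    by (simp add: P_def del: op_power_simps)
  moreover have "(-1) ^ k * fact k * (-1) ^ Suc k = (- fact k :: real)"
    by (simp add: mult.commute flip: power_mult_distrib)
  ultimately show ?thesis unfolding res_deriv_def by (simp del: op_power_simps power_Suc)
qed

lemma factored_res_deriv: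
  assumes "real (Suc k) > t"
  shows "factored (\<lambda>x. res_deriv k (- of_real x)) (real (Suc k) - t)"
proof -
  have "factored (\<lambda>x. op_power (P x) (Suc k)) (real (Suc k) - t)"
    unfolding factored_def
  proof (intro exI conjI allI impI)
    show "1 \<ge> (0 :: real)" by simp
    fix i :: nat assume "i < 1"
    show "continuous_on {0..} (\<lambda>x :: real. id_blinfun :: 'a \<Rightarrow>\<^sub>L 'a)" "continuous_on {0..} (E (Suc k))"
      by (intro continuous_intros E_continuous)+
    fix x :: real assume x: "x \<ge> 0"
    show "id_blinfun \<in> N" by (rule N_id)
    show "E (Suc k) x \<in> N" by (rule E_N[OF x assms])
    show "norm (id_blinfun :: 'a \<Rightarrow>\<^sub>L 'a) \<le> 1" by (rule norm_blinfun_id_le)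
    show "norm (E (Suc k) x) \<le> 1 * (1 + x) powr - (real (Suc k) - t)" using norm_E_le[OF x assms] by simp
  next
    fix x :: real assume x: "x \<ge> 0"
    show "op_power (P x) (Suc k) = (\<Sum>i<(1 :: nat). id_blinfun o\<^sub>L ((S o\<^sub>L S) o\<^sub>L E (Suc k) x))"
      using P_power_factor[OF x assms] by (simp del: op_power_simps add: lessThan_Suc)
  qed
  then show ?thesis unfolding res_deriv_neg by (rule factored_scaleR)
qed

lemma divide_power_eq_powr:
  fixes x :: real
  assumes "x \<ge> 0"
  shows "C / (1 + cmod (- of_real x)) ^ n = C * (1 + x) powr - real n"
proof -
  have "(1 + x) powr - real n = inverse ((1 + x) ^ n)"
    unfolding powr_minus using assms by (subst powr_realpow) auto
  moreover have "cmod (- of_real x) = x" using assms by simp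
  ultimately show ?thesis by (simp only: divide_inverse)
qed

lemma res_deriv_neg_bound:
  "\<exists>L\<ge>0. \<forall>x\<ge>0. norm (res_deriv k (- of_real x)) \<le> L * (1 + x) powr - real (Suc k)"
proof -
  obtain C where C: "C \<ge> 0" "\<And>z. Re z \<le> 1 / 2 \<Longrightarrow> norm (res_deriv k z) \<le> C / (1 + cmod z) ^ Suc k"
    using norm_res_deriv_le by blast
  have "norm (res_deriv k (- of_real x)) \<le> C * (1 + x) powr - real (Suc k)" if "x \<ge> 0" for x
    using C(2)[of "- of_real x"] that unfolding divide_power_eq_powr[OF that] by (simp del: of_nat_Suc)
  with C(1) show ?thesis by blast
qed

lemma word_deriv_neg_bound:
  "\<exists>L\<ge>0. \<forall>x\<ge>0. norm (word_deriv b j k (- of_real x)) \<le> L * (1 + x) powr - real (Suc j + k)"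
proof -
  obtain C where C: "C \<ge> 0" "\<And>z. Re z \<le> 1 / 2 \<Longrightarrow> norm (word_deriv b j k z) \<le> C / (1 + cmod z) ^ (Suc j + k)"
    using norm_word_deriv_le by blast
  have "norm (word_deriv b j k (- of_real x)) \<le> C * (1 + x) powr - real (Suc j + k)" if "x \<ge> 0" for x
    using C(2)[of "- of_real x"] that unfolding divide_power_eq_powr[OF that]
    by (simp del: of_nat_Suc of_nat_add add_Suc)
  with C(1) show ?thesis by blast
qed

lemma continuous_neg:
  assumes "\<And>z. Re z < 1 \<Longrightarrow> isCont F z"
  shows "continuous_on {0..} (\<lambda>x :: real. F (- complex_of_real x))"
proof (rule continuous_at_imp_continuous_on, rule ballI)
  fix x :: real assume "x \<in> {0..}"
  then have "isCont F (- of_real x)" by (intro assms) auto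
  then show "isCont (\<lambda>x. F (- of_real x)) x"
    by (rule isCont_o2[rotated]) (intro continuous_intros)
qed

text \<open>Pigeonhole: if k is at least (j + 1) n, then in each term some of the j + 1 resolvents
  is differentiated at least n times and has a power above t. In the Leibniz sum either the shorter
  word or the last resolvent receives enough derivatives; the other one only adds decay.\<close>

lemma factored_word:
  assumes b: "\<And>j. j \<le> m \<Longrightarrow> b j \<in> N" and n: "real n > t"
  shows "j \<le> m \<Longrightarrow> k \<ge> Suc j * n \<Longrightarrow> factored (\<lambda>x. word_deriv b j k (- of_real x)) (real (Suc j + k) - t)"
proof (induction j arbitrary: k)
  case 0
  have "factored (\<lambda>x. b 0 o\<^sub>L (res_deriv k (- of_real x) o\<^sub>L id_blinfun)) (real (Suc k) - t + 0 + 0)"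
    by (rule factored_compose[where L = "max (norm (b 0)) (norm (id_blinfun :: 'a \<Rightarrow>\<^sub>L 'a))"])
      (use b n 0 factored_res_deriv[of k] in \<open>auto intro!: N_closed\<close>)
  then show ?case by simp
next
  case (Suc j)
  have "factored (\<lambda>x. \<Sum>i\<le>k. real (k choose i) *\<^sub>R (word_deriv b j i (- of_real x) o\<^sub>L (b (Suc j) o\<^sub>L res_deriv (k - i) (- of_real x))))
    (real (Suc (Suc j) + k) - t)"
  proof (intro factored_sum factored_scaleR)
    fix i assume "i \<in> {..k}"
    then have i: "i \<le> k" by simp
    have bN: "b (Suc j) \<in> N" using b Suc.prems by blast
    have rc: "continuous_on {0..} (\<lambda>x. res_deriv (k - i) (- of_real x))"
      by (intro continuous_neg cderiv_continuous[OF cderiv_res_deriv])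
    have rN: "res_deriv (k - i) (- of_real x) \<in> N" if "x \<ge> 0" for x using that by (intro res_deriv_N) simp
    have wc: "continuous_on {0..} (\<lambda>x. word_deriv b j i (- of_real x))"
      by (rule continuous_neg) (use Suc.prems in \<open>auto intro!: cderiv_continuous[OF cderiv_word_deriv[OF b]]\<close>)
    have wN: "word_deriv b j i (- of_real x) \<in> N" if "x \<ge> 0" for x
      using that Suc.prems by (intro word_deriv_N[of m] b) auto
    show "factored (\<lambda>x. word_deriv b j i (- of_real x) o\<^sub>L (b (Suc j) o\<^sub>L res_deriv (k - i) (- of_real x))) (real (Suc (Suc j) + k) - t)"
    proof (cases "i \<ge> Suc j * n")
      case True
      obtain L where L: "L \<ge> 0" "\<And>x. x \<ge> 0 \<Longrightarrow> norm (res_deriv (k - i) (- of_real x)) \<le> L * (1 + x) powr - real (Suc (k - i))"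
        using res_deriv_neg_bound by blast
      have IH: "factored (\<lambda>x. word_deriv b j i (- of_real x)) (real (Suc j + i) - t)"
        using Suc.IH[of i] Suc.prems True by simp
      have "factored (\<lambda>x. id_blinfun o\<^sub>L (word_deriv b j i (- of_real x) o\<^sub>L (b (Suc j) o\<^sub>L res_deriv (k - i) (- of_real x))))
        (real (Suc j + i) - t + 0 + real (Suc (k - i)))"
      proof (rule factored_compose[OF IH, where L = "max 1 (norm (b (Suc j)) * L)"])
        fix x :: real assume x: "x \<ge> 0"
        show "norm (id_blinfun :: 'a \<Rightarrow>\<^sub>L 'a) \<le> max 1 (norm (b (Suc j)) * L) * (1 + x) powr - 0"
          using norm_blinfun_id_le[where 'a = 'a] x by simp
        have "norm (b (Suc j) o\<^sub>L res_deriv (k - i) (- of_real x)) \<le> norm (b (Suc j)) * (L * (1 + x) powr - real (Suc (k - i)))"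
          by (rule norm_compose_mono[OF order_refl L(2)[OF x]])
        also have "\<dots> \<le> max 1 (norm (b (Suc j)) * L) * (1 + x) powr - real (Suc (k - i))"
          unfolding mult.assoc[symmetric] by (rule mult_right_mono) auto
        finally show "norm (b (Suc j) o\<^sub>L res_deriv (k - i) (- of_real x)) \<le> \<dots>" .
      qed (auto intro!: N_closed bN rN continuous_on_compose_ops rc)
      then show ?thesis using i by (simp add: of_nat_diff algebra_simps)
    next
      case False
      have "k - i \<ge> n" using False Suc.prems(2) by simp
      then have big: "real (Suc (k - i)) > t" using n by linarith
      obtain L where L: "L \<ge> 0" "\<And>x. x \<ge> 0 \<Longrightarrow> norm (word_deriv b j i (- of_real x)) \<le> L * (1 + x) powr - real (Suc j + i)"
        using word_deriv_neg_bound by blast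
      have "factored (\<lambda>x. (word_deriv b j i (- of_real x) o\<^sub>L b (Suc j)) o\<^sub>L (res_deriv (k - i) (- of_real x) o\<^sub>L id_blinfun))
        (real (Suc (k - i)) - t + real (Suc j + i) + 0)"
      proof (rule factored_compose[OF factored_res_deriv[OF big], where L = "max 1 (L * norm (b (Suc j)))"])
        fix x :: real assume x: "x \<ge> 0"
        show "norm (id_blinfun :: 'a \<Rightarrow>\<^sub>L 'a) \<le> max 1 (L * norm (b (Suc j))) * (1 + x) powr - 0"
          using norm_blinfun_id_le[where 'a = 'a] x by simp
        have "norm (word_deriv b j i (- of_real x) o\<^sub>L b (Suc j)) \<le> (L * (1 + x) powr - real (Suc j + i)) * norm (b (Suc j))"
          by (rule norm_compose_mono[OF L(2)[OF x] order_refl])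
        also have "\<dots> = (L * norm (b (Suc j))) * (1 + x) powr - real (Suc j + i)" by (simp only: mult_ac)
        also have "\<dots> \<le> max 1 (L * norm (b (Suc j))) * (1 + x) powr - real (Suc j + i)"
          by (intro mult_right_mono) auto
        finally show "norm (word_deriv b j i (- of_real x) o\<^sub>L b (Suc j)) \<le> \<dots>" .
      qed (auto intro!: N_closed bN wN continuous_on_compose_ops wc)
      then show ?thesis using i by (simp add: of_nat_diff algebra_simps blinfun_compose_assoc)
    qed
  qed simp
  then show ?case by simp
qed

text \<open>The function \<open>\<omega>\<close> is built pointwise from the factors, as the sum of
  \<open>ftr S\<close> applied to the products G C. The shift y and the exponent u enter only
  through the argument and a scalar weight, so one \<open>\<omega>\<close> serves all of
  them.\<close>

theorem trace_half_line:
  assumes F: "factored F d"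
  shows "\<exists>\<omega> K. continuous_on {0..} \<omega> \<and> (\<forall>y\<ge>0. cmod (\<omega> y) \<le> K * (1 + y) powr - d) \<and>
    (\<forall>y u. y \<ge> 0 \<longrightarrow> Re u > 0 \<longrightarrow> Re u + 1 < d \<longrightarrow>
       trace_class (integral {0..} (\<lambda>x. scal (of_real x powr u) o\<^sub>L F (x + y))) \<and>
       Tr (integral {0..} (\<lambda>x. scal (of_real x powr u) o\<^sub>L F (x + y))) = integral {0..} (\<lambda>x. of_real x powr u * \<omega> (x + y)))"
proof -
  obtain I :: nat and C G K where 1: "K \<ge> 0"
    "\<And>i. i < I \<Longrightarrow> continuous_on {0..} (C i) \<and> continuous_on {0..} (G i) \<and>
        (\<forall>x\<ge>0. C i x \<in> N \<and> G i x \<in> N \<and> norm (C i x) \<le> K \<and> norm (G i x) \<le> K * (1 + x) powr - d)"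
    "\<And>x. x \<ge> 0 \<Longrightarrow> F x = (\<Sum>i<I. C i x o\<^sub>L ((S o\<^sub>L S) o\<^sub>L G i x))"
    using F unfolding factored_def by blast
  have C: "continuous_on {0..} (C i)" "\<And>x. x \<ge> 0 \<Longrightarrow> C i x \<in> N" "\<And>x. x \<ge> 0 \<Longrightarrow> norm (C i x) \<le> K" if "i < I" for i
    using 1(2)[OF that] by auto
  have G: "continuous_on {0..} (G i)" "\<And>x. x \<ge> 0 \<Longrightarrow> G i x \<in> N" "\<And>x. x \<ge> 0 \<Longrightarrow> norm (G i x) \<le> K * (1 + x) powr - d" if "i < I" for i
    using 1(2)[OF that] by auto
  define om where "om i x = ftr S (G i x o\<^sub>L C i x)" for i x
  define \<omega> where "\<omega> x = (\<Sum>i<I. om i x)" for x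
  have omc: "continuous_on {0..} (om i)" if "i < I" for i
    unfolding om_def by (rule ftr_continuous[OF hs_S]) (use C[OF that] G[OF that] in \<open>auto intro!: continuous_on_compose_ops N_compose\<close>)
  have omb: "cmod (om i y) \<le> (4 * tr (S o\<^sub>L S) * K * K) * (1 + y) powr - d" if i: "i < I" and y: "y \<ge> 0" for i y
  proof -
    have "cmod (om i y) \<le> 4 * tr (S o\<^sub>L S) * norm (G i y o\<^sub>L C i y)"
      unfolding om_def by (intro norm_ftr_le hs_S N_compose C[OF i] G[OF i] y)
    also have "\<dots> \<le> 4 * tr (S o\<^sub>L S) * ((K * (1 + y) powr - d) * K)"
      by (intro mult_left_mono norm_compose_mono C[OF i] G[OF i] y) (simp add: tr_nonneg)
    finally show ?thesis by (simp add: mult_ac)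
  qed
  have "continuous_on {0..} \<omega>" unfolding \<omega>_def by (intro continuous_on_sum omc) auto
  moreover have "cmod (\<omega> y) \<le> (real I * (4 * tr (S o\<^sub>L S) * K * K)) * (1 + y) powr - d" if y: "y \<ge> 0" for y
  proof -
    have "cmod (\<omega> y) \<le> (\<Sum>i<I. (4 * tr (S o\<^sub>L S) * K * K) * (1 + y) powr - d)"
      unfolding \<omega>_def by (rule sum_norm_le) (use omb y in auto)
    then show ?thesis by (simp add: mult_ac)
  qed
  moreover have "trace_class (integral {0..} (\<lambda>x. scal (of_real x powr u) o\<^sub>L F (x + y))) \<and>
       Tr (integral {0..} (\<lambda>x. scal (of_real x powr u) o\<^sub>L F (x + y))) = integral {0..} (\<lambda>x. of_real x powr u * \<omega> (x + y))"
    if y: "y \<ge> 0" and u: "Re u > 0" "Re u + 1 < d" for y u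
  proof -
    \<comment> \<open>With the weights (1 + x) powr -e and (1 + x) powr e on the two factors, both
      decay like (1 + x) powr -e; their squares are integrable because Re u + 1 < d.\<close>
    define e where "e = (d - Re u) / 2"
    have e: "2 * e > 1" "d > 0" using u by (auto simp: e_def)
    define C' where "C' i x = (1 + x) powr - e *\<^sub>R C i (x + y)" for i x
    define E' where "E' i x = (1 + x) powr e *\<^sub>R (scal (of_real x powr u) o\<^sub>L G i (x + y))" for i x
    define g where "g x = K\<^sup>2 * (1 + x) powr - (2 * e)" for x :: real
    have g: "g integrable_on {0..}"
      unfolding g_def using integrable_cmul[OF integrable_on_half_line_powr[OF e(1)], of "K\<^sup>2"] by simp
    have cp: "continuous_on {0..} (\<lambda>x :: real. (1 + x) powr c)" for c
      by (intro continuous_on_powr' continuous_intros) auto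
    have sh: "continuous_on {0..} (\<lambda>x. X (x + y))" if "continuous_on {0..} X" for X :: "real \<Rightarrow> 'a \<Rightarrow>\<^sub>L 'a"
      by (rule continuous_on_compose2[OF that]) (use y in \<open>auto intro!: continuous_intros\<close>)
    have C'c: "continuous_on {0..} (C' i)" if "i < I" for i
      unfolding C'_def by (intro continuous_on_scaleR cp sh C that)
    have E'c: "continuous_on {0..} (E' i)" if "i < I" for i
      unfolding E'_def
      by (intro continuous_on_scaleR cp continuous_on_compose_ops sh G that
          bounded_linear.continuous_on[OF bounded_linear_scal] continuous_on_of_real_powr u)
    have C'N: "C' i x \<in> N" if "i < I" "x \<ge> 0" for i x
      unfolding C'_def using C(2)[OF that(1)] that y by (intro N_scaleR) auto
    have E'N: "E' i x \<in> N" if "i < I" "x \<ge> 0" for i x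
      unfolding E'_def using G(2)[OF that(1)] that y by (intro N_scaleR N_compose N_scal) auto
    have sq: "(K * (1 + x) powr - e)\<^sup>2 = g x" if "x \<ge> 0" for x
      using that by (simp add: g_def power_mult_distrib power2_eq_square powr_add[symmetric])
    have C'le: "(norm (C' i x))\<^sup>2 \<le> g x" if i: "i < I" and x: "x \<ge> 0" for i x
    proof -
      have "norm (C' i x) \<le> (1 + x) powr - e * K"
        unfolding C'_def using C(3)[OF i, of "x + y"] x y by (simp add: mult_left_mono)
      then have "(norm (C' i x))\<^sup>2 \<le> (K * (1 + x) powr - e)\<^sup>2" by (intro power_mono) (auto simp: mult.commute)
      then show ?thesis unfolding sq[OF x] .
    qed
    have E'le: "(norm (E' i x))\<^sup>2 \<le> g x" if i: "i < I" and x: "x \<ge> 0" for i x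
    proof -
      have "cmod (complex_of_real x powr u) \<le> (1 + x) powr Re u"
        using x u by (simp add: norm_powr_real_powr powr_mono2)
      moreover have "norm (G i (x + y)) \<le> K * (1 + x) powr - d"
      proof -
        have "(1 + (x + y)) powr - d \<le> (1 + x) powr - d" using x y e by (intro powr_mono2') auto
        then have "K * (1 + (x + y)) powr - d \<le> K * (1 + x) powr - d" by (rule mult_left_mono) (rule 1(1))
        then show ?thesis using G(3)[OF i, of "x + y"] x y by linarith
      qed
      ultimately have "cmod (complex_of_real x powr u) * norm (G i (x + y)) \<le> (1 + x) powr Re u * (K * (1 + x) powr - d)"
        by (intro mult_mono) auto
      then have "norm (E' i x) \<le> (1 + x) powr e * ((1 + x) powr Re u * (K * (1 + x) powr - d))"
        unfolding E'_def norm_scaleR norm_scal_compose by (simp add: mult_left_mono)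
      also have "\<dots> = K * ((1 + x) powr e * (1 + x) powr Re u * (1 + x) powr - d)" by (simp only: mult_ac)
      also have "(1 + x) powr e * (1 + x) powr Re u * (1 + x) powr - d = (1 + x) powr - e"
        unfolding powr_add[symmetric] by (rule arg_cong[where f = "\<lambda>c. (1 + x) powr c"]) (simp add: e_def field_simps)
      finally have "(norm (E' i x))\<^sup>2 \<le> (K * (1 + x) powr - e)\<^sup>2" by (intro power_mono) auto
      then show ?thesis unfolding sq[OF x] .
    qed
    have one: "(1 + x) powr - e * (1 + x) powr e = 1" if "x \<ge> 0" for x :: real
      unfolding powr_add[symmetric] using that by simp
    define X where "X i = integral {0..} (\<lambda>x. C' i x o\<^sub>L ((S o\<^sub>L S) o\<^sub>L E' i x))" for i
    have cyc: "trace_class (X i)" "Tr (X i) = integral {0..} (\<lambda>x. ftr S (E' i x o\<^sub>L C' i x))"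
      "(\<lambda>x. C' i x o\<^sub>L ((S o\<^sub>L S) o\<^sub>L E' i x)) integrable_on {0..}" if i: "i < I" for i
      unfolding X_def
      using trace_integral_cyclic[OF hs_S C'c[OF i] C'N[OF i] E'c[OF i] E'N[OF i] C'le[OF i] E'le[OF i] g] by blast+
    have bC: "C i x \<in> bounded_ops" "S \<in> bounded_ops" if "i < I" "x \<ge> 0" for i x
      using C(2)[OF that] N_bounded_ops hsD[OF hs_S] by auto
    have tm: "C' i x o\<^sub>L ((S o\<^sub>L S) o\<^sub>L E' i x) = scal (of_real x powr u) o\<^sub>L (C i (x + y) o\<^sub>L ((S o\<^sub>L S) o\<^sub>L G i (x + y)))"
      if i: "i < I" and x: "x \<ge> 0" for i x
    proof -
      have xy: "x + y \<ge> 0" using x y by simp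
      have "C' i x o\<^sub>L ((S o\<^sub>L S) o\<^sub>L E' i x) = ((1 + x) powr - e * (1 + x) powr e) *\<^sub>R
        (scal (of_real x powr u) o\<^sub>L (C i (x + y) o\<^sub>L ((S o\<^sub>L S) o\<^sub>L G i (x + y))))"
        unfolding C'_def E'_def using bC[OF i xy]
        by (simp add: compose_distribs move_scal blinfun_compose_assoc mult.commute)
      then show ?thesis unfolding one[OF x] by simp
    qed
    have "integral {0..} (\<lambda>x. scal (of_real x powr u) o\<^sub>L F (x + y)) = integral {0..} (\<lambda>x. \<Sum>i<I. C' i x o\<^sub>L ((S o\<^sub>L S) o\<^sub>L E' i x))"
    proof (rule integral_cong)
      fix x :: real assume "x \<in> {0..}"
      then have x: "x \<ge> 0" by simp
      have "F (x + y) = (\<Sum>i<I. C i (x + y) o\<^sub>L ((S o\<^sub>L S) o\<^sub>L G i (x + y)))" using 1(3) x y by simp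
      then show "scal (of_real x powr u) o\<^sub>L F (x + y) = (\<Sum>i<I. C' i x o\<^sub>L ((S o\<^sub>L S) o\<^sub>L E' i x))"
        by (simp add: bounded_bilinear.sum_right[OF bounded_bilinear_blinfun_compose] tm[OF _ x])
    qed
    also have "\<dots> = (\<Sum>i<I. X i)"
      unfolding X_def using cyc(3) by (intro integral_sum) auto
    finally have XI: "integral {0..} (\<lambda>x. scal (of_real x powr u) o\<^sub>L F (x + y)) = (\<Sum>i<I. X i)" .
    have ftr_term: "ftr S (E' i x o\<^sub>L C' i x) = of_real x powr u * om i (x + y)" if i: "i < I" and x: "x \<ge> 0" for i x
    proof -
      have xy: "x + y \<ge> 0" using x y by simp
      have "E' i x o\<^sub>L C' i x = ((1 + x) powr - e * (1 + x) powr e) *\<^sub>R (scal (of_real x powr u) o\<^sub>L (G i (x + y) o\<^sub>L C i (x + y)))"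
        unfolding C'_def E'_def by (simp add: compose_distribs blinfun_compose_assoc mult.commute)
      then have "E' i x o\<^sub>L C' i x = scal (of_real x powr u) o\<^sub>L (G i (x + y) o\<^sub>L C i (x + y))" unfolding one[OF x] by simp
      then show ?thesis
        unfolding om_def using ftr_linear(3)[OF hs_S N_compose[OF G(2)[OF i xy] C(2)[OF i xy]] N_zero] by simp
    qed
    have int_om: "(\<lambda>x. of_real x powr u * om i (x + y)) integrable_on {0..}" if i: "i < I" for i
    proof (rule integrable_on_dominated)
      show "continuous_on {0..} (\<lambda>x. of_real x powr u * om i (x + y))"
        by (intro continuous_on_mult continuous_on_of_real_powr u continuous_on_compose2[OF omc[OF i]] continuous_intros) (use y in auto)
      show "(\<lambda>x. (4 * tr (S o\<^sub>L S) * K * K) * (1 + x) powr - (d - Re u)) integrable_on {0..}"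
        using integrable_cmul[OF integrable_on_half_line_powr[of "d - Re u"], of "4 * tr (S o\<^sub>L S) * K * K"] u by simp
      fix x :: real assume "x \<in> {0..}"
      then have x: "x \<ge> 0" by simp
      have pos: "4 * tr (S o\<^sub>L S) * K * K \<ge> 0" using 1(1) tr_nonneg[of "S o\<^sub>L S"] by (intro mult_nonneg_nonneg) auto
      have "cmod (complex_of_real x powr u) \<le> (1 + x) powr Re u"
        using x u by (simp add: norm_powr_real_powr powr_mono2)
      moreover have "cmod (om i (x + y)) \<le> (4 * tr (S o\<^sub>L S) * K * K) * (1 + x) powr - d"
      proof -
        have "(1 + (x + y)) powr - d \<le> (1 + x) powr - d" using x y e by (intro powr_mono2') auto
        then have "4 * tr (S o\<^sub>L S) * K * K * (1 + (x + y)) powr - d \<le> 4 * tr (S o\<^sub>L S) * K * K * (1 + x) powr - d"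
          by (rule mult_left_mono) (rule pos)
        then show ?thesis using omb[OF i, of "x + y"] x y by linarith
      qed
      ultimately have "cmod (of_real x powr u * om i (x + y)) \<le> (1 + x) powr Re u * ((4 * tr (S o\<^sub>L S) * K * K) * (1 + x) powr - d)"
        unfolding norm_mult by (intro mult_mono) auto
      also have "\<dots> = (4 * tr (S o\<^sub>L S) * K * K) * ((1 + x) powr Re u * (1 + x) powr - d)" by (simp only: mult_ac)
      also have "(1 + x) powr Re u * (1 + x) powr - d = (1 + x) powr - (d - Re u)" unfolding powr_add[symmetric] by simp
      finally show "cmod (of_real x powr u * om i (x + y)) \<le> (4 * tr (S o\<^sub>L S) * K * K) * (1 + x) powr - (d - Re u)" .
    qed simp
    have "Tr (\<Sum>i<I. X i) = (\<Sum>i<I. integral {0..} (\<lambda>x. of_real x powr u * om i (x + y)))"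
    proof -
      have "Tr (\<Sum>i<I. X i) = (\<Sum>i<I. Tr (X i))" by (rule Tr_sum) (use cyc(1) in auto)
      also have "\<dots> = (\<Sum>i<I. integral {0..} (\<lambda>x. of_real x powr u * om i (x + y)))"
      proof (rule sum.cong[OF refl])
        fix i assume "i \<in> {..<I}"
        then have i: "i < I" by simp
        show "Tr (X i) = integral {0..} (\<lambda>x. of_real x powr u * om i (x + y))"
          unfolding cyc(2)[OF i] by (rule integral_cong) (use ftr_term[OF i] in auto)
      qed
      finally show ?thesis .
    qed
    also have "\<dots> = integral {0..} (\<lambda>x. \<Sum>i<I. of_real x powr u * om i (x + y))"
      using int_om by (intro integral_sum[symmetric]) auto
    also have "\<dots> = integral {0..} (\<lambda>x. of_real x powr u * \<omega> (x + y))" by (simp add: \<omega>_def sum_distrib_left)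
    finally show ?thesis unfolding XI using trace_class_sum[of "{..<I}" X] cyc(1) by auto
  qed
  ultimately show ?thesis by blast
qed

end


section \<open>Fractional integrals on the half line\<close>

lemma integrable_half_line_powr:
  fixes \<rho> :: "real \<Rightarrow> complex"
  assumes u: "Re u > -1" and [measurable]: "\<rho> \<in> borel_measurable borel"
    and le: "\<And>y. y > 0 \<Longrightarrow> cmod (\<rho> y) \<le> K * (1 + y) powr - p"
    and p: "p > Re u + 1" and c: "c \<ge> 0"
  shows "integrable lborel (\<lambda>x. pos x *\<^sub>R (of_real x powr u * \<rho> (x + c)))"
proof (rule Bochner_Integration.integrable_bound)
  show "integrable lborel (\<lambda>x. K * (pos x * (x powr Re u * (1 + x) powr - p)))"
    using u p by (intro integrable_mult_right integrable_powr_beta) auto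
  have "0 \<le> K * 2 powr - p" using order_trans[OF norm_ge_zero le[of 1]] by simp
  moreover have "2 powr - p > 0" by simp
  ultimately have K: "K \<ge> 0" by (metis not_less mult_neg_pos)
  show "AE x in lborel. norm (pos x *\<^sub>R (of_real x powr u * \<rho> (x + c)))
    \<le> norm (K * (pos x * (x powr Re u * (1 + x) powr - p)))"
  proof (rule AE_I2)
    fix x :: real
    show "norm (pos x *\<^sub>R (of_real x powr u * \<rho> (x + c))) \<le> norm (K * (pos x * (x powr Re u * (1 + x) powr - p)))"
    proof (cases "x > 0")
      case True
      have "(1 + (x + c)) powr - p \<le> (1 + x) powr - p" using True c u p by (intro powr_mono2') auto
      then have "K * (1 + (x + c)) powr - p \<le> K * (1 + x) powr - p" using K by (rule mult_left_mono)
      then have "cmod (\<rho> (x + c)) \<le> K * (1 + x) powr - p" using le[of "x + c"] True c by simp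
      then have "x powr Re u * cmod (\<rho> (x + c)) \<le> x powr Re u * (K * (1 + x) powr - p)"
        by (rule mult_left_mono) simp
      then show ?thesis using True K by (simp add: norm_mult norm_of_real_powr abs_mult mult_ac)
    qed simp
  qed
qed measurable

theorem half_line_shifted_moment:
  fixes \<omega> :: "real \<Rightarrow> complex"
  assumes u: "Re u > -1" and \<omega>: "continuous_on {0..} \<omega>"
    and le: "\<And>y. y \<ge> 0 \<Longrightarrow> cmod (\<omega> y) \<le> K * (1 + y) powr - p"
    and p: "p > Re u + 1 + (real m + 1) / 2"
  shows "integral {0..} (\<lambda>s. of_real (s ^ m) * integral {0..} (\<lambda>x. of_real x powr u * \<omega> (x + s\<^sup>2)))
    = Gamma ((of_nat m + 1) / 2) / 2 * Gamma (u + 1) * rGamma (u + 1 + (of_nat m + 1) / 2) *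
      integral {0..} (\<lambda>y. of_real y powr (u + (of_nat m + 1) / 2) * \<omega> y)"
proof -
  \<comment> \<open>\<open>\<omega>\<close> is controlled on the half line only; extension by 0
    makes it Borel measurable on the whole line without changing the integrals.\<close>
  define \<rho> where "\<rho> y = pos y *\<^sub>R \<omega> y" for y
  have "continuous_on {0<..} \<omega>" by (rule continuous_on_subset[OF \<omega>]) auto
  then have \<rho>: "\<rho> \<in> borel_measurable borel"
    unfolding \<rho>_def by (intro borel_measurable_continuous_on_indicator) auto
  have \<rho>le: "cmod (\<rho> y) \<le> K * (1 + y) powr - p" if "y > 0" for y
    using le[of y] that by (simp add: \<rho>_def)
  have m: "(real m + 1) / 2 > 0" by simp
  have p': "p > Re u + 1" using p m by linarith
  have eq: "pos x *\<^sub>R (of_real x powr v * \<omega> (x + s\<^sup>2)) = pos x *\<^sub>R (of_real x powr v * \<rho> (x + s\<^sup>2))"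
    for x s and v :: complex
    by (cases "x > 0") (simp_all add: \<rho>_def add_pos_nonneg)
  have inner: "integral {0..} (\<lambda>x. of_real x powr u * \<omega> (x + s\<^sup>2)) = (\<integral>x. pos x *\<^sub>R (of_real x powr u * \<rho> (x + s\<^sup>2)) \<partial>lborel)" for s
    using half_line_integral(1)[of "\<lambda>x. of_real x powr u * \<omega> (x + s\<^sup>2)"]
      integrable_half_line_powr[OF u \<rho> \<rho>le p', of "s\<^sup>2"] unfolding eq by simp
  have eq': "pos s *\<^sub>R (of_real (s ^ m) * z) = (pos s * s ^ m) *\<^sub>R z" for s and z :: complex
    by (simp add: scaleR_conv_of_real mult_ac)
  have outer: "integral {0..} (\<lambda>s. of_real (s ^ m) * (\<integral>x. pos x *\<^sub>R (of_real x powr u * \<rho> (x + s\<^sup>2)) \<partial>lborel))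
    = (\<integral>s. (pos s * s ^ m) *\<^sub>R (\<integral>x. pos x *\<^sub>R (of_real x powr u * \<rho> (x + s\<^sup>2)) \<partial>lborel) \<partial>lborel)"
    using half_line_integral(1)[of "\<lambda>s. of_real (s ^ m) * (\<integral>x. pos x *\<^sub>R (of_real x powr u * \<rho> (x + s\<^sup>2)) \<partial>lborel)"]
      half_line_fractional_integrable[OF u \<rho> \<rho>le p] unfolding eq' by simp
  have "Re (u + (of_nat m + 1) / 2) = Re u + (real m + 1) / 2" by simp
  then have "Re (u + (of_nat m + 1) / 2) > -1" "p > Re (u + (of_nat m + 1) / 2) + 1" using u p m by linarith+
  note i = integrable_half_line_powr[OF this(1) \<rho> \<rho>le this(2), of 0]
  have "integral {0..} (\<lambda>y. of_real y powr (u + (of_nat m + 1) / 2) * \<omega> y)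
    = (\<integral>y. pos y *\<^sub>R (of_real y powr (u + (of_nat m + 1) / 2) * \<rho> y) \<partial>lborel)"
    using half_line_integral(1)[of "\<lambda>y. of_real y powr (u + (of_nat m + 1) / 2) * \<omega> y"] i
    using eq[of _ "u + (of_nat m + 1) / 2" 0] by (simp only: power_zero_numeral add_0_right)
  then show ?thesis
    unfolding inner outer by (simp only: half_line_fractional_integral[OF u \<rho> \<rho>le p])
qed


section \<open>Contour integrals of resolvent words\<close>

lemma norm_shift_le:
  assumes "c \<ge> 0"
  shows "1 + cmod z \<le> (1 + c) * (1 + cmod (z - of_real c))"
proof -
  have "cmod z \<le> cmod (z - of_real c) + c"
    using norm_triangle_ineq[of "z - of_real c" "of_real c"] assms by simp
  moreover have "0 \<le> c * cmod (z - of_real c)" using assms by simp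
  ultimately show ?thesis by (simp add: distrib_left distrib_right)
qed

lemma divide_power_shift_le:
  assumes "c \<ge> 0" "C \<ge> 0"
  shows "C / (1 + cmod (z - of_real c)) ^ n \<le> (C * (1 + c) ^ n) / (1 + cmod z) ^ n"
proof -
  have 1: "1 + cmod z > 0" "1 + cmod (z - of_real c) > 0" by (simp_all add: add_pos_nonneg)
  have "(1 + cmod z) ^ n \<le> (1 + c) ^ n * (1 + cmod (z - of_real c)) ^ n"
    unfolding power_mult_distrib[symmetric] using norm_shift_le[OF assms(1)] by (intro power_mono) auto
  then have "C * (1 + cmod z) ^ n \<le> C * ((1 + c) ^ n * (1 + cmod (z - of_real c)) ^ n)"
    using assms(2) by (rule mult_left_mono)
  then show ?thesis using 1 by (simp add: pos_divide_le_eq pos_le_divide_eq mult_ac)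
qed

lemma decaying_shift:
  fixes \<zeta> :: "nat \<Rightarrow> complex \<Rightarrow> complex"
  assumes \<zeta>: "decaying p \<zeta>" and c: "c \<ge> 0"
  shows "decaying p (\<lambda>k z. \<zeta> k (z - of_real c))"
  unfolding decaying_def
proof (intro conjI allI impI)
  fix k and z :: complex assume z: "Re z < 1"
  have "(\<zeta> k has_field_derivative \<zeta> (Suc k) (z - of_real c)) (at (z + - of_real c))"
    using decayingD[OF \<zeta>, of "z - of_real c" k] z c by simp
  then show "((\<lambda>z. \<zeta> k (z - of_real c)) has_field_derivative \<zeta> (Suc k) (z - of_real c)) (at z)"
    unfolding DERIV_shift by simp
next
  fix k
  obtain C where C: "C \<ge> 0" "\<And>z. Re z \<le> 1 / 2 \<Longrightarrow> cmod (\<zeta> k z) \<le> C / (1 + cmod z) ^ (p + k)"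
    using decaying_bound[OF \<zeta>] by blast
  have "cmod (\<zeta> k (z - of_real c)) \<le> (C * (1 + c) ^ (p + k)) / (1 + cmod z) ^ (p + k)" if "Re z \<le> 1 / 2" for z
    by (rule order_trans[OF C(2) divide_power_shift_le[OF c C(1)]]) (use that c in auto)
  then show "\<exists>C. \<forall>z. Re z \<le> 1 / 2 \<longrightarrow> cmod (\<zeta> k (z - of_real c)) \<le> C / (1 + cmod z) ^ (p + k)" by blast
qed

text \<open>The argument of the principal branch is at most pi in absolute value, which bounds the
  contribution of Im w.\<close>

lemma norm_powr_le_exp: "z \<noteq> 0 \<Longrightarrow> cmod (z powr w) \<le> cmod z powr Re w * exp (\<bar>Im w\<bar> * pi)"
proof -
  assume z: "z \<noteq> 0"
  have "- (Im w * Im (Ln z)) \<le> \<bar>Im w\<bar> * \<bar>Im (Ln z)\<bar>" unfolding abs_mult[symmetric] by (rule abs_ge_minus_self)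
  also have "\<dots> \<le> \<bar>Im w\<bar> * pi"
    using Im_Ln_le_pi[OF z] mpi_less_Im_Ln[OF z] by (intro mult_left_mono) auto
  finally have "exp (Re w * ln (cmod z)) * exp (- (Im w * Im (Ln z))) \<le> exp (Re w * ln (cmod z)) * exp (\<bar>Im w\<bar> * pi)"
    by simp
  moreover have "cmod (z powr w) = exp (Re w * ln (cmod z)) * exp (- (Im w * Im (Ln z)))"
    using z by (simp add: powr_def norm_exp_eq_Re Re_Ln flip: exp_add)
  ultimately show ?thesis using z by (simp add: powr_def)
qed

lemma norm_line_powr_le:
  assumes "0 < \<alpha>"
  shows "\<exists>C\<ge>0. \<forall>v. cmod (Complex \<alpha> v powr w) \<le> C * (1 + cmod (Complex \<alpha> v)) powr Re w"
proof -
  \<comment> \<open>The largest factor with l (1 + y) at most y for all y from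
    \<open>\<alpha>\<close> on. It is used for negative Re w, where the power is decreasing.\<close>
  define l where "l = \<alpha> / (1 + \<alpha>)"
  have l: "0 < l" using assms by (simp add: l_def)
  define C where "C = max 1 (l powr Re w) * exp (\<bar>Im w\<bar> * pi)"
  have "cmod (Complex \<alpha> v powr w) \<le> C * (1 + cmod (Complex \<alpha> v)) powr Re w" for v
  proof -
    define y where "y = cmod (Complex \<alpha> v)"
    have y: "y \<ge> \<alpha>" using abs_Re_le_cmod[of "Complex \<alpha> v"] by (simp add: y_def)
    have "\<alpha> * (1 + y) \<le> y * (1 + \<alpha>)" using y by (simp add: distrib_left distrib_right mult.commute)
    then have ly: "l * (1 + y) \<le> y" using assms by (simp add: l_def field_simps)
    have "y powr Re w \<le> max 1 (l powr Re w) * (1 + y) powr Re w"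
    proof (cases "Re w \<ge> 0")
      case True
      have "y powr Re w \<le> 1 * (1 + y) powr Re w" using True y assms by (simp add: powr_mono2)
      also have "\<dots> \<le> max 1 (l powr Re w) * (1 + y) powr Re w" by (intro mult_right_mono) auto
      finally show ?thesis .
    next
      case False
      have "y powr Re w \<le> (l * (1 + y)) powr Re w" using False y assms l ly by (intro powr_mono2') auto
      also have "\<dots> = l powr Re w * (1 + y) powr Re w" using l y assms by (simp add: powr_mult)
      also have "\<dots> \<le> max 1 (l powr Re w) * (1 + y) powr Re w" by (intro mult_right_mono) auto
      finally show ?thesis .
    qed
    then have "y powr Re w * exp (\<bar>Im w\<bar> * pi) \<le> (max 1 (l powr Re w) * (1 + y) powr Re w) * exp (\<bar>Im w\<bar> * pi)"
      by (rule mult_right_mono) simp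
    moreover have "Complex \<alpha> v \<noteq> 0" using assms by (auto simp: complex_eq_iff)
    ultimately have "cmod (Complex \<alpha> v powr w) \<le> (max 1 (l powr Re w) * (1 + y) powr Re w) * exp (\<bar>Im w\<bar> * pi)"
      using norm_powr_le_exp[of "Complex \<alpha> v" w] unfolding y_def by linarith
    then show ?thesis by (simp add: C_def y_def mult_ac)
  qed
  moreover have "C \<ge> 0" by (simp add: C_def)
  ultimately show ?thesis by blast
qed

lemma eq_by_cinner:
  fixes A A' :: "'h::complex_hilbert_space \<Rightarrow>\<^sub>L 'h"
  assumes "\<And>x y. cinner x (A y) = cinner x (A' y)"
  shows "A = A'"
proof (rule blinfun_eqI)
  fix y
  have "cinner (A y - A' y) (A y - A' y) = 0" using assms[of "A y - A' y" y] by (simp add: cinner_simps)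
  then show "A y = A' y" by (simp add: cinner_self)
qed

context summable_triple
begin

lemma word_line_integrable:
  assumes b: "\<And>j. j \<le> m \<Longrightarrow> b j \<in> N" and \<alpha>: "0 < \<alpha>" "\<alpha> < 1 / 2" and c: "c \<ge> 0" and w: "Re w < real m"
  shows "(\<lambda>v. scal (Complex \<alpha> v powr w) o\<^sub>L word_deriv b m 0 (Complex \<alpha> v - of_real c)) integrable_on UNIV"
proof -
  obtain C1 where C1: "C1 \<ge> 0" "\<And>v. cmod (Complex \<alpha> v powr w) \<le> C1 * (1 + cmod (Complex \<alpha> v)) powr Re w"
    using norm_line_powr_le[OF \<alpha>(1)] by blast
  obtain C2 where C2: "C2 \<ge> 0" "\<And>z. Re z \<le> 1 / 2 \<Longrightarrow> norm (word_deriv b m 0 z) \<le> C2 / (1 + cmod z) ^ (Suc m + 0)"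
    using norm_word_deriv_le by blast
  define e where "e = real (Suc m) - Re w"
  have e: "e > 1" using w by (simp add: e_def)
  define C where "C = C1 * (C2 * (1 + c) ^ Suc m)"
  have C: "C \<ge> 0" using C1(1) C2(1) c by (simp add: C_def)
  have cont_line: "continuous_on UNIV (\<lambda>v. Complex \<alpha> v)"
    unfolding Complex_eq by (intro continuous_intros)
  show ?thesis
  proof (rule integrable_on_dominated)
    have "continuous_on UNIV (\<lambda>v. Complex \<alpha> v powr w)"
      using \<alpha> by (intro continuous_on_powr_complex cont_line continuous_on_const) (auto simp: complex_eq_iff)
    moreover have "continuous_on UNIV (\<lambda>v. word_deriv b m 0 (Complex \<alpha> v - of_real c))"
    proof (rule continuous_at_imp_continuous_on, rule ballI)
      fix v :: real
      have "isCont (word_deriv b m 0) (Complex \<alpha> v - of_real c)"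
        by (rule cderiv_continuous[OF cderiv_word_deriv[OF b]]) (use \<alpha> c in auto)
      moreover have "isCont (\<lambda>v. Complex \<alpha> v - of_real c) v"
        using cont_line by (intro continuous_diff continuous_const) (simp add: continuous_on_eq_continuous_at)
      ultimately show "isCont (\<lambda>v. word_deriv b m 0 (Complex \<alpha> v - of_real c)) v" by (rule isCont_o2[rotated])
    qed
    ultimately show "continuous_on UNIV (\<lambda>v. scal (Complex \<alpha> v powr w) o\<^sub>L word_deriv b m 0 (Complex \<alpha> v - of_real c))"
      by (intro continuous_on_compose_ops bounded_linear.continuous_on[OF bounded_linear_scal])
    have "integrable lborel (\<lambda>v :: real. C * (1 + \<bar>v\<bar>) powr - e)"
      by (intro integrable_mult_right integrable_abs_powr e)
    then show "(\<lambda>v. C * (1 + \<bar>v\<bar>) powr - e) integrable_on UNIV" by (rule integrable_on_lborel)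
    fix v :: real
    define y where "y = cmod (Complex \<alpha> v)"
    have y: "y \<ge> \<bar>v\<bar>" using abs_Im_le_cmod[of "Complex \<alpha> v"] by (simp add: y_def)
    have y1: "1 + y > 0" using y by linarith
    have "norm (word_deriv b m 0 (Complex \<alpha> v - of_real c)) \<le> C2 / (1 + cmod (Complex \<alpha> v - of_real c)) ^ Suc m"
      using C2(2)[of "Complex \<alpha> v - of_real c"] \<alpha> c by simp
    also have "\<dots> \<le> (C2 * (1 + c) ^ Suc m) / (1 + y) ^ Suc m"
      unfolding y_def by (rule divide_power_shift_le[OF c C2(1)])
    also have "\<dots> = (C2 * (1 + c) ^ Suc m) * (1 + y) powr - real (Suc m)"
      unfolding powr_minus using y1 by (subst powr_realpow) (auto simp: divide_inverse)
    finally have 2: "norm (word_deriv b m 0 (Complex \<alpha> v - of_real c)) \<le> (C2 * (1 + c) ^ Suc m) * (1 + y) powr - real (Suc m)" .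
    have "norm (scal (Complex \<alpha> v powr w) o\<^sub>L word_deriv b m 0 (Complex \<alpha> v - of_real c))
      \<le> (C1 * (1 + y) powr Re w) * ((C2 * (1 + c) ^ Suc m) * (1 + y) powr - real (Suc m))"
      unfolding norm_scal_compose using C1 2 by (intro mult_mono) (auto simp: y_def)
    also have "\<dots> = C * ((1 + y) powr Re w * (1 + y) powr - real (Suc m))" by (simp only: C_def mult_ac)
    also have "(1 + y) powr Re w * (1 + y) powr - real (Suc m) = (1 + y) powr - e"
      unfolding powr_add[symmetric] by (rule arg_cong[where f = "\<lambda>c. (1 + y) powr c"]) (simp add: e_def)
    also have "C * (1 + y) powr - e \<le> C * (1 + \<bar>v\<bar>) powr - e"
      using C e y by (intro mult_left_mono powr_mono2') auto
    finally show "norm (scal (Complex \<alpha> v powr w) o\<^sub>L word_deriv b m 0 (Complex \<alpha> v - of_real c)) \<le> C * (1 + \<bar>v\<bar>) powr - e" .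
  qed simp
qed

lemma word_half_line_integrable:
  assumes b: "\<And>j. j \<le> m \<Longrightarrow> b j \<in> N" and c: "c \<ge> 0" and u: "Re u > 0" "Re u + 1 < real (Suc m + k)"
  shows "(\<lambda>x. scal (of_real x powr u) o\<^sub>L word_deriv b m k (- of_real (x + c))) integrable_on {0..}"
proof -
  obtain L where L: "L \<ge> 0" "\<And>x. x \<ge> 0 \<Longrightarrow> norm (word_deriv b m k (- of_real x)) \<le> L * (1 + x) powr - real (Suc m + k)"
    using word_deriv_neg_bound by blast
  define e where "e = real (Suc m + k) - Re u"
  have e: "e > 1" using u by (simp add: e_def)
  show ?thesis
  proof (rule integrable_on_dominated)
    have "continuous_on {0..} (\<lambda>x. word_deriv b m k (- complex_of_real x))"
      by (rule continuous_neg) (auto intro!: cderiv_continuous[OF cderiv_word_deriv[OF b]])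
    then have "continuous_on {0..} (\<lambda>x. word_deriv b m k (- complex_of_real (x + c)))"
      by (rule continuous_on_compose2) (use c in \<open>auto intro!: continuous_intros\<close>)
    then show "continuous_on {0..} (\<lambda>x. scal (of_real x powr u) o\<^sub>L word_deriv b m k (- of_real (x + c)))"
      by (intro continuous_on_compose_ops bounded_linear.continuous_on[OF bounded_linear_scal] continuous_on_of_real_powr u)
    show "(\<lambda>x. L * (1 + x) powr - e) integrable_on {0..}"
      using integrable_cmul[OF integrable_on_half_line_powr[OF e], of L] by simp
    fix x :: real assume "x \<in> {0..}"
    then have x: "x \<ge> 0" by simp
    have "(1 + (x + c)) powr - real (Suc m + k) \<le> (1 + x) powr - real (Suc m + k)"
      using x c by (intro powr_mono2') auto
    then have "L * (1 + (x + c)) powr - real (Suc m + k) \<le> L * (1 + x) powr - real (Suc m + k)"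
      using L(1) by (rule mult_left_mono)
    then have "norm (word_deriv b m k (- of_real (x + c))) \<le> L * (1 + x) powr - real (Suc m + k)"
      using L(2)[of "x + c"] x c by linarith
    moreover have "cmod (complex_of_real x powr u) \<le> (1 + x) powr Re u"
      using x u by (simp add: norm_powr_real_powr powr_mono2)
    ultimately have "norm (scal (of_real x powr u) o\<^sub>L word_deriv b m k (- of_real (x + c)))
      \<le> (1 + x) powr Re u * (L * (1 + x) powr - real (Suc m + k))"
      unfolding norm_scal_compose by (intro mult_mono) auto
    also have "\<dots> = L * ((1 + x) powr Re u * (1 + x) powr - real (Suc m + k))" by (simp only: mult_ac)
    also have "(1 + x) powr Re u * (1 + x) powr - real (Suc m + k) = (1 + x) powr - e"
      unfolding powr_add[symmetric] by (rule arg_cong[where f = "\<lambda>c. (1 + x) powr c"]) (simp add: e_def)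
    finally show "norm (scal (of_real x powr u) o\<^sub>L word_deriv b m k (- of_real (x + c))) \<le> L * (1 + x) powr - e" .
  qed simp
qed

text \<open>On matrix elements this is the scalar identity
  \<open>line_integral_eq_half_line\<close>, applied to a shifted function; the shift by c preserves
  the order of decay.\<close>

theorem line_integral_word:
  fixes w :: complex
  assumes b: "\<And>j. j \<le> m \<Longrightarrow> b j \<in> N" and \<alpha>: "0 < \<alpha>" "\<alpha> < 1 / 2" and c: "c \<ge> 0"
    and w: "Re w < real m" "Re w + real k > real m"
  shows "integral UNIV (\<lambda>v. scal (Complex \<alpha> v powr w) o\<^sub>L word_deriv b m 0 (Complex \<alpha> v - of_real c))
    = scal (2 * pi * rGamma (- w) * rGamma (w + of_nat k + 1)) o\<^sub>L
        integral {0..} (\<lambda>x. scal (of_real x powr (w + of_nat k)) o\<^sub>L word_deriv b m k (- of_real (x + c)))"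
    (is "?L = scal ?\<kappa> o\<^sub>L ?R")
proof (rule eq_by_cinner)
  fix x y
  have i1: "(\<lambda>v. scal (Complex \<alpha> v powr w) o\<^sub>L word_deriv b m 0 (Complex \<alpha> v - of_real c)) integrable_on UNIV"
    by (rule word_line_integrable[OF b \<alpha> c w(1)])
  have i2: "(\<lambda>x. scal (of_real x powr (w + of_nat k)) o\<^sub>L word_deriv b m k (- of_real (x + c))) integrable_on {0..}"
    by (rule word_half_line_integrable[OF b c]) (use w in simp_all)
  have "cinner x (?L y) = integral UNIV (\<lambda>v. Complex \<alpha> v powr w * cinner x (word_deriv b m 0 (Complex \<alpha> v - of_real c) y))"
    unfolding cinner_integral(1)[OF i1] by (simp add: scal_apply cinner_scaleC_right)
  also have "\<dots> = ?\<kappa> * integral {0..} (\<lambda>s. of_real s powr (w + of_nat k) * cinner x (word_deriv b m k (- of_real s - of_real c) y))"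
    by (rule line_integral_eq_half_line[OF decaying_shift[OF decaying_word[OF b] c] \<alpha> w])
  also have "integral {0..} (\<lambda>s. of_real s powr (w + of_nat k) * cinner x (word_deriv b m k (- of_real s - of_real c) y)) = cinner x (?R y)"
    unfolding cinner_integral(1)[OF i2] by (simp add: scal_apply cinner_scaleC_right)
  also have "?\<kappa> * cinner x (?R y) = cinner x ((scal ?\<kappa> o\<^sub>L ?R) y)" by (simp add: scal_apply cinner_scaleC_right)
  finally show "cinner x (?L y) = cinner x ((scal ?\<kappa> o\<^sub>L ?R) y)" .
qed

subsection \<open>The words of the cocycle\<close>

text \<open>Two bounded extensions agree on the dense domain, hence everywhere, so the description
  in \<open>commutator\<close> picks the extension that lies in \<open>N\<close>.\<close>

lemma commutator_N:
  assumes "a \<in> \<A>"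
  shows "commutator D a \<in> N"
proof -
  obtain X where X: "X \<in> N" "extends_commutator D a X"
    using triple assms unfolding semifinite_spectral_triple_def by blast
  have "commutator D a = X"
    unfolding commutator_def
  proof (rule the_equality)
    show "extends_commutator D a X" by (rule X(2))
    fix Y assume Y: "extends_commutator D a Y"
    show "Y = X"
    proof (rule blinfun_eqI)
      fix y
      have "(Y - X) y = 0"
      proof (rule continuous_constant_on_closure[where S = "Domain D" and f = "blinfun_apply (Y - X)" and x = y and a = 0])
        show "continuous_on (closure (Domain D)) (blinfun_apply (Y - X))" by (intro continuous_intros)
        show "y \<in> closure (Domain D)" by (simp add: D_dense)
        fix x assume "x \<in> Domain D"
        then obtain z where "(x, z) \<in> D" by blast
        then have "(a x, a z + Y x) \<in> D" "(a x, a z + X x) \<in> D"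
          using X(2) Y unfolding extends_commutator_def by blast+
        from D_unique[OF this] show "(Y - X) x = 0" by (simp add: blinfun.diff_left)
      qed
      then show "Y y = X y" by (simp add: blinfun.diff_left)
    qed
  qed
  then show ?thesis using X(1) by simp
qed

text \<open>Absorbs the special role of \<open>a 0\<close>, so that the words of the cocycles are
  the case k = 0 of \<open>word_deriv\<close>.\<close>

definition letters :: "(nat \<Rightarrow> 'a \<Rightarrow>\<^sub>L 'a) \<Rightarrow> nat \<Rightarrow> 'a \<Rightarrow>\<^sub>L 'a" where
  "letters a j = (if j = 0 then a 0 else commutator D (a j))"

lemma letters_N: "\<forall>j\<le>m. a j \<in> \<A> \<Longrightarrow> j \<le> m \<Longrightarrow> letters a j \<in> N"
  using triple commutator_N[of "a j"]
  by (auto simp: letters_def semifinite_spectral_triple_def unital_star_subalgebra_def)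

lemma resolvent_word_eq:
  assumes "Re z < 1 + s\<^sup>2"
  shows "resolvent_word D a s z j = word_deriv (letters a) j 0 (z - of_real (s\<^sup>2))"
proof (induction j)
  case 0
  show ?case by (simp add: letters_def res_deriv_def resolvent_eq[OF assms])
next
  case (Suc j)
  then show ?case by (simp add: letters_def res_deriv_def resolvent_eq[OF assms] blinfun_compose_assoc)
qed

text \<open>The factor 1 / (2 pi i), the i of the line element and the 2 pi of Cauchy's formula
  cancel, leaving the orientation \<open>\<sigma>\<close>. One k and one \<open>\<omega>\<close>
  serve all s and w in the stated range, and so the two cocycles, whose exponents differ, can be
  compared.\<close>

theorem traced_integral_half_line:
  fixes \<sigma> \<alpha> :: real
  assumes a: "\<forall>j\<le>m. a j \<in> \<A>" and \<gamma>: "\<gamma> \<in> N" and \<alpha>: "0 < \<alpha>" "\<alpha> < 1 / 2"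
    and n: "real n > t" and k: "k \<ge> Suc m * n"
  obtains \<omega> :: "real \<Rightarrow> complex" and K
  where "continuous_on {0..} \<omega>" "\<And>y. y \<ge> 0 \<Longrightarrow> cmod (\<omega> y) \<le> K * (1 + y) powr - (real (Suc m + k) - t)"
    "\<And>s w. Re w + t < real m \<Longrightarrow> Re w + real k > real m \<Longrightarrow>
       traced_integral N \<tau> D \<gamma> \<sigma> \<alpha> m a s w = of_real \<sigma> * rGamma (- w) * rGamma (w + of_nat k + 1) *
         integral {0..} (\<lambda>x. of_real x powr (w + of_nat k) * \<omega> (x + s\<^sup>2))"
proof -
  define b where "b = letters a"
  have b: "b j \<in> N" if "j \<le> m" for j unfolding b_def by (rule letters_N[OF a that])
  define F where "F x = \<gamma> o\<^sub>L word_deriv b m k (- of_real x)" for x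
  have "factored (\<lambda>x. \<gamma> o\<^sub>L (word_deriv b m k (- of_real x) o\<^sub>L id_blinfun)) (real (Suc m + k) - t + 0 + 0)"
    by (rule factored_compose[OF factored_word[OF b n order_refl k], where L = "max (norm \<gamma>) (norm (id_blinfun :: 'a \<Rightarrow>\<^sub>L 'a))"])
      (auto intro!: N_closed \<gamma>)
  then have "factored F (real (Suc m + k) - t)" unfolding F_def by simp
  from trace_half_line[OF this] obtain \<omega> K where \<omega>: "continuous_on {0..} \<omega>"
    "\<And>y. y \<ge> 0 \<Longrightarrow> cmod (\<omega> y) \<le> K * (1 + y) powr - (real (Suc m + k) - t)"
    and tr: "\<And>y u. y \<ge> 0 \<Longrightarrow> Re u > 0 \<Longrightarrow> Re u + 1 < real (Suc m + k) - t \<Longrightarrow>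
       trace_class (integral {0..} (\<lambda>x. scal (of_real x powr u) o\<^sub>L F (x + y))) \<and>
       Tr (integral {0..} (\<lambda>x. scal (of_real x powr u) o\<^sub>L F (x + y))) = integral {0..} (\<lambda>x. of_real x powr u * \<omega> (x + y))"
    by blast
  have "traced_integral N \<tau> D \<gamma> \<sigma> \<alpha> m a s w = of_real \<sigma> * rGamma (- w) * rGamma (w + of_nat k + 1) *
         integral {0..} (\<lambda>x. of_real x powr (w + of_nat k) * \<omega> (x + s\<^sup>2))"
    if w: "Re w + t < real m" "Re w + real k > real m" for s and w :: complex
  proof -
    define u where "u = w + of_nat k"
    have u: "Re u > 0" "Re u + 1 < real (Suc m + k) - t" using w by (simp_all add: u_def)
    have u': "Re u + 1 < real (Suc m + k)" using u t_pos by linarith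
    have wm: "Re w < real m" using w t_pos by linarith
    have s: "s\<^sup>2 \<ge> 0" by simp
    define J where "J = integral {0..} (\<lambda>x. scal (of_real x powr u) o\<^sub>L word_deriv b m k (- of_real (x + s\<^sup>2)))"
    define \<kappa> where "\<kappa> = 2 * of_real pi * rGamma (- w) * rGamma (w + of_nat k + 1)"
    have Ji: "(\<lambda>x. scal (of_real x powr u) o\<^sub>L word_deriv b m k (- of_real (x + s\<^sup>2))) integrable_on {0..}"
      by (rule word_half_line_integrable[OF b s u(1) u'])
    have g: "\<gamma> \<in> bounded_ops" by (rule N_bounded_ops[OF \<gamma>])
    have "line_integral \<sigma> \<alpha> (\<lambda>z. scal (z powr w) o\<^sub>L resolvent_word D a s z m)
      = scal (of_real \<sigma> * \<i>) o\<^sub>L integral UNIV (\<lambda>v. scal (Complex \<alpha> v powr w) o\<^sub>L word_deriv b m 0 (Complex \<alpha> v - of_real (s\<^sup>2)))"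
    proof -
      have "Re (Complex \<alpha> v) < 1 + s\<^sup>2" for v using \<alpha> s unfolding complex.sel by linarith
      from resolvent_word_eq[OF this] show ?thesis unfolding line_integral_def b_def by simp
    qed
    also have "\<dots> = scal (of_real \<sigma> * \<i>) o\<^sub>L (scal \<kappa> o\<^sub>L J)"
    proof -
      have "integral UNIV (\<lambda>v. scal (Complex \<alpha> v powr w) o\<^sub>L word_deriv b m 0 (Complex \<alpha> v - of_real (s\<^sup>2))) = scal \<kappa> o\<^sub>L J"
        using line_integral_word[of m b \<alpha> "s\<^sup>2" w k, OF b \<alpha> s wm w(2)]
        by (simp only: J_def u_def \<kappa>_def of_real_mult of_real_numeral)
      then show ?thesis by (rule arg_cong)
    qed
    finally have line: "line_integral \<sigma> \<alpha> (\<lambda>z. scal (z powr w) o\<^sub>L resolvent_word D a s z m)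
      = scal (of_real \<sigma> * \<i>) o\<^sub>L (scal \<kappa> o\<^sub>L J)" .
    have gJ: "\<gamma> o\<^sub>L J = integral {0..} (\<lambda>x. scal (of_real x powr u) o\<^sub>L F (x + s\<^sup>2))"
      unfolding J_def F_def integral_compose_left[OF Ji, symmetric] move_scal[OF g] ..
    note T = tr[OF s u]
    have "traced_integral N \<tau> D \<gamma> \<sigma> \<alpha> m a s w
      = Tr (scal (1 / (2 * of_real pi * \<i>)) o\<^sub>L (scal (of_real \<sigma> * \<i>) o\<^sub>L (scal \<kappa> o\<^sub>L (\<gamma> o\<^sub>L J))))"
      unfolding traced_integral_def line blinfun_compose_assoc move_scal[OF g] ..
    also have "\<dots> = 1 / (2 * of_real pi * \<i>) * (of_real \<sigma> * \<i> * (\<kappa> * Tr (\<gamma> o\<^sub>L J)))"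
      using T unfolding gJ by (simp only: Tr_scal trace_class_scal)
    also have "\<dots> = of_real \<sigma> * rGamma (- w) * rGamma (w + of_nat k + 1) * Tr (\<gamma> o\<^sub>L J)"
      by (simp add: \<kappa>_def field_simps)
    also have "Tr (\<gamma> o\<^sub>L J) = integral {0..} (\<lambda>x. of_real x powr (w + of_nat k) * \<omega> (x + s\<^sup>2))"
      using T unfolding gJ u_def by blast
    finally show ?thesis .
  qed
  with \<omega> show ?thesis by (rule that)
qed

end

text \<open>Legendre duplication at (m + 1) / 2: the powers of 2 and the Gamma values in
  \<open>eta\<close> cancel against the constant of the fractional integral and leave the square
  root of pi in the reduced cocycle.\<close>

lemma eta_Gamma:
  "eta P m * (Gamma ((of_nat m + 1) / 2) / 2) = (- csqrt (2 * \<i>)) ^ P * of_real (sqrt pi)"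
proof -
  define z :: complex where "z = (of_nat m + 1) / 2"
  have z: "z + 1 / 2 = of_nat m / 2 + 1" "2 * z = of_nat m + 1" by (simp_all add: z_def field_simps)
  have "Re z = (real m + 1) / 2" by (simp add: z_def)
  moreover have "x \<notin> \<int>\<^sub>\<le>\<^sub>0" if "Re x > 0" for x :: complex using that by (auto elim!: nonpos_Ints_cases)
  ultimately have nz: "z \<notin> \<int>\<^sub>\<le>\<^sub>0" "z + 1 / 2 \<notin> \<int>\<^sub>\<le>\<^sub>0" by simp_all
  have "exp ((1 - 2 * z) * of_real (ln 2)) = inverse (2 ^ m)"
  proof -
    have "(1 - 2 * z) * of_real (ln 2) = of_real (- (real m * ln 2))" unfolding z(2) by simp
    then have "exp ((1 - 2 * z) * of_real (ln 2)) = of_real (exp (- (real m * ln 2)))" by (simp only: exp_of_real)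
    also have "exp (- (real m * ln 2)) = inverse (2 ^ m)" by (simp add: exp_minus exp_of_nat_mult)
    finally show ?thesis by simp
  qed
  then have dup: "Gamma z * Gamma (of_nat m / 2 + 1) = inverse (2 ^ m) * of_real (sqrt pi) * Gamma (of_nat m + 1)"
    using Gamma_legendre_duplication[OF nz] unfolding z by simp
  have G: "Gamma (of_nat m + 1 :: complex) \<noteq> 0"
    using Gamma_fact[of m, where 'a = complex] by (simp add: add.commute)
  have "eta P m * (Gamma z / 2) = (- csqrt (2 * \<i>)) ^ P * 2 ^ m * (Gamma z * Gamma (of_nat m / 2 + 1)) / Gamma (of_nat m + 1)"
    by (simp add: eta_def)
  also have "\<dots> = (- csqrt (2 * \<i>)) ^ P * of_real (sqrt pi)"
    unfolding dup using G by simp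
  finally show ?thesis by (simp add: z_def)
qed

text \<open>Both cocycles become Gamma factors times the same integral \<open>M\<close>. In the
  resolvent cocycle the \<open>Gamma (u + 1)\<close> of the fractional integral cancels a reciprocal
  from the contour; in the reduced one the explicit \<open>Gamma (- w')\<close> does so, which is
  where \<open>nonpole\<close> enters.\<close>

theorem (in summable_triple) cocycle_eq_reduced:
  fixes p m :: nat and q \<alpha> \<sigma> :: real
  assumes a: "\<forall>j\<le>m. a j \<in> \<A>" and \<gamma>: "\<gamma> \<in> N" and \<alpha>: "0 < \<alpha>" "\<alpha> < 1 / 2" and q: "q / 2 \<le> t"
    and r: "t - q / 2 < Re r - (1 - real m) / 2"
    and nonpole: "of_real q / 2 + r - (of_nat m + 1) / 2 \<notin> \<int>\<^sub>\<le>\<^sub>0"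
  shows "resolvent_cocycle N \<tau> D \<gamma> p \<sigma> \<alpha> q m r a = reduced_resolvent_cocycle N \<tau> D \<gamma> p \<sigma> \<alpha> q m r a"
proof -
  define w where "w = - of_real q / 2 - r"
  define w' where "w' = w + (of_nat m + 1) / 2"
  have Re_w': "Re w' = Re w + (real m + 1) / 2" by (simp add: w'_def)
  have Re_w: "Re w = - q / 2 - Re r" by (simp add: w_def)
  have w't: "Re w' + t < real m" unfolding Re_w' Re_w using r by (simp add: field_simps)
  have wt: "Re w + t < real m" using w't unfolding Re_w' by (simp add: field_simps)
  obtain n :: nat where n: "real n > t" using reals_Archimedean2 by blast
  obtain k' :: nat where k': "real k' > real m - Re w" using reals_Archimedean2 by blast
  \<comment> \<open>The first summand provides enough derivatives for a trace class factor, the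
    second moves the real parts of w + k and w' + k beyond m.\<close>
  define k where "k = Suc m * n + k'"
  have "real k \<ge> real k'" by (simp add: k_def)
  then have k: "Re w + real k > real m" using k' by linarith
  moreover have "(real m + 1) / 2 > 0" by simp
  ultimately have k'': "Re w' + real k > real m" unfolding Re_w' by linarith
  have kn: "k \<ge> Suc m * n" by (simp add: k_def)
  obtain \<omega> K where \<omega>: "continuous_on {0..} \<omega>" "\<And>y. y \<ge> 0 \<Longrightarrow> cmod (\<omega> y) \<le> K * (1 + y) powr - (real (Suc m + k) - t)"
    and tr: "\<And>s w. Re w + t < real m \<Longrightarrow> Re w + real k > real m \<Longrightarrow>
       traced_integral N \<tau> D \<gamma> \<sigma> \<alpha> m a s w = of_real \<sigma> * rGamma (- w) * rGamma (w + of_nat k + 1) *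
         integral {0..} (\<lambda>x. of_real x powr (w + of_nat k) * \<omega> (x + s\<^sup>2))"
    using traced_integral_half_line[OF a \<gamma> \<alpha> n kn, where \<sigma> = \<sigma>] by blast
  define M where "M = integral {0..} (\<lambda>y. of_real y powr (w' + of_nat k) * \<omega> y)"
  define u where "u = w + of_nat k"
  have u: "Re u > -1" using k by (simp add: u_def)
  have uw': "u + (of_nat m + 1) / 2 = w' + of_nat k" "u + 1 + (of_nat m + 1) / 2 = w' + of_nat k + 1"
    by (simp_all add: u_def w'_def)
  have "real (Suc m + k) - t > Re u + 1 + (real m + 1) / 2" using w't unfolding Re_w' by (simp add: u_def)
  from half_line_shifted_moment[OF u \<omega> this]
  have moment: "integral {0..} (\<lambda>s. of_real (s ^ m) * integral {0..} (\<lambda>x. of_real x powr u * \<omega> (x + s\<^sup>2)))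
    = Gamma ((of_nat m + 1) / 2) / 2 * Gamma (u + 1) * rGamma (w' + of_nat k + 1) * M"
    unfolding uw' M_def .
  have Gu: "rGamma (u + 1) * Gamma (u + 1) = 1"
  proof -
    have "u + 1 \<notin> \<int>\<^sub>\<le>\<^sub>0" using u by (auto simp: complex_eq_iff elim!: nonpos_Ints_cases)
    then show ?thesis by (simp add: rGamma_inverse_Gamma Gamma_eq_zero_iff)
  qed
  have "integral {0..} (\<lambda>s. of_real (s ^ m) * traced_integral N \<tau> D \<gamma> \<sigma> \<alpha> m a s w)
    = integral {0..} (\<lambda>s. (of_real \<sigma> * rGamma (- w) * rGamma (u + 1)) *
        (of_real (s ^ m) * integral {0..} (\<lambda>x. of_real x powr u * \<omega> (x + s\<^sup>2))))"
    unfolding tr[OF wt k] u_def by (simp only: mult_ac)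
  also have "\<dots> = (of_real \<sigma> * rGamma (- w) * rGamma (u + 1)) *
      (Gamma ((of_nat m + 1) / 2) / 2 * Gamma (u + 1) * rGamma (w' + of_nat k + 1) * M)"
    unfolding moment[symmetric] by (rule integral_mult_right)
  also have "\<dots> = (of_real \<sigma> * rGamma (- w) * (Gamma ((of_nat m + 1) / 2) / 2) * rGamma (w' + of_nat k + 1) * M) *
      (rGamma (u + 1) * Gamma (u + 1))"
    by (simp only: mult_ac)
  finally have "resolvent_cocycle N \<tau> D \<gamma> p \<sigma> \<alpha> q m r a =
    (eta p m * (Gamma ((of_nat m + 1) / 2) / 2)) * (of_real \<sigma> * rGamma (- w) * rGamma (w' + of_nat k + 1) * M)"
    unfolding Gu resolvent_cocycle_def w_def[symmetric] by (simp only: mult_ac mult_1_right mult_1_left)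
  also have "\<dots> = (- csqrt (2 * \<i>)) ^ p * of_real (sqrt pi) * (of_real \<sigma> * rGamma (- w) * rGamma (w' + of_nat k + 1) * M)"
    unfolding eta_Gamma ..
  finally have 1: "resolvent_cocycle N \<tau> D \<gamma> p \<sigma> \<alpha> q m r a =
    (- csqrt (2 * \<i>)) ^ p * of_real (sqrt pi) * (of_real \<sigma> * rGamma (- w) * rGamma (w' + of_nat k + 1) * M)" .
  have mw: "of_real q / 2 + r = - w" "of_real q / 2 + r - (of_nat m + 1) / 2 = - w'"
    by (simp_all add: w_def w'_def)
  have Gw': "Gamma (- w') * rGamma (- w') = 1"
    using nonpole unfolding mw(2) by (simp add: rGamma_inverse_Gamma Gamma_eq_zero_iff)
  have "traced_integral N \<tau> D \<gamma> \<sigma> \<alpha> m a 0 w' = of_real \<sigma> * rGamma (- w') * rGamma (w' + of_nat k + 1) * M"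
    using tr[OF w't k'', of 0] by (simp add: M_def)
  then have "reduced_resolvent_cocycle N \<tau> D \<gamma> p \<sigma> \<alpha> q m r a =
    (-1) ^ p * csqrt (2 * \<i>) ^ p * (of_real (sqrt pi) * Gamma (- w') * rGamma (- w)) *
      (of_real \<sigma> * rGamma (- w') * rGamma (w' + of_nat k + 1) * M)"
    unfolding reduced_resolvent_cocycle_def w'_def[symmetric, unfolded w_def] mw(2)
    unfolding mw(1) by (simp only: rGamma_inverse_Gamma divide_inverse)
  also have "\<dots> = ((-1) ^ p * csqrt (2 * \<i>) ^ p) * of_real (sqrt pi) *
      (of_real \<sigma> * rGamma (- w) * rGamma (w' + of_nat k + 1) * M) * (Gamma (- w') * rGamma (- w'))"
    by (simp only: mult_ac)
  also have "(-1) ^ p * csqrt (2 * \<i>) ^ p = (- csqrt (2 * \<i>)) ^ p"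
    unfolding power_mult_distrib[symmetric] by simp
  finally show ?thesis unfolding 1 Gw' by simp
qed

text \<open>For positive k the power is a bounded operator and is itself admissible in the supremum
  that defines \<open>trace_graph\<close>, so its trace is finite.\<close>

lemma (in spectral_triple) summable_tripleI:
  assumes "k > 0" "trace_graph N \<tau> (one_plus_square_power D k) < \<infinity>"
  shows "summable_triple N \<A> \<tau> D (k / 2)"
proof unfold_locales
  show "k / 2 > 0" using assms by simp
  have c: "continuous_on {0..norm (- Rz 0)} (\<lambda>x. x powr (k / 2))"
    using assms(1) by (intro continuous_on_powr') (auto intro!: continuous_intros)
  define X where "X = cont_calculus (\<lambda>x. x powr (k / 2)) (- Rz 0)"
  have "X \<in> pos_cone N"
    unfolding X_def pos_cone_def
    using N_cont_calculus[OF positive_minus_Rz N_minus[OF Rz_N] c] cont_calculus_nonneg[OF positive_minus_Rz c] by simp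
  moreover have "one_plus_square_power D k = graph_of X"
    using assms(1) by (simp add: one_plus_square_power_def X_def bounded_inverse_one_plus_square Let_def)
  ultimately have "\<tau> X \<le> trace_graph N \<tau> (one_plus_square_power D k)"
    unfolding trace_graph_def by (intro SUP_upper) (auto simp: graph_of_def)
  then show "\<tau> (cont_calculus (\<lambda>x. x powr (k / 2)) (- Rz 0)) < \<infinity>"
    using assms(2) unfolding X_def by (rule le_less_trans)
qed

theorem mainTheorem3:
  fixes N \<A> :: "('h::complex_hilbert_space \<Rightarrow>\<^sub>L 'h) set"
    and \<tau> :: "('h \<Rightarrow>\<^sub>L 'h) \<Rightarrow> ennreal"
    and D :: "'h op_graph"
    and \<gamma> :: "'h \<Rightarrow>\<^sub>L 'h"
    and P m :: nat
    and q \<alpha> \<sigma> :: real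
    and a :: "nat \<Rightarrow> 'h \<Rightarrow>\<^sub>L 'h"
  assumes "semifinite_spectral_triple N \<tau> \<A> D"
    and "parity N \<A> D \<gamma> P"
    and "QC_infinity \<A> D"
    and "finitely_summable N \<tau> D"
    and "spectral_dimension N \<tau> D = ereal q" and "q \<ge> 1"
    and "P \<le> m" and "even (m - P)" and "int m \<le> max_degree q P"
    and "0 < \<alpha>" and "\<alpha> < 1 / 2" and "\<sigma> \<in> {1, -1}"
    and "\<forall>j\<le>m. a j \<in> \<A>"
  shows "equal_modulo_holomorphic q m
    {r. of_real q / 2 + r - (of_nat m + 1) / 2 \<in> \<int>\<^sub>\<le>\<^sub>0}
    (\<lambda>r. resolvent_cocycle N \<tau> D \<gamma> P \<sigma> \<alpha> q m r a)
    (\<lambda>r. reduced_resolvent_cocycle N \<tau> D \<gamma> P \<sigma> \<alpha> q m r a)"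
proof -
  interpret spectral_triple N \<A> \<tau> D by unfold_locales (rule assms(1))
  have \<gamma>: "\<gamma> \<in> N"
    using assms(2) by (auto simp: parity_def grading_def N_id split: if_splits)
  have eq: "resolvent_cocycle N \<tau> D \<gamma> P \<sigma> \<alpha> q m r a = reduced_resolvent_cocycle N \<tau> D \<gamma> P \<sigma> \<alpha> q m r a"
    if r: "Re r > (1 - real m) / 2" "of_real q / 2 + r - (of_nat m + 1) / 2 \<notin> \<int>\<^sub>\<le>\<^sub>0" for r
  proof -
    \<comment> \<open>The distance of r from the boundary of the half plane. By the definition of
      the infimum there is a summability exponent k below q + 2 \<open>\<epsilon>\<close>, and t = k
      / 2 then meets the convergence condition at this r.\<close>
    define \<epsilon> where "\<epsilon> = Re r - (1 - real m) / 2"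
    have "spectral_dimension N \<tau> D < ereal (q + 2 * \<epsilon>)" using assms(5) r(1) by (simp add: \<epsilon>_def)
    then obtain k where k: "trace_graph N \<tau> (one_plus_square_power D k) < \<infinity>" "k < q + 2 * \<epsilon>"
      unfolding spectral_dimension_def by (auto simp: INF_less_iff)
    have "ereal q \<le> ereal k" unfolding assms(5)[symmetric] spectral_dimension_def
      by (rule INF_lower) (use k(1) in simp)
    \<comment> \<open>As q is at least 1, this makes k positive, so that
      \<open>one_plus_square_power\<close> is a bounded power.\<close>
    then have qk: "q \<le> k" by simp
    interpret summable_triple N \<A> \<tau> D "k / 2"
      by (rule summable_tripleI) (use k(1) qk assms(6) in auto)
    show ?thesis
      by (rule cocycle_eq_reduced[OF assms(13) \<gamma> assms(10,11)]) (use k qk r in \<open>auto simp: \<epsilon>_def field_simps\<close>)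
  qed
  show ?thesis unfolding equal_modulo_holomorphic_def
    \<comment> \<open>The difference is 0 at every admissible r, so the zero function and any c to
      the left of (1 - q) / 2 serve as witnesses.\<close>
    by (rule exI[of _ "(1 - q) / 2 - 1"], rule exI[of _ "\<lambda>_. 0"]) (use eq in auto)
qed

end
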